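(* Let $R$ be a Noetherian commutative ring and let $A\subset R$ be a subring which is a Noetherian integral domain. Let $\mathfrak{p}\in\operatorname{Spec}(R)$ be a prime ideal such that $\mathfrak{p}\cap A=0$. Then the following statements hold. (i) Suppose that $R_{\mathfrak{p}}/\mathfrak{p}R_{\mathfrak{p}}\otimes_{\operatorname{Quot}(A)}R_{\mathfrak{p}}$ is a Noetherian ring. If $I\subset R$ is a $\mathfrak{p}$-primary ideal, then there exists an $(R\otimes_A R)$-submodule $\mathcal{E}\subseteq\operatorname{Diff}_{R/A}(R,R_{\mathfrak{p}}/\mathfrak{p}R_{\mathfrak{p}})$ such that $$I=\{f\in R\mid \delta(f)=0\text{ for all }\delta\in\mathcal{E}\}$$ and $\mathcal{E}$ is finitely generated via its natural left structure as an $R_{\mathfrak{p}}$-module. (ii) Suppose that $R$ is essentially of finite type over $A$ and that $N$ is a finitely generated torsion-free module over $R/\mathfrak{p}$. (a) If $I\subset R$ is a $\mathfrak{p}$-primary ideal, then there exists an $(R\otimes_A R)$-submodule $\mathcal{E}\subseteq\operatorname{Diff}_{R/A}(R,N)$ such that $$I=\{f\in R\mid \delta(f)=0\text{ for all }\delta\in\mathcal{E}\}$$ and $\mathcal{E}$ is finitely generated via its natural left structure as an $R$-module. (b) If $\operatorname{Quot}(A)\hookrightarrow R_{\mathfrak{p}}/\mathfrak{p}R_{\mathfrak{p}}$ is a separable field extension (which holds whenever $\operatorname{Quot}(A)$ is perfect), then for any $n\ge 0$ and any $\mathfrak{p}$-primary ideal $I\subset R$ containing $\mathfrak{p}^{n+1}$,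 there exists an $(R\otimes_A R)$-submodule $\mathcal{E}\subseteq\operatorname{Diff}^n_{R/A}(R,N)$ such that $$I=\{f\in R\mid \delta(f)=0\text{ for all }\delta\in\mathcal{E}\}.$$
   Context: All rings are commutative. $\operatorname{Quot}(A)$ is the field of fractions of $A$; since $\mathfrak{p}\cap A=0$, it embeds in $R_{\mathfrak{p}}$ and in $R_{\mathfrak{p}}/\mathfrak{p}R_{\mathfrak{p}}$. "Essentially of finite type over $A$" means being a localization of a finitely generated $A$-algebra. Separability of field extensions is meant in the general (not necessarily algebraic) sense. For $R$-modules $M,N$, $\operatorname{Hom}_A(M,N)$ is an $(R\otimes_A R)$-module via $((r\otimes_A s)\delta)(m)=r\,\delta(sm)$. Put $[\delta,r](m)=\delta(rm)-r\delta(m)$. The $A$-linear differential operators are defined inductively by $\operatorname{Diff}^{-1}_{R/A}(M,N)=0$, $\operatorname{Diff}^n_{R/A}(M,N)=\{\delta\in\operatorname{Hom}_A(M,N)\mid[\delta,r]\in\operatorname{Diff}^{n-1}_{R/A}(M,N)\text{ for all }r\in R\}$ for $n\ge0$, and $\operatorname{Diff}_{R/A}(M,N)=\bigcup_{n\ge0}\operatorname{Diff}^n_{R/A}(M,N)$. These are $(R\otimes_A R)$-submodules of $\operatorname{Hom}_A(M,N)$. The natural left module structure is post-composition: $(r\delta)(m)=r\,\delta(m)$, for $r\in R$, or for $r\in R_{\mathfrak{p}}$ when $N$ is an $R_{\mathfrak{p}}$-module (in (i), the conclusion includes that $\mathcal{E}$ is stable under this $R_{\mathfrak{p}}$-ac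tion).
   Formalization: In (ii), N is additionally assumed nonzero: for N = 0, which is finitely generated and torsion-free, every operator is zero and the solution set is all of R, which is never a p-primary ideal, so the claim fails. *)

theory Defs
  imports "HOL-Algebra.Algebra"
begin

definition loc_rel :: "('a, 'r) ring_scheme \<Rightarrow> 'a set \<Rightarrow> (('a \<times> 'a) \<times> ('a \<times> 'a)) set" where
  "loc_rel R S = {((a, s), (b, t)). a \<in> carrier R \<and> s \<in> S \<and> b \<in> carrier R \<and> t \<in> S \<and>
     (\<exists>u\<in>S. u \<otimes>\<^bsub>R\<^esub> (a \<otimes>\<^bsub>R\<^esub> t \<ominus>\<^bsub>R\<^esub> b \<otimes>\<^bsub>R\<^esub> s) = \<zero>\<^bsub>R\<^esub>)}"

definition loc_frac :: "('a, 'r) ring_scheme \<Rightarrow> 'a set \<Rightarrow> 'a \<Rightarrow> 'a \<Rightarrow> ('a \<times> 'a) set" where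
  "loc_frac R S a s = loc_rel R S `` {(a, s)}"

definition localization :: "('a, 'r) ring_scheme \<Rightarrow> 'a set \<Rightarrow> ('a \<times> 'a) set ring" where
  "localization R S =
    \<lparr>carrier = (carrier R \<times> S) // loc_rel R S,
     monoid.mult = (\<lambda>U V. \<Union>(a, s)\<in>U. \<Union>(b, t)\<in>V. loc_frac R S (a \<otimes>\<^bsub>R\<^esub> b) (s \<otimes>\<^bsub>R\<^esub> t)),
     one = loc_frac R S \<one>\<^bsub>R\<^esub> \<one>\<^bsub>R\<^esub>,
     ring.zero = loc_frac R S \<zero>\<^bsub>R\<^esub> \<one>\<^bsub>R\<^esub>,
     ring.add = (\<lambda>U V. \<Union>(a, s)\<in>U. \<Union>(b, t)\<in>V.
              loc_frac R S (a \<otimes>\<^bsub>R\<^esub> t \<oplus>\<^bsub>R\<^esub> b \<otimes>\<^bsub>R\<^esub> s) (s \<otimes>\<^bsub>R\<^esub> t))\<rparr>"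

definition loc_map :: "('a, 'r) ring_scheme \<Rightarrow> 'a set \<Rightarrow> 'a \<Rightarrow> ('a \<times> 'a) set" where
  "loc_map R S r = loc_frac R S r \<one>\<^bsub>R\<^esub>"

definition quot_field :: "('a, 'r) ring_scheme \<Rightarrow> ('a \<times> 'a) set ring" where
  "quot_field A = localization A (carrier A - {\<zero>\<^bsub>A\<^esub>})"

definition local_ring :: "('a, 'r) ring_scheme \<Rightarrow> 'a set \<Rightarrow> ('a \<times> 'a) set ring" where
  "local_ring R P = localization R (carrier R - P)"

definition local_max_ideal :: "('a, 'r) ring_scheme \<Rightarrow> 'a set \<Rightarrow> ('a \<times> 'a) set set" where
  "local_max_ideal R P = Idl\<^bsub>local_ring R P\<^esub> (loc_map R (carrier R - P) ` P)"

definition residue_field :: "('a, 'r) ring_scheme \<Rightarrow> 'a set \<Rightarrow> ('a \<times> 'a) set set ring" where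
  "residue_field R P = local_ring R P Quot local_max_ideal R P"

definition residue_map :: "('a, 'r) ring_scheme \<Rightarrow> 'a set \<Rightarrow> ('a \<times> 'a) set \<Rightarrow> ('a \<times> 'a) set set" where
  "residue_map R P x = local_max_ideal R P +>\<^bsub>local_ring R P\<^esub> x"

text \<open>For a subring \<open>A\<close> of \<open>R\<close> with \<open>P \<inter> A = 0\<close>, the embedding of the fraction field of \<open>A\<close> into
  \<open>R\<^sub>P\<close> sending \<open>a/s\<close> to \<open>a/s\<close>: an element \<open>U\<close> of the fraction field is a set of pairs, and the
  relational image of \<open>U\<close> is the union of the classes in \<open>R\<^sub>P\<close> of these pairs, which all coincide.\<close>

definition quot_embed :: "('a, 'r) ring_scheme \<Rightarrow> 'a set \<Rightarrow> ('a \<times> 'a) set \<Rightarrow> ('a \<times> 'a) set" where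
  "quot_embed R P U = loc_rel R (carrier R - P) `` U"

definition quot_residue_embed :: "('a, 'r) ring_scheme \<Rightarrow> 'a set \<Rightarrow> ('a \<times> 'a) set \<Rightarrow> ('a \<times> 'a) set set" where
  "quot_residue_embed R P U = residue_map R P (quot_embed R P U)"

definition radical :: "('a, 'r) ring_scheme \<Rightarrow> 'a set \<Rightarrow> 'a set" where
  "radical R Q = {r \<in> carrier R. \<exists>n::nat. r [^]\<^bsub>R\<^esub> n \<in> Q}"

definition primary_ideal :: "('a, 'r) ring_scheme \<Rightarrow> 'a set \<Rightarrow> bool" where
  "primary_ideal R Q \<longleftrightarrow> ideal Q R \<and> Q \<noteq> carrier R \<and>
     (\<forall>a\<in>carrier R. \<forall>b\<in>carrier R. a \<otimes>\<^bsub>R\<^esub> b \<in> Q \<longrightarrow> a \<in> Q \<or> b \<in> radical R Q)"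

definition primary_to :: "('a, 'r) ring_scheme \<Rightarrow> 'a set \<Rightarrow> 'a set \<Rightarrow> bool" where
  "primary_to R P Q \<longleftrightarrow> primary_ideal R Q \<and> radical R Q = P"

text \<open>\<open>R\<close> is a localization of a finitely generated algebra \<open>B\<close> over the subring \<open>A\<close>, compatibly
  with the maps from \<open>A\<close>. Taking the elements of \<open>B\<close> in the type \<^typ>\<open>'a\<close> of elements of \<open>R\<close> is no
  restriction: \<open>B\<close> and the multiplicative set may be replaced by their images in \<open>R\<close>.\<close>

definition ess_finite_type :: "'a ring \<Rightarrow> 'a set \<Rightarrow> bool" where
  "ess_finite_type R A \<longleftrightarrow>
    (\<exists>(B :: 'a ring) f S. cring B \<and> f \<in> ring_hom (R\<lparr>carrier := A\<rparr>) B \<and>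
       (\<exists>U. finite U \<and> U \<subseteq> carrier B \<and> generate_ring B (f ` A \<union> U) = carrier B) \<and>
       submonoid S B \<and>
       (\<exists>h \<in> ring_iso (localization B S) R. \<forall>a\<in>A. h (loc_map B S (f a)) = a))"

text \<open>The free abelian group on \<open>B \<times> C\<close>, made into a ring by extending
  \<open>(b, c) (b', c') = (b b', c c')\<close> bilinearly.\<close>

definition free_tensor :: "('b, 'r) ring_scheme \<Rightarrow> ('c, 's) ring_scheme \<Rightarrow> ('b \<times> 'c \<Rightarrow>\<^sub>0 int) ring" where
  "free_tensor B C =
    \<lparr>carrier = {u. Poly_Mapping.keys u \<subseteq> carrier B \<times> carrier C},
     monoid.mult = (\<lambda>u v. frag_extend (\<lambda>(b, c). frag_extend
              (\<lambda>(b', c'). frag_of (b \<otimes>\<^bsub>B\<^esub> b', c \<otimes>\<^bsub>C\<^esub> c')) v) u),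
     one = frag_of (\<one>\<^bsub>B\<^esub>, \<one>\<^bsub>C\<^esub>),
     ring.zero = 0,
     ring.add = (+)\<rparr>"

definition tensor_relations ::
    "('k, 'q) ring_scheme \<Rightarrow> ('k \<Rightarrow> 'b) \<Rightarrow> ('b, 'r) ring_scheme \<Rightarrow> ('k \<Rightarrow> 'c) \<Rightarrow> ('c, 's) ring_scheme
      \<Rightarrow> ('b \<times> 'c \<Rightarrow>\<^sub>0 int) set" where
  "tensor_relations K f B g C =
     {frag_of (b \<oplus>\<^bsub>B\<^esub> b', c) - frag_of (b, c) - frag_of (b', c) | b b' c.
        b \<in> carrier B \<and> b' \<in> carrier B \<and> c \<in> carrier C} \<union>
     {frag_of (b, c \<oplus>\<^bsub>C\<^esub> c') - frag_of (b, c) - frag_of (b, c') | b c c'.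
        b \<in> carrier B \<and> c \<in> carrier C \<and> c' \<in> carrier C} \<union>
     {frag_of (f a \<otimes>\<^bsub>B\<^esub> b, c) - frag_of (b, g a \<otimes>\<^bsub>C\<^esub> c) | a b c.
        a \<in> carrier K \<and> b \<in> carrier B \<and> c \<in> carrier C}"

text \<open>The tensor product over \<open>K\<close> of the algebras \<open>f : K \<rightarrow> B\<close> and \<open>g : K \<rightarrow> C\<close>. The relations are
  stable under multiplication by pairs, so the ideal they generate is just the subgroup they
  generate.\<close>

definition tensor_ideal ::
    "('k, 'q) ring_scheme \<Rightarrow> ('k \<Rightarrow> 'b) \<Rightarrow> ('b, 'r) ring_scheme \<Rightarrow> ('k \<Rightarrow> 'c) \<Rightarrow> ('c, 's) ring_scheme
      \<Rightarrow> ('b \<times> 'c \<Rightarrow>\<^sub>0 int) set" where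
  "tensor_ideal K f B g C = Idl\<^bsub>free_tensor B C\<^esub> (tensor_relations K f B g C)"

definition tensor_ring ::
    "('k, 'q) ring_scheme \<Rightarrow> ('k \<Rightarrow> 'b) \<Rightarrow> ('b, 'r) ring_scheme \<Rightarrow> ('k \<Rightarrow> 'c) \<Rightarrow> ('c, 's) ring_scheme
      \<Rightarrow> ('b \<times> 'c \<Rightarrow>\<^sub>0 int) set ring" where
  "tensor_ring K f B g C = free_tensor B C Quot tensor_ideal K f B g C"

definition enveloping_ring :: "('a, 'r) ring_scheme \<Rightarrow> 'a set \<Rightarrow> ('a \<times> 'a \<Rightarrow>\<^sub>0 int) set ring" where
  "enveloping_ring R A = tensor_ring (R\<lparr>carrier := A\<rparr>) (\<lambda>a. a) R (\<lambda>a. a) R"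

text \<open>The ring-multiplication fields that the record type of modules inherits are left undefined.\<close>

definition restrict_scalars :: "('r \<Rightarrow> 's) \<Rightarrow> ('s, 'm, 'z) module_scheme \<Rightarrow> ('r, 'm) module" where
  "restrict_scalars f M = \<lparr>carrier = carrier M, monoid.mult = undefined, one = undefined,
     ring.zero = \<zero>\<^bsub>M\<^esub>, ring.add = ring.add M, smult = (\<lambda>r. smult M (f r))\<rparr>"

definition ring_module :: "('s, 'z) ring_scheme \<Rightarrow> ('s, 's) module" where
  "ring_module S = \<lparr>carrier = carrier S, monoid.mult = undefined, one = undefined,
     ring.zero = \<zero>\<^bsub>S\<^esub>, ring.add = ring.add S, smult = monoid.mult S\<rparr>"

definition residue_over_local :: "('a, 'r) ring_scheme \<Rightarrow> 'a set \<Rightarrow> (('a \<times> 'a) set, ('a \<times> 'a) set set) module" where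
  "residue_over_local R P = restrict_scalars (residue_map R P) (ring_module (residue_field R P))"

definition residue_over_ring :: "('a, 'r) ring_scheme \<Rightarrow> 'a set \<Rightarrow> ('a, ('a \<times> 'a) set set) module" where
  "residue_over_ring R P = restrict_scalars (loc_map R (carrier R - P)) (residue_over_local R P)"

definition quotient_module_over_ring ::
    "('a, 'r) ring_scheme \<Rightarrow> 'a set \<Rightarrow> ('a set, 'n, 'z) module_scheme \<Rightarrow> ('a, 'n) module" where
  "quotient_module_over_ring R P N = restrict_scalars (\<lambda>r. P +>\<^bsub>R\<^esub> r) N"

definition fg_submodule :: "'m set \<Rightarrow> ('r, 'z) ring_scheme \<Rightarrow> ('r, 'm, 'y) module_scheme \<Rightarrow> bool" where
  "fg_submodule E R M \<longleftrightarrow> submodule E R M \<and>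
     (\<exists>U. finite U \<and> U \<subseteq> E \<and> (\<forall>F. submodule F R M \<longrightarrow> U \<subseteq> F \<longrightarrow> E \<subseteq> F))"

definition fg_module :: "('r, 'z) ring_scheme \<Rightarrow> ('r, 'm, 'y) module_scheme \<Rightarrow> bool" where
  "fg_module R M \<longleftrightarrow> module R M \<and> fg_submodule (carrier M) R M"

definition torsion_free_module :: "('r, 'z) ring_scheme \<Rightarrow> ('r, 'm, 'y) module_scheme \<Rightarrow> bool" where
  "torsion_free_module R M \<longleftrightarrow>
     (\<forall>r\<in>carrier R. \<forall>x\<in>carrier M. r \<odot>\<^bsub>M\<^esub> x = \<zero>\<^bsub>M\<^esub> \<longrightarrow> r = \<zero>\<^bsub>R\<^esub> \<or> x = \<zero>\<^bsub>M\<^esub>)"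

text \<open>Maps are extensional, i.e. \<^term>\<open>undefined\<close> outside the carrier of the domain, so that
  elements of \<open>Hom\<close> are determined by their values on the carrier.\<close>

definition Hom_set ::
    "'a set \<Rightarrow> ('a, 'm, 'y) module_scheme \<Rightarrow> ('a, 'n, 'z) module_scheme \<Rightarrow> ('m \<Rightarrow> 'n) set" where
  "Hom_set A M N = {\<delta> \<in> carrier M \<rightarrow>\<^sub>E carrier N.
     (\<forall>x\<in>carrier M. \<forall>y\<in>carrier M. \<delta> (x \<oplus>\<^bsub>M\<^esub> y) = \<delta> x \<oplus>\<^bsub>N\<^esub> \<delta> y) \<and>
     (\<forall>a\<in>A. \<forall>x\<in>carrier M. \<delta> (a \<odot>\<^bsub>M\<^esub> x) = a \<odot>\<^bsub>N\<^esub> \<delta> x)}"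

definition Hom_module ::
    "'a set \<Rightarrow> ('a, 'm, 'y) module_scheme \<Rightarrow> ('a, 'n, 'z) module_scheme
      \<Rightarrow> ('t \<Rightarrow> ('m \<Rightarrow> 'n) \<Rightarrow> ('m \<Rightarrow> 'n)) \<Rightarrow> ('t, 'm \<Rightarrow> 'n) module" where
  "Hom_module A M N act = \<lparr>carrier = Hom_set A M N, monoid.mult = undefined, one = undefined,
     ring.zero = (\<lambda>m\<in>carrier M. \<zero>\<^bsub>N\<^esub>), ring.add = (\<lambda>\<delta> \<epsilon>. \<lambda>m\<in>carrier M. \<delta> m \<oplus>\<^bsub>N\<^esub> \<epsilon> m), smult = act\<rparr>"

text \<open>The action \<open>(r \<otimes> s) \<delta> = (m \<mapsto> r \<delta> (s m))\<close> of the enveloping ring. An element \<open>T\<close> of the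
  enveloping ring is a coset of formal integer combinations of pairs; the value of the action
  does not depend on the representative \<open>u\<close> chosen.\<close>

definition enveloping_act ::
    "('a, 'm, 'y) module_scheme \<Rightarrow> ('a, 'n, 'z) module_scheme
      \<Rightarrow> ('a \<times> 'a \<Rightarrow>\<^sub>0 int) set \<Rightarrow> ('m \<Rightarrow> 'n) \<Rightarrow> ('m \<Rightarrow> 'n)" where
  "enveloping_act M N T \<delta> = (let u = (SOME u. u \<in> T) in
     (\<lambda>m\<in>carrier M. \<Oplus>\<^bsub>N\<^esub>q\<in>Poly_Mapping.keys u.
       add_pow N (Poly_Mapping.lookup u q) (fst q \<odot>\<^bsub>N\<^esub> \<delta> (snd q \<odot>\<^bsub>M\<^esub> m))))"

definition left_act ::
    "('a, 'm, 'y) module_scheme \<Rightarrow> ('s, 'n, 'z) module_scheme \<Rightarrow> 's \<Rightarrow> ('m \<Rightarrow> 'n) \<Rightarrow> ('m \<Rightarrow> 'n)" where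
  "left_act M N r \<delta> = (\<lambda>m\<in>carrier M. r \<odot>\<^bsub>N\<^esub> \<delta> m)"

definition bracket ::
    "('a, 'm, 'y) module_scheme \<Rightarrow> ('a, 'n, 'z) module_scheme \<Rightarrow> ('m \<Rightarrow> 'n) \<Rightarrow> 'a \<Rightarrow> ('m \<Rightarrow> 'n)" where
  "bracket M N \<delta> r = (\<lambda>m\<in>carrier M. \<delta> (r \<odot>\<^bsub>M\<^esub> m) \<ominus>\<^bsub>N\<^esub> r \<odot>\<^bsub>N\<^esub> \<delta> m)"

text \<open>Operators of order at most \<open>k - 1\<close>; the shift makes \<open>k = 0\<close> the base case of order \<open>-1\<close>.\<close>

primrec Diff_lt ::
    "('a, 'r) ring_scheme \<Rightarrow> 'a set \<Rightarrow> ('a, 'm, 'y) module_scheme \<Rightarrow> ('a, 'n, 'z) module_scheme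
      \<Rightarrow> nat \<Rightarrow> ('m \<Rightarrow> 'n) set" where
  "Diff_lt R A M N 0 = {\<lambda>m\<in>carrier M. \<zero>\<^bsub>N\<^esub>}"
| "Diff_lt R A M N (Suc k) =
     {\<delta> \<in> Hom_set A M N. \<forall>r\<in>carrier R. bracket M N \<delta> r \<in> Diff_lt R A M N k}"

definition Diff_le ::
    "('a, 'r) ring_scheme \<Rightarrow> 'a set \<Rightarrow> ('a, 'm, 'y) module_scheme \<Rightarrow> ('a, 'n, 'z) module_scheme
      \<Rightarrow> nat \<Rightarrow> ('m \<Rightarrow> 'n) set" where
  "Diff_le R A M N n = Diff_lt R A M N (Suc n)"

definition Diff ::
    "('a, 'r) ring_scheme \<Rightarrow> 'a set \<Rightarrow> ('a, 'm, 'y) module_scheme \<Rightarrow> ('a, 'n, 'z) module_scheme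
      \<Rightarrow> ('m \<Rightarrow> 'n) set" where
  "Diff R A M N = (\<Union>n. Diff_le R A M N n)"

definition env_submodule ::
    "('a, 'r) ring_scheme \<Rightarrow> 'a set \<Rightarrow> ('a, 'm, 'y) module_scheme \<Rightarrow> ('a, 'n, 'z) module_scheme
      \<Rightarrow> ('m \<Rightarrow> 'n) set \<Rightarrow> bool" where
  "env_submodule R A M N E \<longleftrightarrow>
     submodule E (enveloping_ring R A) (Hom_module A M N (enveloping_act M N))"

definition solutions ::
    "('a, 'm, 'y) module_scheme \<Rightarrow> ('a, 'n, 'z) module_scheme \<Rightarrow> ('m \<Rightarrow> 'n) set \<Rightarrow> 'm set" where
  "solutions M N E = {f \<in> carrier M. \<forall>\<delta>\<in>E. \<delta> f = \<zero>\<^bsub>N\<^esub>}"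

text \<open>Polynomials are lists of coefficients, leading coefficient first.\<close>

definition (in ring) formal_deriv :: "'a list \<Rightarrow> 'a list" where
  "formal_deriv p = normalize (map (\<lambda>i. add_pow R i (coeff p i)) (rev [1..<length p]))"

definition (in ring) separable_element :: "'a set \<Rightarrow> 'a \<Rightarrow> bool" where
  "separable_element K x \<longleftrightarrow> algebraic K x \<and>
     isgcd (K[X]) \<one>\<^bsub>K[X]\<^esub> (Irr K x) (formal_deriv (Irr K x))"

text \<open>A polynomial with coefficients in \<open>K\<close> in the variables \<open>U\<close> is given by a finite set \<open>M\<close> of
  exponents, which are finitely supported functions on \<open>U\<close>, with coefficients \<open>c\<close>.\<close>

definition (in ring) algebraically_independent :: "'a set \<Rightarrow> 'a set \<Rightarrow> bool" where
  "algebraically_independent K U \<longleftrightarrow>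
     (\<forall>(M :: ('a \<Rightarrow>\<^sub>0 nat) set) c. finite M \<and> (\<forall>e\<in>M. Poly_Mapping.keys e \<subseteq> U) \<and> c \<in> M \<rightarrow> K \<and>
        (\<Oplus>e\<in>M. c e \<otimes> (\<Otimes>x\<in>Poly_Mapping.keys e. x [^] Poly_Mapping.lookup e x)) = \<zero> \<longrightarrow>
        (\<forall>e\<in>M. c e = \<zero>))"

definition (in ring) separably_generated :: "'a set \<Rightarrow> 'a set \<Rightarrow> bool" where
  "separably_generated K F \<longleftrightarrow>
     (\<exists>U \<subseteq> F. algebraically_independent K U \<and>
        (\<forall>x\<in>F. separable_element (generate_field R (K \<union> U)) x))"

text \<open>A not necessarily algebraic field extension \<open>R\<close> of a subfield \<open>K\<close> is separable if each of
  its finitely generated subextensions is separably generated.\<close>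

definition (in ring) separable_extension :: "'a set \<Rightarrow> bool" where
  "separable_extension K \<longleftrightarrow> subfield K R \<and>
     (\<forall>Y. finite Y \<and> Y \<subseteq> carrier R \<longrightarrow> separably_generated K (generate_field R (K \<union> Y)))"

definition perfect_field :: "('a, 'r) ring_scheme \<Rightarrow> bool" where
  "perfect_field K \<longleftrightarrow> field K \<and>
     (\<forall>p::nat. Factorial_Ring.prime p \<and> add_pow K p \<one>\<^bsub>K\<^esub> = \<zero>\<^bsub>K\<^esub> \<longrightarrow>
        (\<forall>x\<in>carrier K. \<exists>y\<in>carrier K. y [^]\<^bsub>K\<^esub> p = x))"

end

theory Submission
  imports Defs
begin

text \<open>Let \<open>\<kappa>\<close> be the residue field of \<open>P\<close>, \<open>B\<close> the quotient of the local ring at \<open>P\<close> by the extension of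
  \<open>I\<close>, and \<open>\<rho> : B \<rightarrow> \<kappa>\<close> the residue map, whose kernel consists of nilpotent elements. By Zorn's lemma
  \<open>B\<close> has a maximal subfield \<open>F\<close> containing \<open>Quot A\<close>. By Hensel's lemma, \<open>\<kappa>\<close> is algebraic and purely
  inseparable over \<open>\<rho> F\<close>. If \<open>\<kappa>\<close> is finitely generated over \<open>Quot A\<close>, it is therefore finite over
  \<open>\<rho> F\<close>, and \<open>B\<close> has a finite basis over \<open>F\<close>. The \<open>F\<close>-linear maps \<open>B \<rightarrow> \<kappa>\<close> separate the points of \<open>B\<close>, are
  stable under multiplication in the argument, and have bounded order: some \<open>p\<close>-power of each basis
  element lies in \<open>F\<close> up to a nilpotent, so iterated commutators with it vanish. Composed with
  \<open>R \<rightarrow> B\<close> they are the operators of (i). In (i) finite generation of \<open>\<kappa>\<close> follows from the Noetherian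
  hypothesis as in Vamos's theorem on tensor products of fields. If \<open>\<kappa>\<close> is separable over \<open>Quot A\<close>,
  then \<open>F\<close> can be chosen to map onto \<open>\<kappa>\<close>, and the order is less than the nilpotency degree of the
  kernel of \<open>\<rho>\<close>. For \<open>R\<close> essentially of finite type, an operator of given order takes values in a
  submodule as soon as it does so on finitely many monomials; this allows clearing denominators in \<open>\<kappa>\<close>
  and embedding the values into \<open>N\<close>.\<close>

\<comment> \<open>The obstacle is inseparability: over Quot(A) the ring \<open>B\<close> need not
  contain a copy of its residue field, so the coefficient field that would make everything explicit
  can be missing. A maximal subfield \<open>F\<close> misses only p-power roots, and these are paid
  for in the order. If q is a power of p with \<open>b [^] q\<close> in \<open>F\<close> up to a
  nilpotent element, the interior binomial coefficients vanish and the q-fold commutator with b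
  multiplies the argument by that nilpotent element. The bound on the order thus grows with q, which
  is why order n for ideals containing the (n+1)-st power of P is tied to separability. For the
  Noetherian hypothesis: the kernel of the multiplication map onto \<open>\<kappa>\<close> is
  finitely generated modulo the tensor relations, and generators involve only finitely many elements
  of \<open>\<kappa>\<close>. If these generated over Quot(A) a proper subfield L, some l outside L
  with lift l' would give an element l \<otimes> 1 - 1 \<otimes> l' of the kernel, and an L-linear
  functional with value 0 at 1 and 1 at l would separate it from the generators.\<close>
syntax "_index" :: "logic \<Rightarrow> index" ("\<^sub>_" [1000] 1000)
alias keys = Poly_Mapping.keys
alias lookup = Poly_Mapping.lookup

section \<open>Pascal recursions and the Frobenius map\<close>

text \<open>Powers of a sum and iterated commutators of an operator with a ring element are both
  binomial expansions in two commuting maps. The recursion isolates what they share, so that no ring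
  of operators has to be set up; the entry at (i, j) stands for i uses of the first map and j of the
  second.\<close>

lemma (in abelian_group) pascal_recursion:
 assumes w: "!!i j. w i j \<in> carrier G"
  and D0: "!!i j. D 0 i j = w i j"
  and DS: "!!n i j. D (Suc n) i j = D n (Suc i) j \<oplus> D n i (Suc j)"
 shows "D n i j = (\<Oplus>k\<in>{..n}. add_pow G (n choose k) (w (i + (n - k)) (j + k)))"
proof (induction n arbitrary: i j)
 case 0
 show ?case by (simp add: D0 w)
next
 case (Suc n)
 let ?t = "\<lambda>m k. add_pow G (m::nat) (w (i + (Suc n - k)) (j + k))"
 have cl: "?t m k \<in> carrier G" for m k
  using w by simp
 have a: "D n (Suc i) j = (\<Oplus>k\<in>{..Suc n}. ?t (n choose k) k)"
 proof -
  have "D n (Suc i) j = (\<Oplus>k\<in>{..n}. ?t (n choose k) k)"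
   unfolding Suc.IH
   by (rule add.finprod_cong') (use w in \<open>auto simp: Suc_diff_le\<close>)
  also have "\<dots> = (\<Oplus>k\<in>{..Suc n}. ?t (n choose k) k)"
  proof -
   have "(\<Oplus>k\<in>{..Suc n}. ?t (n choose k) k) = ?t (n choose Suc n) (Suc n) \<oplus> (\<Oplus>k\<in>{..n}. ?t (n choose k) k)"
    by (rule finsum_Suc) (use cl in blast)
   then show ?thesis using cl w by (simp add: binomial_eq_0 finsum_closed)
  qed
  finally show ?thesis .
 qed
 have b: "D n i (Suc j) = (\<Oplus>k\<in>{..n}. ?t (n choose k) (Suc k))"
  unfolding Suc.IH by (rule add.finprod_cong') (use w in auto)
 have a': "(\<Oplus>k\<in>{..Suc n}. ?t (n choose k) k) = (\<Oplus>k\<in>{..n}. ?t (n choose Suc k) (Suc k)) \<oplus> ?t (n choose 0) 0"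
  using cl by (intro finsum_Suc2) auto
 have c: "(\<Oplus>k\<in>{..Suc n}. ?t (Suc n choose k) k) = (\<Oplus>k\<in>{..n}. ?t (Suc n choose Suc k) (Suc k)) \<oplus> ?t (Suc n choose 0) 0"
  using cl by (intro finsum_Suc2) auto
 have d: "(\<Oplus>k\<in>{..n}. ?t (Suc n choose Suc k) (Suc k))
   = (\<Oplus>k\<in>{..n}. ?t (n choose Suc k) (Suc k)) \<oplus> (\<Oplus>k\<in>{..n}. ?t (n choose k) (Suc k))"
 proof -
  have "(\<Oplus>k\<in>{..n}. ?t (Suc n choose Suc k) (Suc k))
    = (\<Oplus>k\<in>{..n}. ?t (n choose Suc k) (Suc k) \<oplus> ?t (n choose k) (Suc k))"
   by (rule add.finprod_cong') (use w in \<open>auto simp: add.nat_pow_mult add.commute\<close>)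
  also have "\<dots> = (\<Oplus>k\<in>{..n}. ?t (n choose Suc k) (Suc k)) \<oplus> (\<Oplus>k\<in>{..n}. ?t (n choose k) (Suc k))"
   by (rule finsum_addf) (use w in auto)
  finally show ?thesis .
 qed
 have "finsum G (\<lambda>k. ?t (n choose Suc k) (Suc k)) {..n} \<in> carrier G"
  "finsum G (\<lambda>k. ?t (n choose k) (Suc k)) {..n} \<in> carrier G"
  using w by (auto intro!: finsum_closed)
 note cls = this cl[of "n choose 0" 0]
 have e: "?t (Suc n choose 0) 0 = ?t (n choose 0) 0" by simp
 have "u \<oplus> z \<oplus> v = u \<oplus> v \<oplus> z"
  if "u \<in> carrier G" "v \<in> carrier G" "z \<in> carrier G" for u v z
  using that by (simp add: a_ac)
 from this[OF cls] show ?case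
  unfolding DS a b a' c d e .
qed

text \<open>The interior coefficients \<open>p choose k\<close> are divisible by \<open>p\<close>
  and annihilate the entries of \<open>w\<close> by the torsion hypothesis; only the two ends
  remain.\<close>

lemma (in abelian_group) pascal_recursion_prime:
 assumes w: "!!i j. w i j \<in> carrier G"
  and D0: "!!i j. D 0 i j = w i j"
  and DS: "!!n i j. D (Suc n) i j = D n (Suc i) j \<oplus> D n i (Suc j)"
  and p: "Factorial_Ring.prime (p::nat)" and tors: "!!i j. add_pow G p (w i j) = \<zero>"
 shows "D p i j = w (i + p) j \<oplus> w i (j + p)"
proof -
 obtain q where q: "p = Suc (Suc q)"
  using prime_ge_2_nat[OF p] by (metis Suc_1 add_2_eq_Suc le_Suc_ex)
 let ?t = "\<lambda>k. add_pow G (p choose k) (w (i + (p - k)) (j + k))"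
 have cl: "?t k \<in> carrier G" for k using w by simp
 have zero: "?t k = \<zero>" if "0 < k" "k < p" for k
 proof -
  have "p dvd (p choose k)" using that p by (intro dvd_choose_prime) auto
  then obtain m where m: "p choose k = p * m" by auto
  have "?t k = add_pow G m (add_pow G p (w (i + (p - k)) (j + k)))"
   unfolding m using w by (simp add: add.nat_pow_pow)
  then show ?thesis using tors by simp
 qed
 have "D p i j = (\<Oplus>k\<in>{..Suc (Suc q)}. ?t k)"
  using pascal_recursion[where w = w and D = D, OF w D0 DS] q by simp
 also have "\<dots> = ?t (Suc (Suc q)) \<oplus> ((\<Oplus>k\<in>{..q}. ?t (Suc k)) \<oplus> ?t 0)"
  using cl by (subst finsum_Suc, simp, subst finsum_Suc2) auto
 also have "(\<Oplus>k\<in>{..q}. ?t (Suc k)) = \<zero>"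
 proof (rule add.finprod_one_eqI)
  fix k assume "k \<in> {..q}"
  then show "?t (Suc k) = \<zero>" using zero[of "Suc k"] q by auto
 qed
 finally show ?thesis using w q by (simp add: a_comm)
qed

context cring
begin

lemma add_pow_char_zero:
 fixes p :: nat
 assumes "add_pow R p \<one> = \<zero>" "x \<in> carrier R"
 shows "add_pow R p x = \<zero>"
 using add_pow_ldistr[of \<one> x p] assms by simp

lemma frobenius_add:
 assumes p: "Factorial_Ring.prime (p::nat)" and char: "add_pow R p \<one> = \<zero>"
  and a: "a \<in> carrier R" and b: "b \<in> carrier R"
 shows "(a \<oplus> b) [^] p = a [^] p \<oplus> b [^] p"
proof -
 define w where "w = (\<lambda>(i::nat) (j::nat). a [^] i \<otimes> b [^] j)"
 define D where "D = (\<lambda>(n::nat) (i::nat) (j::nat). (a \<oplus> b) [^] n \<otimes> w i j)"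
 have w: "w i j \<in> carrier R" for i j using a b unfolding w_def by simp
 have "D p 0 0 = w (0 + p) 0 \<oplus> w 0 (0 + p)"
 proof (rule pascal_recursion_prime[where w = w and D = D, OF w _ _ p])
  show "D 0 i j = w i j" for i j unfolding D_def using w by simp
  have "u \<otimes> (a \<oplus> b) \<otimes> (x \<otimes> y) = u \<otimes> (x \<otimes> a \<otimes> y) \<oplus> u \<otimes> (x \<otimes> (y \<otimes> b))"
   if "u \<in> carrier R" "x \<in> carrier R" "y \<in> carrier R" for u x y
   using that a b by algebra
  then show "D (Suc n) i j = D n (Suc i) j \<oplus> D n i (Suc j)" for n i j
   unfolding D_def w_def nat_pow_Suc using a b by simp
  show "add_pow R p (w i j) = \<zero>" for i j
   using add_pow_char_zero[OF char w] .
 qed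
 then show ?thesis unfolding D_def w_def using a b by simp
qed

lemma frobenius_pow_add:
 assumes "Factorial_Ring.prime (p::nat)" "add_pow R p \<one> = \<zero>"
  and "a \<in> carrier R" "b \<in> carrier R"
 shows "(a \<oplus> b) [^] (p ^ e) = a [^] (p ^ e) \<oplus> b [^] (p ^ e)"
proof (induction e)
 case 0
 show ?case using assms by simp
next
 case (Suc e)
 have "(a \<oplus> b) [^] (p ^ Suc e) = ((a \<oplus> b) [^] (p ^ e)) [^] p"
  using assms by (simp add: nat_pow_pow mult.commute)
 then show ?case
  unfolding Suc.IH using assms by (simp add: frobenius_add nat_pow_pow mult.commute)
qed

lemma frobenius_finsum:
 assumes p: "Factorial_Ring.prime (p::nat)" and char: "add_pow R p \<one> = \<zero>"
  and "finite I" "f \<in> I \<rightarrow> carrier R"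
 shows "(\<Oplus>i\<in>I. f i) [^] p = (\<Oplus>i\<in>I. f i [^] p)"
 using assms(3,4)
proof (induction I rule: finite_induct)
 case empty
 show ?case using prime_gt_0_nat[OF p] by (simp add: nat_pow_zero)
next
 case (insert x I)
 then have "(\<lambda>i. f i [^] p) \<in> I \<rightarrow> carrier R" by auto
 with insert show ?case
  by (simp add: frobenius_add[OF p char] finsum_closed)
qed

end


section \<open>Polynomials: coefficients, derivatives and Taylor expansion\<close>

context ring
begin

lemma eval_eq_finsum:
 assumes "set p \<subseteq> carrier R" "x \<in> carrier R"
 shows "eval p x = (\<Oplus>i\<in>{..<length p}. coeff p i \<otimes> x [^] i)"
 using assms(1)
proof (induction p)
 case Nil
 show ?case by simp
next
 case (Cons a p)
 have "(\<Oplus>i\<in>{..<length (a # p)}. coeff (a # p) i \<otimes> x [^] i)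
   = a \<otimes> x [^] length p \<oplus> (\<Oplus>i\<in>{..<length p}. coeff (a # p) i \<otimes> x [^] i)"
  using Cons.prems assms(2) by (simp add: lessThan_Suc Pi_iff)
 also have "(\<Oplus>i\<in>{..<length p}. coeff (a # p) i \<otimes> x [^] i) = (\<Oplus>i\<in>{..<length p}. coeff p i \<otimes> x [^] i)"
  by (rule add.finprod_cong') (use Cons.prems assms(2) in auto)
 finally show ?case using Cons by simp
qed

definition poly_from :: "(nat => 'a) => nat => 'a list" where
 "poly_from c n = normalize (map c (rev [0..<n]))"

lemma poly_from_closed:
 assumes "c ` {..<n} \<subseteq> K"
 shows "poly_from c n \<in> carrier (K[X])"
 unfolding poly_from_def univ_poly_carrier[symmetric]
 using assms by (intro normalize_gives_polynomial) auto

lemma eval_poly_from: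
 assumes "c ` {..<n} \<subseteq> carrier R" "x \<in> carrier R"
 shows "eval (poly_from c n) x = (\<Oplus>i\<in>{..<n}. c i \<otimes> x [^] i)"
proof -
 have "eval (poly_from c n) x = eval (map c (rev [0..<n])) x"
  unfolding poly_from_def by (rule eval_normalize) (use assms in auto)
 also have "\<dots> = (\<Oplus>i\<in>{..<n}. c i \<otimes> x [^] i)"
  using assms(1)
 proof (induction n)
  case (Suc n)
  then have "c i \<otimes> x [^] i \<in> carrier R" if "i < Suc n" for i
   using that assms(2) by auto
  then show ?case using Suc assms(2) by (simp add: lessThan_Suc Pi_iff image_subset_iff)
 qed simp
 finally show ?thesis .
qed

lemma length_poly_from_le: "length (poly_from c n) \<le> n"
 unfolding poly_from_def using normalize_length_le[of "map c (rev [0..<n])"] by simp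

lemma coeff_poly_from: "i < n ==> coeff (poly_from c n) i = c i"
 unfolding poly_from_def normalize_coeff[symmetric]
 by (subst coeff_nth) (auto simp: rev_nth)

lemma length_poly_from_gt: "i < n ==> c i \<noteq> \<zero> ==> i < length (poly_from c n)"
 using coeff_poly_from[of i n c] coeff_length[of "poly_from c n" i] by (metis not_le)

lemma normalize_eq_Nil_iff: "normalize p = [] \<longleftrightarrow> set p \<subseteq> {\<zero>}"
 by (induction p) auto

text \<open>A pointwise derivative, free of the normalization built into
  \<open>formal_deriv\<close>. It commutes with ring homomorphisms even when they kill leading
  coefficients (\<open>hom_deriv_at\<close>), which suits the transfer of simple roots along
  \<open>\<rho>\<close>.\<close>

fun deriv_at :: "'a list => 'a => 'a" where
 "deriv_at [] x = \<zero>"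
| "deriv_at (c # q) x = add_pow R (length q) c \<otimes> x [^] (length q - 1) \<oplus> deriv_at q x"

lemma deriv_at_closed [simp]:
 "set p \<subseteq> carrier R ==> x \<in> carrier R ==> deriv_at p x \<in> carrier R"
 by (induction p) auto

lemma eval_formal_deriv:
 assumes "set p \<subseteq> carrier R" "x \<in> carrier R"
 shows "eval (formal_deriv p) x = deriv_at p x"
proof -
 let ?d = "\<lambda>p. map (\<lambda>i. add_pow R i (coeff p i)) (rev [1..<length p])"
 have "eval (formal_deriv p) x = eval (?d p) x"
  unfolding formal_deriv_def by (rule eval_normalize) (use assms in auto)
 also have "\<dots> = deriv_at p x"
  using assms(1)
 proof (induction p)
  case (Cons c q)
  show ?case
  proof (cases "q = []")
   case True
   then show ?thesis using Cons.prems assms(2) by simp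
  next
   case False
   then have "[1..<length (c # q)] = [1..<length q] @ [length q]" by (cases q) auto
   then have "?d (c # q) = add_pow R (length q) c # map (\<lambda>i. add_pow R i (coeff (c # q) i)) (rev [1..<length q])"
    by simp
   also have "map (\<lambda>i. add_pow R i (coeff (c # q) i)) (rev [1..<length q]) = ?d q"
    by (rule map_cong) auto
   finally show ?thesis using Cons by simp
  qed
 qed simp
 finally show ?thesis .
qed

end

lemma (in ring) formal_deriv_closed:
 assumes "subring K R" "p \<in> carrier (K[X])"
 shows "formal_deriv p \<in> carrier (K[X])"
proof -
 have p: "set p \<subseteq> K" using polynomial_incl assms(2) univ_poly_carrier by blast
 have "coeff p i \<in> K" for i
  using coeff_img_restrict[of p] coeff_length[of p i] p subringE(2)[OF assms(1)]
  by (cases "i < length p") auto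
 moreover have "add_pow R (n::nat) k \<in> K" if "k \<in> K" for k n
  using that subringE(1,2,7)[OF assms(1)] by (induction n) auto
 ultimately show ?thesis
  unfolding formal_deriv_def univ_poly_carrier[symmetric]
  by (intro normalize_gives_polynomial) auto
qed

lemma (in ring) length_formal_deriv_le: "length (formal_deriv p) \<le> length p - 1"
 unfolding formal_deriv_def
 by (rule order_trans[OF normalize_length_le]) simp

context cring
begin

lemma power_taylor:
 assumes y: "y \<in> carrier R" and h: "h \<in> carrier R"
 shows "\<exists>t\<in>carrier R. (y \<oplus> h) [^] (n::nat) = y [^] n \<oplus> h \<otimes> (add_pow R n (y [^] (n - 1))) \<oplus> h \<otimes> h \<otimes> t"
proof (induction n)
 case 0
 show ?case using y h by (intro bexI[of _ \<zero>]) auto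
next
 case (Suc n)
 then obtain t where t: "t \<in> carrier R"
  and e: "(y \<oplus> h) [^] n = y [^] n \<oplus> h \<otimes> (add_pow R n (y [^] (n - 1))) \<oplus> h \<otimes> h \<otimes> t" by auto
 let ?a = "add_pow R n (y [^] (n - 1))"
 have a: "?a \<in> carrier R" using y by simp
 have ya: "?a \<otimes> y = add_pow R n (y [^] n)"
  using y by (cases n) (simp_all add: add_pow_ldistr l_distr)
 have "(y \<oplus> h) [^] Suc n = (y [^] n \<oplus> h \<otimes> ?a \<oplus> h \<otimes> h \<otimes> t) \<otimes> (y \<oplus> h)"
  using e by simp
 also have "\<dots> = y [^] n \<otimes> y \<oplus> h \<otimes> (?a \<otimes> y \<oplus> y [^] n) \<oplus> h \<otimes> h \<otimes> (t \<otimes> (y \<oplus> h) \<oplus> ?a)"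
 proof -
  have "(u \<oplus> h \<otimes> v \<oplus> h \<otimes> h \<otimes> t) \<otimes> (y \<oplus> h) = u \<otimes> y \<oplus> h \<otimes> (v \<otimes> y \<oplus> u) \<oplus> h \<otimes> h \<otimes> (t \<otimes> (y \<oplus> h) \<oplus> v)"
   if "u \<in> carrier R" "v \<in> carrier R" for u v
   using that y h t by algebra
  then show ?thesis using a y by simp
 qed
 also have "?a \<otimes> y \<oplus> y [^] n = add_pow R (Suc n) (y [^] n)"
  unfolding ya using y by simp
 finally show ?case
  using y h t a by (intro bexI[of _ "t \<otimes> (y \<oplus> h) \<oplus> ?a"]) auto
qed

text \<open>The explicit square of \<open>h\<close> in the remainder is the estimate behind the
  Newton step in \<open>hensel\<close>.\<close>

lemma eval_taylor:
 assumes y: "y \<in> carrier R" and h: "h \<in> carrier R" and p: "set p \<subseteq> carrier R"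
 shows "\<exists>t\<in>carrier R. eval p (y \<oplus> h) = eval p y \<oplus> h \<otimes> deriv_at p y \<oplus> h \<otimes> h \<otimes> t"
 using p
proof (induction p)
 case Nil
 show ?case using h by (intro bexI[of _ \<zero>]) auto
next
 case (Cons c q)
 then obtain t where t: "t \<in> carrier R"
  and e: "eval q (y \<oplus> h) = eval q y \<oplus> h \<otimes> deriv_at q y \<oplus> h \<otimes> h \<otimes> t" by auto
 obtain s where s: "s \<in> carrier R"
  and f: "(y \<oplus> h) [^] length q = y [^] length q \<oplus> h \<otimes> (add_pow R (length q) (y [^] (length q - 1))) \<oplus> h \<otimes> h \<otimes> s"
  using power_taylor[OF y h] by blast
 let ?b = "add_pow R (length q) (y [^] (length q - 1))"
 have c: "c \<in> carrier R" and q: "set q \<subseteq> carrier R" using Cons.prems by auto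
 have cb: "c \<otimes> ?b = add_pow R (length q) c \<otimes> y [^] (length q - 1)"
  using c y by (simp add: add_pow_ldistr add_pow_rdistr)
 have cl: "?b \<in> carrier R" "y [^] length q \<in> carrier R" "eval q y \<in> carrier R" "deriv_at q y \<in> carrier R"
  using y q eval_in_carrier by auto
 have "eval (c # q) (y \<oplus> h) = c \<otimes> (y [^] length q \<oplus> h \<otimes> ?b \<oplus> h \<otimes> h \<otimes> s) \<oplus>
   (eval q y \<oplus> h \<otimes> deriv_at q y \<oplus> h \<otimes> h \<otimes> t)"
  using e f by simp
 also have "\<dots> = (c \<otimes> y [^] length q \<oplus> eval q y) \<oplus> h \<otimes> (c \<otimes> ?b \<oplus> deriv_at q y) \<oplus> h \<otimes> h \<otimes> (c \<otimes> s \<oplus> t)"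
 proof -
  have "c \<otimes> (u \<oplus> h \<otimes> v \<oplus> h \<otimes> h \<otimes> s) \<oplus> (u' \<oplus> h \<otimes> v' \<oplus> h \<otimes> h \<otimes> t)
    = (c \<otimes> u \<oplus> u') \<oplus> h \<otimes> (c \<otimes> v \<oplus> v') \<oplus> h \<otimes> h \<otimes> (c \<otimes> s \<oplus> t)"
   if "u \<in> carrier R" "v \<in> carrier R" "u' \<in> carrier R" "v' \<in> carrier R" for u v u' v'
   using that c s t h by algebra
  then show ?thesis using cl by simp
 qed
 finally show ?case
  unfolding cb using c s t by (intro bexI[of _ "c \<otimes> s \<oplus> t"]) auto
qed

end

section \<open>Separable and inseparable elements\<close>

context field
begin

text \<open>Turns the gcd condition into a simple root. If the derivative vanished at
  \<open>x\<close>, the minimal polynomial would divide its own derivative, hence the gcd, and would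
  be a unit.\<close>

lemma separable_elementD:
 assumes K: "subfield K R" and x: "x \<in> carrier R" and sep: "separable_element K x"
 shows "deriv_at (Irr K x) x \<noteq> \<zero>"
proof
 assume dz: "deriv_at (Irr K x) x = \<zero>"
 have alg: "(algebraic over K) x" using sep unfolding separable_element_def over_def by simp
 note I = IrrE[OF K x alg]
 have sK: "subring K R" using subfieldE(1)[OF K] .
 have "set (Irr K x) \<subseteq> carrier R"
  using I(1) polynomial_incl univ_poly_carrier subfieldE(3)[OF K] by blast
 then have "eval (formal_deriv (Irr K x)) x = \<zero>"
  using eval_formal_deriv dz x by simp
 moreover have fd: "formal_deriv (Irr K x) \<in> carrier (K[X])"
  using formal_deriv_closed[OF sK I(1)] .
 ultimately have "Irr K x pdivides formal_deriv (Irr K x)"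
  using Irr_minimal[OF K x alg] by blast
 then have "Irr K x divides\<^bsub>K[X]\<^esub> formal_deriv (Irr K x)"
  using pdivides_iff_shell[OF K I(1) fd] by simp
 moreover interpret UP: domain "K[X]" using univ_poly_is_domain[OF sK] .
 have "Irr K x divides\<^bsub>K[X]\<^esub> Irr K x" using I(1) by simp
 ultimately have "Irr K x divides\<^bsub>K[X]\<^esub> \<one>\<^bsub>K[X]\<^esub>"
  using sep I(1) unfolding separable_element_def isgcd_def by blast
 then have "Irr K x \<in> Units (K[X])"
  using I(1) UP.divides_one by simp
 then show False
  using pirreducibleE(2)[OF sK I(1,2)] by simp
qed

text \<open>A common divisor of an irreducible polynomial and its derivative that is no unit is
  associated to the polynomial. Then the polynomial divides its derivative, which would vanish at
  \<open>x\<close>.\<close>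

lemma separable_elementI:
 assumes K: "subfield K R" and x: "x \<in> carrier R" and alg: "(algebraic over K) x"
  and nz: "deriv_at (Irr K x) x \<noteq> \<zero>"
 shows "separable_element K x"
proof -
 note I = IrrE[OF K x alg]
 have sK: "subring K R" using subfieldE(1)[OF K] .
 interpret UP: domain "K[X]" using univ_poly_is_domain[OF sK] .
 have fd: "formal_deriv (Irr K x) \<in> carrier (K[X])"
  using formal_deriv_closed[OF sK I(1)] .
 have sI: "set (Irr K x) \<subseteq> carrier R"
  using I(1) polynomial_incl univ_poly_carrier subfieldE(3)[OF K] by blast
 have "y divides\<^bsub>K[X]\<^esub> \<one>\<^bsub>K[X]\<^esub>"
  if y: "y \<in> carrier (K[X])" and d1: "y divides\<^bsub>K[X]\<^esub> Irr K x"
   and d2: "y divides\<^bsub>K[X]\<^esub> formal_deriv (Irr K x)" for y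
 proof (rule ccontr)
  assume "\<not> y divides\<^bsub>K[X]\<^esub> \<one>\<^bsub>K[X]\<^esub>"
  then have nu: "y \<notin> Units (K[X])" using UP.divides_one y by simp
  obtain r where r: "r \<in> carrier (K[X])" and e: "Irr K x = y \<otimes>\<^bsub>K[X]\<^esub> r"
   using d1 unfolding factor_def by auto
  have "r \<in> Units (K[X])"
   using pirreducibleE(3)[OF sK I(1,2) y r e] nu by simp
  then have "inv\<^bsub>K[X]\<^esub> r \<in> carrier (K[X])" "y = Irr K x \<otimes>\<^bsub>K[X]\<^esub> inv\<^bsub>K[X]\<^esub> r"
   unfolding e using y r by (simp_all add: UP.m_assoc)
  then have "Irr K x divides\<^bsub>K[X]\<^esub> y"
   unfolding factor_def by blast
  then have "Irr K x divides\<^bsub>K[X]\<^esub> formal_deriv (Irr K x)"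
   using d2 I(1) UP.divides_trans by blast
  then obtain s where "s \<in> carrier (K[X])" "formal_deriv (Irr K x) = Irr K x \<otimes>\<^bsub>K[X]\<^esub> s"
   unfolding factor_def by auto
  then have "eval (formal_deriv (Irr K x)) x = eval (Irr K x) x \<otimes> eval s x"
   using ring_hom_mult[OF eval_is_hom[OF sK x]] I(1) by simp
  moreover have "eval s x \<in> carrier R"
   using ring_hom_closed[OF eval_is_hom[OF sK x]] \<open>s \<in> carrier (K[X])\<close> by blast
  ultimately show False
   using I(4) nz eval_formal_deriv[OF sI x] by simp
 qed
 moreover have "\<one>\<^bsub>K[X]\<^esub> divides\<^bsub>K[X]\<^esub> y" if "y \<in> carrier (K[X])" for y
  using that unfolding factor_def by (intro bexI[of _ y]) auto
 ultimately show ?thesis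
  unfolding separable_element_def isgcd_def using alg I(1) fd by (simp add: over_def)
qed

lemma char_prime_exists:
 assumes "0 < (n::nat)" "add_pow R n \<one> = \<zero>"
 shows "\<exists>p::nat. Factorial_Ring.prime p \<and> add_pow R p \<one> = \<zero>"
 using assms
proof (induction n rule: less_induct)
 case (less n)
 have "n \<noteq> 1" using less.prems(2) by auto
 then obtain p where p: "Factorial_Ring.prime p" "p dvd n"
  using prime_factor_nat by blast
 then obtain m where m: "n = p * m" by auto
 have "add_pow R p \<one> \<otimes> add_pow R m \<one> = \<zero>"
  using less.prems(2) unfolding m by (simp add: add_pow_ldistr add.nat_pow_pow mult.commute)
 then have "add_pow R p \<one> = \<zero> \<or> add_pow R m \<one> = \<zero>"
  using integral by simp
 then show ?case
 proof
  assume "add_pow R m \<one> = \<zero>"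
  moreover have "m < n" "0 < m" using m less.prems(1) prime_gt_1_nat[OF p(1)] by auto
  ultimately show ?thesis using less.IH by blast
 qed (use p in blast)
qed

lemma char_prime_dvd:
 assumes p: "Factorial_Ring.prime (p::nat)" "add_pow R p \<one> = \<zero>"
  and n: "add_pow R (n::nat) x = \<zero>" and x: "x \<in> carrier R" "x \<noteq> \<zero>"
 shows "p dvd n"
proof (rule ccontr)
 assume "\<not> p dvd n"
 then have cop: "coprime n p" using p(1) prime_imp_coprime_nat coprime_commute by blast
 have nz: "n \<noteq> 0" using \<open>\<not> p dvd n\<close> by (cases n) auto
 obtain a b where ab: "a * n = b * p + 1"
  using bezout_nat[OF nz, of p] cop by (auto simp: coprime_iff_gcd_eq_1 mult.commute)
 have "add_pow R (a * n) x = \<zero>"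
  using n x(1) by (simp add: mult.commute[of a] add.nat_pow_pow[symmetric])
 moreover have "add_pow R (b * p + 1) x = x"
  using add_pow_char_zero[OF p(2) x(1)] x(1)
  by (simp add: mult.commute[of b] add.nat_pow_pow[symmetric] add.nat_pow_mult[symmetric])
 ultimately show False using ab x(2) by simp
qed

lemma char_prime_unique:
 assumes "Factorial_Ring.prime (p::nat)" "add_pow R p \<one> = \<zero>"
  and "Factorial_Ring.prime (q::nat)" "add_pow R q \<one> = \<zero>"
 shows "p = q"
 using char_prime_dvd[OF assms(1,2) assms(4)] assms(1,3) primes_dvd_imp_eq by auto

text \<open>The derivative of the minimal polynomial has smaller degree and vanishes at
  \<open>x\<close>, so it is zero. Only exponents divisible by the characteristic survive, and the
  minimal polynomial has the form h(X^p).\<close>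

lemma inseparable_imp_polynomial_in_power:
 assumes K: "subfield K R" and x: "x \<in> carrier R" and alg: "(algebraic over K) x"
  and ns: "\<not> separable_element K x"
 shows "\<exists>p h. Factorial_Ring.prime (p::nat) \<and> add_pow R p \<one> = \<zero> \<and> h \<in> carrier (K[X]) \<and> h \<noteq> [] \<and>
   eval h (x [^] p) = \<zero> \<and> degree h < degree (Irr K x)"
proof -
 note I = IrrE[OF K x alg]
 let ?g = "Irr K x"
 have sK: "subring K R" using subfieldE(1)[OF K] .
 have gK: "set ?g \<subseteq> K" using I(1) polynomial_incl univ_poly_carrier by blast
 then have g: "set ?g \<subseteq> carrier R" using subfieldE(3)[OF K] by blast
 have "deriv_at ?g x = \<zero>" using separable_elementI[OF K x alg] ns by blast
 then have e0: "eval (formal_deriv ?g) x = \<zero>" using eval_formal_deriv[OF g x] by simp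
 have fd: "formal_deriv ?g \<in> carrier (K[X])" using formal_deriv_closed[OF sK I(1)] .
 have deg: "degree ?g \<ge> 1" using pirreducible_degree[OF K I(1,2)] .
 have "formal_deriv ?g = []"
 proof (rule ccontr)
  assume nz: "formal_deriv ?g \<noteq> []"
  have "degree ?g \<le> degree (formal_deriv ?g)"
   using pdivides_imp_degree_le[OF sK I(1) fd nz Irr_minimal[OF K x alg fd e0]] .
  moreover have "length (formal_deriv ?g) > 0" using nz by simp
  ultimately show False using length_formal_deriv_le[of ?g] deg by linarith
 qed
 have z: "add_pow R i (coeff ?g i) = \<zero>" for i
 proof (cases "1 \<le> i \<and> i < length ?g")
  case True
  then show ?thesis using \<open>formal_deriv ?g = []\<close>
   unfolding formal_deriv_def normalize_eq_Nil_iff by (auto simp: image_subset_iff)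
 next
  case False
  then show ?thesis by (cases "i = 0") (auto simp: coeff_length)
 qed
 have gne: "?g \<noteq> []" using deg by auto
 \<comment> \<open>Multiplying the leading coefficient 1 by the positive degree gives 0, which
   forces positive characteristic.\<close>
 have lc: "coeff ?g (degree ?g) = \<one>" using I(3) gne lead_coeff_simp[OF gne] by simp
 then obtain p where p: "Factorial_Ring.prime (p::nat)" "add_pow R p \<one> = \<zero>"
  using char_prime_exists[of "degree ?g"] z[of "degree ?g"] deg by (metis less_le_trans zero_less_one)
 have z': "coeff ?g i = \<zero>" if "\<not> p dvd i" for i
  using char_prime_dvd[OF p z, of i] that g by auto
 have pd: "p dvd degree ?g" using z'[of "degree ?g"] lc by auto
 let ?n = "degree ?g div p + 1"
 let ?c = "\<lambda>j. coeff ?g (p * j)"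
 let ?h = "poly_from ?c ?n"
 have cK: "coeff ?g i \<in> K" for i
  using coeff_img_restrict[of ?g] coeff_length[of ?g i] gK subringE(2)[OF sK]
  by (cases "i < length ?g") auto
 have h: "?h \<in> carrier (K[X])" using cK by (intro poly_from_closed) auto
 have "degree ?g div p < length ?h"
  by (rule length_poly_from_gt) (use lc pd in auto)
 then have hne: "?h \<noteq> []" by auto
 have hdeg: "degree ?h < degree ?g"
 proof -
  have "degree ?h \<le> degree ?g div p" using length_poly_from_le[of ?c ?n] by simp
  also have "\<dots> < degree ?g" using deg prime_gt_1_nat[OF p(1)] by auto
  finally show ?thesis .
 qed
 have "eval ?h (x [^] p) = (\<Oplus>j\<in>{..<?n}. ?c j \<otimes> (x [^] p) [^] j)"
  using g x by (intro eval_poly_from) auto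
 also have "\<dots> = (\<Oplus>j\<in>{..<?n}. coeff ?g (p * j) \<otimes> x [^] (p * j))"
  by (rule add.finprod_cong') (use g x in \<open>auto simp: nat_pow_pow\<close>)
 also have "\<dots> = (\<Oplus>i\<in>(\<lambda>j. p * j) ` {..<?n}. coeff ?g i \<otimes> x [^] i)"
  by (rule add.finprod_reindex[symmetric])
    (use g x prime_gt_0_nat[OF p(1)] in \<open>auto simp: inj_on_def\<close>)
 also have "\<dots> = (\<Oplus>i\<in>{..<length ?g}. coeff ?g i \<otimes> x [^] i)"
 proof (rule add.finprod_mono_neutral_cong_left)
  show "(\<lambda>j. p * j) ` {..<?n} \<subseteq> {..<length ?g}"
  proof (rule image_subsetI)
   fix j assume "j \<in> {..<?n}"
   then have "p * j \<le> p * (degree ?g div p)" by (intro mult_le_mono2) simp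
   also have "\<dots> \<le> degree ?g" by simp
   finally show "p * j \<in> {..<length ?g}" using deg by (simp add: less_eq_Suc_le)
  qed
  show "coeff ?g i \<otimes> x [^] i = \<zero>" if "i \<in> {..<length ?g} - (\<lambda>j. p * j) ` {..<?n}" for i
  proof -
   have "\<not> p dvd i"
   proof
    assume "p dvd i"
    then obtain j where j: "i = p * j" by auto
    have "p * j \<le> degree ?g" using that j by auto
    then have "j \<le> degree ?g div p"
     using prime_gt_0_nat[OF p(1)] by (simp add: less_eq_div_iff_mult_less_eq mult.commute)
    then show False using that j by auto
   qed
   then show ?thesis using z' x by simp
  qed
 qed (use g x in auto)
 also have "\<dots> = \<zero>" using eval_eq_finsum[OF g x] I(4) by simp
 finally show ?thesis using p h hne hdeg by blast
qed

text \<open>Iterating the previous lemma strips off the inseparable part.\<close>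

lemma algebraic_power_in_separable_closure:
 assumes K: "subfield K R" and x: "x \<in> carrier R" and alg: "(algebraic over K) x"
  and sep: "!!y. y \<in> carrier R ==> separable_element K y ==> y \<in> K"
 shows "x \<in> K \<or> (\<exists>p e. Factorial_Ring.prime (p::nat) \<and> add_pow R p \<one> = \<zero> \<and> x [^] (p ^ e) \<in> K)"
 using x alg
proof (induction "degree (Irr K x)" arbitrary: x rule: less_induct)
 case less
 show ?case
 proof (cases "separable_element K x")
  case True
  then show ?thesis using sep less.prems by blast
 next
  case False
  then obtain p h where p: "Factorial_Ring.prime (p::nat)" "add_pow R p \<one> = \<zero>"
   and h: "h \<in> carrier (K[X])" "h \<noteq> []" "eval h (x [^] p) = \<zero>" "degree h < degree (Irr K x)"
   using inseparable_imp_polynomial_in_power[OF K less.prems] by blast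
  have y: "x [^] p \<in> carrier R" using less.prems by simp
  have alg: "(algebraic over K) (x [^] p)" using algebraicI[OF h(1,2,3)] .
  have "degree (Irr K (x [^] p)) \<le> degree h"
   using pdivides_imp_degree_le[OF subfieldE(1)[OF K] IrrE(1)[OF K y alg] h(1,2)]
    Irr_minimal[OF K y alg h(1,3)] by blast
  then have "x [^] p \<in> K \<or> (\<exists>q e. Factorial_Ring.prime (q::nat) \<and> add_pow R q \<one> = \<zero> \<and> (x [^] p) [^] (q ^ e) \<in> K)"
   using less.hyps[OF _ y alg] h(4) by (meson le_less_trans)
  then show ?thesis
  proof
   assume "x [^] p \<in> K"
   then have "x [^] (p ^ 1) \<in> K" by simp
   then show ?thesis using p by blast
  next
   assume "\<exists>q e. Factorial_Ring.prime (q::nat) \<and> add_pow R q \<one> = \<zero> \<and> (x [^] p) [^] (q ^ e) \<in> K"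
   then obtain q e where "Factorial_Ring.prime (q::nat)" "add_pow R q \<one> = \<zero>" and e: "(x [^] p) [^] (q ^ e) \<in> K"
    by blast
   then have "q = p" using char_prime_unique[OF _ _ p] by blast
   then have "x [^] (p ^ Suc e) \<in> K" using e less.prems(1) by (simp add: nat_pow_pow)
   then show ?thesis using p by blast
  qed
 qed
qed

end

lemma ring_hom_add_pow:
 assumes "ring R" "ring S" "h \<in> ring_hom R S" "x \<in> carrier R"
 shows "h (add_pow R (n::nat) x) = add_pow S n (h x)"
proof -
 interpret R: ring R by fact
 interpret S: ring S by fact
 have "h \<zero>\<^sub>R = \<zero>\<^sub>S"
  using ring_hom_zero[OF assms(3,1,2)] .
 then show ?thesis
  by (induction n) (use assms in \<open>simp_all add: ring_hom_add\<close>)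
qed

lemma (in ring) finsum_in_subring:
 assumes "subring K R" "!!i. i \<in> I ==> f i \<in> K"
 shows "(\<Oplus>i\<in>I. f i) \<in> K"
 using assms(2)
proof (induction I rule: infinite_finite_induct)
 case (insert x I)
 then have "f \<in> I \<rightarrow> carrier R" "f x \<in> carrier R" using subringE(1)[OF assms(1)] by auto
 then show ?case using insert subringE(7)[OF assms(1)] by simp
qed (use subringE(2)[OF assms(1)] in auto)

lemma (in cring) finprod_in_subring:
 assumes "subring K R" "!!i. i \<in> I ==> f i \<in> K"
 shows "(\<Otimes>i\<in>I. f i) \<in> K"
 using assms(2)
proof (induction I rule: infinite_finite_induct)
 case (insert x I)
 then have "f \<in> I \<rightarrow> carrier R" "f x \<in> carrier R" using subringE(1)[OF assms(1)] by auto
 then show ?case using insert subringE(6)[OF assms(1)] by simp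
qed (use subringE(3)[OF assms(1)] in auto)

lemma (in ring) nat_pow_in_subring:
 assumes "subring K R" "x \<in> K"
 shows "x [^] (n::nat) \<in> K"
 using assms subringE(3,6)[OF assms(1)] by (induction n) auto

lemma (in ring) dimension_Span_le:
 assumes "subfield K R" "set Us \<subseteq> carrier R"
 shows "\<exists>m\<le>length Us. dimension m K (Span K Us)"
 using assms(2)
proof (induction Us)
 case Nil
 show ?case by auto
next
 case (Cons u Us)
 then obtain m where m: "m \<le> length Us" "dimension m K (Span K Us)" by auto
 show ?case
 proof (cases "u \<in> Span K Us")
  case True
  then have "Span K (u # Us) = Span K Us"
   using mono_Span_subset[OF assms(1), of "u # Us" Us] mono_Span[OF assms(1), of Us u]
    Span_base_incl[OF assms(1), of Us] Cons.prems by auto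
  then show ?thesis using m by (auto simp del: Span.simps intro: le_SucI)
 next
  case False
  then have "dimension (Suc m) K (Span K (u # Us))"
   using Suc_dim[of u "Span K Us" m K] m Cons.prems by simp
  then show ?thesis using m by (auto simp del: Span.simps)
 qed
qed

section \<open>Purely inseparable elements and fields generated by p-th powers\<close>

context field
begin

lemma roots_linear_power:
 assumes u: "u \<in> carrier R"
 shows "roots ([\<one>, \<ominus> u] [^]\<^bsub>poly_ring R\<^esub> (n::nat)) = replicate_mset n u"
proof -
 interpret UP: domain "poly_ring R" using univ_poly_is_domain[OF carrier_is_subring] .
 have l: "[\<one>, \<ominus> u] \<in> carrier (poly_ring R)"
  using u unfolding univ_poly_carrier[symmetric] polynomial_def by auto
 have ne: "[\<one>, \<ominus> u] [^]\<^bsub>poly_ring R\<^esub> n \<noteq> []" for n :: nat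
  using polynomial_pow_not_zero[OF l, of n] by simp
 show ?thesis
 proof (induction n)
  case 0
  show ?case using degree_zero_imp_empty_roots[OF UP.one_closed]
   by (simp add: univ_poly_one)
 next
  case (Suc n)
  have "[\<one>, \<ominus> u] [^]\<^bsub>poly_ring R\<^esub> Suc n = [\<one>, \<ominus> u] \<otimes>\<^bsub>poly_ring R\<^esub> [\<one>, \<ominus> u] [^]\<^bsub>poly_ring R\<^esub> n"
   using l by (simp add: UP.m_comm)
  then show ?case
   using poly_mult_degree_one_monic_imp_same_roots[OF u UP.nat_pow_closed[OF l] ne, of n] Suc by simp
 qed
qed

text \<open>By the Frobenius rule in the polynomial ring, (X - u)^p is X^p plus the constant (-u)^p.
  The case \<open>u = \<zero>\<close> is split off because \<open>[\<ominus> u]\<close> is then not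
  a normalized list; keeping (-1)^p as a factor avoids a distinction by parity.\<close>

lemma linear_power_over_subfield:
 assumes K: "subfield K R" and p: "Factorial_Ring.prime (p::nat)" "add_pow R p \<one> = \<zero>"
  and u: "u \<in> carrier R" "u [^] p \<in> K"
 shows "[\<one>, \<ominus> u] [^]\<^bsub>poly_ring R\<^esub> p \<in> carrier (K[X])"
proof (cases "u = \<zero>")
 case True
 have "[\<one>, \<ominus> u] \<in> carrier (K[X])"
  using True subringE(2,3)[OF subfieldE(1)[OF K]]
  unfolding univ_poly_carrier[symmetric] polynomial_def by auto
 interpret UK: domain "K[X]" using univ_poly_is_domain[OF subfieldE(1)[OF K]] .
 have "[\<one>, \<ominus> u] [^]\<^bsub>poly_ring R\<^esub> n = [\<one>, \<ominus> u] [^]\<^bsub>K[X]\<^esub> n" for n :: nat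
  by (induction n) (simp_all add: univ_poly_one univ_poly_mult)
 then show ?thesis using \<open>[\<one>, \<ominus> u] \<in> carrier (K[X])\<close> by simp
next
 case False
 have sK: "subring K R" using subfieldE(1)[OF K] .
 interpret UP: domain "poly_ring R" using univ_poly_is_domain[OF carrier_is_subring] .
 interpret UK: domain "K[X]" using univ_poly_is_domain[OF sK] .
 have hom: "poly_of_const \<in> ring_hom R (poly_ring R)"
  using canonical_embedding_is_hom[OF carrier_is_subring] by simp
 have homK: "poly_of_const \<in> ring_hom (R\<lparr>carrier := K\<rparr>) (K[X])"
  using canonical_embedding_is_hom[OF sK] .
 have char: "add_pow (poly_ring R) p \<one>\<^bsub>poly_ring R\<^esub> = \<zero>\<^bsub>poly_ring R\<^esub>"
  using ring_hom_add_pow[OF ring_axioms UP.ring_axioms hom one_closed, of p] p(2)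
   ring_hom_one[OF hom] ring_hom_zero[OF hom ring_axioms UP.ring_axioms] by simp
 have mu: "\<ominus> u \<in> carrier R" "\<ominus> u \<noteq> \<zero>" using u False by (auto simp: minus_equality)
 have c: "poly_of_const (\<ominus> u) = [\<ominus> u]" using mu unfolding poly_of_const_def by simp
 have e: "[\<one>, \<ominus> u] = X \<oplus>\<^bsub>poly_ring R\<^esub> poly_of_const (\<ominus> u)"
  unfolding c var_def univ_poly_add using mu by simp
 have pc: "poly_of_const (\<ominus> u) \<in> carrier (poly_ring R)" using ring_hom_closed[OF hom mu(1)] .
 have Xc: "X \<in> carrier (poly_ring R)" using var_closed(1)[OF carrier_is_subring] .
 have "[\<one>, \<ominus> u] [^]\<^bsub>poly_ring R\<^esub> p = X [^]\<^bsub>poly_ring R\<^esub> p \<oplus>\<^bsub>poly_ring R\<^esub> poly_of_const (\<ominus> u) [^]\<^bsub>poly_ring R\<^esub> p"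
  unfolding e by (rule UP.frobenius_add[OF p(1) char Xc pc])
 also have "X [^]\<^bsub>poly_ring R\<^esub> p = X [^]\<^bsub>K[X]\<^esub> p"
  using unitary_monom_eq_var_pow[OF carrier_is_subring, of p] unitary_monom_eq_var_pow[OF sK, of p] by simp
 also have "poly_of_const (\<ominus> u) [^]\<^bsub>poly_ring R\<^esub> p = poly_of_const ((\<ominus> u) [^] p)"
 proof -
  interpret h: ring_hom_ring R "poly_ring R" poly_of_const
   using hom ring_axioms UP.ring_axioms by (simp add: ring_hom_ring_def ring_hom_ring_axioms_def)
  show ?thesis using mu(1) by (simp add: h.hom_nat_pow)
 qed
 also have "(\<ominus> u) [^] p = (\<ominus> \<one>) [^] p \<otimes> u [^] p"
  using u(1) nat_pow_distrib[of "\<ominus> \<one>" u p] by (simp add: l_minus)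
 finally have e2: "[\<one>, \<ominus> u] [^]\<^bsub>poly_ring R\<^esub> p =
   X [^]\<^bsub>K[X]\<^esub> p \<oplus>\<^bsub>K[X]\<^esub> poly_of_const ((\<ominus> \<one>) [^] p \<otimes> u [^] p)"
  by (simp add: univ_poly_add)
 have "(\<ominus> \<one>) [^] p \<otimes> u [^] p \<in> K"
  using u(2) nat_pow_in_subring[OF sK] subringE(3,5,6)[OF sK] by blast
 then have "poly_of_const ((\<ominus> \<one>) [^] p \<otimes> u [^] p) \<in> carrier (K[X])"
  using ring_hom_closed[OF homK] by simp
 then show ?thesis unfolding e2 using var_closed(1)[OF sK] by simp
qed

text \<open>Every factor of \<open>(X - u)\<^sup>p\<close> over \<open>K\<close> is a unit times a power of the minimal polynomial of
 \<open>u\<close>, so the degree of \<open>u\<close> divides \<open>p\<close>.\<close>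

lemma mem_subfield_if_small_degree:
 assumes K: "subfield K R" and p: "Factorial_Ring.prime (p::nat)" "add_pow R p \<one> = \<zero>"
  and u: "u \<in> carrier R" "u [^] p \<in> K"
  and f: "f \<in> carrier (K[X])" "f \<noteq> []" "eval f u = \<zero>" "degree f < p"
 shows "u \<in> K"
proof -
 have sK: "subring K R" using subfieldE(1)[OF K] .
 interpret UP: domain "poly_ring R" using univ_poly_is_domain[OF carrier_is_subring] .
 interpret UK: domain "K[X]" using univ_poly_is_domain[OF sK] .
 have alg: "(algebraic over K) u" using algebraicI[OF f(1-3)] .
 note I = IrrE[OF K u(1) alg]
 let ?g = "Irr K u" and ?Q = "[\<one>, \<ominus> u] [^]\<^bsub>poly_ring R\<^esub> p"
 have l: "[\<one>, \<ominus> u] \<in> carrier (poly_ring R)"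
  using u unfolding univ_poly_carrier[symmetric] polynomial_def by auto
 have Q: "?Q \<in> carrier (poly_ring R)" "?Q \<noteq> []" "degree ?Q = p"
  using l polynomial_pow_not_zero[OF l, of p] polynomial_pow_degree[OF l, of p] by auto
 have QK: "?Q \<in> carrier (K[X])" using linear_power_over_subfield[OF K p u] .
 have sQ: "splitted ?Q" unfolding splitted_def roots_linear_power[OF u(1)] Q(3) by simp
 have incl: "s \<in> carrier (poly_ring R)" if "s \<in> carrier (K[X])" for s
  using that carrier_polynomial_shell[OF sK] by blast
 have d1: "degree ?g \<ge> 1" using pirreducible_degree[OF K I(1,2)] .
 \<comment> \<open>Factors \<open>?g\<close> are stripped off as long as \<open>u\<close> is a root.
   A divisor of (X - u)^p without the root \<open>u\<close> splits with no roots at all, hence is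
   constant.\<close>
 have dvd: "degree ?g dvd degree s" if "s \<in> carrier (K[X])" "s pdivides ?Q" for s
  using that
 proof (induction "degree s" arbitrary: s rule: less_induct)
  case less
  have s: "s \<in> carrier (poly_ring R)" using incl less.prems(1) .
  show ?case
  proof (cases "eval s u = \<zero>")
   case False
   have "splitted s" using pdivides_imp_splitted[OF s Q(1,2) sQ less.prems(2)] .
   moreover have "roots s \<subseteq># replicate_mset p u"
    using pdivides_imp_roots_incl[OF s Q(1,2) less.prems(2)] roots_linear_power[OF u(1)] by simp
   moreover have "u \<notin># roots s"
    using roots_mem_iff_is_root[OF s] False unfolding is_root_def by simp
   ultimately have "roots s = {#}"
    by (metis in_replicate_mset mset_subset_eqD multiset_nonemptyE)
   then have "degree s = 0" using \<open>splitted s\<close> unfolding splitted_def by simp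
   then show ?thesis by simp
  next
   case True
   have "?g pdivides s" using Irr_minimal[OF K u(1) alg less.prems(1) True] .
   then obtain r where r: "r \<in> carrier (K[X])" "s = ?g \<otimes>\<^bsub>K[X]\<^esub> r"
    unfolding pdivides_iff_shell[OF K I(1) less.prems(1)] factor_def by auto
   have sne: "s \<noteq> []"
   proof
    assume "s = []"
    then show False using less.prems(2) Q(2) zero_pdivides by simp
   qed
   have gne: "?g \<noteq> []" using d1 by auto
   have rne: "r \<noteq> []" using r(2) sne I(1) UK.r_null by (auto simp: univ_poly_zero[symmetric, of R K])
   have deg: "degree s = degree ?g + degree r"
    using poly_mult_degree_eq[OF sK, of ?g r] I(1) r gne rne
    unfolding univ_poly_mult univ_poly_carrier[symmetric] by simp
   have "r divides\<^bsub>K[X]\<^esub> s"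
    unfolding r(2) factor_def using UK.m_comm[OF I(1) r(1)] I(1) by blast
   then have "r pdivides s" unfolding pdivides_iff_shell[OF K r(1) less.prems(1)] .
   then have "r pdivides ?Q"
    using less.prems(2) UP.divides_trans[of r s ?Q] incl[OF r(1)] unfolding pdivides_def by simp
   then have "degree ?g dvd degree r"
    using less.hyps[OF _ r(1)] deg d1 by simp
   then show ?thesis using deg by simp
  qed
 qed
 have "?Q pdivides ?Q" unfolding pdivides_def using Q(1) by simp
 then have "degree ?g dvd p" using dvd[OF QK] Q(3) by simp
 moreover have "degree ?g \<le> degree f"
  using pdivides_imp_degree_le[OF sK I(1) f(1,2) Irr_minimal[OF K u(1) alg f(1,3)]] .
 \<comment> \<open>A divisor of the prime \<open>p\<close> that is smaller than \<open>p\<close> is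
   1, so the minimal polynomial is linear and its root lies in \<open>K\<close>.\<close>
 ultimately have "degree ?g = 1"
  using p(1) f(4) prime_nat_iff by auto
 then obtain a b where ab: "?g = [a, b]"
  by (metis One_nat_def length_0_conv length_Suc_conv Suc_pred diff_0_eq_0 length_greater_0_conv zero_neq_one)
 then have "a = \<one>" "b \<in> K"
  using I(1,3) unfolding univ_poly_carrier[symmetric] polynomial_def by auto
 moreover have bR: "b \<in> carrier R" using \<open>b \<in> K\<close> subfieldE(3)[OF K] by blast
 ultimately have "u \<oplus> b = \<zero>" using I(4) u(1) unfolding ab by simp
 then have "u = \<ominus> b" using u(1) bR minus_equality by metis
 then show ?thesis using subringE(5)[OF sK \<open>b \<in> K\<close>] by simp
qed

text \<open>A relation for \<open>u\<close> is rewritten with smaller exponents: terms with the same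
  value j of \<open>\<gamma>\<close> are collected, and the excess power of \<open>u\<close>, which
  lies in \<open>E\<close>, moves into the coefficient. With \<open>\<gamma>\<close> the identity
  this yields algebraicity, with \<open>\<gamma>\<close> the residue modulo \<open>p\<close> a
  degree below \<open>p\<close>.\<close>

lemma regrouped_relation:
 fixes \<gamma> :: "nat => nat" and n :: "'i => nat"
 assumes E: "subfield E R" and u: "u \<in> carrier R"
  and fin: "finite M" and c: "!!e. e \<in> M ==> c e \<in> E"
  and pw: "!!e. e \<in> M ==> \<gamma> (n e) \<le> n e \<and> \<gamma> (n e) < N \<and> u [^] (n e - \<gamma> (n e)) \<in> E"
  and rel: "(\<Oplus>e\<in>M. c e \<otimes> u [^] n e) = \<zero>"
  and nz: "(\<Oplus>e\<in>{e\<in>M. \<gamma> (n e) = j}. c e \<otimes> u [^] (n e - j)) \<noteq> \<zero>"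
 shows "\<exists>f\<in>carrier (E[X]). f \<noteq> [] \<and> length f \<le> N \<and> eval f u = \<zero>"
proof -
 define a where "a = (\<lambda>i. \<Oplus>e\<in>{e\<in>M. \<gamma> (n e) = i}. c e \<otimes> u [^] (n e - i))"
 have sE: "subring E R" using subfieldE(1)[OF E] .
 have ER: "E \<subseteq> carrier R" using subfieldE(3)[OF E] .
 have cR: "c e \<in> carrier R" if "e \<in> M" for e using c[OF that] ER by blast
 have aE: "a i \<in> E" for i
  unfolding a_def by (rule finsum_in_subring[OF sE]) (use c pw subringE(6)[OF sE] in auto)
 have aR: "a i \<in> carrier R" for i using aE ER by blast
 let ?f = "poly_from a N"
 have "{e\<in>M. \<gamma> (n e) = j} \<noteq> {}"
 proof
  assume e: "{e\<in>M. \<gamma> (n e) = j} = {}"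
  show False using nz unfolding e by simp
 qed
 then have jN: "j < N" using pw by auto
 have "?f \<in> carrier (E[X])" using aE by (intro poly_from_closed) auto
 moreover have "?f \<noteq> []" using length_poly_from_gt[OF jN, of a] nz unfolding a_def by auto
 moreover have "length ?f \<le> N" using length_poly_from_le .
 moreover have "eval ?f u = \<zero>"
 proof -
  have "eval ?f u = (\<Oplus>i\<in>{..<N}. a i \<otimes> u [^] i)"
   using aR u by (intro eval_poly_from) auto
  also have "\<dots> = (\<Oplus>i\<in>{..<N}. \<Oplus>e\<in>{e\<in>M. \<gamma> (n e) = i}. c e \<otimes> u [^] n e)"
  proof (rule add.finprod_cong')
   fix i assume "i \<in> {..<N}"
   have "a i \<otimes> u [^] i = (\<Oplus>e\<in>{e\<in>M. \<gamma> (n e) = i}. (c e \<otimes> u [^] (n e - i)) \<otimes> u [^] i)"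
    unfolding a_def using fin cR u by (intro finsum_ldistr) auto
   also have "\<dots> = (\<Oplus>e\<in>{e\<in>M. \<gamma> (n e) = i}. c e \<otimes> u [^] n e)"
    by (rule add.finprod_cong') (use cR u pw in \<open>auto simp: m_assoc nat_pow_mult\<close>)
   finally show "a i \<otimes> u [^] i = (\<Oplus>e\<in>{e\<in>M. \<gamma> (n e) = i}. c e \<otimes> u [^] n e)" .
  qed (use cR u in \<open>auto intro!: finsum_closed\<close>)
  also have "\<dots> = (\<Oplus>e\<in>(\<Union>i\<in>{..<N}. {e\<in>M. \<gamma> (n e) = i}). c e \<otimes> u [^] n e)"
   by (rule add.finprod_UN_disjoint[symmetric])
     (use fin cR u in \<open>auto simp: pairwise_def disjnt_def\<close>)
  also have "(\<Union>i\<in>{..<N}. {e\<in>M. \<gamma> (n e) = i}) = M" using pw by auto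
  finally show ?thesis using rel by simp
 qed
 ultimately show ?thesis by blast
qed

lemma power_mod_in_subring:
 assumes "subring E R" "u \<in> carrier R" "u [^] (p::nat) \<in> E"
 shows "u [^] (n - n mod p) \<in> E"
 using nat_pow_in_subring[OF assms(1,3), of "n div p"] assms(2)
 by (simp add: nat_pow_pow minus_mod_eq_mult_div)

text \<open>Since \<open>u [^] p\<close> lies in \<open>E\<close>, exponents may be reduced modulo
  \<open>p\<close>, which brings the degree below \<open>p\<close>; one nonvanishing residue class
  keeps the reduced relation nontrivial.\<close>

lemma mem_subfield_if_relation:
 fixes n :: "'i => nat"
 assumes E: "subfield E R" and p: "Factorial_Ring.prime (p::nat)" "add_pow R p \<one> = \<zero>"
  and u: "u \<in> carrier R" "u [^] p \<in> E"
  and fin: "finite M" and c: "!!e. e \<in> M ==> c e \<in> E"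
  and rel: "(\<Oplus>e\<in>M. c e \<otimes> u [^] n e) = \<zero>"
  and nz: "(\<Oplus>e\<in>{e\<in>M. n e mod p = j}. c e \<otimes> u [^] (n e - j)) \<noteq> \<zero>"
 shows "u \<in> E"
proof -
 have "\<exists>f\<in>carrier (E[X]). f \<noteq> [] \<and> length f \<le> p \<and> eval f u = \<zero>"
  using power_mod_in_subring[OF subfieldE(1)[OF E] u] prime_gt_0_nat[OF p(1)]
  by (intro regrouped_relation[where \<gamma> = "\<lambda>i. i mod p", OF E u(1) fin c _ rel nz]) auto
 then obtain f where f: "f \<in> carrier (E[X])" "f \<noteq> []" "length f \<le> p" "eval f u = \<zero>" by blast
 have "degree f < p" using f(2,3) by (cases f) auto
 then show ?thesis using mem_subfield_if_small_degree[OF E p u] f by blast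
qed

text \<open>The derivative of the minimal polynomial is nonzero, so an exponent i prime to
  \<open>p\<close> occurs. The terms with exponents congruent to i modulo \<open>p\<close>, divided
  by a power of \<open>x\<close>, form a nonzero polynomial of smaller degree, which cannot vanish
  at \<open>x\<close>. Hence reduction of exponents modulo \<open>p\<close> leaves a nontrivial
  relation over the field generated by \<open>x [^] p\<close>.\<close>

lemma separable_imp_generated_by_power:
 assumes K: "subfield K R" and x: "x \<in> carrier R" and sep: "separable_element K x"
  and p: "Factorial_Ring.prime (p::nat)" "add_pow R p \<one> = \<zero>"
 shows "x \<in> generate_field R (insert (x [^] p) K)"
proof -
 have alg: "(algebraic over K) x" using sep unfolding separable_element_def over_def by simp
 note I = IrrE[OF K x alg]
 let ?g = "Irr K x" and ?E = "generate_field R (insert (x [^] p) K)"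
 have sK: "subring K R" using subfieldE(1)[OF K] .
 have KR: "K \<subseteq> carrier R" using subfieldE(3)[OF K] .
 have ins: "insert (x [^] p) K \<subseteq> carrier R" using KR x by simp
 have E: "subfield ?E R" using generate_field_is_subfield[OF ins] .
 have incl: "insert (x [^] p) K \<subseteq> ?E" using generate_field.incl by (metis subsetI)
 have gK: "set ?g \<subseteq> K" using I(1) polynomial_incl univ_poly_carrier by blast
 then have g: "set ?g \<subseteq> carrier R" using KR by blast
 have cK: "coeff ?g i \<in> K" for i
  using coeff_img_restrict[of ?g] coeff_length[of ?g i] gK subringE(2)[OF sK]
  by (cases "i < length ?g") auto
 have "\<exists>i. add_pow R i (coeff ?g i) \<noteq> \<zero>"
 proof (rule ccontr)
  assume "\<not> ?thesis"
  then have "formal_deriv ?g = []"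
   unfolding formal_deriv_def normalize_eq_Nil_iff by auto
  then have "deriv_at ?g x = \<zero>" using eval_formal_deriv[OF g x] by simp
  then show False using separable_elementD[OF K x sep] by simp
 qed
 then obtain i where i: "add_pow R i (coeff ?g i) \<noteq> \<zero>" by blast
 have ci: "coeff ?g i \<noteq> \<zero>" using i by auto
 have ilen: "i < length ?g" using ci coeff_length[of ?g i] by (meson not_le)
 have pi: "\<not> p dvd i"
 proof
  assume "p dvd i"
  then obtain m where "i = p * m" by auto
  then have "add_pow R i (coeff ?g i) = add_pow R m (add_pow R p (coeff ?g i))"
   using g by (simp add: add.nat_pow_pow)
  then show False using i add_pow_char_zero[OF p(2)] g by simp
 qed
 define j where "j = i mod p"
 have j: "0 < j" "j \<le> i" unfolding j_def using pi by (simp_all add: mod_greater_zero_iff_not_dvd)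
 show ?thesis
 proof (rule mem_subfield_if_relation[OF E p x, of "{..<length ?g}" "coeff ?g" "\<lambda>i. i" j])
  show "x [^] p \<in> ?E" using incl by blast
  show "coeff ?g e \<in> ?E" for e using cK incl by blast
  show "(\<Oplus>e\<in>{..<length ?g}. coeff ?g e \<otimes> x [^] e) = \<zero>"
   using eval_eq_finsum[OF g x] I(4) by simp
  \<comment> \<open>The terms with exponents congruent to \<open>j\<close> modulo \<open>p\<close>,
    shifted down by \<open>j\<close>. As \<open>j\<close> is positive, the degree drops below that
    of \<open>?g\<close> and minimality applies.\<close>
  define h where "h = (\<lambda>k. if (k + j) mod p = j then coeff ?g (k + j) else \<zero>)"
  let ?n = "length ?g - j" and ?h = "poly_from h (length ?g - j)"
  have hK: "h k \<in> K" for k unfolding h_def using cK subringE(2)[OF sK] by auto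
  have hp: "?h \<in> carrier (K[X])" using hK by (intro poly_from_closed) auto
  have "i - j < length ?h"
  proof (rule length_poly_from_gt)
   show "i - j < ?n" using ilen j by linarith
   show "h (i - j) \<noteq> \<zero>" using j ci by (simp add: h_def j_def[symmetric])
  qed
  then have hne: "?h \<noteq> []" by auto
  have ev: "eval ?h x = (\<Oplus>e\<in>{e\<in>{..<length ?g}. e mod p = j}. coeff ?g e \<otimes> x [^] (e - j))"
  proof -
   have "eval ?h x = (\<Oplus>k\<in>{..<?n}. h k \<otimes> x [^] k)"
    using hK KR x by (intro eval_poly_from) auto
   also have "\<dots> = (\<Oplus>k\<in>{k\<in>{..<?n}. (k + j) mod p = j}. coeff ?g (k + j) \<otimes> x [^] k)"
    by (rule add.finprod_mono_neutral_cong_right) (use g x in \<open>auto simp: h_def\<close>)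
   also have "\<dots> = (\<Oplus>k\<in>{k\<in>{..<?n}. (k + j) mod p = j}. coeff ?g (k + j) \<otimes> x [^] (k + j - j))"
    by simp
   also have "\<dots> = (\<Oplus>e\<in>(\<lambda>k. k + j) ` {k\<in>{..<?n}. (k + j) mod p = j}. coeff ?g e \<otimes> x [^] (e - j))"
    by (rule add.finprod_reindex[symmetric]) (use g x in auto)
   also have "(\<lambda>k. k + j) ` {k\<in>{..<?n}. (k + j) mod p = j} = {e\<in>{..<length ?g}. e mod p = j}"
   proof (intro equalityI subsetI)
    fix e assume e: "e \<in> {e\<in>{..<length ?g}. e mod p = j}"
    then have "j \<le> e" by auto
    then show "e \<in> (\<lambda>k. k + j) ` {k\<in>{..<?n}. (k + j) mod p = j}"
     using e by (intro image_eqI[of _ _ "e - j"]) (auto intro: diff_less_mono)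
   qed auto
   finally show ?thesis .
  qed
  show "(\<Oplus>e\<in>{e\<in>{..<length ?g}. e mod p = j}. coeff ?g e \<otimes> x [^] (e - j)) \<noteq> \<zero>"
  proof
   assume "(\<Oplus>e\<in>{e\<in>{..<length ?g}. e mod p = j}. coeff ?g e \<otimes> x [^] (e - j)) = \<zero>"
   then have "?g pdivides ?h" using Irr_minimal[OF K x alg hp] ev by simp
   then have "degree ?g \<le> degree ?h" using pdivides_imp_degree_le[OF sK I(1) hp hne] by blast
   moreover have "length ?h \<le> length ?g - j" using length_poly_from_le .
   ultimately show False using j ilen by linarith
  qed
 qed simp
qed

end

context field
begin

text \<open>The \<open>p\<close>-th powers of a basis of \<open>F\<close> over \<open>L\<close> still span \<open>F\<close>, hence remain independent; an
 inseparable element would give a dependence among the \<open>p\<close>-th powers of its powers.\<close>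

lemma Span_powers_subfield:
 assumes L: "subfield L R" and F: "subfield F R" and LF: "L \<subseteq> F"
  and p: "Factorial_Ring.prime (p::nat)" "add_pow R p \<one> = \<zero>"
  and Bs: "set Bs \<subseteq> carrier R" "Span L Bs = F"
  and gen: "F \<subseteq> generate_field R (L \<union> (\<lambda>z. z [^] p) ` F)"
 shows "Span L (map (\<lambda>z. z [^] p) Bs) = F"
proof -
 let ?Ws = "map (\<lambda>z. z [^] p) Bs"
 let ?W = "Span L ?Ws"
 have sL: "subring L R" and sF: "subring F R" using subfieldE(1) L F by auto
 have FR: "F \<subseteq> carrier R" using subfieldE(3)[OF F] .
 have LR: "L \<subseteq> carrier R" using subfieldE(3)[OF L] .
 have BF: "set Bs \<subseteq> F" using Span_base_incl[OF L Bs(1)] Bs(2) by simp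
 have Ws: "set ?Ws \<subseteq> carrier R" using Bs(1) by auto
 have WsF: "set ?Ws \<subseteq> F" using BF nat_pow_in_subring[OF sF] by auto
 have subg: "subgroup ?W (add_monoid R)" using Span_is_add_subgroup[OF L Ws] .
 have "subalgebra L F R"
  using subring.axioms(1)[OF sF] LF subringE(6)[OF sF]
  unfolding subalgebra_def subalgebra_axioms_def by blast
 then have WF: "?W \<subseteq> F" using subalgebra_Span_incl[OF L _ WsF] by blast
 have WR: "?W \<subseteq> carrier R" using WF FR by blast
 \<comment> \<open>Frobenius replaces the coordinates of \<open>z\<close> by their p-th powers,
   which stay in \<open>L\<close>.\<close>
 have powW: "z [^] p \<in> ?W" if z: "z \<in> F" for z
 proof -
  obtain Ks where Ks: "set Ks \<subseteq> L" "length Ks = length Bs" "z = combine Ks Bs"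
   using z Span_mem_iff_length_version[OF L Bs(1)] Bs(2) by blast
  have "set Ks \<subseteq> carrier R" using Ks(1) LR by blast
  with Ks(2) Bs(1) have "(combine Ks Bs) [^] p = combine (map (\<lambda>z. z [^] p) Ks) ?Ws"
  proof (induction Ks Bs rule: list_induct2)
   case Nil
   show ?case using prime_gt_0_nat[OF p(1)] by (simp add: nat_pow_zero)
  next
   case (Cons k Ks b Bs)
   then show ?case by (simp add: frobenius_add[OF p] nat_pow_distrib)
  qed
  moreover have "set (map (\<lambda>z. z [^] p) Ks) \<subseteq> L" using Ks(1) nat_pow_in_subring[OF sL] by auto
  ultimately show ?thesis
   using Span_mem_iff_length_version[OF L Ws] Ks(2,3) by (metis length_map)
 qed
 have sub_preimage: "subgroup {v \<in> carrier R. w \<otimes> v \<in> ?W} (add_monoid R)" if w: "w \<in> carrier R" for w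
 proof (rule add.subgroupI)
  show "{v \<in> carrier R. w \<otimes> v \<in> ?W} \<noteq> {}"
   using w subgroup.one_closed[OF subg] by (intro ex_in_conv[THEN iffD1] exI[of _ \<zero>]) (simp del: Span.simps)
 qed (use w subgroup.m_closed[OF subg] subgroup.m_inv_closed[OF subg] in
   \<open>auto simp: r_distr r_minus a_inv_def[symmetric] simp del: Span.simps\<close>)
 have pow_mult: "w \<otimes> z [^] p \<in> ?W" if w: "w \<in> ?W" and z: "z \<in> F" for w z
 proof -
  have zR: "z [^] p \<in> carrier R" using z FR by auto
  have "L <#> set ?Ws \<subseteq> {v \<in> carrier R. z [^] p \<otimes> v \<in> ?W}"
  proof
   fix v assume "v \<in> L <#> set ?Ws"
   then obtain k b where kb: "k \<in> L" "b \<in> set Bs" "v = k \<otimes> b [^] p"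
    unfolding set_mult_def by auto
   have cl: "k \<in> carrier R" "b \<in> carrier R" "z \<in> carrier R" using kb LR Bs(1) z FR by auto
   have "z [^] p \<otimes> v = k \<otimes> (z \<otimes> b) [^] p"
    unfolding kb(3) using cl by (simp add: nat_pow_distrib m_lcomm)
   also have "\<dots> \<in> ?W"
    using Span_smult_closed[OF L Ws kb(1) powW] subringE(6)[OF sF z] kb(2) BF by blast
   finally show "v \<in> {v \<in> carrier R. z [^] p \<otimes> v \<in> ?W}" using kb cl by (simp del: Span.simps)
  qed
  then have "?W \<subseteq> {v \<in> carrier R. z [^] p \<otimes> v \<in> ?W}"
   by (rule Span_min[OF L Ws sub_preimage[OF zR]])
  then have "z [^] p \<otimes> w \<in> ?W" using w by blast
  moreover have "w \<in> carrier R" using w WR by blast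
  ultimately show ?thesis using m_comm[OF zR] by simp
 qed
 have mult: "w \<otimes> v \<in> ?W" if w: "w \<in> ?W" and v: "v \<in> ?W" for w v
 proof -
  have wR: "w \<in> carrier R" using w WR by blast
  have "L <#> set ?Ws \<subseteq> {v \<in> carrier R. w \<otimes> v \<in> ?W}"
  proof
   fix v assume "v \<in> L <#> set ?Ws"
   then obtain k b where kb: "k \<in> L" "b \<in> set Bs" "v = k \<otimes> b [^] p"
    unfolding set_mult_def by auto
   have cl: "k \<in> carrier R" "b \<in> carrier R" using kb LR Bs(1) by auto
   have "w \<otimes> v = k \<otimes> (w \<otimes> b [^] p)" unfolding kb(3) using cl wR by (simp add: m_lcomm)
   also have "\<dots> \<in> ?W" using Span_smult_closed[OF L Ws kb(1) pow_mult[OF w]] kb(2) BF by blast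
   finally show "v \<in> {v \<in> carrier R. w \<otimes> v \<in> ?W}" using kb cl by (simp del: Span.simps)
  qed
  then have "?W \<subseteq> {v \<in> carrier R. w \<otimes> v \<in> ?W}"
   by (rule Span_min[OF L Ws sub_preimage[OF wR]])
  then show ?thesis using v by blast
 qed
 have one: "\<one> \<in> ?W" using powW[OF subringE(3)[OF sF]] by (simp del: Span.simps)
 have LW: "L \<subseteq> ?W"
 proof
  fix k assume "k \<in> L"
  then show "k \<in> ?W" using Span_smult_closed[OF L Ws _ one, of k] LR by auto
 qed
 \<comment> \<open>\<open>?W\<close> is now a ring between \<open>L\<close> and \<open>F\<close>,
   finite dimensional over \<open>L\<close>. Its elements are algebraic over \<open>L\<close>, so
   inverses stay inside, and \<open>?W\<close> is a field containing \<open>L\<close> and all p-th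
   powers.\<close>
 have sW: "subring ?W R"
  using subg mult one WR subgroup.m_closed[OF subg] subgroup.m_inv_closed[OF subg]
  by (intro subringI) (auto simp: a_inv_def[symmetric] simp del: Span.simps)
 have "subfield ?W R"
 proof (rule subfieldI'[OF sW])
  fix w assume w: "w \<in> ?W - {\<zero>}"
  have wR: "w \<in> carrier R" using w WR by blast
  have "(algebraic over L) w"
   using finite_dimension_imp_algebraic[OF L sW Span_finite_dimension[OF L Ws]] w by blast
  then have "subfield (simple_extension L w) R"
   using simple_extension_is_subfield[OF L wR] by blast
  moreover have "w \<in> simple_extension L w" using simple_extension_mem[OF sL wR] .
  ultimately have "inv w \<in> simple_extension L w"
   using subfield_m_inv(1) w by blast
  then show "inv w \<in> ?W" using simple_extension_subring_incl[OF sW LW] w by blast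
 qed
 moreover have "L \<union> (\<lambda>z. z [^] p) ` F \<subseteq> ?W" using LW powW by blast
 ultimately have "generate_field R (L \<union> (\<lambda>z. z [^] p) ` F) \<subseteq> ?W"
  using generate_field_min_subfield1[of "L \<union> (\<lambda>z. z [^] p) ` F" ?W] WR by blast
 then show ?thesis using gen WF by blast
qed

lemma separable_if_generated_by_powers:
 assumes L: "subfield L R" and F: "subfield F R" and LF: "L \<subseteq> F"
  and fd: "finite_dimension L F"
  and p: "Factorial_Ring.prime (p::nat)" "add_pow R p \<one> = \<zero>"
  and gen: "F \<subseteq> generate_field R (L \<union> (\<lambda>z. z [^] p) ` F)"
  and x: "x \<in> F"
 shows "separable_element L x"
proof (rule ccontr)
 assume ns: "\<not> separable_element L x"
 have sL: "subring L R" and sF: "subring F R" using subfieldE(1) L F by auto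
 have FR: "F \<subseteq> carrier R" using subfieldE(3)[OF F] .
 have xR: "x \<in> carrier R" using x FR by blast
 have alg: "(algebraic over L) x" using finite_dimension_imp_algebraic[OF L sF fd x] .
 let ?d = "degree (Irr L x)"
 obtain q h where q: "Factorial_Ring.prime (q::nat)" "add_pow R q \<one> = \<zero>"
  and h: "h \<in> carrier (L[X])" "h \<noteq> []" "eval h (x [^] q) = \<zero>" "degree h < ?d"
  using inseparable_imp_polynomial_in_power[OF L xR alg ns] by blast
 have qp: "q = p" using char_prime_unique[OF q p] .
 obtain n where n: "dimension n L F" using fd by auto
 have ind: "independent L (exp_base x ?d)" using exp_base_independent[OF L xR alg] .
 have inF: "set (exp_base x ?d) \<subseteq> F"
  unfolding exp_base_def using nat_pow_in_subring[OF sF x] by auto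
 obtain Vs where Vs: "length (Vs @ exp_base x ?d) = n" "independent L (Vs @ exp_base x ?d)"
   "Span L (Vs @ exp_base x ?d) = F"
  using complete_base[OF L n ind inF] by blast
 let ?pw = "map (\<lambda>z. z [^] p)"
 have VR: "set (Vs @ exp_base x ?d) \<subseteq> carrier R" using independent_in_carrier[OF Vs(2)] .
 have sp: "Span L (?pw (Vs @ exp_base x ?d)) = F"
  using Span_powers_subfield[OF L F LF p VR Vs(3) gen] .
 have xp: "x [^] p \<in> carrier R" using xR by simp
 have algp: "(algebraic over L) (x [^] p)" using algebraicI[OF h(1,2)] h(3) qp by simp
 let ?e = "degree (Irr L (x [^] p))"
 have e: "?e \<le> degree h"
  using pdivides_imp_degree_le[OF sL IrrE(1)[OF L xp algp] h(1,2)]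
   Irr_minimal[OF L xp algp h(1)] h(3) qp by simp
 have eb: "set (exp_base (x [^] p) ?e) \<subseteq> carrier R" using exp_base_closed[OF xp] .
 \<comment> \<open>The p-th powers of the \<open>?d\<close> powers of \<open>x\<close> lie in the
   field generated by \<open>x [^] p\<close>, which is spanned by \<open>?e\<close> elements with
   \<open>?e\<close> below \<open>?d\<close>. Replacing them gives a spanning list of
   \<open>F\<close> shorter than its basis.\<close>
 let ?Ws = "?pw Vs @ exp_base (x [^] p) ?e"
 have Ws: "set ?Ws \<subseteq> carrier R" using VR eb by auto
 have "set (?pw (Vs @ exp_base x ?d)) \<subseteq> Span L ?Ws"
 proof
  fix b assume "b \<in> set (?pw (Vs @ exp_base x ?d))"
  then consider "b \<in> set (?pw Vs)" | "b \<in> set (?pw (exp_base x ?d))" by auto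
  then show "b \<in> Span L ?Ws"
  proof cases
   case 1
   then show ?thesis using Span_base_incl[OF L Ws] by auto
  next
   case 2
   then obtain i :: nat where "b = (x [^] i) [^] p" unfolding exp_base_def by auto
   then have "b = (x [^] p) [^] i" using xR by (simp add: nat_pow_pow mult.commute)
   then have "b \<in> simple_extension L (x [^] p)"
    using nat_pow_in_subring[OF simple_extension_is_subring[OF sL xp] simple_extension_mem[OF sL xp]] by simp
   then have "b \<in> Span L (exp_base (x [^] p) ?e)" using Span_exp_base[OF L xp algp] by simp
   moreover have "set (exp_base (x [^] p) ?e) \<subseteq> Span L ?Ws"
    using Span_base_incl[OF L Ws] by auto
   ultimately show ?thesis using mono_Span_subset[OF L _ Ws] by blast
  qed
 qed
 then have "F \<subseteq> Span L ?Ws" using mono_Span_subset[OF L _ Ws] sp by blast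
 moreover obtain m where m: "m \<le> length ?Ws" "dimension m L (Span L ?Ws)"
  using dimension_Span_le[OF L Ws] by blast
 moreover have "set (Vs @ exp_base x ?d) \<subseteq> F" using Span_base_incl[OF L VR] Vs(3) by simp
 ultimately have "length (Vs @ exp_base x ?d) \<le> m"
  using independent_length_le_dimension[OF L m(2) Vs(2)] by blast
 then show False using m(1) e h(4) by (simp add: exp_base_def)
qed

end

section \<open>Algebraic relations and separable generation over perfect fields\<close>

lemma (in domain) nat_pow_eq_zero:
 "x [^] (n::nat) = \<zero> ==> x \<in> carrier R ==> x = \<zero>"
 by (induction n) (use integral in auto)

context field
begin

definition monomial_at :: "'a set => ('a => nat) => 'a" where
 "monomial_at U f = (\<Otimes>x\<in>U. x [^] f x)"

lemma monomial_at_closed [simp]: "U \<subseteq> carrier R ==> monomial_at U f \<in> carrier R"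
 unfolding monomial_at_def by (rule finprod_closed) auto

lemma monomial_at_Diff_closed [simp]: "U \<subseteq> carrier R ==> monomial_at (U - V) f \<in> carrier R"
 by (rule monomial_at_closed) blast

lemma monomial_at_remove:
 assumes "finite U" "U \<subseteq> carrier R" "u \<in> U"
 shows "monomial_at U f = u [^] f u \<otimes> monomial_at (U - {u}) f"
proof -
 have "monomial_at (insert u (U - {u})) f = u [^] f u \<otimes> monomial_at (U - {u}) f"
  unfolding monomial_at_def using assms by (intro finprod_insert) auto
 then show ?thesis using assms(3) by (simp add: insert_absorb)
qed

lemma monomial_at_cong: "U \<subseteq> carrier R ==> (!!x. x \<in> U ==> f x = g x) ==> monomial_at U f = monomial_at U g"
 unfolding monomial_at_def by (rule finprod_cong') auto

lemma monomial_at_power: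
 assumes "finite U" "U \<subseteq> carrier R"
 shows "monomial_at U (\<lambda>x. f x * n) = monomial_at U f [^] (n::nat)"
 using assms
proof (induction U rule: finite_induct)
 case (insert u U)
 have "monomial_at (insert u U) g = u [^] g u \<otimes> monomial_at U g" for g
  using monomial_at_remove[of "insert u U" u g] insert by simp
 then show ?case using insert by (simp add: nat_pow_pow nat_pow_distrib)
qed (simp add: monomial_at_def)

text \<open>Exponents vanish off \<open>U\<close>, coefficients are nonzero and \<open>M\<close> is
  nonempty: every relation is nontrivial, distinct exponents are distinct monomials in
  \<open>U\<close>, and the sum of all total degrees is a measure that can be minimized.\<close>

definition algebraic_relation :: "'a set => 'a set => ('a => nat) set => (('a => nat) => 'a) => bool" where
 "algebraic_relation K U M c \<longleftrightarrow> finite M \<and> M \<noteq> {} \<and> (\<forall>f\<in>M. \<forall>x. x \<notin> U --> f x = 0) \<and>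
   (\<forall>f\<in>M. c f \<in> K \<and> c f \<noteq> \<zero>) \<and> (\<Oplus>f\<in>M. c f \<otimes> monomial_at U f) = \<zero>"

lemma not_algebraically_independentD:
 assumes fin: "finite U" and U: "U \<subseteq> carrier R" and K: "K \<subseteq> carrier R"
  and dep: "\<not> algebraically_independent K U"
 shows "\<exists>M c. algebraic_relation K U M c"
proof -
 obtain M :: "('a \<Rightarrow>\<^sub>0 nat) set" and c where M: "finite M" "!!e. e \<in> M ==> keys e \<subseteq> U"
  and c: "c \<in> M \<rightarrow> K"
  and z: "(\<Oplus>e\<in>M. c e \<otimes> (\<Otimes>x\<in>keys e. x [^] lookup e x)) = \<zero>"
  and nz: "\<exists>e\<in>M. c e \<noteq> \<zero>"
  using dep unfolding algebraically_independent_def by blast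
 have mon: "(\<Otimes>x\<in>keys e. x [^] lookup e x) = monomial_at U (lookup e)"
  if "e \<in> M" for e
  unfolding monomial_at_def
  by (rule finprod_mono_neutral_cong_left) (use fin U M that in \<open>auto simp: in_keys_iff\<close>)
 let ?N = "{e \<in> M. c e \<noteq> \<zero>}"
 let ?c = "\<lambda>f. c (Poly_Mapping.Abs_poly_mapping f)"
 have cR: "c e \<in> carrier R" if "e \<in> M" for e using c K that by blast
 have "(\<Oplus>f\<in>lookup ` ?N. ?c f \<otimes> monomial_at U f)
   = (\<Oplus>e\<in>?N. ?c (lookup e) \<otimes> monomial_at U (lookup e))"
  by (rule add.finprod_reindex) (use cR U in \<open>auto simp: lookup_inverse inj_on_def lookup_inject\<close>)
 also have "\<dots> = (\<Oplus>e\<in>M. c e \<otimes> (\<Otimes>x\<in>keys e. x [^] lookup e x))"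
  by (rule add.finprod_mono_neutral_cong_left)
    (use cR U M mon in \<open>auto simp: lookup_inverse\<close>)
 finally have "(\<Oplus>f\<in>lookup ` ?N. ?c f \<otimes> monomial_at U f) = \<zero>" using z by simp
 moreover have "lookup e x = 0" if "e \<in> M" "x \<notin> U" for e x
  using M(2)[OF that(1)] that(2) by (auto simp: in_keys_iff)
 ultimately have "algebraic_relation K U (lookup ` ?N) ?c"
  unfolding algebraic_relation_def using M(1) c nz by (auto simp: lookup_inverse)
 then show ?thesis by blast
qed

text \<open>If the sum vanished, the terms with the chosen value of \<open>\<gamma>\<close>, divided
  by that power of \<open>u\<close>, would form a relation of strictly smaller total degree; the
  drop is strict because the removed exponent is positive. As in \<open>regrouped_relation\<close>,
  \<open>\<gamma>\<close> is the identity or reduction modulo \<open>p\<close>.\<close>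

lemma minimal_relation_cofactor:
 fixes \<gamma> :: "nat => nat"
 assumes fin: "finite U" and U: "U \<subseteq> carrier R" and K: "K \<subseteq> carrier R"
  and rel: "algebraic_relation K U M c"
  and min: "!!M' c'. algebraic_relation K U M' c' ==> (\<Sum>f\<in>M. sum f U) \<le> (\<Sum>f\<in>M'. sum f U)"
  and u: "u \<in> U" and f0: "f0 \<in> M" "0 < \<gamma> (f0 u)" and le: "!!n. \<gamma> n \<le> n"
 shows "(\<Oplus>f\<in>{f\<in>M. \<gamma> (f u) = \<gamma> (f0 u)}. (c f \<otimes> monomial_at (U - {u}) f) \<otimes> u [^] (f u - \<gamma> (f0 u))) \<noteq> \<zero>"
proof
 let ?j = "\<gamma> (f0 u)"
 let ?M = "{f\<in>M. \<gamma> (f u) = ?j}"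
 assume z: "(\<Oplus>f\<in>?M. (c f \<otimes> monomial_at (U - {u}) f) \<otimes> u [^] (f u - ?j)) = \<zero>"
 have M: "finite M" "!!f x. f \<in> M ==> x \<notin> U ==> f x = 0" "!!f. f \<in> M ==> c f \<in> K" "!!f. f \<in> M ==> c f \<noteq> \<zero>"
  using rel unfolding algebraic_relation_def by auto
 have cR: "c f \<in> carrier R" if "f \<in> M" for f using M(3)[OF that] K by blast
 have uR: "u \<in> carrier R" using u U by blast
 have jle: "?j \<le> f u" if "f \<in> ?M" for f using that le by (metis (mono_tags, lifting) mem_Collect_eq)
 let ?s = "\<lambda>f. f(u := f u - ?j)" and ?t = "\<lambda>f. f(u := f u + ?j)"
 have ts: "?t (?s f) = f" if "f \<in> ?M" for f using jle[OF that] by (auto simp: fun_eq_iff)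
 have inj: "inj_on ?s ?M" by (rule inj_on_inverseI[where g = ?t]) (rule ts)
 have mon: "monomial_at U (?s f) = u [^] (f u - ?j) \<otimes> monomial_at (U - {u}) f" for f
  using monomial_at_remove[OF fin U u, of "?s f"] monomial_at_cong[of "U - {u}" "?s f" f] U
  by (simp add: Diff_subset[THEN subset_trans])
 have mR: "monomial_at (U - {u}) f \<in> carrier R" for f using U by (intro monomial_at_closed) auto
 have "(\<Oplus>f\<in>?s ` ?M. c (?t f) \<otimes> monomial_at U f) = (\<Oplus>f\<in>?M. c (?t (?s f)) \<otimes> monomial_at U (?s f))"
  by (rule add.finprod_reindex[OF _ inj]) (use ts cR U in auto)
 also have "\<dots> = (\<Oplus>f\<in>?M. (c f \<otimes> monomial_at (U - {u}) f) \<otimes> u [^] (f u - ?j))"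
 proof (rule add.finprod_cong')
  fix f assume f: "f \<in> ?M"
  show "c (?t (?s f)) \<otimes> monomial_at U (?s f) = (c f \<otimes> monomial_at (U - {u}) f) \<otimes> u [^] (f u - ?j)"
   unfolding ts[OF f] mon using f cR mR uR by (simp add: m_ac)
 qed (use cR mR uR in auto)
 finally have "(\<Oplus>f\<in>?s ` ?M. c (?t f) \<otimes> monomial_at U f) = \<zero>" using z by simp
 moreover have "c (?t f) \<in> K \<and> c (?t f) \<noteq> \<zero>" if "f \<in> ?s ` ?M" for f
 proof -
  obtain f' where f': "f' \<in> ?M" "f = ?s f'" using \<open>f \<in> ?s ` ?M\<close> by blast
  then have "?t f = f'" using ts[OF f'(1)] by simp
  then show ?thesis using M(3,4) f'(1) by auto
 qed
 moreover have "f x = 0" if "f \<in> ?s ` ?M" "x \<notin> U" for f x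
  using that M(2) u by auto
 ultimately have "algebraic_relation K U (?s ` ?M) (\<lambda>f. c (?t f))"
  unfolding algebraic_relation_def using M(1) f0(1) by auto
 then have "(\<Sum>f\<in>M. sum f U) \<le> (\<Sum>f\<in>?s ` ?M. sum f U)" by (rule min)
 also have "\<dots> = (\<Sum>f\<in>?M. sum (?s f) U)"
  using sum.reindex[OF inj, of "\<lambda>f. sum f U"] by (simp only: comp_def)
 also have "\<dots> < (\<Sum>f\<in>?M. sum f U)"
 proof (rule sum_strict_mono)
  fix f assume f: "f \<in> ?M"
  show "sum (?s f) U < sum f U"
  proof (rule sum_strict_mono_ex1[OF fin])
   show "\<exists>x\<in>U. ?s f x < f x" using u jle[OF f] f0(2) by (intro bexI[of _ u]) auto
  qed auto
 qed (use M(1) f0(1) in auto)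
 also have "\<dots> \<le> (\<Sum>f\<in>M. sum f U)" using M(1) by (intro sum_mono2) auto
 finally show False by simp
qed

text \<open>Over a perfect field a relation all of whose exponents are divisible by \<open>p\<close> is the \<open>p\<close>-th power of
 a smaller one.\<close>

lemma minimal_relation_exponent:
 assumes fin: "finite U" and U: "U \<subseteq> carrier R" and K: "K \<subseteq> carrier R"
  and perf: "!!p x. Factorial_Ring.prime (p::nat) ==> add_pow R p \<one> = \<zero> ==> x \<in> K ==> \<exists>y\<in>K. y [^] p = x"
  and rel: "algebraic_relation K U M c"
  and min: "!!M' c'. algebraic_relation K U M' c' ==> (\<Sum>f\<in>M. sum f U) \<le> (\<Sum>f\<in>M'. sum f U)"
 shows "\<exists>f\<in>M. \<exists>u\<in>U. 0 < f u \<and> (\<forall>p. Factorial_Ring.prime (p::nat) \<and> add_pow R p \<one> = \<zero> --> \<not> p dvd f u)"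
proof (rule ccontr)
 assume neg: "\<not> ?thesis"
 have M: "finite M" "M \<noteq> {}" "!!f x. f \<in> M ==> x \<notin> U ==> f x = 0" "!!f. f \<in> M ==> c f \<in> K"
  "!!f. f \<in> M ==> c f \<noteq> \<zero>" and z: "(\<Oplus>f\<in>M. c f \<otimes> monomial_at U f) = \<zero>"
  using rel unfolding algebraic_relation_def by auto
 have cR: "c f \<in> carrier R" if "f \<in> M" for f using M(4)[OF that] K by blast
 have ex: "\<exists>f\<in>M. \<exists>u\<in>U. 0 < f u"
 proof (rule ccontr)
  assume "\<not> ?thesis"
  then have "f = (\<lambda>_. 0)" if "f \<in> M" for f using M(3)[OF that] that by (metis not_gr_zero)
  then have "M = {\<lambda>_. 0}" using M(2) by auto
  moreover have "monomial_at U (\<lambda>_. 0) = \<one>" unfolding monomial_at_def by simp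
  ultimately show False using z cR M(5) by simp
 qed
 then obtain p where p: "Factorial_Ring.prime (p::nat)" "add_pow R p \<one> = \<zero>" using neg by blast
 have dvd: "p dvd f x" if "f \<in> M" for f x
 proof (cases "x \<in> U \<and> 0 < f x")
  case True
  then obtain q where "Factorial_Ring.prime (q::nat)" "add_pow R q \<one> = \<zero>" "q dvd f x"
   using neg \<open>f \<in> M\<close> by blast
  then show ?thesis using char_prime_unique[OF _ _ p] by blast
 next
  case False
  then show ?thesis using M(3)[OF that] by auto
 qed
 let ?s = "\<lambda>f x. f x div p" and ?t = "\<lambda>f x :: 'a. f x * p"
 have ts: "?t (?s f) = f" if "f \<in> M" for f using dvd[OF that] by (auto simp: fun_eq_iff)
 have inj: "inj_on ?s M" by (rule inj_on_inverseI[where g = ?t]) (rule ts)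
 define b where "b = (\<lambda>f. SOME y. y \<in> K \<and> y [^] p = c (?t f))"
 have b: "b (?s f) \<in> K \<and> b (?s f) [^] p = c f" if "f \<in> M" for f
  unfolding b_def ts[OF that] using perf[OF p M(4)[OF that]] by (metis (mono_tags, lifting) someI_ex)
 have bR: "b (?s f) \<in> carrier R" if "f \<in> M" for f using b[OF that] K by blast
 have "(\<Oplus>f\<in>M. b (?s f) \<otimes> monomial_at U (?s f)) [^] p = (\<Oplus>f\<in>M. (b (?s f) \<otimes> monomial_at U (?s f)) [^] p)"
  by (rule frobenius_finsum[OF p M(1)]) (use bR U in auto)
 also have "\<dots> = (\<Oplus>f\<in>M. c f \<otimes> monomial_at U f)"
 proof (rule add.finprod_cong')
  fix f assume f: "f \<in> M"
  have "monomial_at U (?s f) [^] p = monomial_at U f"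
   using monomial_at_power[OF fin U, of "?s f" p] ts[OF f] by simp
  then show "(b (?s f) \<otimes> monomial_at U (?s f)) [^] p = c f \<otimes> monomial_at U f"
   using b[OF f] bR[OF f] U by (simp add: nat_pow_distrib)
 qed (use cR U in auto)
 finally have "(\<Oplus>f\<in>M. b (?s f) \<otimes> monomial_at U (?s f)) [^] p = \<zero>" using z by simp
 moreover have sc: "(\<Oplus>f\<in>M. b (?s f) \<otimes> monomial_at U (?s f)) \<in> carrier R"
  using bR U by (intro finsum_closed) auto
 ultimately have z': "(\<Oplus>f\<in>M. b (?s f) \<otimes> monomial_at U (?s f)) = \<zero>"
  using nat_pow_eq_zero by blast
 have z2: "(\<Oplus>f\<in>?s ` M. b f \<otimes> monomial_at U f) = \<zero>"
  unfolding z'[symmetric] by (rule add.finprod_reindex[OF _ inj]) (use bR U in auto)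
 have b2: "b f \<in> K \<and> b f \<noteq> \<zero>" if "f \<in> ?s ` M" for f
 proof -
  obtain f' where f': "f' \<in> M" "f = ?s f'" using \<open>f \<in> ?s ` M\<close> by blast
  have "b f \<in> K" "b f [^] p = c f'" using b[OF f'(1)] f'(2) by auto
  then show ?thesis using M(5)[OF f'(1)] prime_gt_0_nat[OF p(1)] by (auto simp: nat_pow_zero)
 qed
 have s2: "f x = 0" if "f \<in> ?s ` M" "x \<notin> U" for f x
 proof -
  obtain f' where f': "f' \<in> M" "f = ?s f'" using \<open>f \<in> ?s ` M\<close> by blast
  then show ?thesis using M(3)[OF f'(1) that(2)] by simp
 qed
 have "algebraic_relation K U (?s ` M) b"
  unfolding algebraic_relation_def
 proof (intro conjI ballI allI impI)
  show "finite (?s ` M)" "?s ` M \<noteq> {}" using M(1,2) by auto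
  show "f x = 0" if "f \<in> ?s ` M" "x \<notin> U" for f x by (rule s2[OF that])
  show "b f \<in> K" "b f \<noteq> \<zero>" if "f \<in> ?s ` M" for f using b2[OF that] by auto
 qed (rule z2)
 then have "(\<Sum>f\<in>M. sum f U) \<le> (\<Sum>f\<in>?s ` M. sum f U)" by (rule min)
 also have "\<dots> = (\<Sum>f\<in>M. sum (?s f) U)" using sum.reindex[OF inj] by simp
 also have "\<dots> < (\<Sum>f\<in>M. sum f U)"
 proof (rule sum_strict_mono_ex1[OF M(1)])
  show "\<forall>f\<in>M. sum (?s f) U \<le> sum f U" by (auto intro: sum_mono)
  obtain f u where fu: "f \<in> M" "u \<in> U" "0 < f u" using ex by blast
  have "sum (?s f) U < sum f U"
   by (rule sum_strict_mono_ex1[OF fin])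
     (use fu prime_gt_1_nat[OF p(1)] in \<open>auto intro!: bexI[of _ u]\<close>)
  then show "\<exists>f\<in>M. sum (?s f) U < sum f U" using fu(1) by blast
 qed
 finally show False by simp
qed

text \<open>MacLane's theorem: a transcendence basis of minimal size among the generators, subject to
 the \<open>p\<close>-th power condition, is separating.\<close>

theorem perfect_imp_separable_extension:
 assumes K: "subfield K R"
  and perf: "!!p x. Factorial_Ring.prime (p::nat) ==> add_pow R p \<one> = \<zero> ==> x \<in> K ==> \<exists>y\<in>K. y [^] p = x"
 shows "separable_extension K"
 unfolding separable_extension_def
proof (intro conjI allI impI K)
 fix Y assume Y: "finite Y \<and> Y \<subseteq> carrier R"
 have KR: "K \<subseteq> carrier R" using subfieldE(3)[OF K] .
 let ?F = "generate_field R (K \<union> Y)"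
 have F: "subfield ?F R" using generate_field_is_subfield KR Y by simp
 have FR: "?F \<subseteq> carrier R" using subfieldE(3)[OF F] .
 define L where "L = (\<lambda>U. generate_field R (K \<union> U))"
 have L_eq: "L U = generate_field R (K \<union> U)" for U unfolding L_def ..
 have Lsub: "subfield (L U) R" if "U \<subseteq> Y" for U
  unfolding L_def by (rule generate_field_is_subfield) (use KR Y that in auto)
 have Lincl: "K \<union> U \<subseteq> L U" for U unfolding L_def using generate_field.incl by (metis subsetI)
 have Lmono: "L U \<subseteq> L V" if "U \<subseteq> V" "V \<subseteq> Y" for U V
  unfolding L_def by (rule mono_generate_field) (use that KR Y in auto)
 have LF: "L U \<subseteq> ?F" if "U \<subseteq> Y" for U using Lmono[OF that] unfolding L_def by simp
 \<comment> \<open>The last condition says that \<open>?F\<close> is generated over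
   \<open>L U\<close> by its p-th powers; quantifying over \<open>p\<close> makes it vacuous in
   characteristic zero, so both cases run together. \<open>Y\<close> itself is good, hence there is
   a good set of least size.\<close>
 define good where "good = (\<lambda>U. U \<subseteq> Y \<and> finite_dimension (L U) ?F \<and>
  (\<forall>p. Factorial_Ring.prime (p::nat) \<and> add_pow R p \<one> = \<zero> -->
    ?F \<subseteq> generate_field R (L U \<union> (\<lambda>z. z [^] p) ` ?F)))"
 have "good Y"
  unfolding good_def
 proof (intro conjI allI impI)
  show "finite_dimension (L Y) ?F"
   using dimension_one[OF F] unfolding finite_dimension_def L_def by blast
  show "?F \<subseteq> generate_field R (L Y \<union> (\<lambda>z. z [^] p) ` ?F)" for p :: nat
   unfolding L_eq[of Y] by (rule subsetI, rule generate_field.incl) blast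
 qed simp
 then obtain U where gU: "good U" and minU: "!!V. good V ==> card U \<le> card V"
  using ex_has_least_nat[of good Y card] by blast
 have UY: "U \<subseteq> Y" and fd: "finite_dimension (L U) ?F"
  and gen: "!!p. Factorial_Ring.prime (p::nat) ==> add_pow R p \<one> = \<zero> ==>
    ?F \<subseteq> generate_field R (L U \<union> (\<lambda>z. z [^] p) ` ?F)"
  using gU unfolding good_def by auto
 have finU: "finite U" and UR: "U \<subseteq> carrier R" using UY Y finite_subset by auto
 have sep: "separable_element (L U) x" if x: "x \<in> ?F" for x
 proof (cases "\<exists>p. Factorial_Ring.prime (p::nat) \<and> add_pow R p \<one> = \<zero>")
  case True
  then show ?thesis
   using separable_if_generated_by_powers[OF Lsub[OF UY] F LF[OF UY] fd _ _ gen x] by blast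
 next
  case False
  moreover have "(algebraic over (L U)) x"
   using finite_dimension_imp_algebraic[OF Lsub[OF UY] subfieldE(1)[OF F] fd x] .
  ultimately show ?thesis
   using inseparable_imp_polynomial_in_power[OF Lsub[OF UY]] x FR by blast
 qed
 \<comment> \<open>A dependence of minimal degree contains some \<open>u\<close> with a positive
   exponent not divisible by the characteristic. Positivity makes \<open>u\<close> algebraic over
   \<open>L (U - {u})\<close>; the exponent modulo \<open>p\<close> puts \<open>u\<close> into the
   field generated by \<open>L (U - {u})\<close> and the p-th powers. So \<open>U - {u}\<close>
   would be good as well.\<close>
 have "algebraically_independent K U"
 proof (rule ccontr)
  assume "\<not> algebraically_independent K U"
  then obtain M0 c0 where "algebraic_relation K U M0 c0"
   using not_algebraically_independentD[OF finU UR KR] by blast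
  then obtain M c where rel: "algebraic_relation K U M c"
   and min: "!!M' c'. algebraic_relation K U M' c' ==> (\<Sum>f\<in>M. sum f U) \<le> (\<Sum>f\<in>M'. sum f U)"
   using ex_has_least_nat[of "\<lambda>M. \<exists>c. algebraic_relation K U M c" M0 "\<lambda>M. \<Sum>f\<in>M. sum f U"] by blast
  have "\<exists>f\<in>M. \<exists>u\<in>U. 0 < f u \<and> (\<forall>p. Factorial_Ring.prime (p::nat) \<and> add_pow R p \<one> = \<zero> --> \<not> p dvd f u)"
  proof (rule minimal_relation_exponent[OF finU UR KR _ rel])
   show "\<exists>y\<in>K. y [^] p = x" if "Factorial_Ring.prime p" "add_pow R p \<one> = \<zero>" "x \<in> K" for p :: nat and x
    using perf that by blast
  qed (rule min)
  then obtain f0 u where f0: "f0 \<in> M" and u: "u \<in> U" and pos: "0 < f0 u"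
   and nd: "!!p. Factorial_Ring.prime (p::nat) ==> add_pow R p \<one> = \<zero> ==> \<not> p dvd f0 u"
   by blast
  have M: "finite M" "!!f. f \<in> M ==> c f \<in> K" and z: "(\<Oplus>f\<in>M. c f \<otimes> monomial_at U f) = \<zero>"
   using rel unfolding algebraic_relation_def by auto
  let ?V = "U - {u}"
  have VY: "?V \<subseteq> Y" using UY by blast
  have sL: "subring (L ?V) R" using subfieldE(1)[OF Lsub[OF VY]] .
  have uR: "u \<in> carrier R" using u UR by blast
  let ?c = "\<lambda>f. c f \<otimes> monomial_at ?V f"
  have cL: "?c f \<in> L ?V" if "f \<in> M" for f
   unfolding monomial_at_def
   using M(2)[OF that] Lincl[of ?V] nat_pow_in_subring[OF sL]
   by (intro subringE(6)[OF sL] finprod_in_subring[OF sL]) blast+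
  have cR: "?c f \<in> carrier R" if "f \<in> M" for f
   using cL[OF that] subfieldE(3)[OF Lsub[OF VY]] by blast
  have rel': "(\<Oplus>f\<in>M. ?c f \<otimes> u [^] f u) = \<zero>"
  proof -
   have "(\<Oplus>f\<in>M. ?c f \<otimes> u [^] f u) = (\<Oplus>f\<in>M. c f \<otimes> monomial_at U f)"
   proof (rule add.finprod_cong')
    fix f assume f: "f \<in> M"
    have "c f \<in> carrier R" "monomial_at ?V f \<in> carrier R" using M(2)[OF f] KR UR by auto
    then show "?c f \<otimes> u [^] f u = c f \<otimes> monomial_at U f"
     using monomial_at_remove[OF finU UR u, of f] uR by (simp add: m_ac)
   next
    have "c f \<in> carrier R" if "f \<in> M" for f using M(2)[OF that] KR by blast
    then show "(\<lambda>f. c f \<otimes> monomial_at U f) \<in> M \<rightarrow> carrier R" using UR by simp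
   qed simp
   then show ?thesis using z by simp
  qed
  have "finite ((\<lambda>f. f u) ` M)" using M(1) by simp
  then obtain N where N: "!!f. f \<in> M ==> f u < N"
   by (metis (no_types, lifting) finite_nat_set_iff_bounded image_eqI)
  have "\<exists>h\<in>carrier ((L ?V)[X]). h \<noteq> [] \<and> length h \<le> N \<and> eval h u = \<zero>"
   using minimal_relation_cofactor[where \<gamma> = "\<lambda>n. n", OF finU UR KR rel min u f0 pos]
    N subringE(3)[OF sL]
   by (intro regrouped_relation[where \<gamma> = "\<lambda>n. n" and n = "\<lambda>f. f u" and c = ?c and M = M and j = "f0 u"]
     Lsub[OF VY] uR M(1) cL rel') auto
  then have alg: "(algebraic over (L ?V)) u" using algebraicI by blast
  have LU: "L U = simple_extension (L ?V) u"
  proof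
   have se: "subfield (simple_extension (L ?V) u) R"
    using simple_extension_is_subfield[OF Lsub[OF VY] uR] alg by blast
   have "K \<union> U \<subseteq> simple_extension (L ?V) u"
    using simple_extension_incl[OF subringE(1)[OF sL] uR] simple_extension_mem[OF sL uR] Lincl[of ?V] by blast
   then show "L U \<subseteq> simple_extension (L ?V) u"
    unfolding L_eq[of U] using generate_field_min_subfield1[OF _ se] KR UR by (metis Un_subset_iff)
   show "simple_extension (L ?V) u \<subseteq> L U"
    using simple_extension_subring_incl[OF subfieldE(1)[OF Lsub[OF UY]] Lmono[OF _ UY]] Lincl[of U] u by blast
  qed
  have "finite_dimension (L ?V) (L U)"
   unfolding LU using finite_dimension_simple_extension[OF Lsub[OF VY] uR] alg by blast
  then have fdV: "finite_dimension (L ?V) ?F"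
   using telescopic_base_dim(1)[OF Lsub[OF VY] Lsub[OF UY] _ fd] by blast
  have genV: "?F \<subseteq> generate_field R (L ?V \<union> (\<lambda>z. z [^] p) ` ?F)"
   if p: "Factorial_Ring.prime (p::nat)" "add_pow R p \<one> = \<zero>" for p
  proof -
   let ?G = "L ?V \<union> (\<lambda>z. z [^] p) ` ?F"
   let ?E = "generate_field R ?G"
   have GR: "?G \<subseteq> carrier R" using subringE(1)[OF sL] FR by auto
   have E: "subfield ?E R" using generate_field_is_subfield[OF GR] .
   have GE: "?G \<subseteq> ?E" using generate_field.incl by (metis subsetI)
   have "u \<in> ?F" using u UY LF[OF UY] Lincl[of U] by blast
   then have up: "u [^] p \<in> ?E" using GE by blast
   let ?j = "f0 u mod p"
   have j: "0 < ?j" using nd[OF p] by (simp add: mod_greater_zero_iff_not_dvd)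
   have "u \<in> ?E"
   proof (rule mem_subfield_if_relation[OF E p uR up M(1), of ?c "\<lambda>f. f u" ?j])
    show "?c f \<in> ?E" if "f \<in> M" for f using cL[OF that] GE by blast
    show "(\<Oplus>f\<in>M. ?c f \<otimes> u [^] f u) = \<zero>" by (rule rel')
    show "(\<Oplus>f\<in>{f\<in>M. f u mod p = ?j}. ?c f \<otimes> u [^] (f u - ?j)) \<noteq> \<zero>"
     using minimal_relation_cofactor[where \<gamma> = "\<lambda>n. n mod p", OF finU UR KR rel min u f0 j] by simp
   qed
   then have "L U \<subseteq> ?E"
    unfolding LU using simple_extension_subring_incl[OF subfieldE(1)[OF E]] GE by blast
   then have "L U \<union> (\<lambda>z. z [^] p) ` ?F \<subseteq> ?E" using GE by blast
   then have "generate_field R (L U \<union> (\<lambda>z. z [^] p) ` ?F) \<subseteq> ?E"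
    by (intro generate_field_min_subfield1[OF _ E] subset_trans[OF _ subfieldE(3)[OF E]])
   then show ?thesis using gen[OF p] by blast
  qed
  have "good ?V" unfolding good_def using VY fdV genV by blast
  then have "card U \<le> card ?V" by (rule minU)
  then show False using u finU by (metis card_Diff1_less not_le)
 qed
 moreover have "U \<subseteq> ?F" using Lincl[of U] LF[OF UY] by blast
 ultimately show "separably_generated K ?F"
  unfolding separably_generated_def using sep unfolding L_def by blast
qed

end

section \<open>Subfields of a ring with nilpotent residue kernel, and Hensel's lemma\<close>

lemma (in cring) subfieldI_inverse:
 assumes "subring K R" "\<one> \<noteq> \<zero>" and inv: "!!x. x \<in> K ==> x \<noteq> \<zero> ==> \<exists>y\<in>K. x \<otimes> y = \<one>"
 shows "subfield K R"
proof (rule subfieldI[OF subcringI'[OF assms(1)]])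
 have KR: "K \<subseteq> carrier R" using subringE(1)[OF assms(1)] .
 show "Units (R\<lparr>carrier := K\<rparr>) = K - {\<zero>}"
 proof (intro equalityI subsetI)
  fix x assume "x \<in> Units (R\<lparr>carrier := K\<rparr>)"
  then show "x \<in> K - {\<zero>}" using KR assms(2) unfolding Units_def by auto
 next
  fix x assume x: "x \<in> K - {\<zero>}"
  then obtain y where y: "y \<in> K" "x \<otimes> y = \<one>" using inv by blast
  then have "y \<otimes> x = \<one>" using m_comm[OF subsetD[OF KR] subsetD[OF KR], of x y] x by simp
  then show "x \<in> Units (R\<lparr>carrier := K\<rparr>)"
   using x y unfolding Units_def by auto
 qed
qed

lemma (in cring) subfield_Union_chain:
 assumes "C \<noteq> {}" "subset.chain {F. subfield F R} C"
 shows "subfield (\<Union>C) R"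
proof -
 have sf: "subfield F R" if "F \<in> C" for F using assms(2) that unfolding subset.chain_def by blast
 have sr: "subring F R" if "F \<in> C" for F using subfieldE(1)[OF sf[OF that]] .
 have two: "\<exists>F\<in>C. x \<in> F \<and> y \<in> F" if "x \<in> \<Union>C" "y \<in> \<Union>C" for x y
 proof -
  obtain F G where "F \<in> C" "G \<in> C" "x \<in> F" "y \<in> G"
   using \<open>x \<in> \<Union>C\<close> \<open>y \<in> \<Union>C\<close> by blast
  moreover have "F \<subseteq> G \<or> G \<subseteq> F" using assms(2) \<open>F \<in> C\<close> \<open>G \<in> C\<close> unfolding subset_chain_def by blast
  ultimately show ?thesis by blast
 qed
 obtain F0 where F0: "F0 \<in> C" using assms(1) by blast
 have "subring (\<Union>C) R"
 proof (rule subringI)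
  show "\<Union>C \<subseteq> carrier R" using subringE(1)[OF sr] by blast
  show "\<one> \<in> \<Union>C" using subringE(3)[OF sr[OF F0]] F0 by blast
  show "\<ominus> h \<in> \<Union>C" if "h \<in> \<Union>C" for h using subringE(5)[OF sr] that by blast
  show "x \<otimes> y \<in> \<Union>C" "x \<oplus> y \<in> \<Union>C" if "x \<in> \<Union>C" "y \<in> \<Union>C" for x y
   using two[OF that] subringE(6,7)[OF sr] by blast+
 qed
 then show ?thesis
 proof (rule subfieldI_inverse)
  show "\<one> \<noteq> \<zero>" using subfieldE(6)[OF sf[OF F0]] .
  fix x assume "x \<in> \<Union>C" "x \<noteq> \<zero>"
  then obtain F where F: "F \<in> C" "x \<in> F - {\<zero>}" by blast
  then show "\<exists>y\<in>\<Union>C. x \<otimes> y = \<one>" using subfield_m_inv(1,2)[OF sf[OF F(1)] F(2)] by blast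
 qed
qed

lemma (in cring) unit_one_minus_nilpotent:
 assumes z: "z \<in> carrier R" and nil: "z [^] (n::nat) = \<zero>"
 shows "\<one> \<ominus> z \<in> Units R"
proof -
 have "\<exists>y\<in>carrier R. (\<one> \<ominus> z) \<otimes> y = \<one> \<ominus> z [^] m" for m :: nat
 proof (induction m)
  case 0
  show ?case using z by (intro bexI[of _ \<zero>]) (auto simp: minus_eq r_neg)
 next
  case (Suc m)
  then obtain y where y: "y \<in> carrier R" "(\<one> \<ominus> z) \<otimes> y = \<one> \<ominus> z [^] m" by blast
  have "(\<one> \<ominus> z) \<otimes> (y \<oplus> w) = \<one> \<ominus> w \<oplus> (\<one> \<ominus> z) \<otimes> w" if "(\<one> \<ominus> z) \<otimes> y = \<one> \<ominus> w" "w \<in> carrier R" for w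
   using that z y(1) by (simp add: r_distr)
  moreover have "\<one> \<ominus> w \<oplus> (\<one> \<ominus> z) \<otimes> w = \<one> \<ominus> w \<otimes> z" if "w \<in> carrier R" for w
   using that z by algebra
  ultimately have "(\<one> \<ominus> z) \<otimes> (y \<oplus> z [^] m) = \<one> \<ominus> z [^] m \<otimes> z"
   using y(2) z by simp
  then show ?case using y(1) z by (intro bexI[of _ "y \<oplus> z [^] m"]) auto
 qed
 then obtain y where "y \<in> carrier R" "(\<one> \<ominus> z) \<otimes> y = \<one>"
  using nil by (metis minus_eq minus_zero one_closed r_zero)
 then show ?thesis using z unit_factor[of "\<one> \<ominus> z" y] by simp
qed

lemma (in ring_hom_cring) hom_deriv_at:
 assumes "set p \<subseteq> carrier R" "x \<in> carrier R"
 shows "h (R.deriv_at p x) = S.deriv_at (map h p) (h x)"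
 using assms(1)
proof (induction p)
 case (Cons c q)
 then show ?case
  using assms(2) ring_hom_add_pow[OF R.ring_axioms S.ring_axioms homh, of c "length q"]
  by (simp add: hom_nat_pow)
qed simp

text \<open>An abstraction of the local ring modulo the primary ideal together with its residue
  field. Nilpotence of the single kernel elements already makes \<open>B\<close> local; the
  Noetherian condition joins where finiteness is at stake.\<close>

locale residue_cover = B?: cring B + k: field k
 for B :: "('b, 'm) ring_scheme" (structure) and k :: "('c, 'n) ring_scheme" +
 fixes \<rho> :: "'b => 'c"
 assumes hom: "\<rho> \<in> ring_hom B k"
  and surj: "\<rho> ` carrier B = carrier k"
  and nil: "!!b. b \<in> carrier B ==> \<rho> b = \<zero>\<^sub>k ==> \<exists>n::nat. b [^] n = \<zero>"
begin

sublocale \<rho>: ring_hom_cring B k \<rho>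
 by unfold_locales (rule hom)

lemma lift_exists: "x \<in> carrier k ==> \<exists>y\<in>carrier B. \<rho> y = x"
 using surj by (metis imageE)

lemma one_not_zero_B: "\<one> \<noteq> \<zero>"
proof
 assume "\<one> = \<zero>"
 then have "\<rho> \<one> = \<rho> \<zero>" by simp
 then show False using k.one_not_zero by simp
qed

text \<open>A lift \<open>c\<close> of the inverse of \<open>\<rho> b\<close> makes
  \<open>b \<otimes> c\<close> differ from 1 by a nilpotent element, so \<open>b\<close> divides a
  unit.\<close>

lemma unitI:
 assumes b: "b \<in> carrier B" and nz: "\<rho> b \<noteq> \<zero>\<^sub>k"
 shows "b \<in> Units B"
proof -
 have "\<rho> b \<in> Units k" using b nz k.field_Units by auto
 then have iv: "inv\<^bsub>k\<^esub> \<rho> b \<in> carrier k" "\<rho> b \<otimes>\<^sub>k inv\<^bsub>k\<^esub> \<rho> b = \<one>\<^sub>k" by auto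
 then obtain c where c: "c \<in> carrier B" "\<rho> c = inv\<^bsub>k\<^esub> \<rho> b" using surj by (metis imageE)
 let ?z = "\<one> \<ominus> b \<otimes> c"
 have z: "?z \<in> carrier B" using b c by simp
 have "\<rho> ?z = \<zero>\<^sub>k" using b c iv by (simp add: minus_eq k.r_neg)
 then obtain n :: nat where "?z [^] n = \<zero>" using nil[OF z] by blast
 then have "\<one> \<ominus> ?z \<in> Units B" using unit_one_minus_nilpotent[OF z] by blast
 moreover have "\<one> \<ominus> ?z = b \<otimes> c" using b c by algebra
 ultimately show ?thesis using unit_factor b c by metis
qed

lemma subfield_inj:
 assumes "subfield F B" "f \<in> F" "\<rho> f = \<zero>\<^sub>k"
 shows "f = \<zero>"
proof (rule ccontr)
 assume "f \<noteq> \<zero>"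
 then have f: "f \<in> F - {\<zero>}" using assms(2) by blast
 have cl: "f \<in> carrier B" "inv f \<in> carrier B"
  using subfieldE(3)[OF assms(1)] assms(2) subfield_m_inv(1)[OF assms(1) f] by auto
 have "\<rho> (f \<otimes> inv f) = \<one>\<^sub>k" using subfield_m_inv(2)[OF assms(1) f] by simp
 then show False using cl assms(3) by simp
qed

text \<open>\<open>\<rho>\<close> embeds \<open>C\<close> into a field, so \<open>C\<close> is a
  domain, and its nonzero elements avoid the kernel and are units of \<open>B\<close>. The fraction
  field of \<open>C\<close> can therefore be formed inside \<open>B\<close>.\<close>

lemma fraction_subfield:
 assumes C: "subring C B" and inj: "!!c. c \<in> C ==> \<rho> c = \<zero>\<^sub>k ==> c = \<zero>"
 defines "Q \<equiv> {c \<otimes> inv d |c d. c \<in> C \<and> d \<in> C \<and> d \<noteq> \<zero>}"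
 shows "subfield Q B" "C \<subseteq> Q"
proof -
 have CB: "C \<subseteq> carrier B" using subringE(1)[OF C] .
 have u: "d \<in> Units B" if "d \<in> C" "d \<noteq> \<zero>" for d
  using unitI[of d] inj[of d] that CB by blast
 have nz: "d \<otimes> d' \<noteq> \<zero>" if "d \<in> C" "d \<noteq> \<zero>" "d' \<in> C" "d' \<noteq> \<zero>" for d d'
 proof
  assume "d \<otimes> d' = \<zero>"
  moreover have cl: "d \<in> carrier B" "d' \<in> carrier B" using that CB by auto
  ultimately have "\<rho> d \<otimes>\<^sub>k \<rho> d' = \<zero>\<^sub>k" using \<rho>.hom_mult[OF cl] by simp
  then have "\<rho> d = \<zero>\<^sub>k \<or> \<rho> d' = \<zero>\<^sub>k" using k.integral cl by simp
  then show False using inj that by blast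
 qed
 have QI: "c \<otimes> inv d \<in> Q" if "c \<in> C" "d \<in> C" "d \<noteq> \<zero>" for c d
  unfolding Q_def using that by blast
 show CQ: "C \<subseteq> Q"
 proof
  fix c assume "c \<in> C"
  moreover have "c = c \<otimes> inv \<one>" using \<open>c \<in> C\<close> CB by auto
  ultimately show "c \<in> Q" unfolding Q_def using subringE(3)[OF C] one_not_zero_B by blast
 qed
 have "subring Q B"
 proof (rule subringI)
  show "Q \<subseteq> carrier B" unfolding Q_def using u CB by auto
  show "\<one> \<in> Q" using CQ subringE(3)[OF C] by blast
 next
  fix x assume "x \<in> Q"
  then obtain c d where x: "x = c \<otimes> inv d" "c \<in> C" "d \<in> C" "d \<noteq> \<zero>" unfolding Q_def by blast
  then have "\<ominus> x = (\<ominus> c) \<otimes> inv d" using CB u by (simp add: l_minus subset_iff)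
  then show "\<ominus> x \<in> Q" using QI[OF subringE(5)[OF C x(2)] x(3,4)] by simp
 next
  fix x y assume "x \<in> Q" "y \<in> Q"
  then obtain c d c' d' where x: "x = c \<otimes> inv d" "c \<in> C" "d \<in> C" "d \<noteq> \<zero>"
   and y: "y = c' \<otimes> inv d'" "c' \<in> C" "d' \<in> C" "d' \<noteq> \<zero>" unfolding Q_def by blast
  have cl: "c \<in> carrier B" "d \<in> carrier B" "c' \<in> carrier B" "d' \<in> carrier B" using x y CB by auto
  have ud: "d \<in> Units B" "d' \<in> Units B" using u x y by auto
  have iv: "inv (d \<otimes> d') = inv d \<otimes> inv d'" 
  proof (rule comm_inv_char)
   have "(d \<otimes> d') \<otimes> (inv d \<otimes> inv d') = (d \<otimes> inv d) \<otimes> (d' \<otimes> inv d')"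
    using cl ud by (simp add: m_ac)
   then show "(d \<otimes> d') \<otimes> (inv d \<otimes> inv d') = \<one>" using ud by simp
  qed (use cl ud in auto)
  have "x \<otimes> y = (c \<otimes> c') \<otimes> inv (d \<otimes> d')" unfolding x y iv using cl ud by (simp add: m_ac)
  moreover have den: "d \<otimes> d' \<in> C" "d \<otimes> d' \<noteq> \<zero>"
   using x y nz subringE(6)[OF C] by auto
  ultimately show "x \<otimes> y \<in> Q" using QI[OF subringE(6)[OF C x(2) y(2)] den] by simp
  have "(c \<otimes> d' \<oplus> c' \<otimes> d) \<otimes> (e \<otimes> e') = c \<otimes> e \<otimes> (d' \<otimes> e') \<oplus> c' \<otimes> e' \<otimes> (d \<otimes> e)"
   if "e \<in> carrier B" "e' \<in> carrier B" for e e' using that cl by algebra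
  then have "x \<oplus> y = (c \<otimes> d' \<oplus> c' \<otimes> d) \<otimes> inv (d \<otimes> d')"
   unfolding x y iv using cl ud by simp
  moreover have "c \<otimes> d' \<oplus> c' \<otimes> d \<in> C"
   using subringE(6,7)[OF C] x(2,3) y(2,3) by simp
  ultimately show "x \<oplus> y \<in> Q" using QI[OF _ den] by simp
 qed
 then show "subfield Q B"
 proof (rule subfieldI_inverse[OF _ one_not_zero_B])
  fix x assume "x \<in> Q" "x \<noteq> \<zero>"
  then obtain c d where x: "x = c \<otimes> inv d" "c \<in> C" "d \<in> C" "d \<noteq> \<zero>" unfolding Q_def by blast
  have ud: "d \<in> Units B" using u x by auto
  have "c \<noteq> \<zero>" using x \<open>x \<noteq> \<zero>\<close> ud by auto
  then have uc: "c \<in> Units B" using u x by auto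
  have "(c \<otimes> inv d) \<otimes> (d \<otimes> inv c) = (c \<otimes> inv c) \<otimes> (d \<otimes> inv d)"
   using Units_closed[OF ud] Units_closed[OF uc] Units_inv_closed[OF ud] Units_inv_closed[OF uc]
   by (simp add: m_ac del: Units_r_inv Units_l_inv)
  then have "x \<otimes> (d \<otimes> inv c) = \<one>" unfolding x(1) using ud uc by simp
  moreover have "d \<otimes> inv c \<in> Q" using QI[OF x(3,2) \<open>c \<noteq> \<zero>\<close>] .
  ultimately show "\<exists>y\<in>Q. x \<otimes> y = \<one>" by blast
 qed
qed

definition maximal_subfield :: "'b set => bool" where
 "maximal_subfield F \<longleftrightarrow> subfield F B \<and> (\<forall>F'. subfield F' B \<and> F \<subseteq> F' --> F' = F)"

lemma maximal_subfield_exists: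
 assumes "subfield F0 B"
 shows "\<exists>F. F0 \<subseteq> F \<and> maximal_subfield F"
proof -
 let ?A = "{F. subfield F B \<and> F0 \<subseteq> F}"
 have "\<exists>M\<in>?A. \<forall>F\<in>?A. M \<subseteq> F --> F = M"
 proof (rule subset_Zorn_nonempty)
  show "?A \<noteq> {}" using assms by blast
  fix C assume C: "C \<noteq> {}" "subset.chain ?A C"
  then have "subset.chain {F. subfield F B} C" unfolding subset_chain_def by blast
  then have "subfield (\<Union>C) B" using subfield_Union_chain[OF C(1)] by blast
  moreover have "F0 \<subseteq> \<Union>C" using C unfolding subset_chain_def by blast
  ultimately show "\<Union>C \<in> ?A" by blast
 qed
 then obtain M where M: "subfield M B" "F0 \<subseteq> M" and max: "!!F. subfield F B ==> F0 \<subseteq> F ==> M \<subseteq> F ==> F = M"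
  by auto
 have "maximal_subfield M"
  unfolding maximal_subfield_def
 proof (intro conjI allI impI M(1))
  fix F' assume F': "subfield F' B \<and> M \<subseteq> F'"
  then show "F' = M" using max[of F'] subset_trans[OF M(2), of F'] by simp
 qed
 then show ?thesis using M(2) by (intro exI[of _ M]) simp
qed

text \<open>The form in which maximality is used: the fraction field of \<open>C\<close>, formed
  inside \<open>B\<close>, is a subfield containing \<open>F\<close>, hence equal to
  \<open>F\<close>.\<close>

lemma maximal_subfield_absorbs:
 assumes F: "maximal_subfield F" and C: "subring C B" "F \<subseteq> C"
  and inj: "!!c. c \<in> C ==> \<rho> c = \<zero>\<^sub>k ==> c = \<zero>"
 shows "C \<subseteq> F"
proof -
 let ?Q = "{c \<otimes> inv d |c d. c \<in> C \<and> d \<in> C \<and> d \<noteq> \<zero>}"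
 have Q: "subfield ?Q B" "C \<subseteq> ?Q" using fraction_subfield[OF C(1) inj] by simp_all
 then have "?Q = F" using F C(2) subset_trans[OF C(2) Q(2)] unfolding maximal_subfield_def by simp
 then show ?thesis using Q(2) by simp
qed

text \<open>Newton iteration along the powers of \<open>eval G y0\<close>, which is nilpotent
  because \<open>y0\<close> is a root modulo the kernel. Each step squares the error; keeping one
  additional factor of it is enough to reach zero.\<close>

lemma hensel:
 assumes G: "set G \<subseteq> carrier B" and y0: "y0 \<in> carrier B"
  and root: "\<rho> (eval G y0) = \<zero>\<^sub>k" and simple: "\<rho> (deriv_at G y0) \<noteq> \<zero>\<^sub>k"
 shows "\<exists>y\<in>carrier B. \<rho> y = \<rho> y0 \<and> eval G y = \<zero>"
proof -
 let ?a = "eval G y0"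
 have a: "?a \<in> carrier B" using eval_in_carrier[OF G y0] .
 have approx: "\<exists>y\<in>carrier B. \<rho> y = \<rho> y0 \<and> (\<exists>t\<in>carrier B. eval G y = ?a [^] Suc n \<otimes> t)" for n
 proof (induction n)
  case 0
  show ?case using y0 a by (intro bexI[of _ y0]) (auto intro: bexI[of _ \<one>])
 next
  case (Suc n)
  then obtain y t where y: "y \<in> carrier B" "\<rho> y = \<rho> y0" and t: "t \<in> carrier B" "eval G y = ?a [^] Suc n \<otimes> t"
   by blast
  let ?d = "deriv_at G y"
  have "\<rho> ?d = \<rho> (deriv_at G y0)" using \<rho>.hom_deriv_at[OF G] y y0 by simp
  moreover have dcl: "?d \<in> carrier B" using G y(1) by simp
  ultimately have d: "?d \<in> Units B" using unitI simple by metis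
  let ?A = "?a [^] Suc n"
  have A: "?A \<in> carrier B" using a by simp
  \<comment> \<open>Newton's correction -G(y)/G'(y), with \<open>eval G y\<close> written as
    \<open>?A \<otimes> t\<close>. It cancels the first two terms of the Taylor expansion against
    each other, and the remainder is divisible by the square of \<open>?A\<close>.\<close>
  define h where "h = \<ominus> (inv ?d \<otimes> (?A \<otimes> t))"
  have h: "h \<in> carrier B" unfolding h_def using d A t by simp
  obtain s where s: "s \<in> carrier B" "eval G (y \<oplus> h) = eval G y \<oplus> h \<otimes> ?d \<oplus> h \<otimes> h \<otimes> s"
   using eval_taylor[OF y(1) h G] by blast
  have "\<ominus> (e \<otimes> u) \<otimes> ?d = \<ominus> ((?d \<otimes> e) \<otimes> u)" if "e \<in> carrier B" "u \<in> carrier B" for e u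
   using that dcl by (simp add: l_minus r_minus m_ac)
  then have "h \<otimes> ?d = \<ominus> ((?d \<otimes> inv ?d) \<otimes> (?A \<otimes> t))"
   unfolding h_def using d A t(1) by simp
  then have "eval G y \<oplus> h \<otimes> ?d = \<zero>" using t A d by (simp add: r_neg)
  then have e0: "eval G (y \<oplus> h) = h \<otimes> h \<otimes> s" using s h by simp
  have hw: "h = ?A \<otimes> (\<ominus> (inv ?d \<otimes> t))"
  proof -
   have "\<ominus> (u \<otimes> (v \<otimes> t)) = v \<otimes> (\<ominus> (u \<otimes> t))" if "u \<in> carrier B" "v \<in> carrier B" for u v
    using that t(1) by (simp add: r_minus m_ac)
   then show ?thesis unfolding h_def using d A by blast
  qed
  have "h \<otimes> h \<otimes> s = ?A \<otimes> (\<ominus> (inv ?d \<otimes> t)) \<otimes> (?A \<otimes> (\<ominus> (inv ?d \<otimes> t))) \<otimes> s"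
   by (simp only: hw)
  with e0 have e: "eval G (y \<oplus> h) = ?A \<otimes> (\<ominus> (inv ?d \<otimes> t)) \<otimes> (?A \<otimes> (\<ominus> (inv ?d \<otimes> t))) \<otimes> s" by (rule trans)
  have "?A \<otimes> w \<otimes> (?A \<otimes> w) \<otimes> s = ?a [^] Suc (Suc n) \<otimes> (?a [^] n \<otimes> w \<otimes> w \<otimes> s)" if "w \<in> carrier B" for w
  proof -
   have "(u \<otimes> v) \<otimes> w \<otimes> ((u \<otimes> v) \<otimes> w) \<otimes> s = (u \<otimes> v \<otimes> v) \<otimes> (u \<otimes> w \<otimes> w \<otimes> s)"
    if "u \<in> carrier B" "v \<in> carrier B" for u v
    using that \<open>w \<in> carrier B\<close> s(1) by (simp add: m_ac)
   then show ?thesis using a by simp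
  qed
  then have "eval G (y \<oplus> h) = ?a [^] Suc (Suc n) \<otimes> (?a [^] n \<otimes> (\<ominus> (inv ?d \<otimes> t)) \<otimes> (\<ominus> (inv ?d \<otimes> t)) \<otimes> s)"
   unfolding e using d t by simp
  moreover have "?a [^] n \<otimes> (\<ominus> (inv ?d \<otimes> t)) \<otimes> (\<ominus> (inv ?d \<otimes> t)) \<otimes> s \<in> carrier B"
   using a d t s by simp
  moreover have "\<rho> (y \<oplus> h) = \<rho> y0"
  proof -
   have "\<rho> h = \<zero>\<^sub>k" unfolding hw using d t a root by simp
   then show ?thesis using y y0 h by simp
  qed
  ultimately show ?case using add.m_closed[OF y(1) h] by blast
 qed
 obtain n :: nat where "?a [^] n = \<zero>" using nil[OF a root] by blast
 then have z: "?a [^] Suc n = \<zero>" using a by simp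
 obtain y t where "y \<in> carrier B" "\<rho> y = \<rho> y0" "t \<in> carrier B" "eval G y = ?a [^] Suc n \<otimes> t"
  using approx[of n] by blast
 then show ?thesis unfolding z by auto
qed

context
 fixes F assumes F: "maximal_subfield F"
begin

lemma F_subfield: "subfield F B" using F unfolding maximal_subfield_def by blast

lemma F_subset: "F \<subseteq> carrier B" using subfieldE(3)[OF F_subfield] .

lemma F_image: "subfield (\<rho> ` F) k" "inj_on \<rho> F"
 using \<rho>.ring.img_is_subfield[OF F_subfield k.one_not_zero] by auto

definition section_map :: "'c => 'b" where "section_map = inv_into F \<rho>"

lemma section_map: "x \<in> \<rho> ` F ==> section_map x \<in> F" "x \<in> \<rho> ` F ==> \<rho> (section_map x) = x"
 "f \<in> F ==> section_map (\<rho> f) = f"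
 unfolding section_map_def using F_image(2) by (auto intro: inv_into_into f_inv_into_f)

lemma section_map_hom: "ring_hom_ring (k\<lparr>carrier := \<rho> ` F\<rparr>) B section_map"
proof -
 have sF: "subring F B" using subfieldE(1)[OF F_subfield] .
 interpret kF: field "k\<lparr>carrier := \<rho> ` F\<rparr>" using k.subfield_iff(2)[OF F_image(1)] .
 have "section_map \<in> ring_hom (k\<lparr>carrier := \<rho> ` F\<rparr>) B"
 proof (rule ring_hom_memI)
  show "section_map x \<in> carrier B" if "x \<in> carrier (k\<lparr>carrier := \<rho> ` F\<rparr>)" for x
   using that section_map(1) F_subset by auto
  show "section_map \<one>\<^bsub>k\<lparr>carrier := \<rho> ` F\<rparr>\<^esub> = \<one>"
   using section_map(3)[OF subringE(3)[OF sF]] by simp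
  fix x y assume "x \<in> carrier (k\<lparr>carrier := \<rho> ` F\<rparr>)" "y \<in> carrier (k\<lparr>carrier := \<rho> ` F\<rparr>)"
  then obtain f g where fg: "f \<in> F" "g \<in> F" "x = \<rho> f" "y = \<rho> g" by auto
  have cl: "f \<in> carrier B" "g \<in> carrier B" using fg F_subset by auto
  show "section_map (x \<otimes>\<^bsub>k\<lparr>carrier := \<rho> ` F\<rparr>\<^esub> y) = section_map x \<otimes> section_map y"
   using section_map(3)[OF subringE(6)[OF sF fg(1,2)]] section_map(3) fg cl by simp
  show "section_map (x \<oplus>\<^bsub>k\<lparr>carrier := \<rho> ` F\<rparr>\<^esub> y) = section_map x \<oplus> section_map y"
   using section_map(3)[OF subringE(7)[OF sF fg(1,2)]] section_map(3) fg cl by simp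
 qed
 then show ?thesis
  using kF.ring_axioms B.ring_axioms by (simp add: ring_hom_ring_def ring_hom_ring_axioms_def)
qed

text \<open>Coefficients in the image of \<open>F\<close> are carried back to \<open>F\<close>
  before evaluation. The values at all polynomials form the subring F[y] of \<open>B\<close>, the
  candidate for \<open>maximal_subfield_absorbs\<close>.\<close>

definition lift_eval :: "'b => 'c list => 'b" where
 "lift_eval y q = eval (map section_map q) y"

lemma lift_eval_props:
 assumes y: "y \<in> carrier B"
 shows "ring_hom_ring ((\<rho> ` F)[X]\<^sub>k) B (lift_eval y)"
  and "!!q. q \<in> carrier ((\<rho> ` F)[X]\<^sub>k) ==> \<rho> (lift_eval y q) = k.eval q (\<rho> y)"
  and "F \<subseteq> lift_eval y ` carrier ((\<rho> ` F)[X]\<^sub>k)"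
  and "y \<in> lift_eval y ` carrier ((\<rho> ` F)[X]\<^sub>k)"
  and "subring (lift_eval y ` carrier ((\<rho> ` F)[X]\<^sub>k)) B"
proof -
 let ?P = "(\<rho> ` F)[X]\<^sub>k" and ?kF = "k\<lparr>carrier := \<rho> ` F\<rparr>"
 interpret s: ring_hom_ring ?kF B section_map by (rule section_map_hom)
 have skF: "subring (\<rho> ` F) k" using subfieldE(1)[OF F_image(1)] .
 interpret P: domain ?P using k.univ_poly_is_domain[OF skF] .
 have set: "set q \<subseteq> \<rho> ` F" if "q \<in> carrier ?P" for q
  using that k.polynomial_incl univ_poly_carrier by blast
 have set': "set (map section_map q) \<subseteq> carrier B" if "q \<in> carrier ?P" for q
  using set[OF that] section_map(1) F_subset by auto
 have "lift_eval y \<in> ring_hom ?P B"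
 proof (rule ring_hom_memI)
  show "lift_eval y q \<in> carrier B" if "q \<in> carrier ?P" for q
   unfolding lift_eval_def using eval_in_carrier[OF set'[OF that] y] .
  show "lift_eval y \<one>\<^bsub>?P\<^esub> = \<one>"
   using s.hom_one y by (simp add: lift_eval_def univ_poly_one)
  fix q r assume q: "q \<in> carrier ?P" and r: "r \<in> carrier ?P"
  have m: "map section_map q \<otimes>\<^bsub>(carrier B)[X]\<^esub> map section_map r = normalize (map section_map (k.poly_mult q r))"
   using s.poly_mult_hom'[of q r] set[OF q] set[OF r] k.poly_mult_consistent[OF skF]
   by (simp add: univ_poly_mult)
  have "set (map section_map (k.poly_mult q r)) \<subseteq> carrier B"
   using set'[OF P.m_closed[OF q r]] by (simp add: univ_poly_mult)
  then have "lift_eval y (q \<otimes>\<^bsub>?P\<^esub> r) = eval (normalize (map section_map (k.poly_mult q r))) y"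
   unfolding lift_eval_def using eval_normalize y by (simp add: univ_poly_mult)
  also have "\<dots> = lift_eval y q \<otimes> lift_eval y r"
   unfolding m[symmetric] lift_eval_def
   using eval_poly_mult[OF set'[OF q] set'[OF r] y] by (simp add: univ_poly_mult)
  finally show "lift_eval y (q \<otimes>\<^bsub>?P\<^esub> r) = lift_eval y q \<otimes> lift_eval y r" .
  have a: "poly_add (map section_map q) (map section_map r) = normalize (map section_map (k.poly_add q r))"
   using s.poly_add_hom'[of q r] set[OF q] set[OF r] k.poly_add_consistent[OF skF] by simp
  have "set (map section_map (k.poly_add q r)) \<subseteq> carrier B"
   using set'[OF P.a_closed[OF q r]] by (simp add: univ_poly_add)
  then have "lift_eval y (q \<oplus>\<^bsub>?P\<^esub> r) = eval (normalize (map section_map (k.poly_add q r))) y"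
   unfolding lift_eval_def using eval_normalize y by (simp add: univ_poly_add)
  also have "\<dots> = lift_eval y q \<oplus> lift_eval y r"
   unfolding a[symmetric] lift_eval_def
   using eval_poly_add[OF set'[OF q] set'[OF r] y] by simp
  finally show "lift_eval y (q \<oplus>\<^bsub>?P\<^esub> r) = lift_eval y q \<oplus> lift_eval y r" .
 qed
 then show rh: "ring_hom_ring ?P B (lift_eval y)"
  using P.ring_axioms B.ring_axioms by (simp add: ring_hom_ring_def ring_hom_ring_axioms_def)
 show "\<rho> (lift_eval y q) = k.eval q (\<rho> y)" if q: "q \<in> carrier ?P" for q
 proof -
  have "map \<rho> (map section_map q) = map (\<lambda>x. x) q"
   unfolding map_map by (rule map_cong) (use set[OF q] section_map(2) in auto)
  then show ?thesis
   unfolding lift_eval_def using \<rho>.ring.eval_hom'[OF y set'[OF q]] by simp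
 qed
 show "F \<subseteq> lift_eval y ` carrier ?P"
 proof
  fix f assume f: "f \<in> F"
  show "f \<in> lift_eval y ` carrier ?P"
  proof (cases "f = \<zero>")
   case True
   have "lift_eval y [] = \<zero>" unfolding lift_eval_def by simp
   then show ?thesis using True by (metis image_eqI univ_poly_zero_closed)
  next
   case False
   then have "[\<rho> f] \<in> carrier ?P"
    using f subfield_inj[OF F_subfield f] unfolding univ_poly_carrier[symmetric] polynomial_def by auto
   moreover have "lift_eval y [\<rho> f] = f"
    unfolding lift_eval_def using section_map(3)[OF f] f F_subset y by auto
   ultimately show ?thesis by (metis image_eqI)
  qed
 qed
 have "lift_eval y X\<^bsub>k\<^esub> = y"
  unfolding lift_eval_def var_def using s.hom_one s.hom_zero y by simp
 then show "y \<in> lift_eval y ` carrier ?P" using k.var_closed(1)[OF skF] by (metis image_eqI)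
 show "subring (lift_eval y ` carrier ?P) B"
  using ring_hom_ring.img_is_subring[OF rh P.carrier_is_subring] .
qed

text \<open>If \<open>x\<close> were transcendental, the subring F[y] generated by a lift y would
  embed into \<open>k\<close>. Maximality would put y into \<open>F\<close>, hence \<open>x\<close>
  into its image, where every element is algebraic.\<close>

lemma residue_algebraic:
 assumes x: "x \<in> carrier k"
 shows "(k.algebraic over (\<rho> ` F)) x"
proof (rule ccontr)
 let ?P = "(\<rho> ` F)[X]\<^sub>k"
 assume "\<not> (k.algebraic over (\<rho> ` F)) x"
 then have tr: "(k.transcendental over (\<rho> ` F)) x" by (simp add: over_def)
 obtain y where y: "y \<in> carrier B" "\<rho> y = x" using lift_exists[OF x] by blast
 note L = lift_eval_props[OF y(1)]
 have "lift_eval y ` carrier ?P \<subseteq> F"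
 proof (rule maximal_subfield_absorbs[OF F L(5,3)])
  fix c assume c: "c \<in> lift_eval y ` carrier ?P" and z: "\<rho> c = \<zero>\<^sub>k"
  obtain q where q: "q \<in> carrier ?P" "c = lift_eval y q" using c by (elim imageE) simp
  then have "k.eval q x = \<zero>\<^sub>k" using L(2)[OF q(1)] q(2) y(2) z by simp
  then have "q = []" using k.eval_transcendental[OF tr q(1)] by blast
  then show "c = \<zero>" using q(2) unfolding lift_eval_def by simp
 qed
 then have "y \<in> F" using L(4) by blast
 then have "(k.algebraic over (\<rho> ` F)) x"
  using k.algebraic_self[OF subfieldE(1)[OF F_image(1)]] y(2) by blast
 then show False using tr by (simp add: over_def)
qed

text \<open>Hensel's lemma lifts \<open>x\<close> to an exact root y of its minimal polynomial. A
  polynomial vanishing at \<open>x\<close> is a multiple of the minimal one and so vanishes at y;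
  thus F[y] embeds into \<open>k\<close> and maximality puts y into \<open>F\<close>.\<close>

lemma residue_separable:
 assumes x: "x \<in> carrier k" and sep: "k.separable_element (\<rho> ` F) x"
 shows "x \<in> \<rho> ` F"
proof -
 let ?P = "(\<rho> ` F)[X]\<^sub>k"
 let ?g = "k.Irr (\<rho> ` F) x"
 have sub: "subfield (\<rho> ` F) k" by (rule F_image(1))
 have alg: "(k.algebraic over (\<rho> ` F)) x" by (rule residue_algebraic[OF x])
 note I = k.IrrE[OF sub x alg]
 have g: "set ?g \<subseteq> \<rho> ` F" using I(1) k.polynomial_incl univ_poly_carrier by blast
 then have G: "set (map section_map ?g) \<subseteq> carrier B" using section_map(1) F_subset by auto
 have m: "map \<rho> (map section_map ?g) = ?g"
  unfolding map_map by (rule map_idI) (use g section_map(2) in auto)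
 obtain y0 where y0: "y0 \<in> carrier B" "\<rho> y0 = x" using lift_exists[OF x] by blast
 have "\<rho> (eval (map section_map ?g) y0) = \<zero>\<^sub>k"
  using lift_eval_props(2)[OF y0(1) I(1)] I(4) y0(2) by (simp add: lift_eval_def)
 moreover have "\<rho> (deriv_at (map section_map ?g) y0) \<noteq> \<zero>\<^sub>k"
  using \<rho>.hom_deriv_at[OF G y0(1)] k.separable_elementD[OF sub x sep] unfolding m y0(2) by simp
 ultimately obtain y where y: "y \<in> carrier B" "\<rho> y = x" "eval (map section_map ?g) y = \<zero>"
  using hensel[OF G y0(1)] y0(2) by metis
 note L = lift_eval_props[OF y(1)]
 interpret P: domain ?P using k.univ_poly_is_domain[OF subfieldE(1)[OF sub]] .
 interpret e: ring_hom_ring ?P B "lift_eval y" by (rule L(1))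
 have "lift_eval y ` carrier ?P \<subseteq> F"
 proof (rule maximal_subfield_absorbs[OF F L(5,3)])
  fix c assume c: "c \<in> lift_eval y ` carrier ?P" and z: "\<rho> c = \<zero>\<^sub>k"
  obtain q where q: "q \<in> carrier ?P" "c = lift_eval y q" using c by (elim imageE) simp
  then have "k.eval q x = \<zero>\<^sub>k" using L(2)[OF q(1)] q(2) y(2) z by simp
  then have "?g pdivides\<^bsub>k\<^esub> q" using k.Irr_minimal[OF sub x alg q(1)] by blast
  then obtain r where r: "r \<in> carrier ?P" "q = ?g \<otimes>\<^bsub>?P\<^esub> r"
   unfolding k.pdivides_iff_shell[OF sub I(1) q(1)] factor_def by blast
  have "lift_eval y q = lift_eval y ?g \<otimes> lift_eval y r" using r I(1) by simp
  moreover have "lift_eval y ?g = \<zero>" using y(3) unfolding lift_eval_def .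
  ultimately show "c = \<zero>" using q(2) r(1) by simp
 qed
 then have "y \<in> F" using L(4) by blast
 then show ?thesis using y(2) by blast
qed

lemma residue_power:
 assumes x: "x \<in> carrier k"
 shows "x \<in> \<rho> ` F \<or> (\<exists>p e. Factorial_Ring.prime (p::nat) \<and> add_pow k p \<one>\<^sub>k = \<zero>\<^sub>k \<and> x [^]\<^sub>k (p ^ e) \<in> \<rho> ` F)"
 apply (rule k.algebraic_power_in_separable_closure[OF F_image(1) x residue_algebraic[OF x]])
 apply (rule residue_separable, assumption, assumption)
 done

end

end

section \<open>Restriction of scalars and operators of finite order\<close>

lemma restrict_scalars_simps [simp]:
 "carrier (restrict_scalars f M) = carrier M" "\<zero>\<^bsub>restrict_scalars f M\<^esub> = \<zero>\<^sub>M"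
 "add (restrict_scalars f M) = add M" "r \<odot>\<^bsub>restrict_scalars f M\<^esub> x = f r \<odot>\<^sub>M x"
 by (simp_all add: restrict_scalars_def)

lemma ring_module_simps [simp]:
 "carrier (ring_module S) = carrier S" "\<zero>\<^bsub>ring_module S\<^esub> = \<zero>\<^sub>S"
 "add (ring_module S) = add S" "r \<odot>\<^bsub>ring_module S\<^esub> x = r \<otimes>\<^sub>S x"
 by (simp_all add: ring_module_def)

lemma a_inv_cong:
 assumes "carrier M = carrier N" "add M = add N" "\<zero>\<^sub>M = \<zero>\<^sub>N"
 shows "a_inv M = a_inv N" "a_minus M = a_minus N"
proof -
 show "a_inv M = a_inv N"
  by (rule ext) (simp add: a_inv_def m_inv_def assms)
 then show "a_minus M = a_minus N"
  by (intro ext) (simp add: a_minus_def assms)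
qed

lemma restrict_scalars_minus [simp]:
 "a_inv (restrict_scalars f M) = a_inv M" "a_minus (restrict_scalars f M) = a_minus M"
 by (rule a_inv_cong(1); simp) (rule a_inv_cong(2); simp)

lemma ring_module_minus [simp]:
 "a_inv (ring_module S) = a_inv S" "a_minus (ring_module S) = a_minus S"
 by (rule a_inv_cong(1); simp) (rule a_inv_cong(2); simp)

lemma abelian_group_cong:
 assumes "carrier M = carrier N" "add M = add N" "\<zero>\<^sub>M = \<zero>\<^sub>N" "abelian_group N"
 shows "abelian_group M"
proof -
 interpret N: abelian_group N by fact
 show ?thesis
 proof (rule abelian_groupI)
  show "\<exists>y\<in>carrier M. y \<oplus>\<^sub>M x = \<zero>\<^sub>M" if "x \<in> carrier M" for x
   using that assms by (intro bexI[of _ "\<ominus>\<^sub>N x"]) (auto simp: N.l_neg)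
 qed (use assms in \<open>auto simp: N.a_ac\<close>)
qed

lemma module_ring_module:
 assumes "cring S" shows "module S (ring_module S)"
proof -
 interpret S: cring S by fact
 show ?thesis
  by (rule moduleI[OF assms])
    (auto simp: S.l_distr S.r_distr S.m_assoc intro: abelian_group_cong[OF _ _ _ S.abelian_group_axioms])
qed

lemma module_restrict_scalars:
 assumes "cring R" "f \<in> ring_hom R S" "module S M"
 shows "module R (restrict_scalars f M)"
proof -
 interpret M: module S M by fact
 show ?thesis
  by (rule moduleI[OF assms(1)])
    (use assms(2) in \<open>auto simp: ring_hom_closed ring_hom_add ring_hom_mult ring_hom_one
     M.smult_l_distr M.smult_r_distr M.smult_assoc1
     intro: abelian_group_cong[OF _ _ _ M.abelian_group_axioms]\<close>)
qed

text \<open>\<open>ord_lt R M L n \<delta>\<close>: all \<open>n\<close>-fold commutators of \<open>\<delta>\<close> with ring elements take values in \<open>L\<close>; for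
 \<open>L = 0\<close> this is the recursion defining operators of order less than \<open>n\<close>.\<close>

definition ad :: "('a, 'r) ring_scheme => ('a, 'n, 'z) module_scheme => 'a => ('a => 'n) => 'a => 'n" where
 "ad R M r \<delta> = (\<lambda>x. \<delta> (r \<otimes>\<^sub>R x) \<ominus>\<^sub>M r \<odot>\<^sub>M \<delta> x)"

primrec ord_lt :: "('a, 'r) ring_scheme => ('a, 'n, 'z) module_scheme => 'n set => nat => ('a => 'n) => bool" where
 "ord_lt R M L 0 \<delta> \<longleftrightarrow> (\<forall>x\<in>carrier R. \<delta> x \<in> L)"
| "ord_lt R M L (Suc n) \<delta> \<longleftrightarrow> (\<forall>r\<in>carrier R. ord_lt R M L n (ad R M r \<delta>))"

lemma ord_lt_cong:
 assumes "ring R" "!!x. x \<in> carrier R ==> \<delta> x = \<epsilon> x"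
 shows "ord_lt R M L n \<delta> \<longleftrightarrow> ord_lt R M L n \<epsilon>"
 using assms(2)
proof (induction n arbitrary: \<delta> \<epsilon>)
 case (Suc n)
 interpret ring R by fact
 have "ord_lt R M L n (ad R M r \<delta>) \<longleftrightarrow> ord_lt R M L n (ad R M r \<epsilon>)" if "r \<in> carrier R" for r
  by (rule Suc.IH) (use that Suc.prems in \<open>simp add: ad_def\<close>)
 then show ?case by simp
qed simp

context module
begin

lemma ad_closed: "\<delta> \<in> carrier R \<rightarrow> carrier M ==> r \<in> carrier R ==> ad R M r \<delta> \<in> carrier R \<rightarrow> carrier M"
 unfolding ad_def by auto

lemma ord_lt_if_values:
 assumes L: "submodule L R M" and "!!x. x \<in> carrier R ==> \<delta> x \<in> L"
 shows "ord_lt R M L n \<delta>"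
 using assms(2)
proof (induction n arbitrary: \<delta>)
 case (Suc n)
 have "ad R M r \<delta> x \<in> L" if "r \<in> carrier R" "x \<in> carrier R" for r x
  unfolding ad_def M.minus_eq
  using Suc.prems that submoduleE(3,4,5)[OF L] by simp
 then show ?case using Suc.IH by simp
qed simp

lemma ord_lt_mult_right:
 assumes s: "s \<in> carrier R" and "ord_lt R M L n \<delta>"
 shows "ord_lt R M L n (\<lambda>x. \<delta> (s \<otimes> x))"
 using assms(2)
proof (induction n arbitrary: \<delta>)
 case 0
 then show ?case using s by simp
next
 case (Suc n)
 have "ord_lt R M L n (ad R M r (\<lambda>x. \<delta> (s \<otimes> x)))" if r: "r \<in> carrier R" for r
 proof -
  have "ord_lt R M L n (\<lambda>x. ad R M r \<delta> (s \<otimes> x))" using Suc r by simp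
  then show ?thesis
   by (rule ord_lt_cong[OF R.ring_axioms, THEN iffD1, rotated])
     (use r s in \<open>simp add: ad_def R.m_lcomm\<close>)
 qed
 then show ?case by simp
qed

lemma ord_lt_add:
 assumes L: "submodule L R M"
  and "\<delta> \<in> carrier R \<rightarrow> carrier M" "\<epsilon> \<in> carrier R \<rightarrow> carrier M"
  and "ord_lt R M L n \<delta>" "ord_lt R M L n \<epsilon>"
 shows "ord_lt R M L n (\<lambda>x. \<delta> x \<oplus>\<^sub>M \<epsilon> x)"
 using assms(2-)
proof (induction n arbitrary: \<delta> \<epsilon>)
 case 0
 then show ?case using submoduleE(5)[OF L] by simp
next
 case (Suc n)
 have "ord_lt R M L n (ad R M r (\<lambda>x. \<delta> x \<oplus>\<^sub>M \<epsilon> x))" if r: "r \<in> carrier R" for r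
 proof -
  have "ord_lt R M L n (\<lambda>x. ad R M r \<delta> x \<oplus>\<^sub>M ad R M r \<epsilon> x)"
   using Suc r ad_closed by simp
  then show ?thesis
  proof (rule ord_lt_cong[OF R.ring_axioms, THEN iffD1, rotated])
   fix x assume x: "x \<in> carrier R"
   then have "\<delta> (r \<otimes> x) \<in> carrier M" "\<epsilon> (r \<otimes> x) \<in> carrier M" "r \<odot>\<^sub>M \<delta> x \<in> carrier M" "r \<odot>\<^sub>M \<epsilon> x \<in> carrier M"
    "\<delta> x \<in> carrier M" "\<epsilon> x \<in> carrier M"
    using r Suc.prems by auto
   then show "ad R M r \<delta> x \<oplus>\<^sub>M ad R M r \<epsilon> x = ad R M r (\<lambda>x. \<delta> x \<oplus>\<^sub>M \<epsilon> x) x"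
    using r by (simp add: ad_def smult_r_distr M.minus_eq M.minus_add M.a_ac)
  qed
 qed
 then show ?case by simp
qed

text \<open>The map \<open>h\<close> is required to be linear only on a submodule \<open>D\<close>
  holding the values of the operator. This covers an embedding that is available after denominators
  are cleared, but not on the whole target.\<close>

lemma ord_lt_comp:
 assumes M': "module R M'" and D: "submodule D R M"
  and h: "h \<in> D \<rightarrow> carrier M'" "!!a b. a \<in> D ==> b \<in> D ==> h (a \<oplus>\<^sub>M b) = h a \<oplus>\<^sub>M' h b"
   "!!r a. r \<in> carrier R ==> a \<in> D ==> h (r \<odot>\<^sub>M a) = r \<odot>\<^sub>M' h a"
  and L: "!!a. a \<in> D ==> a \<in> L ==> h a \<in> L'"
  and "\<delta> \<in> carrier R \<rightarrow> D" "ord_lt R M L n \<delta>"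
 shows "ord_lt R M' L' n (\<lambda>x. h (\<delta> x))"
 using assms(7-)
proof (induction n arbitrary: \<delta>)
 case 0
 then show ?case using L by auto
next
 case (Suc n)
 interpret M': module R M' by fact
 have DM: "D \<subseteq> carrier M" using submoduleE(1)[OF D] .
 have hn: "h (\<ominus>\<^sub>M a) = \<ominus>\<^sub>M' h a" if "a \<in> D" for a
 proof -
  have "h ((\<ominus> \<one>) \<odot>\<^sub>M a) = (\<ominus> \<one>) \<odot>\<^sub>M' h a" using that by (intro h(3)) auto
  moreover have "a \<in> carrier M" "h a \<in> carrier M'" using that DM h(1) by auto
  ultimately show ?thesis by (simp add: smult_l_minus M'.smult_l_minus)
 qed
 have "ord_lt R M' L' n (ad R M' r (\<lambda>x. h (\<delta> x)))" if r: "r \<in> carrier R" for r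
 proof -
  have "ad R M r \<delta> \<in> carrier R \<rightarrow> D"
  proof
   fix x assume x: "x \<in> carrier R"
   then have "\<delta> (r \<otimes> x) \<in> D" "\<delta> x \<in> D" using Suc.prems r by auto
   then show "ad R M r \<delta> x \<in> D"
    unfolding ad_def M.minus_eq
    by (intro submoduleE(5)[OF D] submoduleE(3)[OF D] submoduleE(4)[OF D r])
  qed
  then have "ord_lt R M' L' n (\<lambda>x. h (ad R M r \<delta> x))" using Suc r by simp
  then show ?thesis
  proof (rule ord_lt_cong[OF R.ring_axioms, THEN iffD1, rotated])
   fix x assume x: "x \<in> carrier R"
   then have c: "\<delta> (r \<otimes> x) \<in> D" "\<delta> x \<in> D" using Suc.prems r by auto
   then have c': "r \<odot>\<^sub>M \<delta> x \<in> D" using submoduleE(4)[OF D r] by blast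
   have "h (\<delta> (r \<otimes> x) \<oplus>\<^sub>M \<ominus>\<^sub>M (r \<odot>\<^sub>M \<delta> x)) = h (\<delta> (r \<otimes> x)) \<oplus>\<^sub>M' \<ominus>\<^sub>M' (r \<odot>\<^sub>M' h (\<delta> x))"
    using h(2)[OF c(1) submoduleE(3)[OF D c']] hn[OF c'] h(3)[OF r c(2)] by simp
   then show "h (ad R M r \<delta> x) = ad R M' r (\<lambda>x. h (\<delta> x)) x"
    by (simp add: ad_def M.minus_eq M'.minus_eq)
  qed
 qed
 then show ?case by simp
qed

lemma zero_submodule: "submodule {\<zero>\<^sub>M} R M"
 by (rule submoduleI) auto

end

lemma ord_lt_restrict_scalars:
 assumes "ring R" "f \<in> ring_hom R S" "ord_lt S M L n \<delta>"
 shows "ord_lt R (restrict_scalars f M) L n (\<lambda>x. \<delta> (f x))"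
 using assms(3)
proof (induction n arbitrary: \<delta>)
 case 0
 then show ?case using ring_hom_closed[OF assms(2)] by simp
next
 case (Suc n)
 interpret R: ring R by fact
 have "ord_lt R (restrict_scalars f M) L n (ad R (restrict_scalars f M) r (\<lambda>x. \<delta> (f x)))" if r: "r \<in> carrier R" for r
 proof -
  have "ord_lt R (restrict_scalars f M) L n (\<lambda>x. ad S M (f r) \<delta> (f x))"
   using Suc ring_hom_closed[OF assms(2) r] by simp
  then show ?thesis
   by (rule ord_lt_cong[OF assms(1), THEN iffD1, rotated])
     (use r ring_hom_mult[OF assms(2)] in \<open>simp add: ad_def\<close>)
 qed
 then show ?case by simp
qed

section \<open>Finite bases over a maximal subfield\<close>

lemma (in ring) combine_eq_finsum:
 assumes "length Ks = length Us" "set Ks \<subseteq> carrier R" "set Us \<subseteq> carrier R"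
 shows "combine Ks Us = (\<Oplus>i\<in>{..<length Us}. Ks ! i \<otimes> Us ! i)"
 using assms
proof (induction Ks Us rule: list_induct2)
 case (Cons k Ks u Us)
 have cl: "Ks ! i \<otimes> Us ! i \<in> carrier R" if "i < length Us" for i
  using Cons that by (metis insert_subset list.simps(15) m_closed nth_mem subsetD)
 have "(\<Oplus>i\<in>{..<length (u # Us)}. (k # Ks) ! i \<otimes> (u # Us) ! i)
   = k \<otimes> u \<oplus> (\<Oplus>i\<in>Suc ` {..<length Us}. (k # Ks) ! i \<otimes> (u # Us) ! i)"
  using Cons.prems cl by (simp add: lessThan_Suc_eq_insert_0 Pi_iff)
 also have "(\<Oplus>i\<in>Suc ` {..<length Us}. (k # Ks) ! i \<otimes> (u # Us) ! i) = (\<Oplus>i\<in>{..<length Us}. Ks ! i \<otimes> Us ! i)"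
  by (subst add.finprod_reindex) (use cl in auto)
 finally show ?case using Cons by simp
qed simp

lemma (in cring) combine_mult_right:
 assumes "set Ks \<subseteq> carrier R" "set Us \<subseteq> carrier R" "x \<in> carrier R"
 shows "combine Ks Us \<otimes> x = combine Ks (map (\<lambda>u. u \<otimes> x) Us)"
 using assms
proof (induction Ks Us rule: combine.induct)
 case (1 k Ks u Us)
 then show ?case by (simp add: l_distr m_assoc)
qed auto

lemma (in noetherian_ring) maximal_ideal_in_family:
 assumes "A \<noteq> {}" "!!I. I \<in> A ==> ideal I R"
 shows "\<exists>M\<in>A. \<forall>I\<in>A. M \<subseteq> I --> I = M"
proof (rule subset_Zorn_nonempty[OF assms(1)])
 fix C assume C: "C \<noteq> {}" "subset.chain A C"
 then have "subset.chain {I. ideal I R} C" using assms(2) unfolding subset_chain_def by blast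
 then have "\<Union>C \<in> C" using ideal_chain_is_trivial C(1) by blast
 then show "\<Union>C \<in> A" using C(2) unfolding subset_chain_def by blast
qed

lemma (in noetherian_ring) maximal_idealE:
 assumes "ideal I0 R" "P I0"
 obtains J where "ideal J R" "P J" "!!I. ideal I R ==> P I ==> J \<subseteq> I ==> I = J"
proof -
 have "\<exists>M\<in>{J. ideal J R \<and> P J}. \<forall>I\<in>{J. ideal J R \<and> P J}. M \<subseteq> I --> I = M"
  by (rule maximal_ideal_in_family) (use assms in auto)
 then obtain M where "M \<in> {J. ideal J R \<and> P J}" and "\<forall>I\<in>{J. ideal J R \<and> P J}. M \<subseteq> I --> I = M"
  by (elim bexE)
 then show thesis using that[of M] by simp
qed

lemma (in noetherian_ring) maximal_ideal_image:
 assumes "A \<noteq> {}" "!!x. x \<in> A ==> ideal (f x) R"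
 shows "\<exists>x\<in>A. \<forall>y\<in>A. f x \<subseteq> f y --> f y = f x"
proof -
 have "\<exists>M\<in>f ` A. \<forall>I\<in>f ` A. M \<subseteq> I --> I = M"
  by (rule maximal_ideal_in_family) (use assms in auto)
 then show ?thesis by simp
qed

lemma (in cring) colon_ideal:
 assumes "ideal J R" "x \<in> carrier R"
 shows "ideal {b \<in> carrier R. b \<otimes> x \<in> J} R"
proof -
 interpret J: ideal J R by fact
 show ?thesis
 proof (rule idealI[OF ring_axioms])
  show "subgroup {b \<in> carrier R. b \<otimes> x \<in> J} (add_monoid R)"
  proof (rule add.subgroupI)
   show "{b \<in> carrier R. b \<otimes> x \<in> J} \<noteq> {}" using assms(2) by (auto intro: exI[of _ \<zero>])
  qed (use assms(2) in \<open>auto simp: l_distr l_minus a_inv_def[symmetric]\<close>)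
  fix a y assume a: "a \<in> {b \<in> carrier R. b \<otimes> x \<in> J}" and y: "y \<in> carrier R"
  then have "y \<otimes> (a \<otimes> x) \<in> J" using J.I_l_closed by blast
  moreover have "y \<otimes> (a \<otimes> x) = (y \<otimes> a) \<otimes> x" "(a \<otimes> y) \<otimes> x = (y \<otimes> a) \<otimes> x" using a y assms(2) by (simp_all add: m_ac)
  ultimately show "y \<otimes> a \<in> {b \<in> carrier R. b \<otimes> x \<in> J}" "a \<otimes> y \<in> {b \<in> carrier R. b \<otimes> x \<in> J}"
   using a y by auto
 qed
qed

context residue_cover
begin

text \<open>Noetherian induction replaces composition series: modulo a proper ideal \<open>J\<close> there is an element
 killed by the nilpotent kernel of \<open>\<rho>\<close>, which spans a copy of a quotient of \<open>k\<close>.\<close>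

lemma socle_element:
 assumes noeth: "noetherian_ring B" and J: "ideal J B" "J \<noteq> carrier B"
 shows "\<exists>x\<in>carrier B - J. \<forall>z\<in>carrier B. \<rho> z = \<zero>\<^sub>k --> z \<otimes> x \<in> J"
proof -
 interpret N: noetherian_ring B by fact
 interpret J: ideal J B by fact
 let ?col = "\<lambda>x. {b \<in> carrier B. b \<otimes> x \<in> J}"
 \<comment> \<open>Choose \<open>x\<close> outside \<open>J\<close> with maximal annihilator modulo
   \<open>J\<close>. If a kernel element z had \<open>z \<otimes> x\<close> outside
   \<open>J\<close>, both would have the same annihilator, so no power of z could move
   \<open>x\<close> into \<open>J\<close>, against nilpotence.\<close>
 have "\<exists>x\<in>carrier B - J. \<forall>y\<in>carrier B - J. ?col x \<subseteq> ?col y --> ?col y = ?col x"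
 proof (rule N.maximal_ideal_image)
  show "carrier B - J \<noteq> {}" using J(2) J.a_subset by blast
  show "ideal (?col x) B" if "x \<in> carrier B - J" for x
   using that by (intro colon_ideal[OF J(1)]) simp
 qed
 then obtain x where xJ: "x \<in> carrier B - J"
  and max: "\<forall>y\<in>carrier B - J. ?col x \<subseteq> ?col y --> ?col y = ?col x" by (elim bexE)
 from xJ have x: "x \<in> carrier B" "x \<notin> J" by simp_all
 have "z \<otimes> x \<in> J" if z: "z \<in> carrier B" "\<rho> z = \<zero>\<^sub>k" for z
 proof (rule ccontr)
  assume nz: "z \<otimes> x \<notin> J"
  have "?col x \<subseteq> ?col (z \<otimes> x)"
  proof
   fix b assume "b \<in> ?col x"
   then have b: "b \<in> carrier B" "b \<otimes> x \<in> J" by simp_all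
   then have "z \<otimes> (b \<otimes> x) \<in> J" using J.I_l_closed z by blast
   then show "b \<in> ?col (z \<otimes> x)" using b z x by (simp add: m_lcomm)
  qed
  then have e: "?col (z \<otimes> x) = ?col x" using bspec[OF max, of "z \<otimes> x"] nz z x by simp
  have "z [^] n \<otimes> x \<notin> J" for n :: nat
  proof (induction n)
   case 0
   show ?case using x by simp
  next
   case (Suc n)
   show ?case
   proof
    assume "z [^] Suc n \<otimes> x \<in> J"
    then have "z [^] n \<in> ?col (z \<otimes> x)" using z x by (simp add: m_assoc)
    then show False using Suc unfolding e by simp
   qed
  qed
  note nJ = this
  obtain n :: nat where n: "z [^] n = \<zero>" using nil[OF z] by (elim exE)
  show False using nJ[of n] x unfolding n by simp
 qed
 then show ?thesis using xJ by (intro bexI[of _ x]) simp_all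
qed

text \<open>Take an ideal J maximal among those modulo which no finite spanning list exists, and x
  from \<open>socle_element\<close>. Modulo the larger ideal J + Bx there is such a list. Modulo J,
  multiplication by x makes Bx an image of the residue field, so the multiples of x by
  \<open>Us0\<close> span it.\<close>

lemma finite_spanning:
 assumes noeth: "noetherian_ring B" and F: "subfield F B" and Us0: "set Us0 \<subseteq> carrier B"
  and cover: "!!b. b \<in> carrier B ==> \<exists>v\<in>Span F Us0. \<rho> b = \<rho> v"
 shows "\<exists>Us. set Us \<subseteq> carrier B \<and> Span F Us = carrier B"
proof -
 interpret N: noetherian_ring B by fact
 define good where "good = (\<lambda>J. \<exists>Us. set Us \<subseteq> carrier B \<and> (\<forall>b\<in>carrier B. \<exists>v\<in>Span F Us. b \<ominus> v \<in> J))"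
 have "good {\<zero>}"
 proof (rule ccontr)
  assume "\<not> good {\<zero>}"
  then obtain J where J: "ideal J B" "\<not> good J"
   and max: "!!I. ideal I B ==> \<not> good I ==> J \<subseteq> I ==> I = J"
   using N.maximal_idealE[OF zeroideal, of "\<lambda>J. \<not> good J"] by metis
  interpret J: ideal J B by fact
  have "good (carrier B)"
   unfolding good_def by (rule exI[of _ "[]"]) auto
  then have "J \<noteq> carrier B" using J(2) by blast
  then obtain x where x: "x \<in> carrier B" "x \<notin> J"
   and soc: "!!z. z \<in> carrier B ==> \<rho> z = \<zero>\<^sub>k ==> z \<otimes> x \<in> J"
   using socle_element[OF noeth J(1)] by blast
  let ?I = "J <+>\<^sub>B PIdl x"
  have I: "ideal ?I B" using add_ideals[OF J(1) cgenideal_ideal[OF x(1)]] .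
  have mem: "y \<in> ?I \<longleftrightarrow> (\<exists>j\<in>J. \<exists>c\<in>carrier B. y = j \<oplus> c \<otimes> x)" for y
   unfolding set_add_defs cgenideal_def by auto
  have "J \<subseteq> ?I"
  proof
   fix j assume "j \<in> J"
   moreover have "j = j \<oplus> \<zero> \<otimes> x" using x J.Icarr[OF \<open>j \<in> J\<close>] by simp
   ultimately show "j \<in> ?I" unfolding mem by blast
  qed
  moreover have "x \<in> ?I"
   unfolding mem using x by (intro bexI[of _ \<zero>] bexI[of _ \<one>]) auto
  ultimately have "good ?I" using max[OF I] x(2) by blast
  then obtain Us where Us: "set Us \<subseteq> carrier B" "!!b. b \<in> carrier B ==> \<exists>v\<in>Span F Us. b \<ominus> v \<in> ?I"
   unfolding good_def by blast
  let ?Vs = "map (\<lambda>u. u \<otimes> x) Us0"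
  have Vs: "set ?Vs \<subseteq> carrier B" using Us0 x by auto
  have FB: "F \<subseteq> carrier B" using subfieldE(3)[OF F] .
  have "\<exists>v\<in>Span F (Us @ ?Vs). b \<ominus> v \<in> J" if b: "b \<in> carrier B" for b
  proof -
   obtain v where v: "v \<in> Span F Us" "b \<ominus> v \<in> ?I" using Us(2)[OF b] by blast
   then obtain j c where jc: "j \<in> J" "c \<in> carrier B" "b \<ominus> v = j \<oplus> c \<otimes> x" unfolding mem by blast
   obtain w where w: "w \<in> Span F Us0" "\<rho> c = \<rho> w" using cover[OF jc(2)] by blast
   have cl: "v \<in> carrier B" "w \<in> carrier B" "j \<in> carrier B"
    using Span_subgroup_props(1)[OF F Us(1)] v(1) Span_subgroup_props(1)[OF F Us0] w(1) J.Icarr jc(1) by blast+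
   have "\<rho> (c \<ominus> w) = \<zero>\<^sub>k" using w(2) jc(2) cl by (simp add: minus_eq k.r_neg)
   then have m: "(c \<ominus> w) \<otimes> x \<in> J" using soc jc(2) cl by simp
   obtain Ks where Ks: "set Ks \<subseteq> F" "length Ks = length Us0" "w = combine Ks Us0"
    using Span_mem_iff_length_version[OF F Us0] w(1) by blast
   have "w \<otimes> x = combine Ks ?Vs"
    unfolding Ks(3) by (rule combine_mult_right) (use Ks FB Us0 x in auto)
   then have wx: "w \<otimes> x \<in> Span F ?Vs"
    using Span_mem_iff_length_version[OF F Vs] Ks(1,2) by auto
   have "v \<oplus> w \<otimes> x \<in> Span F (Us @ ?Vs)"
    unfolding Span_append_eq_set_add[OF F Us(1) Vs] set_add_def'
    by (rule UN_I[OF v(1)], rule UN_I[OF wx]) simp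
   moreover have "b \<ominus> (v \<oplus> w \<otimes> x) \<in> J"
   proof -
    have "b \<ominus> (v \<oplus> w \<otimes> x) = (b \<ominus> v) \<ominus> w \<otimes> x"
     using b cl x(1) by (simp add: minus_eq minus_add a_assoc)
    also have "\<dots> = j \<oplus> (c \<ominus> w) \<otimes> x"
     unfolding jc(3) using cl jc(2) x(1) by (simp add: minus_eq l_distr l_minus a_assoc)
    finally have "b \<ominus> (v \<oplus> w \<otimes> x) = j \<oplus> (c \<ominus> w) \<otimes> x" .
    then show ?thesis using jc(1) m by simp
   qed
   ultimately show ?thesis by blast
  qed
  then have "good J" unfolding good_def using Us(1) Vs by (intro exI[of _ "Us @ ?Vs"]) simp
  then show False using J(2) by simp
 qed
 then obtain Us where Us: "set Us \<subseteq> carrier B" "!!b. b \<in> carrier B ==> \<exists>v\<in>Span F Us. b \<ominus> v \<in> {\<zero>}"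
  unfolding good_def by blast
 have "carrier B \<subseteq> Span F Us"
 proof
  fix b assume b: "b \<in> carrier B"
  obtain v where v: "v \<in> Span F Us" "b \<ominus> v = \<zero>" using Us(2)[OF b] by blast
  have "v \<in> carrier B" using Span_subgroup_props(1)[OF F Us(1)] v(1) by blast
  then have "b = v" using b v(2) by (simp add: r_right_minus_eq)
  then show "b \<in> Span F Us" using v(1) by simp
 qed
 then have "Span F Us = carrier B" using Span_subgroup_props(1)[OF F Us(1)] by (rule equalityI[rotated])
 then show ?thesis using Us(1) by (intro exI[of _ Us]) simp
qed

lemma finite_basis:
 assumes noeth: "noetherian_ring B" and K0: "K0 \<subseteq> F" and Y: "finite Y" "Y \<subseteq> carrier k"
  and gen: "generate_field k (\<rho> ` K0 \<union> Y) = carrier k" and F: "maximal_subfield F"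
 shows "\<exists>Bs. independent F Bs \<and> Span F Bs = carrier B"
proof -
 have sF: "subfield F B" by (rule F_subfield[OF F])
 have sk: "subfield (\<rho> ` F) k" by (rule F_image(1)[OF F])
 obtain ys where ys: "set ys = Y" using finite_list[OF Y(1)] by blast
 have alg: "(k.algebraic over (\<rho> ` F)) y" if "y \<in> set ys" for y
  using residue_algebraic[OF F] that ys Y(2) by blast
 have ysk: "set ys \<subseteq> carrier k" using ys Y(2) by simp
 let ?E = "k.finite_extension (\<rho> ` F) ys"
 have E: "subfield ?E k" using k.finite_extension_is_subfield[OF sk ysk alg] by blast
 have "\<rho> ` K0 \<union> Y \<subseteq> ?E"
  using k.finite_extension_incl[OF subfieldE(3)[OF sk] ysk] K0
   k.finite_extension_mem[OF subfieldE(1)[OF sk] ysk] ys by blast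
 moreover have "\<rho> ` K0 \<union> Y \<subseteq> carrier k"
  using K0 F_subset[OF F] Y(2) by auto
 ultimately have "carrier k \<subseteq> ?E"
  using k.generate_field_min_subfield1[OF _ E] gen by blast
 then have "?E = carrier k" using subfieldE(3)[OF E] by (rule equalityI[rotated])
 then have "k.finite_dimension (\<rho> ` F) (carrier k)"
  using k.finite_extension_finite_dimension(1)[OF sk ysk alg] by simp
 then obtain n where "k.dimension n (\<rho> ` F) (carrier k)" unfolding k.finite_dimension_def by blast
 then obtain Vs where Vs: "set Vs \<subseteq> carrier k" "k.Span (\<rho> ` F) Vs = carrier k"
  using k.exists_base[OF sk] by blast
 define l where "l = (\<lambda>v. SOME b. b \<in> carrier B \<and> \<rho> b = v)"
 have l: "l v \<in> carrier B \<and> \<rho> (l v) = v" if "v \<in> carrier k" for v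
  unfolding l_def by (rule someI_ex) (use lift_exists[OF that] in blast)
 let ?Us = "map l Vs"
 have Us: "set ?Us \<subseteq> carrier B" using l Vs(1) by auto
 have "map \<rho> ?Us = Vs" unfolding map_map by (rule map_idI) (use l Vs(1) in auto)
 then have sp: "\<rho> ` Span F ?Us = carrier k"
  using \<rho>.ring.Span_hom[OF F_subset[OF F] Us] Vs(2) by simp
 have "\<exists>v\<in>Span F ?Us. \<rho> b = \<rho> v" if b: "b \<in> carrier B" for b
 proof -
  have "\<rho> b \<in> \<rho> ` Span F ?Us" unfolding sp using b by simp
  then show ?thesis by (rule imageE) (rule bexI)
 qed
 then obtain Us where "set Us \<subseteq> carrier B" "Span F Us = carrier B"
  using finite_spanning[OF noeth sF Us] by blast
 then show ?thesis using filter_base[OF sF, of Us] by metis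
qed

end

section \<open>Iterated commutators of functionals linear over a subfield\<close>

text \<open>As a function of n, \<open>D (m + n)\<close> is again a recursion, with initial table
  \<open>D m\<close>. By induction, p^e steps at once act as a single step of length p^e. The coarse
  table made of these steps obeys the recursion once more, and the prime case handles
  \<open>p\<close> coarse steps.\<close>

lemma (in abelian_group) pascal_recursion_prime_power:
 assumes w: "!!i j. w i j \<in> carrier G"
  and D0: "!!i j. D 0 i j = w i j"
  and DS: "!!n i j. D (Suc n) i j = D n (Suc i) j \<oplus> D n i (Suc j)"
  and p: "Factorial_Ring.prime (p::nat)" and tors: "!!i j. add_pow G p (w i j) = \<zero>"
 shows "D (p ^ e) i j = w (i + p ^ e) j \<oplus> w i (j + p ^ e)"
 using w D0 DS tors
proof (induction e arbitrary: w D i j)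
 case 0
 then show ?case by simp
next
 case (Suc e)
 let ?q = "p ^ e"
 have Dcl: "D m a b \<in> carrier G" for m a b
  unfolding pascal_recursion[where w = w and D = D, OF Suc.prems(1-3)]
  by (rule finsum_closed) (use Suc.prems(1) in auto)
 have Dtors: "add_pow G p (D m a b) = \<zero>" for m a b
 proof (induction m arbitrary: a b)
  case 0
  then show ?case using Suc.prems(2,4) by simp
 next
  case (Suc m)
  show ?case
   unfolding \<open>!!n i j. D (Suc n) i j = D n (Suc i) j \<oplus> D n i (Suc j)\<close>
   using add.nat_pow_distrib[OF Dcl Dcl] Suc by simp
 qed
 have shift: "D (m + ?q) a b = D m (a + ?q) b \<oplus> D m a (b + ?q)" for m a b
  by (rule Suc.IH[where w = "D m" and D = "\<lambda>n. D (m + n)"])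
    (use Dcl Dtors Suc.prems(3) in auto)
 define D' where "D' = (\<lambda>n a b. D (?q * n) (i + ?q * a) (j + ?q * b))"
 define w' where "w' = (\<lambda>a b. w (i + ?q * a) (j + ?q * b))"
 have "D' p 0 0 = w' (0 + p) 0 \<oplus> w' 0 (0 + p)"
 proof (rule pascal_recursion_prime[where w = w' and D = D', OF _ _ _ p])
  show "w' a b \<in> carrier G" "D' 0 a b = w' a b" "add_pow G p (w' a b) = \<zero>" for a b
   unfolding w'_def D'_def using Suc.prems by auto
  show "D' (Suc n) a b = D' n (Suc a) b \<oplus> D' n a (Suc b)" for n a b
   using shift[of "?q * n" "i + ?q * a" "j + ?q * b"]
   unfolding D'_def by (simp add: algebra_simps)
 qed
 then show ?case unfolding D'_def w'_def by (simp add: mult.commute)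
qed

lemma (in cring) frobenius_uminus:
 assumes "Factorial_Ring.prime (p::nat)" "add_pow R p \<one> = \<zero>" "a \<in> carrier R"
 shows "(\<ominus> a) [^] (p ^ e) = \<ominus> (a [^] (p ^ e))"
proof -
 have "p ^ e > 0" using prime_gt_0_nat[OF assms(1)] by simp
 then have "(\<ominus> a) [^] (p ^ e) \<oplus> a [^] (p ^ e) = \<zero>"
  using frobenius_pow_add[OF assms(1,2), of "\<ominus> a" a e] assms(3) by (simp add: l_neg nat_pow_zero)
 then show ?thesis using assms(3) by (simp add: minus_equality)
qed

context residue_cover
begin

abbreviation kmod where "kmod \<equiv> restrict_scalars \<rho> (ring_module k)"

lemma module_kmod: "module B kmod"
 by (rule module_restrict_scalars[OF is_cring hom module_ring_module[OF k.is_cring]])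

lemma ad_kmod: "ad B kmod r \<delta> x = \<delta> (r \<otimes> x) \<ominus>\<^sub>k \<rho> r \<otimes>\<^sub>k \<delta> x"
 unfolding ad_def by simp

lemma ad_kmod_closed: "\<delta> \<in> carrier B \<rightarrow> carrier k ==> r \<in> carrier B ==> ad B kmod r \<delta> \<in> carrier B \<rightarrow> carrier k"
 using module.ad_closed[OF module_kmod] by simp

lemma ad_pow_closed:
 "\<delta> \<in> carrier B \<rightarrow> carrier k ==> r \<in> carrier B ==> (ad B kmod r ^^ n) \<delta> \<in> carrier B \<rightarrow> carrier k"
 by (induction n) (simp_all add: ad_kmod_closed del: Pi_iff)

text \<open>The commutator with \<open>b\<close> is the difference of two commuting maps,
  \<open>b\<close> acting on the argument and \<open>\<rho> b\<close> acting on the value. In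
  characteristic \<open>p\<close> a p^e-th power of such a difference is the difference of the
  powers; the Pascal recursion with \<open>c = \<ominus>\<^sub>k \<rho> b\<close> expresses
  this.\<close>

lemma ad_prime_power:
 assumes p: "Factorial_Ring.prime (p::nat)" "add_pow k p \<one>\<^sub>k = \<zero>\<^sub>k"
  and b: "b \<in> carrier B" and \<delta>: "\<delta> \<in> carrier B \<rightarrow> carrier k" and x: "x \<in> carrier B"
 shows "(ad B kmod b ^^ (p ^ e)) \<delta> x = \<delta> (b [^] (p ^ e) \<otimes> x) \<ominus>\<^sub>k \<rho> b [^]\<^sub>k (p ^ e) \<otimes>\<^sub>k \<delta> x"
proof -
 define c where "c = \<ominus>\<^sub>k \<rho> b"
 have c: "c \<in> carrier k" unfolding c_def using b by simp
 define g where "g = (\<lambda>n. (ad B kmod b ^^ n) \<delta>)"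
 have g: "g n y \<in> carrier k" if "y \<in> carrier B" for n y
  unfolding g_def using ad_pow_closed[OF \<delta> b] that by (rule funcset_mem)
 define w where "w = (\<lambda>(i::nat) (j::nat). c [^]\<^sub>k i \<otimes>\<^sub>k \<delta> (b [^] j \<otimes> x))"
 define D where "D = (\<lambda>(n::nat) (i::nat) (j::nat). c [^]\<^sub>k i \<otimes>\<^sub>k g n (b [^] j \<otimes> x))"
 have w: "w i j \<in> carrier k" for i j
  unfolding w_def using c funcset_mem[OF \<delta>] b x by simp
 have "D (p ^ e) 0 0 = w (0 + p ^ e) 0 \<oplus>\<^sub>k w 0 (0 + p ^ e)"
 proof (rule k.pascal_recursion_prime_power[where w = w and D = D, OF w _ _ p(1)])
  show "D 0 i j = w i j" for i j unfolding D_def w_def g_def by simp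
  show "add_pow k p (w i j) = \<zero>\<^sub>k" for i j using k.add_pow_char_zero[OF p(2) w] .
  show "D (Suc n) i j = D n (Suc i) j \<oplus>\<^sub>k D n i (Suc j)" for n i j
  proof -
   let ?y = "b [^] j \<otimes> x"
   have y: "?y \<in> carrier B" using b x by simp
   have "b \<otimes> ?y = b [^] Suc j \<otimes> x" using b x by (simp add: m_ac)
   then have e: "g (Suc n) ?y = g n (b [^] Suc j \<otimes> x) \<ominus>\<^sub>k \<rho> b \<otimes>\<^sub>k g n ?y"
    unfolding g_def by (simp add: ad_kmod)
   have "u \<otimes>\<^sub>k (s \<ominus>\<^sub>k \<rho> b \<otimes>\<^sub>k t) = (u \<otimes>\<^sub>k c) \<otimes>\<^sub>k t \<oplus>\<^sub>k u \<otimes>\<^sub>k s"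
    if "u \<in> carrier k" "s \<in> carrier k" "t \<in> carrier k" for u s t
    unfolding c_def using that \<rho>.hom_closed[OF b] by algebra
   then show ?thesis
    unfolding D_def e k.nat_pow_Suc using c g y b x by simp
  qed
 qed
 then have "(ad B kmod b ^^ (p ^ e)) \<delta> x = c [^]\<^sub>k (p ^ e) \<otimes>\<^sub>k \<delta> x \<oplus>\<^sub>k \<delta> (b [^] (p ^ e) \<otimes> x)"
  unfolding D_def w_def g_def using b x c funcset_mem[OF \<delta>] funcset_mem[OF ad_pow_closed[OF \<delta> b]] by simp
 also have "c [^]\<^sub>k (p ^ e) = \<ominus>\<^sub>k (\<rho> b [^]\<^sub>k (p ^ e))"
  unfolding c_def using k.frobenius_uminus[OF p \<rho>.hom_closed[OF b]] .
 finally show ?thesis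
  using b x funcset_mem[OF \<delta>] by (simp add: k.l_minus k.minus_eq k.a_comm)
qed

definition flin :: "'b set => ('b => 'c) => bool" where
 "flin F \<delta> \<longleftrightarrow> \<delta> \<in> carrier B \<rightarrow> carrier k \<and>
   (\<forall>x\<in>carrier B. \<forall>y\<in>carrier B. \<delta> (x \<oplus> y) = \<delta> x \<oplus>\<^sub>k \<delta> y) \<and>
   (\<forall>f\<in>F. \<forall>x\<in>carrier B. \<delta> (f \<otimes> x) = \<rho> f \<otimes>\<^sub>k \<delta> x)"

lemma flinD:
 assumes "flin F \<delta>"
 shows "\<delta> \<in> carrier B \<rightarrow> carrier k" "!!x. x \<in> carrier B ==> \<delta> x \<in> carrier k"
  "!!x y. x \<in> carrier B ==> y \<in> carrier B ==> \<delta> (x \<oplus> y) = \<delta> x \<oplus>\<^sub>k \<delta> y"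
  "!!f x. f \<in> F ==> x \<in> carrier B ==> \<delta> (f \<otimes> x) = \<rho> f \<otimes>\<^sub>k \<delta> x"
 using assms unfolding flin_def by auto

lemma flinI:
 assumes "!!x. x \<in> carrier B ==> \<delta> x \<in> carrier k"
  "!!x y. x \<in> carrier B ==> y \<in> carrier B ==> \<delta> (x \<oplus> y) = \<delta> x \<oplus>\<^sub>k \<delta> y"
  "!!f x. f \<in> F ==> x \<in> carrier B ==> \<delta> (f \<otimes> x) = \<rho> f \<otimes>\<^sub>k \<delta> x"
 shows "flin F \<delta>"
 using assms unfolding flin_def by auto

lemma flin_zero: assumes "flin F \<delta>" shows "\<delta> \<zero> = \<zero>\<^sub>k"
proof -
 have "\<delta> \<zero> \<oplus>\<^sub>k \<delta> \<zero> = \<delta> \<zero>" using flinD(3)[OF assms, of \<zero> \<zero>] by simp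
 then show ?thesis using flinD(2)[OF assms zero_closed] by (simp add: k.add.r_cancel_one')
qed

lemma flin_minus:
 assumes "flin F \<delta>" "x \<in> carrier B" "y \<in> carrier B"
 shows "\<delta> (x \<ominus> y) = \<delta> x \<ominus>\<^sub>k \<delta> y"
proof -
 have "x = (x \<ominus> y) \<oplus> y" using assms by (simp add: minus_eq a_assoc l_neg)
 then have "\<delta> x = \<delta> (x \<ominus> y) \<oplus>\<^sub>k \<delta> y" using flinD(3)[OF assms(1), of "x \<ominus> y" y] assms by simp
 then show ?thesis using flinD(2)[OF assms(1)] assms by (simp add: k.minus_eq k.a_assoc k.r_neg)
qed

lemma flin_finsum:
 assumes "flin F \<delta>" "finite I" "!!i. i \<in> I ==> c i \<in> F" "F \<subseteq> carrier B" "!!i. i \<in> I ==> b i \<in> carrier B"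
 shows "\<delta> (\<Oplus>i\<in>I. c i \<otimes> b i) = (\<Oplus>\<^sub>k i\<in>I. \<rho> (c i) \<otimes>\<^sub>k \<delta> (b i))"
 using assms(2,3,5)
proof (induction I rule: finite_induct)
 case empty
 show ?case using flin_zero[OF assms(1)] by simp
next
 case (insert i I)
 have c: "c j \<in> carrier B" if "j \<in> insert i I" for j using insert.prems(1)[OF that] assms(4) by blast
 have cl: "(\<lambda>i. c i \<otimes> b i) \<in> I \<rightarrow> carrier B" "c i \<otimes> b i \<in> carrier B"
  using c insert.prems(2) by auto
 have clk: "(\<lambda>i. \<rho> (c i) \<otimes>\<^sub>k \<delta> (b i)) \<in> I \<rightarrow> carrier k" "\<rho> (c i) \<otimes>\<^sub>k \<delta> (b i) \<in> carrier k"
  using c insert.prems(2) flinD(2)[OF assms(1)] by auto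
 have "\<delta> (\<Oplus>i\<in>insert i I. c i \<otimes> b i) = \<delta> (c i \<otimes> b i \<oplus> (\<Oplus>i\<in>I. c i \<otimes> b i))"
  using insert.hyps cl by simp
 also have "\<dots> = \<rho> (c i) \<otimes>\<^sub>k \<delta> (b i) \<oplus>\<^sub>k \<delta> (\<Oplus>i\<in>I. c i \<otimes> b i)"
  using flinD(3)[OF assms(1) cl(2) finsum_closed[OF cl(1)]] flinD(4)[OF assms(1)] insert.prems by simp
 also have "\<dots> = (\<Oplus>\<^sub>k i\<in>insert i I. \<rho> (c i) \<otimes>\<^sub>k \<delta> (b i))"
  using insert clk by simp
 finally show ?case .
qed

lemma flin_ad:
 assumes "flin F \<delta>" "F \<subseteq> carrier B" "b \<in> carrier B"
 shows "flin F (ad B kmod b \<delta>)"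
proof (rule flinI)
 note d = flinD[OF assms(1)]
 have rb: "\<rho> b \<in> carrier k" using assms(3) by simp
 show "ad B kmod b \<delta> x \<in> carrier k" if "x \<in> carrier B" for x
  using that assms(3) d(2) by (simp add: ad_kmod)
 show "ad B kmod b \<delta> (x \<oplus> y) = ad B kmod b \<delta> x \<oplus>\<^sub>k ad B kmod b \<delta> y" if "x \<in> carrier B" "y \<in> carrier B" for x y
 proof -
  have "(u \<oplus>\<^sub>k v) \<ominus>\<^sub>k \<rho> b \<otimes>\<^sub>k (s \<oplus>\<^sub>k t) = (u \<ominus>\<^sub>k \<rho> b \<otimes>\<^sub>k s) \<oplus>\<^sub>k (v \<ominus>\<^sub>k \<rho> b \<otimes>\<^sub>k t)"
   if "u \<in> carrier k" "v \<in> carrier k" "s \<in> carrier k" "t \<in> carrier k" for u v s t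
   using that rb by algebra
  then show ?thesis using that assms(3) d(2,3) by (simp add: ad_kmod r_distr)
 qed
 show "ad B kmod b \<delta> (f \<otimes> x) = \<rho> f \<otimes>\<^sub>k ad B kmod b \<delta> x" if "f \<in> F" "x \<in> carrier B" for f x
 proof -
  have f: "f \<in> carrier B" using that assms(2) by blast
  have "b \<otimes> (f \<otimes> x) = f \<otimes> (b \<otimes> x)" using f that assms(3) by (simp add: m_lcomm)
  moreover have "v \<otimes>\<^sub>k s \<ominus>\<^sub>k \<rho> b \<otimes>\<^sub>k (v \<otimes>\<^sub>k t) = v \<otimes>\<^sub>k (s \<ominus>\<^sub>k \<rho> b \<otimes>\<^sub>k t)"
   if "v \<in> carrier k" "s \<in> carrier k" "t \<in> carrier k" for v s t
   using that rb by algebra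
  ultimately show ?thesis using that f assms(3) d(2,4) by (simp add: ad_kmod)
 qed
qed

lemma flin_ad_pow:
 assumes "flin F \<delta>" "F \<subseteq> carrier B" "b \<in> carrier B"
 shows "flin F ((ad B kmod b ^^ n) \<delta>)"
 by (induction n) (use assms flin_ad in simp_all)

text \<open>Linearity in the element with which the commutator is taken reduces commutators with
  arbitrary elements of \<open>B\<close> to those with the members of a basis over
  \<open>F\<close>.\<close>

lemma flin_ad_arg:
 assumes "flin F \<delta>" "F \<subseteq> carrier B" "x \<in> carrier B"
 shows "flin F (\<lambda>r. ad B kmod r \<delta> x)"
proof (rule flinI)
 note d = flinD[OF assms(1)]
 show "ad B kmod r \<delta> x \<in> carrier k" if "r \<in> carrier B" for r
  using that assms(3) d(2) by (simp add: ad_kmod)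
 show "ad B kmod (r \<oplus> s) \<delta> x = ad B kmod r \<delta> x \<oplus>\<^sub>k ad B kmod s \<delta> x" if "r \<in> carrier B" "s \<in> carrier B" for r s
 proof -
  have "(u \<oplus>\<^sub>k v) \<ominus>\<^sub>k (s \<oplus>\<^sub>k t) \<otimes>\<^sub>k z = (u \<ominus>\<^sub>k s \<otimes>\<^sub>k z) \<oplus>\<^sub>k (v \<ominus>\<^sub>k t \<otimes>\<^sub>k z)"
   if "u \<in> carrier k" "v \<in> carrier k" "s \<in> carrier k" "t \<in> carrier k" "z \<in> carrier k" for u v s t z
   using that by algebra
  then show ?thesis using that assms(3) d(2,3) by (simp add: ad_kmod l_distr)
 qed
 show "ad B kmod (f \<otimes> r) \<delta> x = \<rho> f \<otimes>\<^sub>k ad B kmod r \<delta> x" if "f \<in> F" "r \<in> carrier B" for f r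
 proof -
  have f: "f \<in> carrier B" using that assms(2) by blast
  have "v \<otimes>\<^sub>k s \<ominus>\<^sub>k (v \<otimes>\<^sub>k u) \<otimes>\<^sub>k t = v \<otimes>\<^sub>k (s \<ominus>\<^sub>k u \<otimes>\<^sub>k t)"
   if "v \<in> carrier k" "s \<in> carrier k" "t \<in> carrier k" "u \<in> carrier k" for v s t u
   using that by algebra
  then show ?thesis using that f assms(3) d(2,4) by (simp add: ad_kmod m_assoc)
 qed
qed

lemma ad_commute:
 assumes "\<delta> \<in> carrier B \<rightarrow> carrier k" "b \<in> carrier B" "c \<in> carrier B" "x \<in> carrier B"
 shows "ad B kmod b (ad B kmod c \<delta>) x = ad B kmod c (ad B kmod b \<delta>) x"
proof -
 have "c \<otimes> (b \<otimes> x) = b \<otimes> (c \<otimes> x)" using assms by (simp add: m_lcomm)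
 moreover have "(u \<ominus>\<^sub>k \<rho> c \<otimes>\<^sub>k s) \<ominus>\<^sub>k \<rho> b \<otimes>\<^sub>k (t \<ominus>\<^sub>k \<rho> c \<otimes>\<^sub>k z)
   = (u \<ominus>\<^sub>k \<rho> b \<otimes>\<^sub>k t) \<ominus>\<^sub>k \<rho> c \<otimes>\<^sub>k (s \<ominus>\<^sub>k \<rho> b \<otimes>\<^sub>k z)"
  if "u \<in> carrier k" "s \<in> carrier k" "t \<in> carrier k" "z \<in> carrier k" for u s t z
  using that \<rho>.hom_closed[OF assms(2)] \<rho>.hom_closed[OF assms(3)] by algebra
 ultimately show ?thesis using assms funcset_mem[OF assms(1)] by (simp add: ad_kmod)
qed

lemma ad_kmod_cong:
 assumes "!!y. y \<in> carrier B ==> \<delta> y = \<epsilon> y" "b \<in> carrier B" "x \<in> carrier B"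
 shows "ad B kmod b \<delta> x = ad B kmod b \<epsilon> x"
 unfolding ad_kmod using assms by simp

lemma ad_pow_commute:
 assumes \<delta>: "\<delta> \<in> carrier B \<rightarrow> carrier k" and b: "b \<in> carrier B" and c: "c \<in> carrier B" and x: "x \<in> carrier B"
 shows "(ad B kmod b ^^ n) (ad B kmod c \<delta>) x = ad B kmod c ((ad B kmod b ^^ n) \<delta>) x"
 using x
proof (induction n arbitrary: x)
 case (Suc n)
 have "ad B kmod b ((ad B kmod b ^^ n) (ad B kmod c \<delta>)) x = ad B kmod b (ad B kmod c ((ad B kmod b ^^ n) \<delta>)) x"
  by (rule ad_kmod_cong[OF Suc.IH b Suc.prems])
 also have "\<dots> = ad B kmod c (ad B kmod b ((ad B kmod b ^^ n) \<delta>)) x"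
  by (rule ad_commute[OF ad_pow_closed[OF \<delta> b] b c Suc.prems])
 finally show ?case by simp
qed simp

text \<open>Some power q, equal to 1 or to a power of the characteristic, moves the residue of
  \<open>b\<close> into the image of \<open>F\<close>. The q-fold commutator then multiplies the
  argument by the nilpotent difference \<open>\<mu>\<close> of \<open>b [^] q\<close> and its
  representative in \<open>F\<close>, and iteration exhausts \<open>\<mu>\<close>. The exponent is
  found from \<open>b\<close> and \<open>F\<close>, so it serves all functionals at once.\<close>

lemma ad_nilpotent:
 assumes F: "maximal_subfield F" and b: "b \<in> carrier B"
 shows "\<exists>N. \<forall>\<delta>. flin F \<delta> --> (\<forall>x\<in>carrier B. (ad B kmod b ^^ N) \<delta> x = \<zero>\<^sub>k)"
proof -
 have FB: "F \<subseteq> carrier B" by (rule F_subset[OF F])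
 have "\<exists>q::nat. \<rho> b [^]\<^sub>k q \<in> \<rho> ` F \<and> (\<forall>\<delta> x. \<delta> \<in> carrier B \<rightarrow> carrier k --> x \<in> carrier B -->
   (ad B kmod b ^^ q) \<delta> x = \<delta> (b [^] q \<otimes> x) \<ominus>\<^sub>k \<rho> b [^]\<^sub>k q \<otimes>\<^sub>k \<delta> x)"
  using residue_power[OF F \<rho>.hom_closed[OF b]]
 proof (elim disjE exE conjE)
  assume "\<rho> b \<in> \<rho> ` F"
  then show ?thesis using b by (intro exI[of _ 1]) (simp add: ad_kmod)
 next
  fix p e assume p: "Factorial_Ring.prime (p::nat)" "add_pow k p \<one>\<^sub>k = \<zero>\<^sub>k"
   and "\<rho> b [^]\<^sub>k (p ^ e) \<in> \<rho> ` F"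
  then show ?thesis using ad_prime_power[OF p b] by (intro exI[of _ "p ^ e"]) simp
 qed
 then obtain q :: nat where q: "\<rho> b [^]\<^sub>k q \<in> \<rho> ` F"
  and adq: "!!\<delta> x. \<delta> \<in> carrier B \<rightarrow> carrier k ==> x \<in> carrier B ==>
   (ad B kmod b ^^ q) \<delta> x = \<delta> (b [^] q \<otimes> x) \<ominus>\<^sub>k \<rho> b [^]\<^sub>k q \<otimes>\<^sub>k \<delta> x"
  by (elim exE conjE) simp
 obtain f where f: "f \<in> F" "\<rho> b [^]\<^sub>k q = \<rho> f" using q by (elim imageE) simp
 have fB: "f \<in> carrier B" using f(1) FB by blast
 define \<mu> where "\<mu> = b [^] q \<ominus> f"
 have \<mu>: "\<mu> \<in> carrier B" unfolding \<mu>_def using b fB by simp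
 have \<rho>\<mu>: "\<rho> \<mu> = \<zero>\<^sub>k" unfolding \<mu>_def using b fB f(2)[symmetric] by (simp add: minus_eq k.r_neg \<rho>.ring.hom_nat_pow)
 obtain n :: nat where n: "\<mu> [^] n = \<zero>" using nil[OF \<mu> \<rho>\<mu>] by (elim exE)
 have adq': "(ad B kmod b ^^ q) \<delta> x = \<delta> (\<mu> \<otimes> x)" if "flin F \<delta>" "x \<in> carrier B" for \<delta> x
 proof -
  have "\<mu> \<otimes> x = b [^] q \<otimes> x \<ominus> f \<otimes> x"
   unfolding \<mu>_def using b fB that(2) by (simp add: minus_eq l_distr l_minus)
  then show ?thesis
   using adq[OF flinD(1)[OF that(1)] that(2)] flin_minus[OF that(1)] flinD(4)[OF that(1) f(1) that(2)] b fB that(2) f(2)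
   by simp
 qed
 have pow: "(ad B kmod b ^^ (q * m)) \<delta> x = \<delta> (\<mu> [^] m \<otimes> x)" if "flin F \<delta>" "x \<in> carrier B" for \<delta> x m
  using that(2)
 proof (induction m arbitrary: x)
  case (Suc m)
  have "(ad B kmod b ^^ (q * Suc m)) \<delta> x = (ad B kmod b ^^ q) ((ad B kmod b ^^ (q * m)) \<delta>) x"
   by (simp add: funpow_add)
  also have "\<dots> = (ad B kmod b ^^ (q * m)) \<delta> (\<mu> \<otimes> x)"
   by (rule adq'[OF flin_ad_pow[OF that(1) FB b] Suc.prems])
  also have "\<dots> = \<delta> (\<mu> [^] m \<otimes> (\<mu> \<otimes> x))" using Suc \<mu> by simp
  also have "\<mu> [^] m \<otimes> (\<mu> \<otimes> x) = \<mu> [^] Suc m \<otimes> x" using \<mu> Suc.prems by (simp add: m_assoc)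
  finally show ?case .
 qed simp
 have "(ad B kmod b ^^ (q * n)) \<delta> x = \<zero>\<^sub>k" if "flin F \<delta>" "x \<in> carrier B" for \<delta> x
  using pow[OF that, of n] flin_zero[OF that(1)] that(2) unfolding n by simp
 then show ?thesis by (intro exI[of _ "q * n"]) simp
qed

lemma ord_lt_zero: "(!!x. x \<in> carrier B ==> \<delta> x = \<zero>\<^sub>k) ==> ord_lt B kmod {\<zero>\<^sub>k} n \<delta>"
 using module.ord_lt_if_values[OF module_kmod module.zero_submodule[OF module_kmod]] by simp

lemma ord_lt_transfer:
 assumes "!!x. x \<in> carrier B ==> \<epsilon> x = \<delta> x" "ord_lt B kmod L n \<epsilon>"
 shows "ord_lt B kmod L n \<delta>"
 using ord_lt_cong[where R = B and M = kmod and L = L and n = n and \<delta> = \<epsilon> and \<epsilon> = \<delta>, OF ring_axioms assms(1)]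
  assms(2) by simp

lemma ord_lt_linear_combination:
 fixes m :: nat
 assumes "!!i. i < m ==> c i \<in> carrier k" "!!i. i < m ==> g i \<in> carrier B \<rightarrow> carrier k"
  "!!i. i < m ==> ord_lt B kmod {\<zero>\<^sub>k} n (g i)"
 shows "ord_lt B kmod {\<zero>\<^sub>k} n (\<lambda>x. \<Oplus>\<^sub>k i\<in>{..<m}. c i \<otimes>\<^sub>k g i x)"
 using assms
proof (induction m)
 case 0
 show ?case by (rule ord_lt_zero) simp
next
 case (Suc m)
 interpret M: module B kmod by (rule module_kmod)
 have g: "g i x \<in> carrier k" if "i < Suc m" "x \<in> carrier B" for i x
  using funcset_mem[OF Suc.prems(2)] that by simp
 have "ord_lt B kmod {\<zero>\<^sub>k} n (\<lambda>x. c m \<otimes>\<^sub>k g m x)"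
  by (rule M.ord_lt_comp[where D = "carrier kmod" and L = "{\<zero>\<^sub>k}" and h = "\<lambda>y. c m \<otimes>\<^sub>k y" and \<delta> = "g m", OF module_kmod M.carrier_is_submodule])
    (use Suc.prems in \<open>auto simp: k.r_distr k.m_lcomm\<close>)
 moreover have "ord_lt B kmod {\<zero>\<^sub>k} n (\<lambda>x. \<Oplus>\<^sub>k i\<in>{..<m}. c i \<otimes>\<^sub>k g i x)"
  using Suc by simp
 ultimately have sum: "ord_lt B kmod {\<zero>\<^sub>k} n (\<lambda>x. c m \<otimes>\<^sub>k g m x \<oplus>\<^sub>kmod (\<Oplus>\<^sub>k i\<in>{..<m}. c i \<otimes>\<^sub>k g i x))"
  using M.zero_submodule g Suc.prems(1)
  by (intro M.ord_lt_add) (auto intro!: k.finsum_closed)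
 have eq: "c m \<otimes>\<^sub>k g m x \<oplus>\<^sub>kmod (\<Oplus>\<^sub>k i\<in>{..<m}. c i \<otimes>\<^sub>k g i x) = (\<Oplus>\<^sub>k i\<in>{..<Suc m}. c i \<otimes>\<^sub>k g i x)"
  if "x \<in> carrier B" for x
  using g[OF _ that] Suc.prems(1) by (simp add: lessThan_Suc Pi_iff)
 show ?case by (rule ord_lt_transfer[OF eq sum])
qed

lemma span_sumE:
 assumes "subfield F B" "set Bs \<subseteq> carrier B" "x \<in> Span F Bs"
 shows "\<exists>c. (\<forall>i<length Bs. c i \<in> F) \<and> x = (\<Oplus>i\<in>{..<length Bs}. c i \<otimes> Bs ! i)"
proof -
 obtain Ks where Ks: "set Ks \<subseteq> F" "length Ks = length Bs" "x = combine Ks Bs"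
  using iffD1[OF Span_mem_iff_length_version[OF assms(1,2)] assms(3)] by blast
 have "x = (\<Oplus>i\<in>{..<length Bs}. Ks ! i \<otimes> Bs ! i)"
  unfolding Ks(3) by (rule combine_eq_finsum[OF Ks(2) _ assms(2)]) (use Ks(1) subfieldE(3)[OF assms(1)] in blast)
 moreover have "Ks ! i \<in> F" if "i < length Bs" for i using Ks(1,2) that nth_mem[of i Ks] by auto
 ultimately show ?thesis by (intro exI[of _ "\<lambda>i. Ks ! i"]) simp
qed

text \<open>By linearity, iterated commutators with ring elements expand into iterated commutators
  with basis elements. These commute, so in a word whose length is the sum of the \<open>e i\<close>
  some basis element occurs at least \<open>e i\<close> times, and the word vanishes. The induction
  lowers one exponent per commutator.\<close>

lemma ord_lt_multi_exponent:
 assumes F: "subfield F B" and Bs: "set Bs \<subseteq> carrier B" "Span F Bs = carrier B"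
  and \<delta>: "flin F \<delta>"
  and e: "!!i x. i < length Bs ==> x \<in> carrier B ==> (ad B kmod (Bs ! i) ^^ (e i)) \<delta> x = \<zero>\<^sub>k"
 shows "ord_lt B kmod {\<zero>\<^sub>k} (\<Sum>i<length Bs. e i) \<delta>"
 using \<delta> e
proof (induction "\<Sum>i<length Bs. e i" arbitrary: \<delta> e rule: less_induct)
 case less
 have FB: "F \<subseteq> carrier B" using subfieldE(3)[OF F] .
 have b: "Bs ! i \<in> carrier B" if "i < length Bs" for i using Bs(1) that nth_mem by blast
 show ?case
 proof (cases "\<exists>i<length Bs. e i = 0")
  case True
  then obtain i where "i < length Bs" "e i = 0" by blast
  then show ?thesis using less.prems(2)[of i] by (intro ord_lt_zero) simp
 next
  case False
  \<comment> \<open>An empty spanning list would make \<open>B\<close> the zero ring. So there is an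
    exponent to lower, and the sum is a successor.\<close>
  have "Bs \<noteq> []"
  proof
   assume "Bs = []"
   then have "carrier B = {\<zero>}" using Bs(2) by simp
   then show False using one_not_zero_B one_closed by (metis singletonD)
  qed
  then have len: "0 < length Bs" by simp
  then have "0 < e 0" using False by auto
  moreover have "e 0 \<le> (\<Sum>i<length Bs. e i)" by (rule member_le_sum) (use len in auto)
  ultimately obtain m where m: "(\<Sum>i<length Bs. e i) = Suc m" by (metis Suc_pred less_le_trans)
  have ordi: "ord_lt B kmod {\<zero>\<^sub>k} m (ad B kmod (Bs ! i) \<delta>)" if i: "i < length Bs" for i
  proof -
   let ?e = "e(i := e i - 1)"
   have ei: "e i = Suc (e i - 1)" using False i by simp
   have "(\<Sum>j<length Bs. e j) = e i + (\<Sum>j\<in>{..<length Bs} - {i}. e j)"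
    by (rule sum.remove) (use i in auto)
   moreover have "(\<Sum>j<length Bs. ?e j) = ?e i + (\<Sum>j\<in>{..<length Bs} - {i}. ?e j)"
    by (rule sum.remove) (use i in auto)
   moreover have "(\<Sum>j\<in>{..<length Bs} - {i}. ?e j) = (\<Sum>j\<in>{..<length Bs} - {i}. e j)"
    by (rule sum.cong) auto
   ultimately have s: "(\<Sum>j<length Bs. ?e j) = m" using ei m by simp
   have "(ad B kmod (Bs ! j) ^^ ?e j) (ad B kmod (Bs ! i) \<delta>) x = \<zero>\<^sub>k" if j: "j < length Bs" and x: "x \<in> carrier B" for j x
   proof (cases "j = i")
    case True
    have "(ad B kmod (Bs ! i) ^^ (e i - 1)) (ad B kmod (Bs ! i) \<delta>) x = (ad B kmod (Bs ! i) ^^ (Suc (e i - 1))) \<delta> x"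
     unfolding funpow_Suc_right by simp
    also have "\<dots> = \<zero>\<^sub>k" using less.prems(2)[OF i x] ei by simp
    finally show ?thesis using True by simp
   next
    case False
    then have "(ad B kmod (Bs ! j) ^^ ?e j) (ad B kmod (Bs ! i) \<delta>) x = ad B kmod (Bs ! i) ((ad B kmod (Bs ! j) ^^ e j) \<delta>) x"
     using ad_pow_commute[OF flinD(1)[OF less.prems(1)] b[OF j] b[OF i] x] by simp
    also have "\<dots> = \<zero>\<^sub>k"
     using less.prems(2)[OF j x] less.prems(2)[OF j m_closed[OF b[OF i] x]] b[OF i] by (simp add: ad_kmod k.minus_eq)
    finally show ?thesis .
   qed
   then have "ord_lt B kmod {\<zero>\<^sub>k} (\<Sum>j<length Bs. ?e j) (ad B kmod (Bs ! i) \<delta>)"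
    using s m by (intro less.hyps flin_ad[OF less.prems(1) FB b[OF i]]) simp_all
   then show ?thesis unfolding s .
  qed
  have "ord_lt B kmod {\<zero>\<^sub>k} m (ad B kmod r \<delta>)" if r: "r \<in> carrier B" for r
  proof -
   have "r \<in> Span F Bs" using r Bs(2) by simp
   then obtain c where c: "\<forall>i<length Bs. c i \<in> F" "r = (\<Oplus>i\<in>{..<length Bs}. c i \<otimes> Bs ! i)"
    using span_sumE[OF F Bs(1)] by blast
   have eq: "ad B kmod r \<delta> x = (\<Oplus>\<^sub>k i\<in>{..<length Bs}. \<rho> (c i) \<otimes>\<^sub>k ad B kmod (Bs ! i) \<delta> x)"
    if x: "x \<in> carrier B" for x
    unfolding c(2) by (rule flin_finsum[OF flin_ad_arg[OF less.prems(1) FB x]]) (use c(1) FB b in auto)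
   have sum: "ord_lt B kmod {\<zero>\<^sub>k} m (\<lambda>x. \<Oplus>\<^sub>k i\<in>{..<length Bs}. \<rho> (c i) \<otimes>\<^sub>k ad B kmod (Bs ! i) \<delta> x)"
    by (rule ord_lt_linear_combination)
      (use c(1) FB b ordi ad_kmod_closed[OF flinD(1)[OF less.prems(1)]] in auto)
   show ?thesis by (rule ord_lt_transfer[OF eq[symmetric] sum])
  qed
  then show ?thesis unfolding m by simp
 qed
qed

lemma flin_order_bound:
 assumes F: "maximal_subfield F" and Bs: "set Bs \<subseteq> carrier B" "Span F Bs = carrier B"
 shows "\<exists>n. \<forall>\<delta>. flin F \<delta> --> ord_lt B kmod {\<zero>\<^sub>k} n \<delta>"
proof -
 have "\<forall>i. \<exists>N. i < length Bs --> (\<forall>\<delta>. flin F \<delta> --> (\<forall>x\<in>carrier B. (ad B kmod (Bs ! i) ^^ N) \<delta> x = \<zero>\<^sub>k))"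
 proof
  fix i
  show "\<exists>N. i < length Bs --> (\<forall>\<delta>. flin F \<delta> --> (\<forall>x\<in>carrier B. (ad B kmod (Bs ! i) ^^ N) \<delta> x = \<zero>\<^sub>k))"
  proof (cases "i < length Bs")
   case True
   then have "Bs ! i \<in> carrier B" using Bs(1) nth_mem by blast
   then show ?thesis using ad_nilpotent[OF F] by simp
  qed simp
 qed
 then obtain N where N: "!!i \<delta> x. i < length Bs ==> flin F \<delta> ==> x \<in> carrier B ==> (ad B kmod (Bs ! i) ^^ (N i)) \<delta> x = \<zero>\<^sub>k"
  by metis
 have "ord_lt B kmod {\<zero>\<^sub>k} (\<Sum>i<length Bs. N i) \<delta>" if "flin F \<delta>" for \<delta>
  by (rule ord_lt_multi_exponent[OF F_subfield[OF F] Bs that]) (rule N[OF _ that])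
 then show ?thesis by (intro exI[of _ "\<Sum>i<length Bs. N i"]) simp
qed

text \<open>With \<open>F\<close> mapping onto the residue field, each r differs from some f in
  \<open>F\<close> by a kernel element, and linearity over \<open>F\<close> turns the commutator
  with r into multiplication of the argument by r - f. So \<open>j\<close> commutators insert
  \<open>j\<close> kernel elements, and no power of the characteristic enters the bound.\<close>

lemma flin_order_if_section:
 assumes FB: "F \<subseteq> carrier B" and onto: "\<rho> ` F = carrier k" and \<delta>: "flin F \<delta>"
  and nil: "!!xs x. length xs = j ==> (!!z. z \<in> set xs ==> z \<in> carrier B \<and> \<rho> z = \<zero>\<^sub>k) ==> x \<in> carrier B ==>
   \<delta> (foldr (\<otimes>) xs x) = \<zero>\<^sub>k"
 shows "ord_lt B kmod {\<zero>\<^sub>k} j \<delta>"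
 using \<delta> nil
proof (induction j arbitrary: \<delta>)
 case 0
 have "\<delta> x = \<zero>\<^sub>k" if "x \<in> carrier B" for x using "0.prems"(2)[of "[]" x] that by simp
 then show ?case by simp
next
 case (Suc j)
 have "ord_lt B kmod {\<zero>\<^sub>k} j (ad B kmod r \<delta>)" if r: "r \<in> carrier B" for r
 proof (rule Suc.IH[OF flin_ad[OF Suc.prems(1) FB r]])
  have "\<rho> r \<in> \<rho> ` F" unfolding onto using r by simp
  then obtain f where f: "f \<in> F" "\<rho> r = \<rho> f" by (elim imageE) simp
  have fB: "f \<in> carrier B" using f FB by blast
  have ad: "ad B kmod r \<delta> y = \<delta> ((r \<ominus> f) \<otimes> y)" if y: "y \<in> carrier B" for y
  proof -
   have "(r \<ominus> f) \<otimes> y = r \<otimes> y \<ominus> f \<otimes> y" using r fB y by (simp add: minus_eq l_distr l_minus)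
   then show ?thesis
    using flin_minus[OF Suc.prems(1)] flinD(4)[OF Suc.prems(1) f(1) y] r fB y f(2) by (simp add: ad_kmod)
  qed
  fix xs x assume xs: "length xs = j" "!!z. z \<in> set xs ==> z \<in> carrier B \<and> \<rho> z = \<zero>\<^sub>k" and x: "x \<in> carrier B"
  have cl: "foldr (\<otimes>) ys x \<in> carrier B" if "set ys \<subseteq> carrier B" for ys
   using that x by (induction ys) auto
  have rf: "\<rho> (r \<ominus> f) = \<zero>\<^sub>k" using r fB f(2) by (simp add: minus_eq k.r_neg)
  have "\<delta> (foldr (\<otimes>) ((r \<ominus> f) # xs) x) = \<zero>\<^sub>k"
  proof (rule Suc.prems(2))
   show "z \<in> carrier B \<and> \<rho> z = \<zero>\<^sub>k" if "z \<in> set ((r \<ominus> f) # xs)" for z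
    using that xs(2)[of z] rf r fB by (cases "z = r \<ominus> f") simp_all
  qed (use xs(1) x in simp_all)
  then show "ad B kmod r \<delta> (foldr (\<otimes>) xs x) = \<zero>\<^sub>k"
   using ad[OF cl] xs(2) by (simp add: subset_iff)
 qed
 then show ?case by simp
qed

text \<open>Coordinates with respect to the basis, followed by \<open>\<rho>\<close>; as
  \<open>\<rho>\<close> is injective on \<open>F\<close>, they separate points. The last clause
  applies in particular to \<open>g x = \<delta> i (b \<otimes> x)\<close> and so gives stability of
  the span under multiplication in the argument.\<close>

lemma coordinate_functionals:
 assumes F: "subfield F B" and Bs: "independent F Bs" "Span F Bs = carrier B"
 shows "\<exists>\<delta>. (\<forall>i<length Bs. flin F (\<delta> i)) \<and>
  (\<forall>x\<in>carrier B. (\<forall>i<length Bs. \<delta> i x = \<zero>\<^sub>k) --> x = \<zero>) \<and>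
  (\<forall>g. flin F g --> (\<forall>x\<in>carrier B. g x = (\<Oplus>\<^sub>k i\<in>{..<length Bs}. g (Bs ! i) \<otimes>\<^sub>k \<delta> i x)))"
proof -
 let ?n = "length Bs"
 have BsB: "set Bs \<subseteq> carrier B" using independent_in_carrier[OF Bs(1)] .
 have b: "Bs ! i \<in> carrier B" if "i < ?n" for i using BsB that nth_mem by blast
 have FB: "F \<subseteq> carrier B" using subfieldE(3)[OF F] .
 have sF: "subring F B" using subfieldE(1)[OF F] .
 have "\<forall>x. \<exists>c. x \<in> carrier B --> (\<forall>i<?n. c i \<in> F) \<and> x = (\<Oplus>i\<in>{..<?n}. c i \<otimes> Bs ! i)"
  using span_sumE[OF F BsB] unfolding Bs(2) by auto
 then obtain c where c: "!!x i. x \<in> carrier B ==> i < ?n ==> c x i \<in> F"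
  and xc: "!!x. x \<in> carrier B ==> x = (\<Oplus>i\<in>{..<?n}. c x i \<otimes> Bs ! i)" by metis
 have uniq: "c' i = c x i" if c': "!!i. i < ?n ==> c' i \<in> F" and x: "x \<in> carrier B"
  and e: "x = (\<Oplus>i\<in>{..<?n}. c' i \<otimes> Bs ! i)" and i: "i < ?n" for c' x i
 proof -
  have comb: "combine (map d [0..<?n]) Bs = (\<Oplus>i\<in>{..<?n}. d i \<otimes> Bs ! i)" if d: "!!i. i < ?n ==> d i \<in> F" for d
  proof -
   have "set (map d [0..<?n]) \<subseteq> carrier B" using d FB by auto
   then have "combine (map d [0..<?n]) Bs = (\<Oplus>i\<in>{..<?n}. map d [0..<?n] ! i \<otimes> Bs ! i)"
    using BsB by (intro combine_eq_finsum) simp_all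
   also have "\<dots> = (\<Oplus>i\<in>{..<?n}. d i \<otimes> Bs ! i)"
    by (rule add.finprod_cong') (use d FB b in auto)
   finally show ?thesis .
  qed
  have u: "\<exists>!Ks. set Ks \<subseteq> F \<and> length Ks = ?n \<and> x = combine Ks Bs"
   using unique_decomposition[OF F Bs(1)] x Bs(2) by simp
  have p1: "set (map c' [0..<?n]) \<subseteq> F \<and> length (map c' [0..<?n]) = ?n \<and> x = combine (map c' [0..<?n]) Bs"
   using c' comb[OF c'] e by auto
  have p2: "set (map (c x) [0..<?n]) \<subseteq> F \<and> length (map (c x) [0..<?n]) = ?n \<and> x = combine (map (c x) [0..<?n]) Bs"
   using c[OF x] comb[of "c x"] xc[OF x] by auto
  have "map c' [0..<?n] = map (c x) [0..<?n]"
   using the1_equality[OF u p1] the1_equality[OF u p2] by simp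
  then show ?thesis using i by simp
 qed
 define \<delta> where "\<delta> = (\<lambda>i x. \<rho> (c x i))"
 have cB: "c x i \<in> carrier B" if "x \<in> carrier B" "i < ?n" for x i using c[OF that] FB by blast
 have lin: "flin F (\<delta> i)" if i: "i < ?n" for i
 proof (rule flinI)
  show "\<delta> i x \<in> carrier k" if "x \<in> carrier B" for x unfolding \<delta>_def using cB[OF that i] by simp
  show "\<delta> i (x \<oplus> y) = \<delta> i x \<oplus>\<^sub>k \<delta> i y" if x: "x \<in> carrier B" and y: "y \<in> carrier B" for x y
  proof -
   have "x \<oplus> y = (\<Oplus>i\<in>{..<?n}. c x i \<otimes> Bs ! i) \<oplus> (\<Oplus>i\<in>{..<?n}. c y i \<otimes> Bs ! i)"
    using xc[OF x] xc[OF y] by simp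
   also have "\<dots> = (\<Oplus>i\<in>{..<?n}. c x i \<otimes> Bs ! i \<oplus> c y i \<otimes> Bs ! i)"
    by (rule finsum_addf[symmetric]) (use cB x y b in auto)
   also have "\<dots> = (\<Oplus>i\<in>{..<?n}. (c x i \<oplus> c y i) \<otimes> Bs ! i)"
    by (rule add.finprod_cong') (use cB x y b in \<open>auto simp: l_distr\<close>)
   finally have e: "x \<oplus> y = (\<Oplus>i\<in>{..<?n}. (c x i \<oplus> c y i) \<otimes> Bs ! i)" .
   have "c x i \<oplus> c y i = c (x \<oplus> y) i"
    by (rule uniq[of "\<lambda>i. c x i \<oplus> c y i" "x \<oplus> y" i, OF _ a_closed[OF x y] e i]) (rule subringE(7)[OF sF c[OF x] c[OF y]])
   then show ?thesis unfolding \<delta>_def using \<rho>.hom_add[OF cB[OF x i] cB[OF y i]] by simp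
  qed
  show "\<delta> i (f \<otimes> x) = \<rho> f \<otimes>\<^sub>k \<delta> i x" if f: "f \<in> F" and x: "x \<in> carrier B" for f x
  proof -
   have fB: "f \<in> carrier B" using f FB by blast
   have "f \<otimes> x = f \<otimes> (\<Oplus>i\<in>{..<?n}. c x i \<otimes> Bs ! i)" using xc[OF x] by simp
   also have "\<dots> = (\<Oplus>i\<in>{..<?n}. f \<otimes> (c x i \<otimes> Bs ! i))"
    by (rule finsum_rdistr) (use cB x b fB in auto)
   also have "\<dots> = (\<Oplus>i\<in>{..<?n}. (f \<otimes> c x i) \<otimes> Bs ! i)"
    by (rule add.finprod_cong') (use cB x b fB in \<open>auto simp: m_assoc\<close>)
   finally have e: "f \<otimes> x = (\<Oplus>i\<in>{..<?n}. (f \<otimes> c x i) \<otimes> Bs ! i)" .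
   have "f \<otimes> c x i = c (f \<otimes> x) i"
    by (rule uniq[of "\<lambda>i. f \<otimes> c x i" "f \<otimes> x" i, OF _ m_closed[OF fB x] e i]) (rule subringE(6)[OF sF f c[OF x]])
   then show ?thesis unfolding \<delta>_def using \<rho>.hom_mult[OF fB cB[OF x i]] by simp
  qed
 qed
 have inj: "x = \<zero>" if x: "x \<in> carrier B" and z: "\<forall>i<?n. \<delta> i x = \<zero>\<^sub>k" for x
 proof -
  have "c x i = \<zero>" if "i < ?n" for i
   using subfield_inj[OF F c[OF x that]] z that unfolding \<delta>_def by simp
  then have "(\<Oplus>i\<in>{..<?n}. c x i \<otimes> Bs ! i) = (\<Oplus>i\<in>{..<?n}. \<zero>)"
   by (intro add.finprod_cong') (use b in auto)
  then show ?thesis using xc[OF x] by simp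
 qed
 have exp: "g x = (\<Oplus>\<^sub>k i\<in>{..<?n}. g (Bs ! i) \<otimes>\<^sub>k \<delta> i x)" if g: "flin F g" and x: "x \<in> carrier B" for g x
 proof -
  have "g x = g (\<Oplus>i\<in>{..<?n}. c x i \<otimes> Bs ! i)" using xc[OF x] by simp
  also have "\<dots> = (\<Oplus>\<^sub>k i\<in>{..<?n}. \<rho> (c x i) \<otimes>\<^sub>k g (Bs ! i))"
   by (rule flin_finsum[OF g]) (use c[OF x] FB b in auto)
  also have "\<dots> = (\<Oplus>\<^sub>k i\<in>{..<?n}. g (Bs ! i) \<otimes>\<^sub>k \<delta> i x)"
   by (rule k.add.finprod_cong') (use cB[OF x] b flinD(2)[OF g] in \<open>auto simp: \<delta>_def k.m_comm\<close>)
  finally show ?thesis .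
 qed
 show ?thesis using lin inj exp by (intro exI[of _ \<delta>]) simp
qed

end

section \<open>Sections of the residue map in the separable case\<close>

context field
begin

lemma frobenius_preimage_subfield:
 assumes p: "Factorial_Ring.prime (p::nat)" "add_pow R p \<one> = \<zero>" and G: "subfield G R"
 shows "subfield {y \<in> carrier R. y [^] (p ^ e) \<in> G} R"
proof (rule subfieldI')
 have sG: "subring G R" using subfieldE(1)[OF G] .
 show "subring {y \<in> carrier R. y [^] (p ^ e) \<in> G} R"
 proof (rule subringI)
  show "\<one> \<in> {y \<in> carrier R. y [^] (p ^ e) \<in> G}" using subringE(3)[OF sG] by simp
  show "\<ominus> h \<in> {y \<in> carrier R. y [^] (p ^ e) \<in> G}" if "h \<in> {y \<in> carrier R. y [^] (p ^ e) \<in> G}" for h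
   using that subringE(5)[OF sG] by (simp add: frobenius_uminus[OF p])
  show "h \<otimes> g \<in> {y \<in> carrier R. y [^] (p ^ e) \<in> G}"
   if "h \<in> {y \<in> carrier R. y [^] (p ^ e) \<in> G}" "g \<in> {y \<in> carrier R. y [^] (p ^ e) \<in> G}" for h g
   using that subringE(6)[OF sG] by (simp add: nat_pow_distrib)
  show "h \<oplus> g \<in> {y \<in> carrier R. y [^] (p ^ e) \<in> G}"
   if "h \<in> {y \<in> carrier R. y [^] (p ^ e) \<in> G}" "g \<in> {y \<in> carrier R. y [^] (p ^ e) \<in> G}" for h g
   using that subringE(7)[OF sG] by (simp add: frobenius_pow_add[OF p])
 qed auto
 fix y assume y: "y \<in> {y \<in> carrier R. y [^] (p ^ e) \<in> G} - {\<zero>}"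
 then have yR: "y \<in> carrier R" "y \<noteq> \<zero>" by auto
 then have iv: "inv y \<in> carrier R" "y \<otimes> inv y = \<one>" using field_Units by auto
 have "y [^] (p ^ e) \<noteq> \<zero>" using nat_pow_eq_zero yR by blast
 then have "y [^] (p ^ e) \<in> G - {\<zero>}" using y by simp
 then have "inv (y [^] (p ^ e)) \<in> G" using subfield_m_inv(1)[OF G] by blast
 moreover have "inv (y [^] (p ^ e)) = inv y [^] (p ^ e)"
 proof (rule comm_inv_char)
  show "y [^] (p ^ e) \<otimes> inv y [^] (p ^ e) = \<one>"
   using nat_pow_distrib[OF yR(1) iv(1), of "p ^ e"] iv(2) by simp
 qed (use yR iv in auto)
 ultimately show "inv y \<in> {y \<in> carrier R. y [^] (p ^ e) \<in> G}" using iv(1) by simp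
qed

text \<open>Descent on e: the elements whose p^e-th power lies in \<open>G\<close> form a field
  containing \<open>L\<close> and \<open>x [^] p\<close>, so it contains \<open>x\<close> by
  \<open>separable_imp_generated_by_power\<close>. One Frobenius power is thereby removed.\<close>

lemma mem_if_separable_and_power:
 assumes L: "subfield L R" and G: "subfield G R" "L \<subseteq> G"
  and x: "x \<in> carrier R" and sep: "separable_element L x"
  and p: "Factorial_Ring.prime (p::nat)" "add_pow R p \<one> = \<zero>" and pw: "x [^] (p ^ e) \<in> G"
 shows "x \<in> G"
 using pw
proof (induction e)
 case 0
 then show ?case using x by simp
next
 case (Suc e)
 let ?H = "{y \<in> carrier R. y [^] (p ^ e) \<in> G}"
 have H: "subfield ?H R" by (rule frobenius_preimage_subfield[OF p G(1)])
 have "x [^] p \<in> ?H" using Suc.prems x by (simp add: nat_pow_pow mult.commute)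
 moreover have "L \<subseteq> ?H"
  using nat_pow_in_subring[OF subfieldE(1)[OF G(1)]] G(2) subfieldE(3)[OF L] by auto
 ultimately have "generate_field R (insert (x [^] p) L) \<subseteq> ?H"
  using generate_field_min_subfield1[OF _ H] subfieldE(3)[OF L] x by simp
 then have "x \<in> ?H" using separable_imp_generated_by_power[OF L x sep p] by blast
 then show ?case using Suc.IH by simp
qed

end

text \<open>A polynomial expression in lifts of algebraically independent elements that maps to zero has
 zero coefficients, so the lifts generate a subring meeting the kernel only in zero.\<close>

context residue_cover
begin

definition mon_at :: "('c => 'b) => ('c \<Rightarrow>\<^sub>0 nat) => 'b" where
 "mon_at l e = (\<Otimes>x\<in>keys e. l x [^] lookup e x)"

lemma mon_at_superset:
 assumes "l \<in> UNIV \<rightarrow> carrier B" "finite V" "keys e \<subseteq> V"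
 shows "mon_at l e = (\<Otimes>x\<in>V. l x [^] lookup e x)"
 unfolding mon_at_def
 by (rule finprod_mono_neutral_cong_left) (use assms in \<open>auto simp: in_keys_iff\<close>)

lemma mon_at_closed [simp]: "l \<in> UNIV \<rightarrow> carrier B ==> mon_at l e \<in> carrier B"
 unfolding mon_at_def by (rule finprod_closed) auto

lemma mon_at_add:
 assumes l: "l \<in> UNIV \<rightarrow> carrier B"
 shows "mon_at l (e + e') = mon_at l e \<otimes> mon_at l e'"
proof -
 let ?V = "keys e \<union> keys e'"
 have lB: "l x \<in> carrier B" for x using l by auto
 have "mon_at l (e + e') = (\<Otimes>x\<in>?V. l x [^] lookup (e + e') x)"
  by (rule mon_at_superset[OF l]) (auto simp: in_keys_iff lookup_add)
 also have "\<dots> = (\<Otimes>x\<in>?V. l x [^] lookup e x \<otimes> l x [^] lookup e' x)"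
  by (rule finprod_cong') (use lB in \<open>auto simp: lookup_add nat_pow_mult\<close>)
 also have "\<dots> = (\<Otimes>x\<in>?V. l x [^] lookup e x) \<otimes> (\<Otimes>x\<in>?V. l x [^] lookup e' x)"
  by (rule finprod_multf) (use lB in auto)
 also have "\<dots> = mon_at l e \<otimes> mon_at l e'"
  using mon_at_superset[OF l, of ?V] by simp
 finally show ?thesis .
qed

text \<open>The subring of \<open>B\<close> generated by the lifts over the coefficients, when
  \<open>K\<close> is a subring. Coefficients are total and zero off \<open>M\<close>, so that two
  sums can be extended to a common index set.\<close>

definition poly_exprs :: "'b set => ('c => 'b) => 'c set => 'b set" where
 "poly_exprs K l U = {x. \<exists>M c. finite M \<and> (\<forall>e\<in>M. keys e \<subseteq> U) \<and> (\<forall>e. c e \<in> K) \<and>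
   (\<forall>e. e \<notin> M --> c e = \<zero>) \<and> x = (\<Oplus>e\<in>M. c e \<otimes> mon_at l e)}"

lemma poly_exprsI:
 assumes "finite M" "!!e. e \<in> M ==> keys e \<subseteq> U" "!!e. c e \<in> K" "!!e. e \<notin> M ==> c e = \<zero>"
  "x = (\<Oplus>e\<in>M. c e \<otimes> mon_at l e)"
 shows "x \<in> poly_exprs K l U"
 unfolding poly_exprs_def using assms by (intro CollectI exI[of _ M] exI[of _ c]) simp

lemma poly_exprsE:
 assumes "x \<in> poly_exprs K l U"
 obtains M c where "finite M" "!!e. e \<in> M ==> keys e \<subseteq> U" "!!e. c e \<in> K" "!!e. e \<notin> M ==> c e = \<zero>"
  "x = (\<Oplus>e\<in>M. c e \<otimes> mon_at l e)"
 using assms unfolding poly_exprs_def mem_Collect_eq by (elim exE conjE) (rule that, simp_all)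

context
 fixes K :: "'b set" and l :: "'c => 'b" and U :: "'c set"
 assumes K: "subring K B" and l: "l \<in> UNIV \<rightarrow> carrier B"
begin

lemma poly_exprs_coeff_closed: "c \<in> K ==> c \<otimes> mon_at l e \<in> carrier B"
 using subringE(1)[OF K] l by auto

lemma poly_exprs_subset: "poly_exprs K l U \<subseteq> carrier B"
proof
 fix x assume "x \<in> poly_exprs K l U"
 then show "x \<in> carrier B"
  by (elim poly_exprsE) (use poly_exprs_coeff_closed in \<open>auto intro!: finsum_closed\<close>)
qed

lemma poly_exprs_add:
 assumes "x \<in> poly_exprs K l U" "y \<in> poly_exprs K l U"
 shows "x \<oplus> y \<in> poly_exprs K l U"
proof -
 obtain M c where M: "finite M" "!!e. e \<in> M ==> keys e \<subseteq> U" "!!e. c e \<in> K" "!!e. e \<notin> M ==> c e = \<zero>"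
  and x: "x = (\<Oplus>e\<in>M. c e \<otimes> mon_at l e)" by (rule poly_exprsE[OF assms(1)]) (rule that, simp_all)
 obtain M' c' where M': "finite M'" "!!e. e \<in> M' ==> keys e \<subseteq> U" "!!e. c' e \<in> K" "!!e. e \<notin> M' ==> c' e = \<zero>"
  and y: "y = (\<Oplus>e\<in>M'. c' e \<otimes> mon_at l e)" by (rule poly_exprsE[OF assms(2)]) (rule that, simp_all)
 have cB: "c e \<in> carrier B" "c' e \<in> carrier B" for e using M(3) M'(3) subringE(1)[OF K] by auto
 have m: "mon_at l e \<in> carrier B" for e using l by simp
 show ?thesis
 proof (rule poly_exprsI[of "M \<union> M'" U "\<lambda>e. c e \<oplus> c' e"])
  have "x = (\<Oplus>e\<in>M \<union> M'. c e \<otimes> mon_at l e)"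
   unfolding x by (rule add.finprod_mono_neutral_cong_left) (use M M' cB m in auto)
  moreover have "y = (\<Oplus>e\<in>M \<union> M'. c' e \<otimes> mon_at l e)"
   unfolding y by (rule add.finprod_mono_neutral_cong_left) (use M M' cB m in auto)
  ultimately have "x \<oplus> y = (\<Oplus>e\<in>M \<union> M'. c e \<otimes> mon_at l e \<oplus> c' e \<otimes> mon_at l e)"
   using finsum_addf[of "\<lambda>e. c e \<otimes> mon_at l e" "M \<union> M'" "\<lambda>e. c' e \<otimes> mon_at l e"] cB m by simp
  also have "\<dots> = (\<Oplus>e\<in>M \<union> M'. (c e \<oplus> c' e) \<otimes> mon_at l e)"
   by (rule add.finprod_cong') (use cB m in \<open>auto simp: l_distr\<close>)
  finally show "x \<oplus> y = (\<Oplus>e\<in>M \<union> M'. (c e \<oplus> c' e) \<otimes> mon_at l e)" .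
  show "c e \<oplus> c' e \<in> K" for e using subringE(7)[OF K M(3) M'(3)] .
  show "c e \<oplus> c' e = \<zero>" if "e \<notin> M \<union> M'" for e using that M(4) M'(4) by simp
  show "keys e \<subseteq> U" if "e \<in> M \<union> M'" for e using that M(2)[of e] M'(2)[of e] by blast
 qed (use M M' in auto)
qed

lemma poly_exprs_monomial_mult:
 assumes k0: "k0 \<in> K" and e0: "keys e0 \<subseteq> U" and xl: "x \<in> poly_exprs K l U"
 shows "(k0 \<otimes> mon_at l e0) \<otimes> x \<in> poly_exprs K l U"
proof -
 obtain M c where M: "finite M" "!!e. e \<in> M ==> keys e \<subseteq> U" "!!e. c e \<in> K" "!!e. e \<notin> M ==> c e = \<zero>"
  and x: "x = (\<Oplus>e\<in>M. c e \<otimes> mon_at l e)" by (rule poly_exprsE[OF xl]) (rule that, simp_all)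
 have cB: "c e \<in> carrier B" for e using M(3) subringE(1)[OF K] by auto
 have kB: "k0 \<in> carrier B" using k0 subringE(1)[OF K] by auto
 have m: "mon_at l e \<in> carrier B" for e using l by simp
 let ?M = "(\<lambda>e. e0 + e) ` M" and ?c = "\<lambda>e. if e \<in> (\<lambda>e. e0 + e) ` M then k0 \<otimes> c (e - e0) else \<zero>"
 show ?thesis
 proof (rule poly_exprsI[of ?M U ?c])
  have "(k0 \<otimes> mon_at l e0) \<otimes> x = (\<Oplus>e\<in>M. (k0 \<otimes> mon_at l e0) \<otimes> (c e \<otimes> mon_at l e))"
   unfolding x by (rule finsum_rdistr) (use M cB m kB in auto)
  also have "\<dots> = (\<Oplus>e\<in>M. ?c (e0 + e) \<otimes> mon_at l (e0 + e))"
   by (rule add.finprod_cong') (use cB m kB in \<open>auto simp: mon_at_add[OF l] m_ac\<close>)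
  also have "\<dots> = (\<Oplus>e\<in>?M. ?c e \<otimes> mon_at l e)"
   by (rule add.finprod_reindex[symmetric]) (use cB m kB in auto)
  finally show "(k0 \<otimes> mon_at l e0) \<otimes> x = (\<Oplus>e\<in>?M. ?c e \<otimes> mon_at l e)" .
  show "keys e \<subseteq> U" if "e \<in> ?M" for e
  proof -
   obtain e' where e': "e' \<in> M" "e = e0 + e'" using \<open>e \<in> ?M\<close> by (elim imageE) simp
   have "keys (e0 + e') \<subseteq> keys e0 \<union> keys e'"
    by (auto simp: in_keys_iff lookup_add)
   then show ?thesis using e0 M(2)[OF e'(1)] e'(2) by blast
  qed
  show "?c e \<in> K" for e using subringE(2)[OF K] subringE(6)[OF K k0 M(3)] by simp
 qed (use M in auto)
qed

lemma poly_exprs_zero: "\<zero> \<in> poly_exprs K l U"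
 by (rule poly_exprsI[of "{}" U "\<lambda>_. \<zero>"]) (use subringE(2)[OF K] in auto)

lemma poly_exprs_monomial:
 assumes "k0 \<in> K" "keys e0 \<subseteq> U"
 shows "k0 \<otimes> mon_at l e0 \<in> poly_exprs K l U"
 by (rule poly_exprsI[of "{e0}" U "\<lambda>e. if e = e0 then k0 else \<zero>"])
   (use assms subringE(2)[OF K] poly_exprs_coeff_closed in auto)

lemma poly_exprs_mult:
 assumes "x \<in> poly_exprs K l U" "y \<in> poly_exprs K l U"
 shows "x \<otimes> y \<in> poly_exprs K l U"
proof -
 obtain M c where M: "finite M" "!!e. e \<in> M ==> keys e \<subseteq> U" "!!e. c e \<in> K"
  and x: "x = (\<Oplus>e\<in>M. c e \<otimes> mon_at l e)" by (rule poly_exprsE[OF assms(1)]) (rule that, simp_all)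
 have y: "y \<in> carrier B" using assms(2) poly_exprs_subset by blast
 have cm: "c e \<otimes> mon_at l e \<in> carrier B" for e using poly_exprs_coeff_closed[OF M(3)] .
 have "x \<otimes> y = (\<Oplus>e\<in>M. (c e \<otimes> mon_at l e) \<otimes> y)"
  unfolding x by (rule finsum_ldistr) (use M cm y in auto)
 moreover have "(\<Oplus>e\<in>N. (c e \<otimes> mon_at l e) \<otimes> y) \<in> poly_exprs K l U" if "finite N" "N \<subseteq> M" for N
  using that
 proof (induction N rule: finite_induct)
  case empty
  show ?case using poly_exprs_zero by simp
 next
  case (insert e N)
  have "(\<Oplus>e\<in>insert e N. (c e \<otimes> mon_at l e) \<otimes> y) = (c e \<otimes> mon_at l e) \<otimes> y \<oplus> (\<Oplus>e\<in>N. (c e \<otimes> mon_at l e) \<otimes> y)"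
   using insert.hyps cm y by simp
  then show ?case
   using poly_exprs_add[OF poly_exprs_monomial_mult[OF M(3) M(2) assms(2)]] insert by simp
 qed
 ultimately show ?thesis using M(1) by simp
qed

lemma mon_at_0 [simp]: "mon_at l 0 = \<one>"
 unfolding mon_at_def by simp

lemma poly_exprs_const: "k0 \<in> K ==> k0 \<in> poly_exprs K l U"
 using poly_exprs_monomial[of k0 0] subringE(1)[OF K] by auto

lemma poly_exprs_var: "u \<in> U ==> l u \<in> poly_exprs K l U"
proof -
 assume u: "u \<in> U"
 have lu: "l u \<in> carrier B" using l by auto
 have "mon_at l (Poly_Mapping.single u 1) = l u"
  unfolding mon_at_def using lu by simp
 then show ?thesis using poly_exprs_monomial[OF subringE(3)[OF K], of "Poly_Mapping.single u 1"] u lu by simp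
qed

lemma poly_exprs_subring: "subring (poly_exprs K l U) B"
proof (rule subringI[OF poly_exprs_subset])
 show "\<one> \<in> poly_exprs K l U" by (rule poly_exprs_const[OF subringE(3)[OF K]])
 show "\<ominus> x \<in> poly_exprs K l U" if x: "x \<in> poly_exprs K l U" for x
 proof -
  have "\<ominus> \<one> \<in> poly_exprs K l U" using poly_exprs_const subringE(3,5)[OF K] by blast
  then have "(\<ominus> \<one>) \<otimes> x \<in> poly_exprs K l U" using poly_exprs_mult x by blast
  moreover have "x \<in> carrier B" using x poly_exprs_subset by blast
  ultimately show ?thesis by (simp add: l_minus)
 qed
qed (rule poly_exprs_mult, assumption+, rule poly_exprs_add, assumption+)

lemma poly_exprs_kernel:
 assumes lift: "!!u. u \<in> U ==> \<rho> (l u) = u" and KF: "subfield K B"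
  and ind: "k.algebraically_independent (\<rho> ` K) U"
  and x: "x \<in> poly_exprs K l U" "\<rho> x = \<zero>\<^sub>k"
 shows "x = \<zero>"
proof -
 obtain M c where M: "finite M" "!!e. e \<in> M ==> keys e \<subseteq> U" "!!e. c e \<in> K"
  and x': "x = (\<Oplus>e\<in>M. c e \<otimes> mon_at l e)" by (rule poly_exprsE[OF x(1)]) (rule that, simp_all)
 have lB: "l u \<in> carrier B" for u using l by auto
 have cB: "c e \<in> carrier B" for e using M(3) subringE(1)[OF K] by blast
 have mon: "\<rho> (mon_at l e) = (\<Otimes>\<^sub>k x\<in>keys e. x [^]\<^sub>k lookup e x)" if "e \<in> M" for e
 proof -
  have "\<rho> (mon_at l e) = (\<Otimes>\<^sub>k x\<in>keys e. \<rho> (l x [^] lookup e x))"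
   unfolding mon_at_def using lB by (simp add: \<rho>.hom_finprod comp_def)
  also have "\<dots> = (\<Otimes>\<^sub>k x\<in>keys e. x [^]\<^sub>k lookup e x)"
  proof (rule k.finprod_cong')
   fix u assume "u \<in> keys e"
   then have u: "u \<in> U" using M(2)[OF that] by blast
   show "\<rho> (l u [^] lookup e u) = u [^]\<^sub>k lookup e u"
    using lift[OF u] lB by (simp add: \<rho>.ring.hom_nat_pow)
  next
   have "u \<in> carrier k" if "u \<in> keys e" for u
    using M(2)[OF \<open>e \<in> M\<close>] that lift[of u] \<rho>.hom_closed[OF lB[of u]] by auto
   then show "(\<lambda>x. x [^]\<^sub>k lookup e x) \<in> keys e \<rightarrow> carrier k" by auto
  qed simp
  finally show ?thesis .
 qed
 have "\<rho> x = (\<Oplus>\<^sub>k e\<in>M. \<rho> (c e \<otimes> mon_at l e))"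
  unfolding x' using cB l by (simp add: comp_def)
 also have "\<dots> = (\<Oplus>\<^sub>k e\<in>M. \<rho> (c e) \<otimes>\<^sub>k (\<Otimes>\<^sub>k x\<in>keys e. x [^]\<^sub>k lookup e x))"
 proof (rule k.add.finprod_cong')
  fix e assume e: "e \<in> M"
  show "\<rho> (c e \<otimes> mon_at l e) = \<rho> (c e) \<otimes>\<^sub>k (\<Otimes>\<^sub>k x\<in>keys e. x [^]\<^sub>k lookup e x)"
   unfolding mon[OF e, symmetric] using cB l by simp
 next
  show "(\<lambda>e. \<rho> (c e) \<otimes>\<^sub>k (\<Otimes>\<^sub>k x\<in>keys e. x [^]\<^sub>k lookup e x)) \<in> M \<rightarrow> carrier k"
  proof
   fix e assume e: "e \<in> M"
   show "\<rho> (c e) \<otimes>\<^sub>k (\<Otimes>\<^sub>k x\<in>keys e. x [^]\<^sub>k lookup e x) \<in> carrier k"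
    unfolding mon[OF e, symmetric] using cB l by simp
  qed
 qed simp
 finally have "(\<Oplus>\<^sub>k e\<in>M. \<rho> (c e) \<otimes>\<^sub>k (\<Otimes>\<^sub>k x\<in>keys e. x [^]\<^sub>k lookup e x)) = \<zero>\<^sub>k"
  using x(2) by simp
 moreover have "(\<lambda>e. \<rho> (c e)) \<in> M \<rightarrow> \<rho> ` K" using M(3) by auto
 ultimately have "\<forall>e\<in>M. \<rho> (c e) = \<zero>\<^sub>k"
  using ind[unfolded k.algebraically_independent_def, THEN spec[of _ M], THEN spec[of _ "\<lambda>e. \<rho> (c e)"]] M(1,2)
  by blast
 then have "c e = \<zero>" if "e \<in> M" for e using subfield_inj[OF KF M(3)] that by blast
 then have "x = (\<Oplus>e\<in>M. \<zero>)"
  unfolding x' by (intro add.finprod_cong') (use l in auto)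
 then show ?thesis by simp
qed

end

text \<open>If \<open>k\<close> is separably generated over \<open>\<rho> K\<^sub>0\<close>, some subfield containing \<open>K\<^sub>0\<close> maps onto \<open>k\<close>.\<close>

lemma separable_section:
 assumes K0: "subfield K0 B" and sep: "k.separable_extension (\<rho> ` K0)"
  and Y: "finite Y" "Y \<subseteq> carrier k" and gen: "generate_field k (\<rho> ` K0 \<union> Y) = carrier k"
 shows "\<exists>F. K0 \<subseteq> F \<and> maximal_subfield F \<and> \<rho> ` F = carrier k"
proof -
 have "k.separably_generated (\<rho> ` K0) (carrier k)"
  using sep Y gen unfolding k.separable_extension_def by metis
 then obtain U where U: "U \<subseteq> carrier k" "k.algebraically_independent (\<rho> ` K0) U"
  and sepU: "!!x. x \<in> carrier k ==> k.separable_element (generate_field k (\<rho> ` K0 \<union> U)) x"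
  unfolding k.separably_generated_def by (elim exE conjE) simp
 \<comment> \<open>Outside the residue field the lift is set to 0, which makes \<open>l\<close> a
   total map into \<open>B\<close> as the lemmas on \<open>poly_exprs\<close> expect.\<close>
 define l where "l = (\<lambda>u. if u \<in> carrier k then SOME b. b \<in> carrier B \<and> \<rho> b = u else \<zero>)"
 have l: "l u \<in> carrier B \<and> \<rho> (l u) = u" if "u \<in> carrier k" for u
 proof -
  have "\<exists>b. b \<in> carrier B \<and> \<rho> b = u" using lift_exists[OF that] by blast
  then show ?thesis unfolding l_def using that someI_ex[OF \<open>\<exists>b. b \<in> carrier B \<and> \<rho> b = u\<close>] by simp
 qed
 have lcl: "l \<in> UNIV \<rightarrow> carrier B"
 proof
  show "l u \<in> carrier B" for u using l[of u] by (cases "u \<in> carrier k") (simp_all add: l_def)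
 qed
 have sK0: "subring K0 B" using subfieldE(1)[OF K0] .
 let ?C = "poly_exprs K0 l U"
 have C: "subring ?C B" by (rule poly_exprs_subring[OF sK0 lcl])
 have ker: "c = \<zero>" if "c \<in> ?C" "\<rho> c = \<zero>\<^sub>k" for c
  by (rule poly_exprs_kernel[OF sK0 lcl _ K0 U(2) that]) (use l U(1) in blast)
 let ?Q = "{c \<otimes> inv d |c d. c \<in> ?C \<and> d \<in> ?C \<and> d \<noteq> \<zero>}"
 have Q: "subfield ?Q B" "?C \<subseteq> ?Q" using fraction_subfield[OF C ker] by simp_all
 obtain F where F: "?Q \<subseteq> F" "maximal_subfield F" using maximal_subfield_exists[OF Q(1)] by (elim exE conjE)
 have K0F: "K0 \<subseteq> F" using poly_exprs_const[OF sK0 lcl] Q(2) F(1) by blast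
 let ?L = "generate_field k (\<rho> ` K0 \<union> U)"
 have sub: "\<rho> ` K0 \<union> U \<subseteq> carrier k" using subfieldE(3)[OF K0] U(1) by auto
 have L: "subfield ?L k" by (rule k.generate_field_is_subfield[OF sub])
 have "u \<in> \<rho> ` F" if u: "u \<in> U" for u
 proof -
  have "l u \<in> F" using poly_exprs_var[OF sK0 lcl u] Q(2) F(1) by blast
  moreover have "\<rho> (l u) = u" using l u U(1) by blast
  ultimately show ?thesis by (metis imageI)
 qed
 then have "\<rho> ` K0 \<union> U \<subseteq> \<rho> ` F" using K0F by blast
 then have LF: "?L \<subseteq> \<rho> ` F" by (rule k.generate_field_min_subfield1[OF sub F_image(1)[OF F(2)]])
 \<comment> \<open>By maximality a power of \<open>x\<close> lies in the image of \<open>F\<close>,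
   and \<open>x\<close> is separable over \<open>?L\<close>, which that image contains; both
   together force \<open>x\<close> into the image.\<close>
 have "x \<in> \<rho> ` F" if x: "x \<in> carrier k" for x
  using residue_power[OF F(2) x]
 proof (elim disjE exE conjE)
  fix p e assume "Factorial_Ring.prime (p::nat)" "add_pow k p \<one>\<^sub>k = \<zero>\<^sub>k" "x [^]\<^sub>k (p ^ e) \<in> \<rho> ` F"
  then show ?thesis
   by (rule k.mem_if_separable_and_power[OF L F_image(1)[OF F(2)] LF x sepU[OF x]])
 qed
 then have "\<rho> ` F = carrier k" using subfieldE(3)[OF F_image(1)[OF F(2)]] by blast
 then show ?thesis using K0F F(2) by (intro exI[of _ F]) simp
qed

end

section \<open>Modules of differential operators\<close>

lemma free_tensor_simps [simp]:
 "carrier (free_tensor B C) = {u. keys u \<subseteq> carrier B \<times> carrier C}"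
 "\<one>\<^bsub>free_tensor B C\<^esub> = frag_of (\<one>\<^sub>B, \<one>\<^sub>C)" "\<zero>\<^bsub>free_tensor B C\<^esub> = 0"
 "u \<oplus>\<^bsub>free_tensor B C\<^esub> v = u + v"
 by (simp_all add: free_tensor_def)

lemma free_tensor_mult_of:
 "frag_of (b, c) \<otimes>\<^bsub>free_tensor B C\<^esub> frag_of (b', c') = frag_of (b \<otimes>\<^sub>B b', c \<otimes>\<^sub>C c')"
 by (simp add: free_tensor_def)

lemma frag_extend_diff_fun: "frag_extend (\<lambda>q. f q - g q) u = frag_extend f u - frag_extend g u"
 using subset_UNIV
 by (induction u rule: frag_induction) (auto simp: frag_extend_diff)

lemma free_tensor_mult_diff:
 "(u - u') \<otimes>\<^bsub>free_tensor B C\<^esub> v = u \<otimes>\<^bsub>free_tensor B C\<^esub> v - u' \<otimes>\<^bsub>free_tensor B C\<^esub> v"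
 "v \<otimes>\<^bsub>free_tensor B C\<^esub> (u - u') = v \<otimes>\<^bsub>free_tensor B C\<^esub> u - v \<otimes>\<^bsub>free_tensor B C\<^esub> u'"
 "0 \<otimes>\<^bsub>free_tensor B C\<^esub> v = 0" "v \<otimes>\<^bsub>free_tensor B C\<^esub> 0 = 0"
 "(u + u') \<otimes>\<^bsub>free_tensor B C\<^esub> v = u \<otimes>\<^bsub>free_tensor B C\<^esub> v + u' \<otimes>\<^bsub>free_tensor B C\<^esub> v"
 by (simp_all add: free_tensor_def frag_extend_diff case_prod_unfold frag_extend_diff_fun frag_extend_eq_0 frag_extend_add)

text \<open>The ring laws are additive in each factor, so \<open>frag_induction\<close> reduces them
  to single pairs, where they hold componentwise.\<close>

lemma free_tensor_cring:
 assumes "cring B" "cring C"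
 shows "cring (free_tensor B C)"
proof -
 interpret B: cring B by fact
 interpret C: cring C by fact
 let ?T = "free_tensor B C" and ?S = "carrier B \<times> carrier C"
 have closed: "keys (u \<otimes>\<^bsub>?T\<^esub> v) \<subseteq> ?S" if u: "keys u \<subseteq> ?S" and v: "keys v \<subseteq> ?S" for u v
  using u
 proof (induction u rule: frag_induction)
  case (one x)
  obtain b c where x: "x = (b, c)" "b \<in> carrier B" "c \<in> carrier C" using one by auto
  show ?case using v
  proof (induction v rule: frag_induction)
   case (one y)
   then show ?case using x by (cases y) (simp add: free_tensor_mult_of)
  next
   case (diff v v')
   then show ?case using keys_diff[of "frag_of x \<otimes>\<^bsub>?T\<^esub> v" "frag_of x \<otimes>\<^bsub>?T\<^esub> v'"]
    unfolding free_tensor_mult_diff by (meson Un_least order.trans)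
  qed (simp add: free_tensor_mult_diff)
 next
  case (diff u u')
  then show ?case using keys_diff[of "u \<otimes>\<^bsub>?T\<^esub> v" "u' \<otimes>\<^bsub>?T\<^esub> v"]
   unfolding free_tensor_mult_diff by (meson Un_least order.trans)
 qed (simp add: free_tensor_mult_diff)
 have comm: "u \<otimes>\<^bsub>?T\<^esub> v = v \<otimes>\<^bsub>?T\<^esub> u" if u: "keys u \<subseteq> ?S" and v: "keys v \<subseteq> ?S" for u v
  using u
 proof (induction u rule: frag_induction)
  case (one x)
  show ?case using v
  proof (induction v rule: frag_induction)
   case (one y)
   then show ?case using \<open>x \<in> ?S\<close>
    by (cases x, cases y) (simp add: free_tensor_mult_of B.m_comm C.m_comm)
  qed (simp_all add: free_tensor_mult_diff)
 qed (simp_all add: free_tensor_mult_diff)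
 have assoc: "(u \<otimes>\<^bsub>?T\<^esub> v) \<otimes>\<^bsub>?T\<^esub> w = u \<otimes>\<^bsub>?T\<^esub> (v \<otimes>\<^bsub>?T\<^esub> w)"
  if u: "keys u \<subseteq> ?S" and v: "keys v \<subseteq> ?S" and w: "keys w \<subseteq> ?S" for u v w
  using u
 proof (induction u rule: frag_induction)
  case (one x)
  show ?case using v
  proof (induction v rule: frag_induction)
   case (one y)
   show ?case using w
   proof (induction w rule: frag_induction)
    case (one z)
    then show ?case using \<open>x \<in> ?S\<close> \<open>y \<in> ?S\<close>
     by (cases x, cases y, cases z) (simp add: free_tensor_mult_of B.m_assoc C.m_assoc)
   qed (simp_all add: free_tensor_mult_diff)
  qed (simp_all add: free_tensor_mult_diff)
 qed (simp_all add: free_tensor_mult_diff)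
 have one: "frag_of (\<one>\<^sub>B, \<one>\<^sub>C) \<otimes>\<^bsub>?T\<^esub> u = u" if "keys u \<subseteq> ?S" for u
  using that
 proof (induction u rule: frag_induction)
  case (one x)
  then show ?case by (cases x) (simp add: free_tensor_mult_of)
 qed (simp_all add: free_tensor_mult_diff)
 show ?thesis
 proof (rule cringI)
  show "abelian_group ?T"
  proof (rule abelian_groupI)
   show "x \<oplus>\<^bsub>?T\<^esub> y \<in> carrier ?T" if "x \<in> carrier ?T" "y \<in> carrier ?T" for x y
    using that keys_add[of x y] by auto
   show "\<exists>y\<in>carrier ?T. y \<oplus>\<^bsub>?T\<^esub> x = \<zero>\<^bsub>?T\<^esub>" if "x \<in> carrier ?T" for x
    using that by (intro bexI[of _ "- x"]) auto
  qed (auto simp: algebra_simps)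
  show "comm_monoid ?T"
   by (rule comm_monoidI) (use closed comm assoc one in auto)
 qed (auto simp: free_tensor_mult_diff)
qed

lemma tensor_relations_closed:
 assumes "cring B" "cring C" "f \<in> carrier K \<rightarrow> carrier B" "g \<in> carrier K \<rightarrow> carrier C"
 shows "tensor_relations K f B g C \<subseteq> carrier (free_tensor B C)"
proof
 interpret B: cring B by fact
 interpret C: cring C by fact
 let ?S = "carrier B \<times> carrier C"
 have three: "keys (frag_of x - frag_of y - frag_of z) \<subseteq> ?S" if "x \<in> ?S" "y \<in> ?S" "z \<in> ?S" for x y z
  using keys_diff[of "frag_of x - frag_of y" "frag_of z"] keys_diff[of "frag_of x" "frag_of y"] that by auto
 have two: "keys (frag_of x - frag_of y) \<subseteq> ?S" if "x \<in> ?S" "y \<in> ?S" for x y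
  using keys_diff[of "frag_of x" "frag_of y"] that by auto
 fix u assume "u \<in> tensor_relations K f B g C"
 then show "u \<in> carrier (free_tensor B C)"
  unfolding tensor_relations_def free_tensor_simps mem_Collect_eq
 proof (elim UnE CollectE exE conjE)
  fix a b c assume "u = frag_of (f a \<otimes>\<^sub>B b, c) - frag_of (b, g a \<otimes>\<^sub>C c)" "a \<in> carrier K" "b \<in> carrier B" "c \<in> carrier C"
  then show "keys u \<subseteq> ?S" using assms(3,4) by (simp only:) (rule two; auto)
 qed (simp only:, rule three; simp)+
qed

lemma tensor_ideal_is_ideal:
 assumes "cring B" "cring C" "f \<in> carrier K \<rightarrow> carrier B" "g \<in> carrier K \<rightarrow> carrier C"
 shows "ideal (tensor_ideal K f B g C) (free_tensor B C)"
 unfolding tensor_ideal_def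
 by (rule ring.genideal_ideal[OF cring.axioms(1)[OF free_tensor_cring[OF assms(1,2)]] tensor_relations_closed[OF assms]])

text \<open>\<open>enveloping_act\<close> works with some member of the coset \<open>T\<close>.
  These facts guarantee that there is one and that any member is a formal sum of pairs of ring
  elements.\<close>

lemma enveloping_ring_representatives:
 assumes R: "cring R" and A: "A \<subseteq> carrier R" and T: "T \<in> carrier (enveloping_ring R A)"
 shows "T \<noteq> {}" "u \<in> T ==> keys u \<subseteq> carrier R \<times> carrier R"
proof -
 let ?T = "free_tensor R R" and ?I = "tensor_ideal (R\<lparr>carrier := A\<rparr>) (\<lambda>a. a) R (\<lambda>a. a) R"
 have I: "ideal ?I ?T" by (rule tensor_ideal_is_ideal[OF R R]) (use A in auto)
 have "T \<in> (\<Union>a\<in>carrier ?T. {?I +>\<^bsub>?T\<^esub> a})"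
  using T unfolding enveloping_ring_def tensor_ring_def FactRing_def A_RCOSETS_def' by (simp only: partial_object.select_convs)
 then obtain x where x: "x \<in> carrier ?T" "T = ?I +>\<^bsub>?T\<^esub> x" by blast
 have T': "T = (\<Union>h\<in>?I. {h \<oplus>\<^bsub>?T\<^esub> x})" unfolding x(2) a_r_coset_def' ..
 show "T \<noteq> {}" using additive_subgroup.zero_closed[OF ideal.axioms(1)[OF I]] unfolding T' by blast
 show "keys u \<subseteq> carrier R \<times> carrier R" if u: "u \<in> T"
 proof -
  obtain h where h: "h \<in> ?I" "u = h \<oplus>\<^bsub>?T\<^esub> x" using u unfolding T' by blast
  have "keys h \<subseteq> carrier R \<times> carrier R" using ideal.Icarr[OF I h(1)] by simp
  moreover have "keys x \<subseteq> carrier R \<times> carrier R" using x(1) by simp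
  ultimately show ?thesis using keys_add[of h x] unfolding h(2) free_tensor_simps by blast
 qed
qed

lemma add_monoid_restrict_scalars [simp]:
 "add_pow (restrict_scalars f M) = (add_pow M :: int => _)" "finsum (restrict_scalars f M) = finsum M"
 by (simp_all add: add_pow_def fun_eq_iff finsum_def finprod_def int_pow_def nat_pow_def m_inv_def Let_def)

lemma (in module) add_pow_int_eq_smult:
 assumes "x \<in> carrier M"
 shows "add_pow M (i::int) x = add_pow R i \<one> \<odot>\<^sub>M x"
proof -
 have "group_hom (add_monoid R) (add_monoid M) (\<lambda>c. c \<odot>\<^sub>M x)"
  unfolding group_hom_def group_hom_axioms_def hom_def
  using assms R.add.is_group M.add.is_group by (simp add: smult_l_distr Pi_iff)
 from group_hom.hom_int_pow[OF this, of \<one> i] assms show ?thesis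
  by (simp add: add_pow_def)
qed

text \<open>Commutators are taken over \<open>R\<close>, while the left structure of the operators
  comes from \<open>S\<close>: the local ring for (i), \<open>R\<close> itself for (ii).\<close>

locale hom_setting =
 fixes R :: "('a, 'r) ring_scheme" (structure) and A :: "'a set"
  and S :: "('s, 't) ring_scheme" and f :: "'a => 's" and N' :: "('s, 'n, 'z) module_scheme"
 assumes R: "cring R" and A: "A \<subseteq> carrier R" and f: "f \<in> ring_hom R S" and N': "module S N'"
begin

abbreviation N :: "('a, 'n) module" where "N \<equiv> restrict_scalars f N'"
abbreviation H :: "('a => 'n) set" where "H \<equiv> Hom_set A (ring_module R) N"
abbreviation M :: "('s, 'a => 'n) module" where
 "M \<equiv> Hom_module A (ring_module R) N (left_act (ring_module R) N')"

sublocale R: cring R by (rule R)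
sublocale N': module S N' by (rule N')
sublocale N: module R "restrict_scalars f N'"
 rewrites "carrier (restrict_scalars f N') = carrier N'" and "\<zero>\<^bsub>restrict_scalars f N'\<^esub> = \<zero>\<^sub>N'"
  and "ring.add (restrict_scalars f N') = ring.add N'" and "!!r x. r \<odot>\<^bsub>restrict_scalars f N'\<^esub> x = f r \<odot>\<^sub>N' x"
 by (rule module_restrict_scalars[OF R f N']) simp_all

lemma f_closed [simp]: "x \<in> carrier R ==> f x \<in> carrier S"
 using ring_hom_closed[OF f] .

lemma Hom_module_simps [simp]:
 "carrier M = H" "\<zero>\<^sub>M = (\<lambda>m\<in>carrier R. \<zero>\<^sub>N')"
 "\<delta> \<oplus>\<^sub>M \<epsilon> = (\<lambda>m\<in>carrier R. \<delta> m \<oplus>\<^sub>N' \<epsilon> m)" "c \<odot>\<^sub>M \<delta> = (\<lambda>m\<in>carrier R. c \<odot>\<^sub>N' \<delta> m)"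
 by (simp_all add: Hom_module_def left_act_def)

lemma HomI:
 assumes "!!x. x \<in> carrier R ==> d x \<in> carrier N'"
  "!!x y. x \<in> carrier R ==> y \<in> carrier R ==> d (x \<oplus> y) = d x \<oplus>\<^sub>N' d y"
  "!!a x. a \<in> A ==> x \<in> carrier R ==> d (a \<otimes> x) = f a \<odot>\<^sub>N' d x"
 shows "(\<lambda>x\<in>carrier R. d x) \<in> H"
 unfolding Hom_set_def using assms A by auto

lemma HomD:
 assumes "\<delta> \<in> H"
 shows "x \<in> carrier R ==> \<delta> x \<in> carrier N'"
  "x \<in> carrier R ==> y \<in> carrier R ==> \<delta> (x \<oplus> y) = \<delta> x \<oplus>\<^sub>N' \<delta> y"
  "a \<in> A ==> x \<in> carrier R ==> \<delta> (a \<otimes> x) = f a \<odot>\<^sub>N' \<delta> x"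
  "(\<lambda>x\<in>carrier R. \<delta> x) = \<delta>"
 using assms unfolding Hom_set_def by (auto simp: PiE_restrict)

lemma Hom_ext:
 assumes "\<delta> \<in> H" "\<epsilon> \<in> H" "!!x. x \<in> carrier R ==> \<delta> x = \<epsilon> x"
 shows "\<delta> = \<epsilon>"
 using assms unfolding Hom_set_def by (auto intro: PiE_ext)

lemma Hom_add_closed:
 assumes "\<delta> \<in> H" "\<epsilon> \<in> H"
 shows "(\<lambda>m\<in>carrier R. \<delta> m \<oplus>\<^sub>N' \<epsilon> m) \<in> H"
 by (rule HomI) (use A in \<open>auto simp: HomD[OF assms(1)] HomD[OF assms(2)] N'.a_ac N'.smult_r_distr subset_iff\<close>)

lemma Hom_smult_closed:
 assumes c: "c \<in> carrier S" and "\<delta> \<in> H"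
 shows "(\<lambda>m\<in>carrier R. c \<odot>\<^sub>N' \<delta> m) \<in> H"
proof (rule HomI)
 fix a x assume ax: "a \<in> A" "x \<in> carrier R"
 then have "f a \<in> carrier S" using A by auto
 then show "c \<odot>\<^sub>N' \<delta> (a \<otimes> x) = f a \<odot>\<^sub>N' (c \<odot>\<^sub>N' \<delta> x)"
  using c ax HomD[OF assms(2)] by (simp add: N'.smult_assoc1[symmetric] N'.R.m_comm)
qed (use c in \<open>auto simp: HomD[OF assms(2)] N'.smult_r_distr\<close>)

lemma Hom_zero_closed: "(\<lambda>m\<in>carrier R. \<zero>\<^sub>N') \<in> H"
 by (rule HomI) (use A in auto)

lemma Hom_module: "module S M"
proof (rule moduleI)
 show "abelian_group M"
 proof (rule abelian_groupI)
  show "\<exists>\<epsilon>\<in>carrier M. \<epsilon> \<oplus>\<^sub>M \<delta> = \<zero>\<^sub>M" if "\<delta> \<in> carrier M" for \<delta>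
  proof (intro bexI[of _ "\<lambda>m\<in>carrier R. (\<ominus>\<^sub>S \<one>\<^sub>S) \<odot>\<^sub>N' \<delta> m"])
   have d: "\<delta> \<in> H" using that by simp
   show "(\<lambda>m\<in>carrier R. (\<ominus>\<^sub>S \<one>\<^sub>S) \<odot>\<^sub>N' \<delta> m) \<oplus>\<^sub>M \<delta> = \<zero>\<^sub>M"
    unfolding Hom_module_simps
    by (rule restrict_ext) (simp add: HomD(1)[OF d] N'.smult_l_minus N'.l_neg)
   show "(\<lambda>m\<in>carrier R. (\<ominus>\<^sub>S \<one>\<^sub>S) \<odot>\<^sub>N' \<delta> m) \<in> carrier M"
    using Hom_smult_closed[OF _ d] by simp
  qed
  show "\<zero>\<^sub>M \<oplus>\<^sub>M \<delta> = \<delta>" if "\<delta> \<in> carrier M" for \<delta>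
  proof -
   have d: "\<delta> \<in> H" using that by simp
   show ?thesis unfolding Hom_module_simps
    by (rule Hom_ext[OF Hom_add_closed[OF Hom_zero_closed d] d]) (simp add: HomD(1)[OF d])
  qed
 qed (auto simp: Hom_add_closed Hom_zero_closed HomD(1) N'.a_ac intro!: restrict_ext)
 show "\<one>\<^sub>S \<odot>\<^sub>M \<delta> = \<delta>" if "\<delta> \<in> carrier M" for \<delta>
 proof -
  have d: "\<delta> \<in> H" using that by simp
  show ?thesis unfolding Hom_module_simps
   by (rule Hom_ext[OF Hom_smult_closed[OF _ d] d]) (simp_all add: HomD(1)[OF d])
 qed
qed (auto simp: Hom_smult_closed HomD(1) N'.smult_l_distr N'.smult_r_distr N'.smult_assoc1 N'.R.cring_axioms intro!: restrict_ext)

sublocale M: module S M by (rule Hom_module)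

text \<open>Claims about all members of a generated submodule are proved by showing that the maps
  with the desired property form a submodule containing the generators.\<close>

lemma condition_submodule:
 assumes "Q (\<lambda>m\<in>carrier R. \<zero>\<^sub>N')"
  "!!\<delta> \<epsilon>. \<delta> \<in> H ==> \<epsilon> \<in> H ==> Q \<delta> ==> Q \<epsilon> ==> Q (\<lambda>m\<in>carrier R. \<delta> m \<oplus>\<^sub>N' \<epsilon> m)"
  and smult: "!!c \<delta>. c \<in> carrier S ==> \<delta> \<in> H ==> Q \<delta> ==> Q (\<lambda>m\<in>carrier R. c \<odot>\<^sub>N' \<delta> m)"
 shows "submodule {\<delta> \<in> H. Q \<delta>} S M"
proof (rule M.submoduleI)
 fix \<delta> assume d: "\<delta> \<in> {\<delta> \<in> H. Q \<delta>}"
 then have "\<delta> \<in> carrier M" by simp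
 then have "\<ominus>\<^sub>M \<delta> = (\<ominus>\<^sub>S \<one>\<^sub>S) \<odot>\<^sub>M \<delta>"
  using M.smult_l_minus[of "\<one>\<^sub>S" \<delta>] M.smult_one by simp
 also have "\<dots> = (\<lambda>m\<in>carrier R. (\<ominus>\<^sub>S \<one>\<^sub>S) \<odot>\<^sub>N' \<delta> m)" by simp
 finally show "\<ominus>\<^sub>M \<delta> \<in> {\<delta> \<in> H. Q \<delta>}"
  using d smult[of "\<ominus>\<^sub>S \<one>\<^sub>S" \<delta>] Hom_smult_closed[of "\<ominus>\<^sub>S \<one>\<^sub>S" \<delta>] by simp
qed (use assms Hom_zero_closed Hom_add_closed Hom_smult_closed in auto)

lemma submodule_zero:
 assumes "submodule F S M" shows "(\<lambda>m\<in>carrier R. \<zero>\<^sub>N') \<in> F"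
proof -
 have "\<zero>\<^sub>M \<in> F" using subgroup.one_closed[OF submodule.axioms(1)[OF assms]] by (simp only: monoid.simps)
 then show ?thesis by (simp only: Hom_module_simps)
qed

definition gen :: "('a => 'n) set => ('a => 'n) set" where
 "gen U = \<Inter>{F. submodule F S M \<and> U \<subseteq> F}"

lemma gen_incl: "U \<subseteq> gen U"
 unfolding gen_def by blast

lemma gen_min: "submodule F S M ==> U \<subseteq> F ==> gen U \<subseteq> F"
 unfolding gen_def by blast

lemma gen_subset: "U \<subseteq> H ==> gen U \<subseteq> H"
 using gen_min[OF M.carrier_is_submodule] by simp

lemma gen_submodule:
 assumes "U \<subseteq> H" shows "submodule (gen U) S M"
proof (rule M.submoduleI)
 show "gen U \<subseteq> carrier M" using gen_subset[OF assms] by simp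
 show "\<zero>\<^sub>M \<in> gen U" unfolding gen_def Hom_module_simps using submodule_zero by blast
 show "\<ominus>\<^sub>M a \<in> gen U" if "a \<in> gen U" for a
  using that M.submoduleE(3) unfolding gen_def by blast
 show "a \<oplus>\<^sub>M b \<in> gen U" if "a \<in> gen U" "b \<in> gen U" for a b
  using that M.submoduleE(5) unfolding gen_def by blast
 show "c \<odot>\<^sub>M a \<in> gen U" if "c \<in> carrier S" "a \<in> gen U" for c a
  using that M.submoduleE(4) unfolding gen_def by blast
qed

lemma fg_submodule_gen: "finite U ==> U \<subseteq> H ==> fg_submodule (gen U) S M"
 unfolding fg_submodule_def using gen_submodule gen_incl gen_min by (intro conjI exI[of _ U]) auto

lemma submodule_sum_closed:
 assumes F: "submodule F S M" and "finite J"
  and "!!j. j \<in> J ==> c j \<in> carrier S" "!!j. j \<in> J ==> \<delta> j \<in> F"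
 shows "(\<lambda>x\<in>carrier R. \<Oplus>\<^sub>N' j\<in>J. c j \<odot>\<^sub>N' \<delta> j x) \<in> F"
 using assms(2-)
proof (induction J rule: finite_induct)
 case empty
 show ?case using submodule_zero[OF F] by (simp only: N'.finsum_empty)
next
 case (insert j J)
 have dH: "\<delta> i \<in> H" if "i \<in> insert j J" for i using insert.prems(2)[OF that] M.submoduleE(1)[OF F] by auto
 have "c j \<odot>\<^sub>M \<delta> j \<oplus>\<^sub>M (\<lambda>x\<in>carrier R. \<Oplus>\<^sub>N' j\<in>J. c j \<odot>\<^sub>N' \<delta> j x) \<in> F"
 proof (intro M.submoduleE(5)[OF F] M.submoduleE(4)[OF F])
  show "(\<lambda>x\<in>carrier R. \<Oplus>\<^sub>N' j\<in>J. c j \<odot>\<^sub>N' \<delta> j x) \<in> F"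
   by (rule insert.IH) (rule insert.prems, rule insertI2, assumption)+
  show "c j \<in> carrier S" "\<delta> j \<in> F" by (rule insert.prems, rule insertI1)+
 qed
 moreover have "c j \<odot>\<^sub>M \<delta> j \<oplus>\<^sub>M (\<lambda>x\<in>carrier R. \<Oplus>\<^sub>N' j\<in>J. c j \<odot>\<^sub>N' \<delta> j x)
   = (\<lambda>x\<in>carrier R. \<Oplus>\<^sub>N' j\<in>insert j J. c j \<odot>\<^sub>N' \<delta> j x)"
  unfolding Hom_module_simps
 proof (rule restrict_ext)
  fix x assume x: "x \<in> carrier R"
  then have "c i \<odot>\<^sub>N' \<delta> i x \<in> carrier N'" if "i \<in> insert j J" for i
   using insert.prems(1)[OF that] HomD(1)[OF dH[OF that]] by simp
  then show "(\<lambda>m\<in>carrier R. c j \<odot>\<^sub>N' \<delta> j m) x \<oplus>\<^sub>N' (\<lambda>x\<in>carrier R. \<Oplus>\<^sub>N' j\<in>J. c j \<odot>\<^sub>N' \<delta> j x) x =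
    (\<Oplus>\<^sub>N' j\<in>insert j J. c j \<odot>\<^sub>N' \<delta> j x)"
   using insert.hyps x by (simp add: Pi_iff)
 qed
 ultimately show ?case by (simp only:)
qed

text \<open>\<open>Diff_lt\<close> asks for extensional commutators linear over \<open>A\<close> at
  every level, while \<open>ord_lt\<close> records only their values; the induction supplies the
  linearity.\<close>

lemma Diff_lt_if_ord_lt:
 assumes "\<delta> \<in> H" "ord_lt R N {\<zero>\<^sub>N'} n \<delta>"
 shows "\<delta> \<in> Diff_lt R A (ring_module R) N n"
 using assms
proof (induction n arbitrary: \<delta>)
 case 0
 have "\<delta> = (\<lambda>m\<in>carrier R. \<zero>\<^sub>N')"
  by (rule Hom_ext[OF 0(1) Hom_zero_closed]) (use 0(2) in simp)
 then show ?case by (simp only: Diff_lt.simps ring_module_simps restrict_scalars_simps singleton_iff)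
next
 case (Suc n)
 have "bracket (ring_module R) N \<delta> r \<in> Diff_lt R A (ring_module R) N n" if r: "r \<in> carrier R" for r
 proof (rule Suc.IH)
  have br: "bracket (ring_module R) N \<delta> r = (\<lambda>x\<in>carrier R. ad R N r \<delta> x)"
   by (simp add: bracket_def ad_def)
  have dc: "\<delta> x \<in> carrier N'" if "x \<in> carrier R" for x using HomD(1)[OF Suc.prems(1) that] .
  show "bracket (ring_module R) N \<delta> r \<in> H"
   unfolding br
  proof (rule HomI)
   show "ad R N r \<delta> x \<in> carrier N'" if "x \<in> carrier R" for x
    using that r dc by (simp add: ad_def)
   show "ad R N r \<delta> (x \<oplus> y) = ad R N r \<delta> x \<oplus>\<^sub>N' ad R N r \<delta> y" if "x \<in> carrier R" "y \<in> carrier R" for x y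
    using that r dc HomD(2)[OF Suc.prems(1)]
    by (simp add: ad_def R.r_distr N'.smult_r_distr N'.minus_eq N'.minus_add N'.a_ac)
   show "ad R N r \<delta> (a \<otimes> x) = f a \<odot>\<^sub>N' ad R N r \<delta> x" if "a \<in> A" "x \<in> carrier R" for a x
   proof -
    have aR: "a \<in> carrier R" using that A by blast
    have "\<delta> (r \<otimes> (a \<otimes> x)) = f a \<odot>\<^sub>N' \<delta> (r \<otimes> x)"
     using HomD(3)[OF Suc.prems(1) that(1), of "r \<otimes> x"] that r aR by (simp add: R.m_lcomm)
    moreover have "f r \<odot>\<^sub>N' (f a \<odot>\<^sub>N' \<delta> x) = f a \<odot>\<^sub>N' (f r \<odot>\<^sub>N' \<delta> x)"
     using that r aR dc by (simp add: N'.smult_assoc1[symmetric] N'.R.m_comm)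
    ultimately show ?thesis
     using HomD(3)[OF Suc.prems(1) that] that r aR dc
     by (simp add: ad_def N'.minus_eq N'.smult_r_distr N'.smult_r_minus)
   qed
  qed
  have "ord_lt R N {\<zero>\<^sub>N'} n (ad R N r \<delta>)" using Suc.prems(2) r by simp
  then show "ord_lt R N {\<zero>\<^sub>N'} n (bracket (ring_module R) N \<delta> r)"
   unfolding br by (rule ord_lt_cong[OF R.ring_axioms, THEN iffD1, rotated]) simp
 qed
 then show ?case using Suc.prems(1) by simp
qed

lemma zero_submodule_N: "submodule {\<zero>\<^sub>N'} R N"
 using N.zero_submodule by simp

lemma ord_lt_submodule: "submodule {\<delta> \<in> H. ord_lt R N {\<zero>\<^sub>N'} n \<delta>} S M"
proof (rule condition_submodule)
 show "ord_lt R N {\<zero>\<^sub>N'} n (\<lambda>m\<in>carrier R. \<zero>\<^sub>N')"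
  by (rule N.ord_lt_if_values[OF zero_submodule_N]) simp
next
 fix \<delta> \<epsilon> assume d: "\<delta> \<in> H" "\<epsilon> \<in> H" "ord_lt R N {\<zero>\<^sub>N'} n \<delta>" "ord_lt R N {\<zero>\<^sub>N'} n \<epsilon>"
 have "ord_lt R N {\<zero>\<^sub>N'} n (\<lambda>x. \<delta> x \<oplus>\<^sub>N' \<epsilon> x)"
  using N.ord_lt_add[OF zero_submodule_N, of \<delta> \<epsilon> n] d HomD(1) by simp
 then show "ord_lt R N {\<zero>\<^sub>N'} n (\<lambda>m\<in>carrier R. \<delta> m \<oplus>\<^sub>N' \<epsilon> m)"
  by (rule ord_lt_cong[OF R.ring_axioms, THEN iffD1, rotated]) simp
next
 fix c \<delta> assume c: "c \<in> carrier S" and d: "\<delta> \<in> H" "ord_lt R N {\<zero>\<^sub>N'} n \<delta>"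
 have "ord_lt R N {\<zero>\<^sub>N'} n (\<lambda>x. c \<odot>\<^sub>N' \<delta> x)"
 proof (rule N.ord_lt_comp[where h = "\<lambda>y. c \<odot>\<^sub>N' y" and D = "carrier N'" and L = "{\<zero>\<^sub>N'}"])
  show "module R N" by (rule module_restrict_scalars[OF R f N'])
  show "submodule (carrier N') R N" using N.carrier_is_submodule by simp
  show "c \<odot>\<^sub>N' (f r \<odot>\<^sub>N' a) = r \<odot>\<^sub>N (c \<odot>\<^sub>N' a)" if "r \<in> carrier R" "a \<in> carrier N'" for r a
   using that c by (simp add: N'.smult_assoc1[symmetric] N'.R.m_comm)
 qed (use c d HomD(1) in \<open>auto simp: N'.smult_r_distr\<close>)
 then show "ord_lt R N {\<zero>\<^sub>N'} n (\<lambda>m\<in>carrier R. c \<odot>\<^sub>N' \<delta> m)"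
  by (rule ord_lt_cong[OF R.ring_axioms, THEN iffD1, rotated]) simp
qed

text \<open>Sums and left multiples stay in \<open>gen U\<close> by construction, so stability under
  the enveloping ring amounts to stability under multiplication in the argument. Each required
  property defines a left submodule, so it passes from \<open>U\<close> to its span.\<close>

theorem operator_module:
 assumes U: "finite U" "U \<subseteq> H" and ord: "!!\<delta>. \<delta> \<in> U ==> ord_lt R N {\<zero>\<^sub>N'} n \<delta>"
  and I: "I = {x \<in> carrier R. \<forall>\<delta>\<in>U. \<delta> x = \<zero>\<^sub>N'}"
  and stable: "!!\<delta> s. \<delta> \<in> U ==> s \<in> carrier R ==> (\<lambda>x\<in>carrier R. \<delta> (s \<otimes> x)) \<in> gen U"
 shows "gen U \<subseteq> Diff_lt R A (ring_module R) N n"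
  and "env_submodule R A (ring_module R) N (gen U)"
  and "I = solutions (ring_module R) N (gen U)"
  and "fg_submodule (gen U) S M"
proof -
 have E: "submodule (gen U) S M" by (rule gen_submodule[OF U(2)])
 have EH: "gen U \<subseteq> H" by (rule gen_subset[OF U(2)])
 have "gen U \<subseteq> {\<delta> \<in> H. ord_lt R N {\<zero>\<^sub>N'} n \<delta>}"
  by (rule gen_min[OF ord_lt_submodule]) (use U(2) ord in auto)
 then show "gen U \<subseteq> Diff_lt R A (ring_module R) N n" using Diff_lt_if_ord_lt by auto
 show "fg_submodule (gen U) S M" by (rule fg_submodule_gen[OF U])
 have IR: "I \<subseteq> carrier R" unfolding I by auto
 have "submodule {\<delta> \<in> H. \<forall>x\<in>I. \<delta> x = \<zero>\<^sub>N'} S M"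
  by (rule condition_submodule) (use IR in \<open>auto simp: subset_iff\<close>)
 then have "gen U \<subseteq> {\<delta> \<in> H. \<forall>x\<in>I. \<delta> x = \<zero>\<^sub>N'}"
  by (rule gen_min) (use U(2) in \<open>auto simp: I\<close>)
 then have "I \<subseteq> {x \<in> carrier R. \<forall>\<delta>\<in>gen U. \<delta> x = \<zero>\<^sub>N'}" using IR by blast
 moreover have "{x \<in> carrier R. \<forall>\<delta>\<in>gen U. \<delta> x = \<zero>\<^sub>N'} \<subseteq> I" unfolding I using gen_incl by blast
 ultimately show "I = solutions (ring_module R) N (gen U)"
  unfolding solutions_def by simp
 have "submodule {\<delta> \<in> H. \<forall>s\<in>carrier R. (\<lambda>x\<in>carrier R. \<delta> (s \<otimes> x)) \<in> gen U} S M"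
 proof (rule condition_submodule)
  have "(\<lambda>m\<in>carrier R. \<zero>\<^sub>N') \<in> gen U"
   by (rule submodule_zero[OF E])
  moreover have "(\<lambda>x\<in>carrier R. (\<lambda>m\<in>carrier R. \<zero>\<^sub>N') (s \<otimes> x)) = (\<lambda>m\<in>carrier R. \<zero>\<^sub>N')" if "s \<in> carrier R" for s
   by (rule restrict_ext) (use that in simp)
  ultimately show "\<forall>s\<in>carrier R. (\<lambda>x\<in>carrier R. (\<lambda>m\<in>carrier R. \<zero>\<^sub>N') (s \<otimes> x)) \<in> gen U" by metis
 next
  fix \<delta> \<epsilon>
  assume d: "\<forall>s\<in>carrier R. (\<lambda>x\<in>carrier R. \<delta> (s \<otimes> x)) \<in> gen U" "\<forall>s\<in>carrier R. (\<lambda>x\<in>carrier R. \<epsilon> (s \<otimes> x)) \<in> gen U"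
  show "\<forall>s\<in>carrier R. (\<lambda>x\<in>carrier R. (\<lambda>m\<in>carrier R. \<delta> m \<oplus>\<^sub>N' \<epsilon> m) (s \<otimes> x)) \<in> gen U"
  proof
   fix s assume s: "s \<in> carrier R"
   have "(\<lambda>x\<in>carrier R. (\<lambda>m\<in>carrier R. \<delta> m \<oplus>\<^sub>N' \<epsilon> m) (s \<otimes> x))
     = (\<lambda>x\<in>carrier R. \<delta> (s \<otimes> x)) \<oplus>\<^sub>M (\<lambda>x\<in>carrier R. \<epsilon> (s \<otimes> x))"
    unfolding Hom_module_simps by (rule restrict_ext) (use s in simp)
   also have "\<dots> \<in> gen U" by (rule M.submoduleE(5)[OF E bspec[OF d(1) s] bspec[OF d(2) s]])
   finally show "(\<lambda>x\<in>carrier R. (\<lambda>m\<in>carrier R. \<delta> m \<oplus>\<^sub>N' \<epsilon> m) (s \<otimes> x)) \<in> gen U" .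
  qed
 next
  fix c \<delta>
  assume c: "c \<in> carrier S" and d: "\<forall>s\<in>carrier R. (\<lambda>x\<in>carrier R. \<delta> (s \<otimes> x)) \<in> gen U"
  show "\<forall>s\<in>carrier R. (\<lambda>x\<in>carrier R. (\<lambda>m\<in>carrier R. c \<odot>\<^sub>N' \<delta> m) (s \<otimes> x)) \<in> gen U"
  proof
   fix s assume s: "s \<in> carrier R"
   have "(\<lambda>x\<in>carrier R. (\<lambda>m\<in>carrier R. c \<odot>\<^sub>N' \<delta> m) (s \<otimes> x)) = c \<odot>\<^sub>M (\<lambda>x\<in>carrier R. \<delta> (s \<otimes> x))"
    unfolding Hom_module_simps by (rule restrict_ext) (use s in simp)
   also have "\<dots> \<in> gen U" by (rule M.submoduleE(4)[OF E c bspec[OF d s]])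
   finally show "(\<lambda>x\<in>carrier R. (\<lambda>m\<in>carrier R. c \<odot>\<^sub>N' \<delta> m) (s \<otimes> x)) \<in> gen U" .
  qed
 qed
 then have "gen U \<subseteq> {\<delta> \<in> H. \<forall>s\<in>carrier R. (\<lambda>x\<in>carrier R. \<delta> (s \<otimes> x)) \<in> gen U}"
  by (rule gen_min) (use U(2) stable in auto)
 then have stable': "(\<lambda>x\<in>carrier R. \<delta> (s \<otimes> x)) \<in> gen U" if "\<delta> \<in> gen U" "s \<in> carrier R" for \<delta> s
  using that by blast
 show "env_submodule R A (ring_module R) N (gen U)"
  unfolding env_submodule_def
 proof (intro submodule.intro submodule_axioms.intro)
  show "subgroup (gen U) (add_monoid (Hom_module A (ring_module R) N (enveloping_act (ring_module R) N)))"
   using submodule.axioms(1)[OF E] unfolding subgroup_def Hom_module_def by (simp add: m_inv_def)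
 next
  fix T \<delta> assume T: "T \<in> carrier (enveloping_ring R A)" and d: "\<delta> \<in> gen U"
  define u where "u = (SOME u. u \<in> T)"
  have "u \<in> T" unfolding u_def using enveloping_ring_representatives(1)[OF R A T] by (simp add: some_in_eq)
  then have keys: "keys u \<subseteq> carrier R \<times> carrier R"
   by (rule enveloping_ring_representatives(2)[OF R A T])
  \<comment> \<open>The integer multiplicity and the left factor of a pair merge into one scalar of
    \<open>S\<close>; the right factor multiplies the argument and is covered by
    \<open>stable'\<close>.\<close>
  let ?c = "\<lambda>q. add_pow S (lookup u q) \<one>\<^sub>S \<otimes>\<^sub>S f (fst q)"
   and ?d = "\<lambda>q. (\<lambda>x\<in>carrier R. \<delta> (snd q \<otimes> x))"
  have "enveloping_act (ring_module R) N T \<delta> = (\<lambda>x\<in>carrier R. \<Oplus>\<^sub>N' q\<in>keys u.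
    add_pow N' (lookup u q) (f (fst q) \<odot>\<^sub>N' \<delta> (snd q \<otimes> x)))"
   unfolding enveloping_act_def u_def Let_def by simp
  also have "\<dots> = (\<lambda>x\<in>carrier R. \<Oplus>\<^sub>N' q\<in>keys u. ?c q \<odot>\<^sub>N' ?d q x)"
  proof (rule restrict_ext)
   fix x assume x: "x \<in> carrier R"
   have dH: "\<delta> \<in> H" using d EH by blast
   have *: "fst q \<in> carrier R \<and> snd q \<in> carrier R" if "q \<in> keys u" for q using keys that by auto
   show "(\<Oplus>\<^sub>N' q\<in>keys u. add_pow N' (lookup u q) (f (fst q) \<odot>\<^sub>N' \<delta> (snd q \<otimes> x)))
     = (\<Oplus>\<^sub>N' q\<in>keys u. ?c q \<odot>\<^sub>N' ?d q x)"
   proof (rule N'.add.finprod_cong')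
    fix q assume "q \<in> keys u"
    from *[OF this] x show "add_pow N' (lookup u q) (f (fst q) \<odot>\<^sub>N' \<delta> (snd q \<otimes> x)) = ?c q \<odot>\<^sub>N' ?d q x"
     using HomD(1)[OF dH] by (simp add: N'.add_pow_int_eq_smult N'.smult_assoc1)
   qed (use * x HomD(1)[OF dH] in auto)
  qed
  also have "\<dots> \<in> gen U"
  proof (rule submodule_sum_closed[OF E])
   fix q assume "q \<in> keys u"
   then have q: "fst q \<in> carrier R" "snd q \<in> carrier R" using keys by auto
   show "?c q \<in> carrier S" using q(1) by simp
   show "?d q \<in> gen U" by (rule stable'[OF d q(2)])
  qed simp
  finally have "enveloping_act (ring_module R) N T \<delta> \<in> gen U" .
  moreover have "T \<odot>\<^bsub>Hom_module A (ring_module R) N (enveloping_act (ring_module R) N)\<^esub> \<delta>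
    = enveloping_act (ring_module R) N T \<delta>"
   by (simp add: Hom_module_def)
  ultimately show "T \<odot>\<^bsub>Hom_module A (ring_module R) N (enveloping_act (ring_module R) N)\<^esub> \<delta> \<in> gen U"
   by (simp only:)
 qed
qed

end

section \<open>Operators determined by finitely many values\<close>

text \<open>For \<open>G\<close> the union of \<open>A\<close> and a finite set, this is what
  \<open>ess_finite_type\<close> provides inside \<open>R\<close> itself: commutators can then be
  controlled through generators, sums, products and inverses of units.\<close>

definition fraction_generated :: "('a, 'r) ring_scheme => 'a set => bool" where
 "fraction_generated R G \<longleftrightarrow> (\<forall>r\<in>carrier R. \<exists>c\<in>generate_ring R G. \<exists>w\<in>generate_ring R G.
   w \<in> Units R \<and> r = c \<otimes>\<^sub>R inv\<^bsub>R\<^esub> w)"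

context module
begin

context
 fixes D assumes D: "D \<in> carrier R \<rightarrow> carrier M"
  and D_add: "!!x y. x \<in> carrier R ==> y \<in> carrier R ==> D (x \<oplus> y) = D x \<oplus>\<^sub>M D y"
begin

lemma additive_zero: "D \<zero> = \<zero>\<^sub>M"
proof -
 have "D \<zero> \<in> carrier M" using D by auto
 then show ?thesis using D_add[of \<zero> \<zero>] by simp
qed

lemma additive_minus: "x \<in> carrier R ==> D (\<ominus> x) = \<ominus>\<^sub>M D x"
proof -
 assume x: "x \<in> carrier R"
 then have c: "D x \<in> carrier M" "D (\<ominus> x) \<in> carrier M" using D by auto
 have "D (\<ominus> x) \<oplus>\<^sub>M D x = \<zero>\<^sub>M" using D_add[of "\<ominus> x" x] x additive_zero by (simp add: R.l_neg)
 then show ?thesis using M.minus_equality[OF _ c(1,2)] by simp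
qed

lemma ad_add:
 assumes "r \<in> carrier R" "x \<in> carrier R" "y \<in> carrier R"
 shows "ad R M r D (x \<oplus> y) = ad R M r D x \<oplus>\<^sub>M ad R M r D y"
proof -
 have "D x \<in> carrier M" "D y \<in> carrier M" "D (r \<otimes> x) \<in> carrier M" "D (r \<otimes> y) \<in> carrier M"
  using D assms by auto
 then show ?thesis using assms
  by (simp add: ad_def D_add R.r_distr smult_r_distr M.minus_eq M.minus_add M.a_ac)
qed

lemma ad_linear:
 assumes lin: "!!x. x \<in> carrier R ==> D (a \<otimes> x) = a \<odot>\<^sub>M D x"
  and "a \<in> carrier R" "r \<in> carrier R" "x \<in> carrier R"
 shows "ad R M r D (a \<otimes> x) = a \<odot>\<^sub>M ad R M r D x"
proof -
 have c: "D x \<in> carrier M" "D (r \<otimes> x) \<in> carrier M" using D assms by auto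
 have "D (r \<otimes> (a \<otimes> x)) = a \<odot>\<^sub>M D (r \<otimes> x)" using lin[of "r \<otimes> x"] assms by (simp add: R.m_lcomm)
 moreover have "r \<odot>\<^sub>M (a \<odot>\<^sub>M D x) = a \<odot>\<^sub>M (r \<odot>\<^sub>M D x)"
  using assms c by (simp add: smult_assoc1[symmetric] R.m_comm)
 ultimately show ?thesis
  using assms c by (simp add: ad_def lin M.minus_eq smult_r_distr smult_r_minus)
qed

lemma ad_one: "x \<in> carrier R ==> ad R M \<one> D x = \<zero>\<^sub>M"
 using funcset_mem[OF D, of x] by (simp add: ad_def M.minus_eq M.r_neg)

lemma ad_uminus:
 assumes "r \<in> carrier R" "x \<in> carrier R"
 shows "ad R M (\<ominus> r) D x = \<ominus>\<^sub>M ad R M r D x"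
proof -
 have c: "D x \<in> carrier M" "D (r \<otimes> x) \<in> carrier M" using D assms by auto
 then show ?thesis using assms additive_minus[of "r \<otimes> x"]
  by (simp add: ad_def R.l_minus smult_l_minus M.minus_eq M.minus_add)
qed

lemma ad_plus:
 assumes "r \<in> carrier R" "s \<in> carrier R" "x \<in> carrier R"
 shows "ad R M (r \<oplus> s) D x = ad R M r D x \<oplus>\<^sub>M ad R M s D x"
proof -
 have c: "D x \<in> carrier M" "D (r \<otimes> x) \<in> carrier M" "D (s \<otimes> x) \<in> carrier M" using D assms by auto
 then show ?thesis using assms
  by (simp add: ad_def R.l_distr smult_l_distr D_add M.minus_eq M.minus_add M.a_ac)
qed

text \<open>A Leibniz rule for commutators. It carries information from generators to products and,
  applied to \<open>inv w \<otimes> w\<close>, to inverses.\<close>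

lemma ad_mult:
 assumes "r \<in> carrier R" "s \<in> carrier R" "x \<in> carrier R"
 shows "ad R M (r \<otimes> s) D x = ad R M r D (s \<otimes> x) \<oplus>\<^sub>M r \<odot>\<^sub>M ad R M s D x"
proof -
 have c: "D x \<in> carrier M" "D (r \<otimes> (s \<otimes> x)) \<in> carrier M" "D (s \<otimes> x) \<in> carrier M" using D assms by auto
 define a b e where "a = D (r \<otimes> (s \<otimes> x))" and "b = r \<odot>\<^sub>M D (s \<otimes> x)" and "e = r \<odot>\<^sub>M (s \<odot>\<^sub>M D x)"
 have abe: "a \<in> carrier M" "b \<in> carrier M" "e \<in> carrier M" using c assms by (auto simp: a_def b_def e_def)
 have "(a \<oplus>\<^sub>M \<ominus>\<^sub>M b) \<oplus>\<^sub>M (b \<oplus>\<^sub>M \<ominus>\<^sub>M e) = a \<oplus>\<^sub>M \<ominus>\<^sub>M e"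
  using abe by (simp add: M.a_assoc M.r_neg1)
 then show ?thesis using assms c
  by (simp add: ad_def a_def b_def e_def R.m_assoc smult_assoc1 smult_r_distr smult_r_minus M.minus_eq)
qed

end

text \<open>An operator of finite order is determined modulo \<open>L\<close> by its values on finitely many
 monomials: inductively all commutators with ring elements take values in \<open>L\<close>, because this
 holds for the generators and is inherited by sums, products and inverses.\<close>

lemma values_in_submodule:
 assumes L: "submodule L R M" and G: "A \<subseteq> carrier R" "U \<subseteq> carrier R" "fraction_generated R (A \<union> U)"
  and D: "D \<in> carrier R \<rightarrow> carrier M"
  "!!x y. x \<in> carrier R ==> y \<in> carrier R ==> D (x \<oplus> y) = D x \<oplus>\<^sub>M D y"
  "!!a x. a \<in> A ==> x \<in> carrier R ==> D (a \<otimes> x) = a \<odot>\<^sub>M D x"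
  and ord: "ord_lt R M L n D"
  and mon: "!!xs. set xs \<subseteq> U ==> length xs < n ==> D (foldr (\<otimes>) xs \<one>) \<in> L"
  and x: "x \<in> carrier R"
 shows "D x \<in> L"
 using D ord mon x
proof (induction n arbitrary: D x)
 case 0
 then show ?case by simp
next
 case (Suc n)
 note D = Suc.prems(1,2,3)
 have zL: "\<zero>\<^sub>M \<in> L" using subgroup.one_closed[OF submodule.axioms(1)[OF L]] by simp
 have adU: "ad R M u D x \<in> L" if u: "u \<in> U" and x: "x \<in> carrier R" for u x
 proof (rule Suc.IH)
  have uR: "u \<in> carrier R" using u G by blast
  show "ad R M u D \<in> carrier R \<rightarrow> carrier M" by (rule ad_closed[OF D(1) uR])
  show "ad R M u D (x \<oplus> y) = ad R M u D x \<oplus>\<^sub>M ad R M u D y" if "x \<in> carrier R" "y \<in> carrier R" for x y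
   by (rule ad_add[OF D(1,2) uR that])
  show "ad R M u D (a \<otimes> x) = a \<odot>\<^sub>M ad R M u D x" if "a \<in> A" "x \<in> carrier R" for a x
   by (rule ad_linear[OF D(1,2) D(3)[OF that(1)] _ uR that(2)]) (use that G in auto)
  show "ord_lt R M L n (ad R M u D)" using Suc.prems(4) uR by simp
  show "ad R M u D (foldr (\<otimes>) xs \<one>) \<in> L" if xs: "set xs \<subseteq> U" "length xs < n" for xs
  proof -
   \<comment> \<open>The extra factor \<open>u\<close> lengthens the monomial by one, matching the
     passage from \<open>n\<close> to \<open>Suc n\<close>.\<close>
   have "D (u \<otimes> foldr (\<otimes>) xs \<one>) \<in> L" using Suc.prems(5)[of "u # xs"] u xs by simp
   moreover have "D (foldr (\<otimes>) xs \<one>) \<in> L" using Suc.prems(5)[of xs] xs by simp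
   ultimately show ?thesis
    unfolding ad_def M.minus_eq by (intro submoduleE(5)[OF L] submoduleE(3)[OF L] submoduleE(4)[OF L uR])
  qed
  show "x \<in> carrier R" by fact
 qed
 have GR: "A \<union> U \<subseteq> carrier R" using G by blast
 have gen: "c \<in> carrier R \<and> (\<forall>x\<in>carrier R. ad R M c D x \<in> L)" if "c \<in> generate_ring R (A \<union> U)" for c
  using that
 proof (induction c rule: generate_ring.induct)
  case one
  then show ?case using ad_one[OF D(1,2)] zL by simp
 next
  case (incl h)
  then show ?case
  proof
   assume h: "h \<in> A"
   then have hR: "h \<in> carrier R" using G by blast
   have "ad R M h D x = \<zero>\<^sub>M" if "x \<in> carrier R" for x
   proof -
    have "D x \<in> carrier M" using D(1) that by auto
    then show ?thesis using D(3)[OF h that] hR by (simp add: ad_def M.minus_eq M.r_neg)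
   qed
   then show ?thesis using hR zL by simp
  next
   assume h: "h \<in> U"
   then show ?thesis using adU G by blast
  qed
 next
  case (a_inv h)
  then show ?case using ad_uminus[OF D(1,2)] submoduleE(3)[OF L] by simp
 next
  case (eng_add h1 h2)
  then show ?case using ad_plus[OF D(1,2)] submoduleE(5)[OF L] by simp
 next
  case (eng_mult h1 h2)
  have "ad R M (h1 \<otimes> h2) D x \<in> L" if x: "x \<in> carrier R" for x
  proof -
   have "ad R M (h1 \<otimes> h2) D x = ad R M h1 D (h2 \<otimes> x) \<oplus>\<^sub>M h1 \<odot>\<^sub>M ad R M h2 D x"
    using eng_mult x by (intro ad_mult[OF D(1,2)]) auto
   then show ?thesis using eng_mult x submoduleE(5)[OF L] submoduleE(4)[OF L] by simp
  qed
  then show ?case using eng_mult by simp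
 qed
 \<comment> \<open>The Leibniz rule for \<open>inv w \<otimes> w = \<one>\<close>, where the
   commutator is zero, is solved for the commutator with \<open>inv w\<close>.\<close>
 have inv: "ad R M (inv w) D x \<in> L" if w: "w \<in> generate_ring R (A \<union> U)" "w \<in> Units R" and x: "x \<in> carrier R" for w x
 proof -
  have wR: "w \<in> carrier R" "inv w \<in> carrier R" "inv w \<otimes> w = \<one>" using w(2) by auto
  have "ad R M (inv w \<otimes> w) D x = ad R M (inv w) D (w \<otimes> x) \<oplus>\<^sub>M inv w \<odot>\<^sub>M ad R M w D x" if "x \<in> carrier R" for x
   using ad_mult[OF D(1,2) wR(2,1) that] .
  from this[of "inv w \<otimes> x"] have "\<zero>\<^sub>M = ad R M (inv w) D x \<oplus>\<^sub>M inv w \<odot>\<^sub>M ad R M w D (inv w \<otimes> x)"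
   using wR x ad_one[OF D(1,2), of "inv w \<otimes> x"] w(2) by (simp add: R.m_assoc[symmetric] R.Units_r_inv)
  moreover have b: "inv w \<odot>\<^sub>M ad R M w D (inv w \<otimes> x) \<in> L" (is "?b \<in> L")
   using gen[OF w(1)] wR x submoduleE(4)[OF L] by simp
  moreover have "ad R M (inv w) D x \<in> carrier M" "?b \<in> carrier M"
   using ad_closed[OF D(1) wR(2)] x b submoduleE(1)[OF L] by auto
  ultimately have "ad R M (inv w) D x = \<ominus>\<^sub>M ?b" using M.minus_equality by metis
  then show ?thesis using submoduleE(3)[OF L b] by simp
 qed
 obtain c w where c: "c \<in> generate_ring R (A \<union> U)" "w \<in> generate_ring R (A \<union> U)" "w \<in> Units R" "x = c \<otimes> inv w"
  using G(3) Suc.prems(6) unfolding fraction_generated_def by blast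
 have iw: "inv w \<in> carrier R" using c(3) by simp
 have cR: "c \<in> carrier R" using gen[OF c(1)] by blast
 have "ad R M x D \<one> = ad R M c D (inv w \<otimes> \<one>) \<oplus>\<^sub>M c \<odot>\<^sub>M ad R M (inv w) D \<one>"
  unfolding c(4) by (rule ad_mult[OF D(1,2) cR iw R.one_closed])
 then have adx: "ad R M x D \<one> \<in> L"
  using gen[OF c(1)] inv[OF c(2,3)] iw cR submoduleE(5)[OF L] submoduleE(4)[OF L] by simp
 have D1: "D \<one> \<in> L" using Suc.prems(5)[of "[]"] by simp
 have cl: "D x \<in> carrier M" "D \<one> \<in> carrier M" "x \<odot>\<^sub>M D \<one> \<in> L"
  using D(1) Suc.prems(6) submoduleE(4)[OF L _ D1] by auto
 \<comment> \<open>The commutator with \<open>x\<close>, evaluated at 1, recovers the value at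
   \<open>x\<close> from the value at 1.\<close>
 have "D x = ad R M x D \<one> \<oplus>\<^sub>M x \<odot>\<^sub>M D \<one>"
  using cl Suc.prems(6) by (simp add: ad_def M.minus_eq M.a_assoc M.l_neg)
 then show ?case using submoduleE(5)[OF L adx cl(3)] by simp
qed

lemma common_denominator:
 assumes P: "primeideal P R" and L: "submodule L R M"
  and den: "!!y. y \<in> carrier M ==> \<exists>d\<in>carrier R - P. d \<odot>\<^sub>M y \<in> L"
  and "finite Y" "Y \<subseteq> carrier M"
 shows "\<exists>d\<in>carrier R - P. \<forall>y\<in>Y. d \<odot>\<^sub>M y \<in> L"
 using assms(4,5)
proof (induction Y rule: finite_induct)
 case empty
 have "\<one> \<notin> P" using ideal.one_imp_carrier[OF primeideal.axioms(1)[OF P]] primeideal.I_notcarr[OF P] by blast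
 then show ?case by blast
next
 case (insert y Y)
 obtain d where d: "d \<in> carrier R - P" "\<forall>y\<in>Y. d \<odot>\<^sub>M y \<in> L" using insert by blast
 obtain e where e: "e \<in> carrier R - P" "e \<odot>\<^sub>M y \<in> L" using den insert.prems by blast
 have "d \<otimes> e \<in> carrier R - P" using d e primeideal.I_prime[OF P] by blast
 moreover have "(d \<otimes> e) \<odot>\<^sub>M z \<in> L" if z: "z \<in> insert y Y" for z
 proof (cases "z = y")
  case True
  then show ?thesis using d e insert.prems submoduleE(4)[OF L] by (simp add: smult_assoc1)
 next
  case False
  have "(d \<otimes> e) \<odot>\<^sub>M z = e \<odot>\<^sub>M (d \<odot>\<^sub>M z)"
   using d e z insert.prems by (subst R.m_comm) (auto simp: smult_assoc1)
  then show ?thesis using d e z False submoduleE(4)[OF L] by simp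
 qed
 ultimately show ?case by blast
qed

end

lemma finite_short_monomials:
 assumes "finite U" shows "finite {foldr m xs e |xs. set xs \<subseteq> U \<and> length xs < n}"
proof -
 have "finite {xs. set xs \<subseteq> U \<and> length xs \<le> n}" by (rule finite_lists_length_le[OF assms])
 then have "finite {xs. set xs \<subseteq> U \<and> length xs < n}" by (rule finite_subset[rotated]) auto
 then show ?thesis by (simp add: setcompr_eq_image)
qed

context hom_setting
begin

lemma HomD':
 assumes "(\<lambda>x\<in>carrier R. \<epsilon> x) \<in> H"
 shows "\<epsilon> \<in> carrier R \<rightarrow> carrier N'" "x \<in> carrier R ==> \<epsilon> x \<in> carrier N'"
  "x \<in> carrier R ==> y \<in> carrier R ==> \<epsilon> (x \<oplus> y) = \<epsilon> x \<oplus>\<^sub>N' \<epsilon> y"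
  "a \<in> A ==> x \<in> carrier R ==> \<epsilon> (a \<otimes> x) = f a \<odot>\<^sub>N' \<epsilon> x"
proof -
 show c: "\<epsilon> x \<in> carrier N'" if "x \<in> carrier R" for x using HomD(1)[OF assms that] that by simp
 then show "\<epsilon> \<in> carrier R \<rightarrow> carrier N'" by blast
 show "\<epsilon> (x \<oplus> y) = \<epsilon> x \<oplus>\<^sub>N' \<epsilon> y" if "x \<in> carrier R" "y \<in> carrier R"
  using HomD(2)[OF assms that] that by simp
 show "\<epsilon> (a \<otimes> x) = f a \<odot>\<^sub>N' \<epsilon> x" if "a \<in> A" "x \<in> carrier R"
  using HomD(3)[OF assms that] that A by (simp add: subset_iff)
qed

lemma Hom_translate:
 assumes "(\<lambda>x\<in>carrier R. \<epsilon> x) \<in> H" "t \<in> carrier R"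
 shows "(\<lambda>x\<in>carrier R. \<epsilon> (t \<otimes> x)) \<in> H"
proof (rule HomI)
 fix a x assume ax: "a \<in> A" "x \<in> carrier R"
 then have "a \<in> carrier R" using A by blast
 then show "\<epsilon> (t \<otimes> (a \<otimes> x)) = f a \<odot>\<^sub>N' \<epsilon> (t \<otimes> x)"
  using HomD'(4)[OF assms(1) ax(1), of "t \<otimes> x"] ax assms(2) by (simp add: R.m_lcomm)
qed (use assms(2) in \<open>simp_all add: HomD'[OF assms(1)] R.r_distr\<close>)

lemma Hom_ad:
 assumes e: "(\<lambda>x\<in>carrier R. \<epsilon> x) \<in> H" and r: "r \<in> carrier R"
 shows "(\<lambda>x\<in>carrier R. ad R N r \<epsilon> x) \<in> H"
proof (rule HomI)
 show "ad R N r \<epsilon> x \<in> carrier N'" if "x \<in> carrier R" for x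
  using funcset_mem[OF N.ad_closed[OF HomD'(1)[OF e] r] that] .
 show "ad R N r \<epsilon> (x \<oplus> y) = ad R N r \<epsilon> x \<oplus>\<^sub>N' ad R N r \<epsilon> y" if "x \<in> carrier R" "y \<in> carrier R" for x y
  by (rule N.ad_add[OF HomD'(1)[OF e] HomD'(3)[OF e] r that])
 show "ad R N r \<epsilon> (a \<otimes> x) = f a \<odot>\<^sub>N' ad R N r \<epsilon> x" if "a \<in> A" "x \<in> carrier R" for a x
  by (rule N.ad_linear[OF HomD'(1)[OF e] HomD'(3)[OF e] HomD'(4)[OF e that(1)] _ r that(2)]) (use A that in auto)
qed

lemma Hom_uminus:
 assumes dH: "(\<lambda>x\<in>carrier R. d x) \<in> H"
 shows "\<ominus>\<^sub>M (\<lambda>x\<in>carrier R. d x) = (\<lambda>x\<in>carrier R. \<ominus>\<^sub>N' d x)"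
proof -
 have dc: "d x \<in> carrier N'" if "x \<in> carrier R" for x using HomD'(2)[OF dH that] .
 have "\<ominus>\<^sub>M (\<lambda>x\<in>carrier R. d x) = (\<ominus>\<^sub>S \<one>\<^sub>S) \<odot>\<^sub>M (\<lambda>x\<in>carrier R. d x)"
  using M.smult_l_minus[of "\<one>\<^sub>S" "\<lambda>x\<in>carrier R. d x"] M.smult_one[of "\<lambda>x\<in>carrier R. d x"] dH
  by (simp only: Hom_module_simps(1) N'.R.one_closed)
 also have "\<dots> = (\<lambda>x\<in>carrier R. \<ominus>\<^sub>N' d x)"
  unfolding Hom_module_simps by (rule restrict_ext) (simp add: dc N'.smult_l_minus)
 finally show ?thesis .
qed

text \<open>The translates of \<open>\<epsilon>\<close> are viewed as one operator from
  \<open>R\<close> to the module of maps, sending t to the translate by t. Its commutators are the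
  translates of the commutators of \<open>\<epsilon>\<close>, so its order is bounded in the same
  way and \<open>values_in_submodule\<close> applies to it.\<close>

lemma ord_lt_translates:
 assumes e: "(\<lambda>x\<in>carrier R. \<epsilon> x) \<in> H"
  and ord: "ord_lt R N {\<zero>\<^sub>N'} n \<epsilon>" and E: "(\<lambda>x\<in>carrier R. \<zero>\<^sub>N') \<in> E"
 shows "ord_lt R (restrict_scalars f M) E n (\<lambda>t. \<lambda>x\<in>carrier R. \<epsilon> (t \<otimes> x))"
 using e ord
proof (induction n arbitrary: \<epsilon>)
 case 0
 have "(\<lambda>x\<in>carrier R. \<epsilon> (t \<otimes> x)) = (\<lambda>x\<in>carrier R. \<zero>\<^sub>N')" if "t \<in> carrier R" for t
  by (rule restrict_ext) (use 0 that in simp)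
 then show ?case using E by (simp only: ord_lt.simps) simp
next
 case (Suc n)
 have "ord_lt R (restrict_scalars f M) E n (ad R (restrict_scalars f M) r (\<lambda>t. \<lambda>x\<in>carrier R. \<epsilon> (t \<otimes> x)))"
  if r: "r \<in> carrier R" for r
 proof -
  have "ord_lt R N {\<zero>\<^sub>N'} n (ad R N r \<epsilon>)" using Suc.prems(2) r by simp
  from Suc.IH[OF Hom_ad[OF Suc.prems(1) r] this]
  have "ord_lt R (restrict_scalars f M) E n (\<lambda>t. \<lambda>x\<in>carrier R. ad R N r \<epsilon> (t \<otimes> x))" .
  then show ?thesis
  proof (rule ord_lt_cong[OF R.ring_axioms, THEN iffD1, rotated])
   fix t assume t: "t \<in> carrier R"
   have tH: "(\<lambda>x\<in>carrier R. \<epsilon> (t \<otimes> x)) \<in> H" by (rule Hom_translate[OF Suc.prems(1) t])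
   have fr: "f r \<odot>\<^sub>M (\<lambda>x\<in>carrier R. \<epsilon> (t \<otimes> x)) = (\<lambda>x\<in>carrier R. f r \<odot>\<^sub>N' \<epsilon> (t \<otimes> x))"
    unfolding Hom_module_simps by (rule restrict_ext) simp
   have frH: "(\<lambda>x\<in>carrier R. f r \<odot>\<^sub>N' \<epsilon> (t \<otimes> x)) \<in> H"
    using M.submoduleE(4)[OF M.carrier_is_submodule, of "f r", OF f_closed[OF r], of "\<lambda>x\<in>carrier R. \<epsilon> (t \<otimes> x)"] tH
    by (simp only: fr Hom_module_simps(1))
   have "ad R (restrict_scalars f M) r (\<lambda>t. \<lambda>x\<in>carrier R. \<epsilon> (t \<otimes> x)) t =
     (\<lambda>x\<in>carrier R. \<epsilon> ((r \<otimes> t) \<otimes> x)) \<oplus>\<^sub>M (\<lambda>x\<in>carrier R. \<ominus>\<^sub>N' (f r \<odot>\<^sub>N' \<epsilon> (t \<otimes> x)))"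
    unfolding ad_def restrict_scalars_minus restrict_scalars_simps M.minus_eq fr Hom_uminus[OF frH] ..
   also have "\<dots> = (\<lambda>x\<in>carrier R. ad R N r \<epsilon> (t \<otimes> x))"
    unfolding Hom_module_simps
    by (rule restrict_ext) (use r t in \<open>simp add: ad_def N'.minus_eq R.m_assoc\<close>)
   finally show "(\<lambda>x\<in>carrier R. ad R N r \<epsilon> (t \<otimes> x)) =
     ad R (restrict_scalars f M) r (\<lambda>t. \<lambda>x\<in>carrier R. \<epsilon> (t \<otimes> x)) t" by (rule sym)
  qed
 qed
 then show ?case unfolding ord_lt.simps by (rule ballI)
qed

text \<open>The span of \<open>W\<close> need not be stable under multiplication in the argument.
  Adding the translates by monomials of length below \<open>n\<close> in the generators repairs
  this: by \<open>values_in_submodule\<close>, applied to the operator formed by all translates,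
  they span every translate. Since \<open>I\<close> is an ideal, the added translates do not shrink
  the set of common zeros.\<close>

theorem operator_module_of_family:
 assumes W: "finite W" "!!\<epsilon>. \<epsilon> \<in> W ==> (\<lambda>x\<in>carrier R. \<epsilon> x) \<in> H"
  "!!\<epsilon>. \<epsilon> \<in> W ==> ord_lt R N {\<zero>\<^sub>N'} n \<epsilon>" and n: "0 < n"
  and G: "finite V" "V \<subseteq> carrier R" "fraction_generated R (A \<union> V)"
  and I: "ideal I R" "I = {x \<in> carrier R. \<forall>\<epsilon>\<in>W. \<epsilon> x = \<zero>\<^sub>N'}"
 shows "\<exists>E. E \<subseteq> Diff_lt R A (ring_module R) N n \<and> env_submodule R A (ring_module R) N E \<and>
  I = solutions (ring_module R) N E \<and> fg_submodule E S M"
proof -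
 define Z where "Z = {foldr (\<otimes>) xs \<one> |xs. set xs \<subseteq> V \<and> length xs < n}"
 define T where "T = (\<lambda>\<epsilon> t. \<lambda>x\<in>carrier R. \<epsilon> (t \<otimes> x) :: 'n)"
 define U where "U = (\<lambda>(\<epsilon>, z). T \<epsilon> z) ` (W \<times> Z)"
 have "finite Z" unfolding Z_def by (rule finite_short_monomials[OF G(1)])
 then have finU: "finite U" unfolding U_def by (intro finite_imageI finite_cartesian_product W(1))
 have fold: "foldr (\<otimes>) xs \<one> \<in> carrier R" if "set xs \<subseteq> V" for xs
  using that G(2) by (induction xs) auto
 have ZR: "Z \<subseteq> carrier R" unfolding Z_def using fold by blast
 have oneZ: "\<one> \<in> Z" unfolding Z_def mem_Collect_eq by (rule exI[of _ "[]"]) (use n in simp)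
 have TH: "T \<epsilon> t \<in> H" if "\<epsilon> \<in> W" "t \<in> carrier R" for \<epsilon> t
  unfolding T_def by (rule Hom_translate[OF W(2)[OF that(1)] that(2)])
 have UE: "\<exists>\<epsilon>\<in>W. \<exists>z\<in>Z. \<delta> = T \<epsilon> z" if "\<delta> \<in> U" for \<delta> using that unfolding U_def by auto
 have UI: "T \<epsilon> z \<in> U" if "\<epsilon> \<in> W" "z \<in> Z" for \<epsilon> z using that unfolding U_def by force
 have UH: "U \<subseteq> H"
 proof
  fix \<delta> assume "\<delta> \<in> U"
  from UE[OF this] show "\<delta> \<in> H" using TH ZR by blast
 qed
 have E: "submodule (gen U) S M" by (rule gen_submodule[OF UH])
 have E': "submodule (gen U) R (restrict_scalars f M)"
 proof (intro submodule.intro submodule_axioms.intro)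
  show "subgroup (gen U) (add_monoid (restrict_scalars f M))"
   using submodule.axioms(1)[OF E] unfolding subgroup_def restrict_scalars_def by (simp add: m_inv_def)
  show "r \<odot>\<^bsub>restrict_scalars f M\<^esub> \<delta> \<in> gen U" if "r \<in> carrier R" "\<delta> \<in> gen U" for r \<delta>
   using M.submoduleE(4)[OF E f_closed[OF that(1)] that(2)] by (simp only: restrict_scalars_simps)
 qed
 interpret RM: module R "restrict_scalars f M" by (rule module_restrict_scalars[OF R f Hom_module])
 have Tgen: "T \<epsilon> t \<in> gen U" if e: "\<epsilon> \<in> W" and t: "t \<in> carrier R" for \<epsilon> t
 proof (rule RM.values_in_submodule[OF E' A G(2,3) _ _ _ _ _ t, of "T \<epsilon>" n])
  show "T \<epsilon> \<in> carrier R \<rightarrow> carrier (restrict_scalars f M)"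
   unfolding restrict_scalars_simps Hom_module_simps(1) by (rule funcsetI) (rule TH[OF e])
  show "T \<epsilon> (x \<oplus> y) = T \<epsilon> x \<oplus>\<^bsub>restrict_scalars f M\<^esub> T \<epsilon> y" if xy: "x \<in> carrier R" "y \<in> carrier R" for x y
   unfolding T_def restrict_scalars_simps Hom_module_simps
   by (rule restrict_ext) (use xy HomD'[OF W(2)[OF e]] in \<open>simp add: R.l_distr\<close>)
  show "T \<epsilon> (a \<otimes> x) = a \<odot>\<^bsub>restrict_scalars f M\<^esub> T \<epsilon> x" if ax: "a \<in> A" "x \<in> carrier R" for a x
   unfolding T_def restrict_scalars_simps Hom_module_simps
  proof (rule restrict_ext)
   fix y assume y: "y \<in> carrier R"
   have "a \<in> carrier R" using ax A by blast
   then show "\<epsilon> (a \<otimes> x \<otimes> y) = f a \<odot>\<^sub>N' (\<lambda>y\<in>carrier R. \<epsilon> (x \<otimes> y)) y"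
    using ax y HomD'(4)[OF W(2)[OF e] ax(1), of "x \<otimes> y"] by (simp add: R.m_assoc)
  qed
  show "ord_lt R (restrict_scalars f M) (gen U) n (T \<epsilon>)"
   unfolding T_def by (rule ord_lt_translates[OF W(2,3)[OF e] submodule_zero[OF E]])
  show "T \<epsilon> (foldr (\<otimes>) xs \<one>) \<in> gen U" if "set xs \<subseteq> V" "length xs < n" for xs
  proof -
   have "foldr (\<otimes>) xs \<one> \<in> Z" unfolding Z_def using that by blast
   then show ?thesis using UI[OF e] gen_incl by blast
  qed
 qed
 have ordU: "ord_lt R N {\<zero>\<^sub>N'} n \<delta>" if d: "\<delta> \<in> U" for \<delta>
 proof -
  obtain \<epsilon> z where ez: "\<epsilon> \<in> W" "z \<in> Z" "\<delta> = T \<epsilon> z" using UE[OF d] by blast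
  have "ord_lt R N {\<zero>\<^sub>N'} n (\<lambda>x. \<epsilon> (z \<otimes> x))"
   by (rule N.ord_lt_mult_right[OF _ W(3)[OF ez(1)]]) (use ez ZR in blast)
  then show ?thesis unfolding ez(3) T_def
   by (rule ord_lt_cong[OF R.ring_axioms, THEN iffD1, rotated]) simp
 qed
 have IU: "I = {x \<in> carrier R. \<forall>\<delta>\<in>U. \<delta> x = \<zero>\<^sub>N'}"
 proof (intro equalityI subsetI)
  fix x assume x: "x \<in> I"
  then have xR: "x \<in> carrier R" using I(2) by blast
  have "\<delta> x = \<zero>\<^sub>N'" if d: "\<delta> \<in> U" for \<delta>
  proof -
   obtain \<epsilon> z where ez: "\<epsilon> \<in> W" "z \<in> Z" "\<delta> = T \<epsilon> z" using UE[OF d] by blast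
   have "z \<otimes> x \<in> I" using ideal.I_l_closed[OF I(1) x] ez ZR by blast
   then have "\<epsilon> (z \<otimes> x) = \<zero>\<^sub>N'" using I(2) ez(1) by blast
   then show ?thesis unfolding ez(3) T_def using xR by simp
  qed
  then show "x \<in> {x \<in> carrier R. \<forall>\<delta>\<in>U. \<delta> x = \<zero>\<^sub>N'}" using xR by blast
 next
  fix x assume x: "x \<in> {x \<in> carrier R. \<forall>\<delta>\<in>U. \<delta> x = \<zero>\<^sub>N'}"
  then have xR: "x \<in> carrier R" by blast
  have "\<epsilon> x = \<zero>\<^sub>N'" if e: "\<epsilon> \<in> W" for \<epsilon>
  proof -
   have "T \<epsilon> \<one> x = \<zero>\<^sub>N'" using x UI[OF e oneZ] by blast
   then show ?thesis unfolding T_def using xR by simp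
  qed
  then show "x \<in> I" using I(2) xR by blast
 qed
 have stable: "(\<lambda>x\<in>carrier R. \<delta> (s \<otimes> x)) \<in> gen U" if d: "\<delta> \<in> U" and s: "s \<in> carrier R" for \<delta> s
 proof -
  obtain \<epsilon> z where ez: "\<epsilon> \<in> W" "z \<in> Z" "\<delta> = T \<epsilon> z" using UE[OF d] by blast
  have zR: "z \<in> carrier R" using ez ZR by blast
  have "(\<lambda>x\<in>carrier R. \<delta> (s \<otimes> x)) = T \<epsilon> (z \<otimes> s)"
   unfolding ez(3) T_def by (rule restrict_ext) (use s zR in \<open>simp add: R.m_assoc\<close>)
  then show ?thesis using Tgen[OF ez(1), of "z \<otimes> s"] zR s by simp
 qed
 show ?thesis
  using operator_module[OF finU UH ordU IU stable] by (intro exI[of _ "gen U"] conjI)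
qed

text \<open>Operators with values in \<open>K\<close> are moved to \<open>N'\<close> by clearing the denominators of finitely many
 values and then embedding the submodule \<open>L\<close> of \<open>K\<close> into \<open>N'\<close>.\<close>

theorem operator_module_transfer:
 assumes K: "module R K" and P: "primeideal P R" and L: "submodule L R K"
  and den: "!!y. y \<in> carrier K ==> \<exists>d\<in>carrier R - P. d \<odot>\<^sub>K y \<in> L"
  and cancel: "!!d y. d \<in> carrier R - P ==> y \<in> carrier K ==> d \<odot>\<^sub>K y = \<zero>\<^sub>K ==> y = \<zero>\<^sub>K"
  and h: "h \<in> L \<rightarrow> carrier N'" "!!a b. a \<in> L ==> b \<in> L ==> h (a \<oplus>\<^sub>K b) = h a \<oplus>\<^sub>N' h b"
   "!!r a. r \<in> carrier R ==> a \<in> L ==> h (r \<odot>\<^sub>K a) = f r \<odot>\<^sub>N' h a"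
   "!!a. a \<in> L ==> h a = \<zero>\<^sub>N' ==> a = \<zero>\<^sub>K"
  and W: "finite W" "!!D. D \<in> W ==> D \<in> carrier R \<rightarrow> carrier K"
  "!!D x y. D \<in> W ==> x \<in> carrier R ==> y \<in> carrier R ==> D (x \<oplus> y) = D x \<oplus>\<^sub>K D y"
  "!!D a x. D \<in> W ==> a \<in> A ==> x \<in> carrier R ==> D (a \<otimes> x) = a \<odot>\<^sub>K D x"
  "!!D. D \<in> W ==> ord_lt R K {\<zero>\<^sub>K} n D" and n: "0 < n"
  and G: "finite V" "V \<subseteq> carrier R" "fraction_generated R (A \<union> V)"
  and I: "ideal I R" "I = {x \<in> carrier R. \<forall>D\<in>W. D x = \<zero>\<^sub>K}"
 shows "\<exists>E. E \<subseteq> Diff_lt R A (ring_module R) N n \<and> env_submodule R A (ring_module R) N E \<and>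
  I = solutions (ring_module R) N E \<and> fg_submodule E S M"
proof -
 interpret K: module R K by (rule K)
 define Z where "Z = {foldr (\<otimes>) xs \<one> |xs. set xs \<subseteq> V \<and> length xs < n}"
 have finZ: "finite Z" unfolding Z_def by (rule finite_short_monomials[OF G(1)])
 have fold: "foldr (\<otimes>) xs \<one> \<in> carrier R" if "set xs \<subseteq> V" for xs
  using that G(2) by (induction xs) auto
 have ZR: "Z \<subseteq> carrier R" unfolding Z_def using fold by blast
 \<comment> \<open>Finitely many values, so one \<open>d\<close> outside \<open>P\<close> clears
   their denominators; \<open>values_in_submodule\<close> then places all values of the multiplied
   operators in \<open>L\<close>.\<close>
 define Y where "Y = (\<Union>D\<in>W. D ` Z)"
 have "finite Y" unfolding Y_def using W(1) finZ by simp
 moreover have "Y \<subseteq> carrier K"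
 proof
  fix y assume "y \<in> Y"
  then obtain D z where "D \<in> W" "z \<in> Z" "y = D z" unfolding Y_def by blast
  then show "y \<in> carrier K" using funcset_mem[OF W(2)] ZR by blast
 qed
 ultimately obtain d where d: "d \<in> carrier R - P" "\<forall>y\<in>Y. d \<odot>\<^sub>K y \<in> L"
  using K.common_denominator[OF P L den] by blast
 have dR: "d \<in> carrier R" using d by blast
 have Dc: "D x \<in> carrier K" if "D \<in> W" "x \<in> carrier R" for D x using funcset_mem[OF W(2)] that by blast
 have zL: "\<zero>\<^sub>K \<in> L" using subgroup.one_closed[OF submodule.axioms(1)[OF L]] by simp
 have comm: "d \<odot>\<^sub>K (r \<odot>\<^sub>K y) = r \<odot>\<^sub>K (d \<odot>\<^sub>K y)" if "r \<in> carrier R" "y \<in> carrier K" for r y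
  using that dR by (simp add: K.smult_assoc1[symmetric] R.m_comm)
 have ord: "ord_lt R K L' n (\<lambda>x. d \<odot>\<^sub>K D x)" if D: "D \<in> W" and "\<zero>\<^sub>K \<in> L'" for D L'
  by (rule K.ord_lt_comp[where h = "\<lambda>y. d \<odot>\<^sub>K y" and D = "carrier K" and L = "{\<zero>\<^sub>K}", OF K K.carrier_is_submodule])
   (use that dR comm W(2,5)[OF D] in \<open>auto simp: K.smult_r_distr\<close>)
 have DL: "d \<odot>\<^sub>K D x \<in> L" if D: "D \<in> W" and x: "x \<in> carrier R" for D x
 proof (rule K.values_in_submodule[OF L A G(2,3) _ _ _ ord[OF D zL] _ x])
  show "(\<lambda>x. d \<odot>\<^sub>K D x) \<in> carrier R \<rightarrow> carrier K" using Dc[OF D] dR by simp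
  show "d \<odot>\<^sub>K D (x \<oplus> y) = d \<odot>\<^sub>K D x \<oplus>\<^sub>K d \<odot>\<^sub>K D y" if "x \<in> carrier R" "y \<in> carrier R" for x y
   using that W(3)[OF D] Dc[OF D] dR by (simp add: K.smult_r_distr)
  show "d \<odot>\<^sub>K D (a \<otimes> x) = a \<odot>\<^sub>K (d \<odot>\<^sub>K D x)" if "a \<in> A" "x \<in> carrier R" for a x
   using that W(4)[OF D that] Dc[OF D] comm A by auto
  show "d \<odot>\<^sub>K D (foldr (\<otimes>) xs \<one>) \<in> L" if "set xs \<subseteq> V" "length xs < n" for xs
  proof -
   have "D (foldr (\<otimes>) xs \<one>) \<in> Y" unfolding Y_def Z_def using that D by blast
   then show ?thesis using d(2) by blast
  qed
 qed
 let ?\<epsilon> = "\<lambda>D x. h (d \<odot>\<^sub>K D x)"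
 have hz: "h \<zero>\<^sub>K = \<zero>\<^sub>N'"
 proof -
  have "h \<zero>\<^sub>K \<in> carrier N'" using funcset_mem[OF h(1) zL] .
  then show ?thesis using h(2)[OF zL zL] by simp
 qed
 show ?thesis
 proof (rule operator_module_of_family[OF _ _ _ n G I(1), of "?\<epsilon> ` W"])
  show "finite (?\<epsilon> ` W)" using W(1) by simp
 next
  fix \<epsilon> assume "\<epsilon> \<in> ?\<epsilon> ` W"
  then obtain D where D: "D \<in> W" "\<epsilon> = ?\<epsilon> D" by blast
  show "(\<lambda>x\<in>carrier R. \<epsilon> x) \<in> H"
   unfolding D(2)
  proof (rule HomI)
   show "h (d \<odot>\<^sub>K D x) \<in> carrier N'" if "x \<in> carrier R" for x
    using funcset_mem[OF h(1) DL[OF D(1) that]] .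
   show "h (d \<odot>\<^sub>K D (x \<oplus> y)) = h (d \<odot>\<^sub>K D x) \<oplus>\<^sub>N' h (d \<odot>\<^sub>K D y)" if "x \<in> carrier R" "y \<in> carrier R" for x y
    using that W(3)[OF D(1)] Dc[OF D(1)] dR h(2)[OF DL[OF D(1)] DL[OF D(1)]] by (simp add: K.smult_r_distr)
   show "h (d \<odot>\<^sub>K D (a \<otimes> x)) = f a \<odot>\<^sub>N' h (d \<odot>\<^sub>K D x)" if "a \<in> A" "x \<in> carrier R" for a x
   proof -
    have aR: "a \<in> carrier R" using that A by blast
    show ?thesis using that W(4)[OF D(1) that] Dc[OF D(1)] comm[OF aR] h(3)[OF aR DL[OF D(1)]] by simp
   qed
  qed
  show "ord_lt R N {\<zero>\<^sub>N'} n \<epsilon>"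
   unfolding D(2)
  proof (rule K.ord_lt_comp[where h = h and D = L and L = "{\<zero>\<^sub>K}", OF module_restrict_scalars[OF R f N'] L])
   show "h \<in> L \<rightarrow> carrier N" unfolding restrict_scalars_simps by (rule h(1))
   show "h (a \<oplus>\<^sub>K b) = h a \<oplus>\<^sub>N h b" if "a \<in> L" "b \<in> L" for a b
    unfolding restrict_scalars_simps by (rule h(2)[OF that])
   show "h (r \<odot>\<^sub>K a) = r \<odot>\<^sub>N h a" if "r \<in> carrier R" "a \<in> L" for r a
    unfolding restrict_scalars_simps by (rule h(3)[OF that])
   show "h a \<in> {\<zero>\<^sub>N'}" if "a \<in> {\<zero>\<^sub>K}" for a using that hz by simp
   show "(\<lambda>x. d \<odot>\<^sub>K D x) \<in> carrier R \<rightarrow> L" by (rule funcsetI) (rule DL[OF D(1)])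
   show "ord_lt R K {\<zero>\<^sub>K} n (\<lambda>x. d \<odot>\<^sub>K D x)" by (rule ord[OF D(1) singletonI])
  qed
 next
  \<comment> \<open>Multiplication by \<open>d\<close> and the map \<open>h\<close> both have zero
    kernel, so the common zeros are still those of \<open>W\<close>.\<close>
  have iff: "h (d \<odot>\<^sub>K D x) = \<zero>\<^sub>N' \<longleftrightarrow> D x = \<zero>\<^sub>K" if "D \<in> W" "x \<in> carrier R" for D x
  proof
   assume "h (d \<odot>\<^sub>K D x) = \<zero>\<^sub>N'"
   then have "d \<odot>\<^sub>K D x = \<zero>\<^sub>K" by (rule h(4)[OF DL[OF that]])
   then show "D x = \<zero>\<^sub>K" by (rule cancel[OF d(1) Dc[OF that]])
  next
   assume "D x = \<zero>\<^sub>K"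
   then show "h (d \<odot>\<^sub>K D x) = \<zero>\<^sub>N'" using hz dR by simp
  qed
  show "I = {x \<in> carrier R. \<forall>\<epsilon>\<in>?\<epsilon> ` W. \<epsilon> x = \<zero>\<^sub>N'}"
   unfolding I(2) by (rule Collect_cong) (simp add: iff cong: conj_cong)
 qed
qed

end

section \<open>Localizations\<close>

locale localization_setting = cring R for R (structure) +
 fixes S assumes S: "submonoid S R"
begin

abbreviation "L \<equiv> localization R S"
abbreviation "fr \<equiv> loc_frac R S"

lemma S_closed [simp]: "s \<in> S ==> s \<in> carrier R"
 and S_one [simp]: "\<one> \<in> S"
 and S_mult [simp]: "s \<in> S ==> t \<in> S ==> s \<otimes> t \<in> S"
 using submonoid.mem_carrier[OF S] submonoid.one_closed[OF S] submonoid.m_closed[OF S] by auto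

lemma loc_rel_iff: "((a, s), (b, t)) \<in> loc_rel R S \<longleftrightarrow> a \<in> carrier R \<and> s \<in> S \<and> b \<in> carrier R \<and> t \<in> S \<and>
  (\<exists>u\<in>S. u \<otimes> (a \<otimes> t \<ominus> b \<otimes> s) = \<zero>)"
 by (simp add: loc_rel_def)

lemma loc_rel_equiv: "equiv (carrier R \<times> S) (loc_rel R S)"
proof (rule equivI)
 show "loc_rel R S \<subseteq> (carrier R \<times> S) \<times> (carrier R \<times> S)" by (auto simp: loc_rel_def)
 show "refl_on (carrier R \<times> S) (loc_rel R S)"
 proof (rule refl_onI)
  fix x assume "x \<in> carrier R \<times> S"
  then obtain a s where "x = (a, s)" "a \<in> carrier R" "s \<in> S" by blast
  then show "(x, x) \<in> loc_rel R S" by (auto simp: loc_rel_iff minus_eq r_neg intro!: bexI[of _ \<one>])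
 qed
 show "sym (loc_rel R S)"
 proof (rule symI)
  fix x y assume xy: "(x, y) \<in> loc_rel R S"
  obtain a s b t where x: "x = (a, s)" "y = (b, t)" by (cases x, cases y)
  obtain u where u: "a \<in> carrier R" "s \<in> S" "b \<in> carrier R" "t \<in> S" "u \<in> S" "u \<otimes> (a \<otimes> t \<ominus> b \<otimes> s) = \<zero>"
   using xy unfolding x loc_rel_iff by blast
  have id: "u \<otimes> (b \<otimes> s \<ominus> a \<otimes> t) = \<ominus> (u \<otimes> (a \<otimes> t \<ominus> b \<otimes> s))"
   if "u \<in> carrier R" "a \<in> carrier R" "b \<in> carrier R" "s \<in> carrier R" "t \<in> carrier R" for u a b s t
   using that by algebra
  have "u \<otimes> (b \<otimes> s \<ominus> a \<otimes> t) = \<zero>" using id[of u a b s t] u by simp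
  then show "(y, x) \<in> loc_rel R S" unfolding x loc_rel_iff using u by blast
 qed
 show "trans (loc_rel R S)"
 proof (rule transI)
  fix x y z assume xy: "(x, y) \<in> loc_rel R S" and yz: "(y, z) \<in> loc_rel R S"
  obtain a s b t c w where x: "x = (a, s)" "y = (b, t)" "z = (c, w)" by (cases x, cases y, cases z)
  obtain u where u: "a \<in> carrier R" "s \<in> S" "b \<in> carrier R" "t \<in> S" "u \<in> S" "u \<otimes> (a \<otimes> t \<ominus> b \<otimes> s) = \<zero>"
   using xy unfolding x loc_rel_iff by blast
  obtain v where v: "c \<in> carrier R" "w \<in> S" "v \<in> S" "v \<otimes> (b \<otimes> w \<ominus> c \<otimes> t) = \<zero>"
   using yz unfolding x loc_rel_iff by blast
  have id: "(u \<otimes> v \<otimes> t) \<otimes> (a \<otimes> w \<ominus> c \<otimes> s) =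
    (v \<otimes> w) \<otimes> (u \<otimes> (a \<otimes> t \<ominus> b \<otimes> s)) \<oplus> (u \<otimes> s) \<otimes> (v \<otimes> (b \<otimes> w \<ominus> c \<otimes> t))"
   if "u \<in> carrier R" "v \<in> carrier R" "a \<in> carrier R" "b \<in> carrier R" "c \<in> carrier R" "s \<in> carrier R" "t \<in> carrier R"
    "w \<in> carrier R" for u v a b c s t w
   using that by algebra
  have "(u \<otimes> v \<otimes> t) \<otimes> (a \<otimes> w \<ominus> c \<otimes> s) = \<zero>"
   using id[of u v a b c s t w] u v by simp
  then show "(x, z) \<in> loc_rel R S" unfolding x loc_rel_iff using u v by (meson S_mult)
 qed
qed

lemma frac_eq_iff:
 assumes "a \<in> carrier R" "s \<in> S" "b \<in> carrier R" "t \<in> S"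
 shows "fr a s = fr b t \<longleftrightarrow> (\<exists>u\<in>S. u \<otimes> (a \<otimes> t \<ominus> b \<otimes> s) = \<zero>)"
 unfolding loc_frac_def
 using eq_equiv_class_iff[OF loc_rel_equiv, of "(a, s)" "(b, t)"] assms by (simp add: loc_rel_iff)

lemma frac_eqI:
 assumes "a \<in> carrier R" "s \<in> S" "b \<in> carrier R" "t \<in> S" "a \<otimes> t = b \<otimes> s"
 shows "fr a s = fr b t"
 using assms by (auto simp: frac_eq_iff minus_eq r_neg intro!: bexI[of _ \<one>])

lemma frac_mem: "a \<in> carrier R ==> s \<in> S ==> fr a s \<in> carrier L"
 unfolding localization_def loc_frac_def by (simp add: quotientI)

lemma frac_cases:
 assumes "x \<in> carrier L"
 shows "\<exists>a s. a \<in> carrier R \<and> s \<in> S \<and> x = fr a s"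
proof -
 have "x \<in> (carrier R \<times> S) // loc_rel R S" using assms by (simp add: localization_def)
 then show ?thesis by (rule quotientE) (auto simp: loc_frac_def)
qed

lemma frac_self: "a \<in> carrier R ==> s \<in> S ==> (a, s) \<in> fr a s"
 unfolding loc_frac_def using equiv_class_self[OF loc_rel_equiv] by simp

lemma frac_rep:
 assumes "p \<in> fr a s"
 shows "\<exists>b t. p = (b, t) \<and> b \<in> carrier R \<and> t \<in> S \<and> (\<exists>u\<in>S. u \<otimes> (a \<otimes> t \<ominus> b \<otimes> s) = \<zero>)"
 using assms unfolding loc_frac_def by (cases p) (auto simp: loc_rel_iff)

text \<open>Sum and product in \<open>localization\<close> are unions over all representatives. When
  the expression does not depend on the representative, the union collapses to its single
  value.\<close>

lemma UN_frac:
 assumes "a \<in> carrier R" "s \<in> S" "!!b t. b \<in> carrier R ==> t \<in> S ==> (\<exists>u\<in>S. u \<otimes> (a \<otimes> t \<ominus> b \<otimes> s) = \<zero>) ==> g b t = Z"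
 shows "(\<Union>(b, t)\<in>fr a s. g b t) = Z"
proof -
 have "(case p of (b, t) => g b t) = Z" if p: "p \<in> fr a s" for p
 proof -
  obtain b t where bt: "p = (b, t)" "b \<in> carrier R" "t \<in> S" "\<exists>u\<in>S. u \<otimes> (a \<otimes> t \<ominus> b \<otimes> s) = \<zero>"
   using frac_rep[OF p] by (elim exE conjE) (rule that)
  then show ?thesis using assms(3) by simp
 qed
 moreover have "fr a s \<noteq> {}" using frac_self[OF assms(1,2)] by blast
 ultimately show ?thesis by (simp add: UN_constant_eq)
qed

lemma frac_mult:
 assumes "a \<in> carrier R" "s \<in> S" "b \<in> carrier R" "t \<in> S"
 shows "fr a s \<otimes>\<^sub>L fr b t = fr (a \<otimes> b) (s \<otimes> t)"
proof -
 have id: "(u \<otimes> v) \<otimes> ((a' \<otimes> b') \<otimes> (s \<otimes> t) \<ominus> (a \<otimes> b) \<otimes> (s' \<otimes> t')) =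
   (v \<otimes> (b \<otimes> t')) \<otimes> \<ominus> (u \<otimes> (a \<otimes> s' \<ominus> a' \<otimes> s)) \<oplus> (u \<otimes> (a' \<otimes> s)) \<otimes> \<ominus> (v \<otimes> (b \<otimes> t' \<ominus> b' \<otimes> t))"
  if "u \<in> carrier R" "v \<in> carrier R" "a \<in> carrier R" "b \<in> carrier R" "a' \<in> carrier R" "b' \<in> carrier R"
   "s \<in> carrier R" "t \<in> carrier R" "s' \<in> carrier R" "t' \<in> carrier R" for u v a b a' b' s t s' t'
  using that by algebra
 have "fr a' s' = fr a' s' \<and> fr (a' \<otimes> b') (s' \<otimes> t') = fr (a \<otimes> b) (s \<otimes> t)"
  if "a' \<in> carrier R" "s' \<in> S" "\<exists>u\<in>S. u \<otimes> (a \<otimes> s' \<ominus> a' \<otimes> s) = \<zero>"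
   "b' \<in> carrier R" "t' \<in> S" "\<exists>u\<in>S. u \<otimes> (b \<otimes> t' \<ominus> b' \<otimes> t) = \<zero>" for a' s' b' t'
 proof -
  obtain u v where uv: "u \<in> S" "u \<otimes> (a \<otimes> s' \<ominus> a' \<otimes> s) = \<zero>" "v \<in> S" "v \<otimes> (b \<otimes> t' \<ominus> b' \<otimes> t) = \<zero>"
   using \<open>\<exists>u\<in>S. u \<otimes> (a \<otimes> s' \<ominus> a' \<otimes> s) = \<zero>\<close> \<open>\<exists>u\<in>S. u \<otimes> (b \<otimes> t' \<ominus> b' \<otimes> t) = \<zero>\<close> by blast
  have "(u \<otimes> v) \<otimes> ((a' \<otimes> b') \<otimes> (s \<otimes> t) \<ominus> (a \<otimes> b) \<otimes> (s' \<otimes> t')) = \<zero>"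
   using id[of u v a b a' b' s t s' t'] assms uv that(1,2,4,5) by simp
  then show ?thesis using assms uv that(1,2,4,5) by (auto simp: frac_eq_iff)
 qed
 then have "(\<Union>(a', s')\<in>fr a s. \<Union>(b', t')\<in>fr b t. fr (a' \<otimes> b') (s' \<otimes> t')) = fr (a \<otimes> b) (s \<otimes> t)"
  using assms by (intro UN_frac) simp_all
 then show ?thesis by (simp add: localization_def)
qed

lemma frac_add:
 assumes "a \<in> carrier R" "s \<in> S" "b \<in> carrier R" "t \<in> S"
 shows "fr a s \<oplus>\<^sub>L fr b t = fr (a \<otimes> t \<oplus> b \<otimes> s) (s \<otimes> t)"
proof -
 have id: "(u \<otimes> v) \<otimes> ((a' \<otimes> t' \<oplus> b' \<otimes> s') \<otimes> (s \<otimes> t) \<ominus> (a \<otimes> t \<oplus> b \<otimes> s) \<otimes> (s' \<otimes> t')) =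
   (v \<otimes> (t \<otimes> t')) \<otimes> \<ominus> (u \<otimes> (a \<otimes> s' \<ominus> a' \<otimes> s)) \<oplus> (u \<otimes> (s \<otimes> s')) \<otimes> \<ominus> (v \<otimes> (b \<otimes> t' \<ominus> b' \<otimes> t))"
  if "u \<in> carrier R" "v \<in> carrier R" "a \<in> carrier R" "b \<in> carrier R" "a' \<in> carrier R" "b' \<in> carrier R"
   "s \<in> carrier R" "t \<in> carrier R" "s' \<in> carrier R" "t' \<in> carrier R" for u v a b a' b' s t s' t'
  using that by algebra
 have "fr (a' \<otimes> t' \<oplus> b' \<otimes> s') (s' \<otimes> t') = fr (a \<otimes> t \<oplus> b \<otimes> s) (s \<otimes> t)"
  if "a' \<in> carrier R" "s' \<in> S" "\<exists>u\<in>S. u \<otimes> (a \<otimes> s' \<ominus> a' \<otimes> s) = \<zero>"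
   "b' \<in> carrier R" "t' \<in> S" "\<exists>u\<in>S. u \<otimes> (b \<otimes> t' \<ominus> b' \<otimes> t) = \<zero>" for a' s' b' t'
 proof -
  obtain u v where uv: "u \<in> S" "u \<otimes> (a \<otimes> s' \<ominus> a' \<otimes> s) = \<zero>" "v \<in> S" "v \<otimes> (b \<otimes> t' \<ominus> b' \<otimes> t) = \<zero>"
   using \<open>\<exists>u\<in>S. u \<otimes> (a \<otimes> s' \<ominus> a' \<otimes> s) = \<zero>\<close> \<open>\<exists>u\<in>S. u \<otimes> (b \<otimes> t' \<ominus> b' \<otimes> t) = \<zero>\<close> by blast
  have "(u \<otimes> v) \<otimes> ((a' \<otimes> t' \<oplus> b' \<otimes> s') \<otimes> (s \<otimes> t) \<ominus> (a \<otimes> t \<oplus> b \<otimes> s) \<otimes> (s' \<otimes> t')) = \<zero>"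
   using id[of u v a b a' b' s t s' t'] assms uv that(1,2,4,5) by simp
  then show ?thesis using assms uv that(1,2,4,5) by (auto simp: frac_eq_iff)
 qed
 then have "(\<Union>(a', s')\<in>fr a s. \<Union>(b', t')\<in>fr b t. fr (a' \<otimes> t' \<oplus> b' \<otimes> s') (s' \<otimes> t')) = fr (a \<otimes> t \<oplus> b \<otimes> s) (s \<otimes> t)"
  using assms by (intro UN_frac) simp_all
 then show ?thesis by (simp add: localization_def)
qed

lemma frac_one: "\<one>\<^sub>L = fr \<one> \<one>" and frac_zero: "\<zero>\<^sub>L = fr \<zero> \<one>"
 by (simp_all add: localization_def)

lemma localization_cring: "cring L"
proof (rule cringI)
 show "abelian_group L"
 proof (rule abelian_groupI)
  fix x y z assume x: "x \<in> carrier L" and y: "y \<in> carrier L" and z: "z \<in> carrier L"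
  obtain a s where a: "a \<in> carrier R" "s \<in> S" "x = fr a s" using frac_cases[OF x] by (elim exE conjE)
  obtain b t where b: "b \<in> carrier R" "t \<in> S" "y = fr b t" using frac_cases[OF y] by (elim exE conjE)
  obtain c w where c: "c \<in> carrier R" "w \<in> S" "z = fr c w" using frac_cases[OF z] by (elim exE conjE)
  have id: "((a \<otimes> t \<oplus> b \<otimes> s) \<otimes> w \<oplus> c \<otimes> (s \<otimes> t)) = (a \<otimes> (t \<otimes> w) \<oplus> (b \<otimes> w \<oplus> c \<otimes> t) \<otimes> s)"
   if "a \<in> carrier R" "b \<in> carrier R" "c \<in> carrier R" "s \<in> carrier R" "t \<in> carrier R" "w \<in> carrier R" for a b c s t w
   using that by algebra
  show "x \<oplus>\<^sub>L y \<oplus>\<^sub>L z = x \<oplus>\<^sub>L (y \<oplus>\<^sub>L z)"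
   unfolding a(3) b(3) c(3) using a b c id[of a b c s t w] by (simp add: frac_add m_assoc)
  show "x \<oplus>\<^sub>L y = y \<oplus>\<^sub>L x"
   unfolding a(3) b(3) using a b by (simp add: frac_add a_comm m_comm)
 next
  fix x assume x: "x \<in> carrier L"
  obtain a s where a: "a \<in> carrier R" "s \<in> S" "x = fr a s" using frac_cases[OF x] by (elim exE conjE)
  show "\<zero>\<^sub>L \<oplus>\<^sub>L x = x" unfolding a(3) frac_zero using a by (simp add: frac_add)
  show "\<exists>y\<in>carrier L. y \<oplus>\<^sub>L x = \<zero>\<^sub>L"
  proof (rule bexI[of _ "fr (\<ominus> a) s"])
   have "fr (\<ominus> a \<otimes> s \<oplus> a \<otimes> s) (s \<otimes> s) = fr \<zero> \<one>"
    by (rule frac_eqI) (use a in \<open>simp_all add: l_minus l_neg\<close>)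
   then show "fr (\<ominus> a) s \<oplus>\<^sub>L x = \<zero>\<^sub>L" unfolding a(3) frac_zero using a by (simp add: frac_add)
  qed (use a in \<open>simp add: frac_mem\<close>)
 next
  fix x y assume x: "x \<in> carrier L" and y: "y \<in> carrier L"
  obtain a s where a: "a \<in> carrier R" "s \<in> S" "x = fr a s" using frac_cases[OF x] by (elim exE conjE)
  obtain b t where b: "b \<in> carrier R" "t \<in> S" "y = fr b t" using frac_cases[OF y] by (elim exE conjE)
  show "x \<oplus>\<^sub>L y \<in> carrier L" unfolding a(3) b(3) using a b by (simp add: frac_add frac_mem)
 qed (simp add: frac_zero frac_mem)
 show "comm_monoid L"
 proof (rule comm_monoidI)
  fix x y z assume x: "x \<in> carrier L" and y: "y \<in> carrier L" and z: "z \<in> carrier L"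
  obtain a s where a: "a \<in> carrier R" "s \<in> S" "x = fr a s" using frac_cases[OF x] by (elim exE conjE)
  obtain b t where b: "b \<in> carrier R" "t \<in> S" "y = fr b t" using frac_cases[OF y] by (elim exE conjE)
  obtain c w where c: "c \<in> carrier R" "w \<in> S" "z = fr c w" using frac_cases[OF z] by (elim exE conjE)
  show "x \<otimes>\<^sub>L y \<otimes>\<^sub>L z = x \<otimes>\<^sub>L (y \<otimes>\<^sub>L z)"
   unfolding a(3) b(3) c(3) using a b c by (simp add: frac_mult m_assoc)
 next
  fix x y assume x: "x \<in> carrier L" and y: "y \<in> carrier L"
  obtain a s where a: "a \<in> carrier R" "s \<in> S" "x = fr a s" using frac_cases[OF x] by (elim exE conjE)
  obtain b t where b: "b \<in> carrier R" "t \<in> S" "y = fr b t" using frac_cases[OF y] by (elim exE conjE)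
  show "x \<otimes>\<^sub>L y \<in> carrier L" unfolding a(3) b(3) using a b by (simp add: frac_mult frac_mem)
  show "x \<otimes>\<^sub>L y = y \<otimes>\<^sub>L x" unfolding a(3) b(3) using a b by (simp add: frac_mult m_comm)
  show "\<one>\<^sub>L \<otimes>\<^sub>L x = x" unfolding a(3) frac_one using a by (simp add: frac_mult)
 qed (simp add: frac_one frac_mem)
 fix x y z assume x: "x \<in> carrier L" and y: "y \<in> carrier L" and z: "z \<in> carrier L"
 obtain a s where a: "a \<in> carrier R" "s \<in> S" "x = fr a s" using frac_cases[OF x] by (elim exE conjE)
 obtain b t where b: "b \<in> carrier R" "t \<in> S" "y = fr b t" using frac_cases[OF y] by (elim exE conjE)
 obtain c w where c: "c \<in> carrier R" "w \<in> S" "z = fr c w" using frac_cases[OF z] by (elim exE conjE)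
 have id: "((a \<otimes> t \<oplus> b \<otimes> s) \<otimes> c) \<otimes> ((s \<otimes> w) \<otimes> (t \<otimes> w)) = ((a \<otimes> c) \<otimes> (t \<otimes> w) \<oplus> (b \<otimes> c) \<otimes> (s \<otimes> w)) \<otimes> ((s \<otimes> t) \<otimes> w)"
  if "a \<in> carrier R" "b \<in> carrier R" "c \<in> carrier R" "s \<in> carrier R" "t \<in> carrier R" "w \<in> carrier R" for a b c s t w
  using that by algebra
 have "fr ((a \<otimes> t \<oplus> b \<otimes> s) \<otimes> c) ((s \<otimes> t) \<otimes> w) = fr ((a \<otimes> c) \<otimes> (t \<otimes> w) \<oplus> (b \<otimes> c) \<otimes> (s \<otimes> w)) ((s \<otimes> w) \<otimes> (t \<otimes> w))"
  by (rule frac_eqI) (use a b c id[of a b c s t w] in simp_all)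
 then show "(x \<oplus>\<^sub>L y) \<otimes>\<^sub>L z = x \<otimes>\<^sub>L z \<oplus>\<^sub>L y \<otimes>\<^sub>L z"
  unfolding a(3) b(3) c(3) using a b c by (simp add: frac_add frac_mult)
qed

lemma loc_map_hom: "loc_map R S \<in> ring_hom R L"
 by (rule ring_hom_memI) (auto simp: loc_map_def frac_mem frac_mult frac_add frac_one)

lemma frac_mult_denominator:
 assumes "a \<in> carrier R" "s \<in> S"
 shows "fr a s \<otimes>\<^sub>L loc_map R S s = loc_map R S a"
proof -
 have "fr (a \<otimes> s) (s \<otimes> \<one>) = fr a \<one>" by (rule frac_eqI) (use assms in simp_all)
 then show ?thesis using assms by (simp add: loc_map_def frac_mult)
qed

lemma loc_map_unit:
 assumes "s \<in> S" shows "fr \<one> s \<otimes>\<^sub>L loc_map R S s = \<one>\<^sub>L" "loc_map R S s \<in> Units L"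
proof -
 interpret L: cring L by (rule localization_cring)
 show *: "fr \<one> s \<otimes>\<^sub>L loc_map R S s = \<one>\<^sub>L"
  using frac_mult_denominator[of \<one> s] assms by (simp add: loc_map_def frac_one)
 have c: "loc_map R S s \<in> carrier L" "fr \<one> s \<in> carrier L"
  using ring_hom_closed[OF loc_map_hom] assms by (auto simp: frac_mem)
 then show "loc_map R S s \<in> Units L"
  using * L.m_comm[OF c] unfolding Units_def by (intro CollectI conjI bexI[of _ "fr \<one> s"]) simp_all
qed

lemma frac_eq_mult: "a \<in> carrier R ==> s \<in> S ==> fr a s = loc_map R S a \<otimes>\<^sub>L fr \<one> s"
 by (simp add: loc_map_def frac_mult)

lemma extended_ideal:
 assumes I: "ideal I R"
 shows "Idl\<^bsub>L\<^esub> (loc_map R S ` I) = {fr a s |a s. a \<in> I \<and> s \<in> S}" (is "_ = ?J")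
proof
 interpret L: cring L by (rule localization_cring)
 interpret I: ideal I R by (rule I)
 have sub: "loc_map R S ` I \<subseteq> carrier L" using ring_hom_closed[OF loc_map_hom] I.a_subset by blast
 have J: "ideal ?J L"
 proof (rule idealI[OF L.ring_axioms])
  show "subgroup ?J (add_monoid L)"
  proof (rule L.add.subgroupI)
   show "?J \<subseteq> carrier L" using frac_mem I.a_subset by auto
   show "?J \<noteq> {}" using I.zero_closed S_one by blast
   show "\<ominus>\<^sub>L x \<in> ?J" if xJ: "x \<in> ?J" for x
   proof -
    obtain a s where a: "x = fr a s" "a \<in> I" "s \<in> S" using xJ by blast
    have "fr (\<ominus> a \<otimes> s \<oplus> a \<otimes> s) (s \<otimes> s) = fr \<zero> \<one>"
     by (rule frac_eqI) (use a in \<open>simp_all add: l_minus l_neg\<close>)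
    then have "fr (\<ominus> a) s \<oplus>\<^sub>L x = \<zero>\<^sub>L" unfolding a(1) frac_zero using a by (simp add: frac_add)
    then have "\<ominus>\<^sub>L x = fr (\<ominus> a) s" using L.minus_equality a frac_mem by simp
    then show ?thesis using a by blast
   qed
   show "x \<oplus>\<^sub>L y \<in> ?J" if xJ: "x \<in> ?J" and yJ: "y \<in> ?J" for x y
   proof -
    obtain a s where a: "x = fr a s" "a \<in> I" "s \<in> S" using xJ by blast
    obtain b t where b: "y = fr b t" "b \<in> I" "t \<in> S" using yJ by blast
    have "a \<otimes> t \<oplus> b \<otimes> s \<in> I" using a b I.I_r_closed by simp
    moreover have "x \<oplus>\<^sub>L y = fr (a \<otimes> t \<oplus> b \<otimes> s) (s \<otimes> t)" unfolding a(1) b(1) using a b by (simp add: frac_add)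
    ultimately show ?thesis using a b S_mult by blast
   qed
  qed
  have *: "x \<otimes>\<^sub>L y \<in> ?J" if xJ: "x \<in> ?J" and y: "y \<in> carrier L" for x y
  proof -
   obtain a s where a: "x = fr a s" "a \<in> I" "s \<in> S" using xJ by blast
   obtain b t where b: "b \<in> carrier R" "t \<in> S" "y = fr b t" using frac_cases[OF y] by (elim exE conjE)
   have "x \<otimes>\<^sub>L y = fr (a \<otimes> b) (s \<otimes> t)" unfolding a(1) b(3) using a b by (simp add: frac_mult)
   then show ?thesis using a b S_mult I.I_r_closed by blast
  qed
  show "x \<otimes>\<^sub>L y \<in> ?J" if "x \<in> ?J" "y \<in> carrier L" for x y using *[OF that] .
  show "y \<otimes>\<^sub>L x \<in> ?J" if xJ: "x \<in> ?J" and y: "y \<in> carrier L" for x y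
  proof -
   have "x \<in> carrier L" using xJ frac_mem by auto
   then show ?thesis using *[OF xJ y] y by (simp add: L.m_comm)
  qed
 qed
 show "Idl\<^bsub>L\<^esub> (loc_map R S ` I) \<subseteq> ?J"
 proof (rule L.genideal_minimal[OF J], rule image_subsetI)
  fix a assume "a \<in> I"
  then show "loc_map R S a \<in> ?J" unfolding loc_map_def using S_one by (intro CollectI exI conjI) (rule refl)
 qed
 show "?J \<subseteq> Idl\<^bsub>L\<^esub> (loc_map R S ` I)"
 proof
  fix x assume "x \<in> ?J"
  then obtain a s where a: "x = fr a s" "a \<in> I" "s \<in> S" by blast
  have "loc_map R S a \<in> Idl\<^bsub>L\<^esub> (loc_map R S ` I)" using L.genideal_self[OF sub] a(2) by blast
  then have "loc_map R S a \<otimes>\<^sub>L fr \<one> s \<in> Idl\<^bsub>L\<^esub> (loc_map R S ` I)"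
   using ideal.I_r_closed[OF L.genideal_ideal[OF sub]] a frac_mem by simp
  then show "x \<in> Idl\<^bsub>L\<^esub> (loc_map R S ` I)" unfolding a(1) frac_eq_mult[OF I.Icarr[OF a(2)] a(3)] .
 qed
qed

end

text \<open>Every ideal of \<open>B\<close> is generated by the image of its contraction to
  \<open>R\<close>, because each of its elements is, up to a unit, the image of an element of the
  contraction.\<close>

lemma noetherian_if_fractions:
 assumes "noetherian_ring R" "cring B" and f: "f \<in> ring_hom R B"
  and frac: "!!b. b \<in> carrier B ==> \<exists>a\<in>carrier R. \<exists>s\<in>carrier R. f s \<in> Units B \<and> b \<otimes>\<^sub>B f s = f a"
 shows "noetherian_ring B"
proof -
 interpret R: noetherian_ring R by fact
 interpret B: cring B by fact
 interpret f: ring_hom_ring R B f using f by (intro ring_hom_ringI2 R.ring_axioms B.ring_axioms)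
 show ?thesis
 proof (intro noetherian_ring.intro noetherian_ring_axioms.intro B.ring_axioms)
  fix K assume K: "ideal K B"
  have K': "ideal {x \<in> carrier R. f x \<in> K} R" by (rule f.ideal_vimage[OF K])
  obtain A where A: "A \<subseteq> carrier R" "finite A" "{x \<in> carrier R. f x \<in> K} = Idl\<^bsub>R\<^esub> A"
   using R.finetely_gen[OF K'] by blast
  have fA: "f ` A \<subseteq> carrier B" using A(1) by auto
  have J: "ideal (Idl\<^bsub>B\<^esub> (f ` A)) B" by (rule B.genideal_ideal[OF fA])
  have "Idl\<^bsub>R\<^esub> A \<subseteq> {x \<in> carrier R. f x \<in> Idl\<^bsub>B\<^esub> (f ` A)}"
   by (rule R.genideal_minimal[OF f.ideal_vimage[OF J]]) (use A(1) B.genideal_self[OF fA] in blast)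
  then have sub: "f x \<in> Idl\<^bsub>B\<^esub> (f ` A)" if "x \<in> carrier R" "f x \<in> K" for x
   using that A(3) by blast
  have "K = Idl\<^bsub>B\<^esub> (f ` A)"
  proof
   have "A \<subseteq> {x \<in> carrier R. f x \<in> K}" unfolding A(3) by (rule R.genideal_self[OF A(1)])
   then show "Idl\<^bsub>B\<^esub> (f ` A) \<subseteq> K" by (intro B.genideal_minimal[OF K]) blast
   show "K \<subseteq> Idl\<^bsub>B\<^esub> (f ` A)"
   proof
    fix b assume b: "b \<in> K"
    have bB: "b \<in> carrier B" using ideal.Icarr[OF K b] .
    obtain a s where as: "a \<in> carrier R" "s \<in> carrier R" "f s \<in> Units B" "b \<otimes>\<^sub>B f s = f a"
     using frac[OF bB] by blast
    have "f a \<in> K" using ideal.I_r_closed[OF K b, of "f s"] as by simp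
    then have "f a \<in> Idl\<^bsub>B\<^esub> (f ` A)" using sub as by blast
    then have "f a \<otimes>\<^sub>B inv\<^bsub>B\<^esub> f s \<in> Idl\<^bsub>B\<^esub> (f ` A)"
     using ideal.I_r_closed[OF J] as(3) by simp
    moreover have "f a \<otimes>\<^sub>B inv\<^bsub>B\<^esub> f s = b"
     unfolding as(4)[symmetric]
     using B.m_assoc[OF bB B.Units_closed[OF as(3)] B.Units_inv_closed[OF as(3)]] B.Units_r_inv[OF as(3)] bB
     by (simp only: B.r_one)
    ultimately show "b \<in> Idl\<^bsub>B\<^esub> (f ` A)" by simp
   qed
  qed
  then show "\<exists>A\<subseteq>carrier B. finite A \<and> K = Idl\<^bsub>B\<^esub> A" using fA A(2) by blast
 qed
qed

section \<open>The residue field and the local ring modulo a primary ideal\<close>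

locale light_hom =
 fixes R :: "('a, 'r) ring_scheme" (structure) and S :: "('b, 's) ring_scheme" and h :: "'a => 'b"
 assumes R: "ring R" and S: "ring S" and h: "h \<in> ring_hom R S"
begin

lemma ring_hom_ring: "ring_hom_ring R S h"
 by (intro ring_hom_ringI2 R S h)

lemma hom_closed [simp]: "x \<in> carrier R ==> h x \<in> carrier S"
 and hom_mult [simp]: "x \<in> carrier R ==> y \<in> carrier R ==> h (x \<otimes> y) = h x \<otimes>\<^sub>S h y"
 and hom_add [simp]: "x \<in> carrier R ==> y \<in> carrier R ==> h (x \<oplus> y) = h x \<oplus>\<^sub>S h y"
 and hom_one [simp]: "h \<one> = \<one>\<^sub>S"
 using ring_hom_closed[OF h] ring_hom_mult[OF h] ring_hom_add[OF h] ring_hom_one[OF h] by simp_all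

lemma hom_zero [simp]: "h \<zero> = \<zero>\<^sub>S"
 using ring_hom_zero[OF h R S] .

lemma hom_nat_pow: "x \<in> carrier R ==> h (x [^] (n::nat)) = h x [^]\<^sub>S n"
 using ring_hom_ring.hom_nat_pow[OF ring_hom_ring] .

lemma img_is_subring: "subring K R ==> subring (h ` K) S"
 using ring_hom_ring.img_is_subring[OF ring_hom_ring] .

end

lemma quotient_elements:
 assumes "T \<in> carrier (L Quot J)" shows "\<exists>x\<in>carrier L. T = J +>\<^sub>L x"
 using assms unfolding FactRing_def A_RCOSETS_def' by auto

lemma quotient_zero: "\<zero>\<^bsub>L Quot J\<^esub> = J"
 by (simp add: FactRing_def)

lemma quotient_eq_zero_iff:
 assumes "ideal J L" "x \<in> carrier L"
 shows "J +>\<^sub>L x = \<zero>\<^bsub>L Quot J\<^esub> \<longleftrightarrow> x \<in> J"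
proof -
 interpret J: ideal J L by fact
 show ?thesis unfolding quotient_zero using J.a_rcos_const J.a_rcos_self[OF assms(2)] by metis
qed

text \<open>The natural map between quotients of \<open>L\<close>: elements of one coset of an ideal
  contained in \<open>m\<close> have the same coset modulo \<open>m\<close>, so the union is that
  coset.\<close>

definition induced_map :: "('l, 'r) ring_scheme => 'l set => 'l set => 'l set" where
 "induced_map L m T = (\<Union>x\<in>T. m +>\<^sub>L x)"

lemma induced_map_coset:
 assumes J: "ideal J L" and m: "ideal m L" and "J \<subseteq> m" and x: "x \<in> carrier L"
 shows "induced_map L m (J +>\<^sub>L x) = m +>\<^sub>L x"
proof -
 interpret J: ideal J L by fact
 interpret m: ideal m L by fact
 have "m +>\<^sub>L y = m +>\<^sub>L x" if y: "y \<in> J +>\<^sub>L x" for y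
 proof -
  obtain h where h: "h \<in> J" "y = h \<oplus>\<^sub>L x" using y unfolding a_r_coset_def' by blast
  then have "y \<in> m +>\<^sub>L x" using assms(3) unfolding a_r_coset_def' by blast
  then show ?thesis using m.a_repr_independence'[OF _ x] by simp
 qed
 moreover have "J +>\<^sub>L x \<noteq> {}" using J.a_rcos_self[OF x] by blast
 ultimately show ?thesis unfolding induced_map_def by (simp add: UN_constant_eq)
qed

lemma induced_map_hom:
 assumes J: "ideal J L" and m: "ideal m L" and Jm: "J \<subseteq> m"
 shows "induced_map L m \<in> ring_hom (L Quot J) (L Quot m)"
proof -
 interpret J: ideal J L by fact
 interpret m: ideal m L by fact
 interpret qJ: light_hom L "L Quot J" "(+>\<^sub>L) J"
  by (intro light_hom.intro J.ring_axioms J.quotient_is_ring J.rcos_ring_hom)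
 interpret qm: light_hom L "L Quot m" "(+>\<^sub>L) m"
  by (intro light_hom.intro J.ring_axioms m.quotient_is_ring m.rcos_ring_hom)
 note ic = induced_map_coset[OF J m Jm]
 show ?thesis
 proof (rule ring_hom_memI)
  fix S T assume S: "S \<in> carrier (L Quot J)" and T: "T \<in> carrier (L Quot J)"
  obtain x where x: "x \<in> carrier L" "S = J +>\<^sub>L x" using quotient_elements[OF S] by blast
  obtain y where y: "y \<in> carrier L" "T = J +>\<^sub>L y" using quotient_elements[OF T] by blast
  show "induced_map L m (S \<otimes>\<^bsub>L Quot J\<^esub> T) = induced_map L m S \<otimes>\<^bsub>L Quot m\<^esub> induced_map L m T"
   unfolding x(2) y(2) using x(1) y(1)
   by (simp only: qJ.hom_mult[symmetric] qm.hom_mult[symmetric] ic J.m_closed)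
  show "induced_map L m (S \<oplus>\<^bsub>L Quot J\<^esub> T) = induced_map L m S \<oplus>\<^bsub>L Quot m\<^esub> induced_map L m T"
   unfolding x(2) y(2) using x(1) y(1)
   by (simp only: qJ.hom_add[symmetric] qm.hom_add[symmetric] ic J.add.m_closed)
 next
  fix S assume S: "S \<in> carrier (L Quot J)"
  obtain x where x: "x \<in> carrier L" "S = J +>\<^sub>L x" using quotient_elements[OF S] by blast
  show "induced_map L m S \<in> carrier (L Quot m)" unfolding x(2) using x(1) by (simp only: ic qm.hom_closed)
 next
  show "induced_map L m \<one>\<^bsub>L Quot J\<^esub> = \<one>\<^bsub>L Quot m\<^esub>"
   unfolding qJ.hom_one[symmetric] qm.hom_one[symmetric] by (rule ic[OF J.one_closed])
 qed
qed

locale local_setting =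
 fixes R :: "('a, 'r) ring_scheme" (structure) and A P :: "'a set"
 assumes R: "cring R" and noeth: "noetherian_ring R" and A: "subring A R"
  and P: "primeideal P R" and PA: "P \<inter> A = {\<zero>}"
begin

sublocale R: cring R by (rule R)
sublocale P: primeideal P R by (rule P)

lemma complement_submonoid: "submonoid (carrier R - P) R"
proof (rule submonoid.intro)
 show "\<one> \<in> carrier R - P" using ideal.one_imp_carrier[OF P.ideal_axioms] P.I_notcarr by blast
 show "x \<otimes> y \<in> carrier R - P" if "x \<in> carrier R - P" "y \<in> carrier R - P" for x y
  using P.I_prime that by blast
qed auto

sublocale loc: localization_setting R "carrier R - P"
 by (intro localization_setting.intro localization_setting_axioms.intro R complement_submonoid)

abbreviation "\<phi> \<equiv> loc_map R (carrier R - P)"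
abbreviation "fr \<equiv> loc_frac R (carrier R - P)"
abbreviation "LR \<equiv> local_ring R P"
abbreviation "m \<equiv> local_max_ideal R P"
abbreviation "\<kappa> \<equiv> residue_field R P"
abbreviation "\<pi> \<equiv> residue_map R P"
definition res :: "'a => ('a \<times> 'a) set set" where "res r = \<pi> (\<phi> r)"

lemma LR_eq: "localization R (carrier R - P) = LR"
 by (simp add: local_ring_def)

sublocale LR: cring LR using loc.localization_cring unfolding LR_eq .

lemma phi_hom: "\<phi> \<in> ring_hom R LR" using loc.loc_map_hom unfolding LR_eq .

sublocale phi: light_hom R LR \<phi>
 by (intro light_hom.intro R.ring_axioms LR.ring_axioms phi_hom)

lemma fr_closed: "a \<in> carrier R ==> s \<in> carrier R - P ==> fr a s \<in> carrier LR"
 using loc.frac_mem unfolding LR_eq .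

lemma fr_cases: "x \<in> carrier LR ==> \<exists>a s. a \<in> carrier R \<and> s \<in> carrier R - P \<and> x = fr a s"
 using loc.frac_cases unfolding LR_eq .

lemma fr_denominator: "a \<in> carrier R ==> s \<in> carrier R - P ==> fr a s \<otimes>\<^sub>LR \<phi> s = \<phi> a"
 using loc.frac_mult_denominator unfolding LR_eq .

lemma phi_unit: "s \<in> carrier R - P ==> \<phi> s \<in> Units LR"
 using loc.loc_map_unit(2) unfolding LR_eq .

lemma phi_eq_fr: "\<phi> r = fr r \<one>" by (simp add: loc_map_def)

lemma extended_ideal': "ideal I R ==> Idl\<^bsub>LR\<^esub> (\<phi> ` I) = {fr a s |a s. a \<in> I \<and> s \<in> carrier R - P}"
 using loc.extended_ideal unfolding LR_eq .

lemma extended_is_ideal: "ideal I R ==> ideal (Idl\<^bsub>LR\<^esub> (\<phi> ` I)) LR"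
proof (rule LR.genideal_ideal, rule image_subsetI)
 show "\<phi> x \<in> carrier LR" if "ideal I R" "x \<in> I" for x
  by (rule phi.hom_closed[OF ideal.Icarr[OF that]])
qed

lemma m_eq: "m = {fr a s |a s. a \<in> P \<and> s \<in> carrier R - P}"
 unfolding local_max_ideal_def by (rule extended_ideal'[OF P.ideal_axioms])

lemma m_ideal: "ideal m LR"
 unfolding local_max_ideal_def by (rule extended_is_ideal[OF P.ideal_axioms])

sublocale m: ideal m LR by (rule m_ideal)

lemma fr_mem_extended:
 assumes "a \<in> carrier R" "s \<in> carrier R - P" "ideal I R" "fr a s \<in> Idl\<^bsub>LR\<^esub> (\<phi> ` I)"
 shows "\<exists>u\<in>carrier R - P. a \<otimes> u \<in> I"
proof -
 interpret I: ideal I R by fact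
 obtain b t where b: "fr a s = fr b t" "b \<in> I" "t \<in> carrier R - P"
  using assms(4) unfolding extended_ideal'[OF assms(3)] by blast
 then obtain u where u: "u \<in> carrier R - P" "u \<otimes> (a \<otimes> t \<ominus> b \<otimes> s) = \<zero>"
  using loc.frac_eq_iff[of a s b t] assms I.Icarr by blast
 have id: "a \<otimes> (u \<otimes> t) = u \<otimes> (a \<otimes> t \<ominus> b \<otimes> s) \<oplus> (u \<otimes> s) \<otimes> b"
  if "a \<in> carrier R" "u \<in> carrier R" "t \<in> carrier R" "b \<in> carrier R" "s \<in> carrier R" for a u t b s
  using that by algebra
 have "a \<otimes> (u \<otimes> t) = (u \<otimes> s) \<otimes> b" using id[of a u t b s] u b assms I.Icarr by simp
 moreover have "(u \<otimes> s) \<otimes> b \<in> I" using I.I_l_closed[OF b(2)] u assms by simp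
 moreover have "u \<otimes> t \<in> carrier R - P" using submonoid.m_closed[OF complement_submonoid u(1) b(3)] .
 ultimately show ?thesis by metis
qed

lemma pi_def: "\<pi> x = m +>\<^sub>LR x" by (simp add: residue_map_def)

lemma pi_hom: "\<pi> \<in> ring_hom LR \<kappa>"
 unfolding residue_field_def using m.rcos_ring_hom by (simp add: pi_def[abs_def])

lemma kappa_cring: "cring \<kappa>"
 unfolding residue_field_def by (rule m.quotient_is_cring[OF LR.cring_axioms])

sublocale kappa: cring \<kappa> by (rule kappa_cring)

sublocale pi: light_hom LR \<kappa> \<pi>
 by (intro light_hom.intro LR.ring_axioms kappa.ring_axioms pi_hom)

lemma pi_zero_iff: "x \<in> carrier LR ==> \<pi> x = \<zero>\<^sub>\<kappa> \<longleftrightarrow> x \<in> m"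
 unfolding pi_def residue_field_def by (rule quotient_eq_zero_iff[OF m_ideal])

lemma pi_surj: "y \<in> carrier \<kappa> ==> \<exists>x\<in>carrier LR. y = \<pi> x"
 unfolding pi_def residue_field_def by (rule quotient_elements)

lemma fr_mem_m: "a \<in> carrier R ==> s \<in> carrier R - P ==> fr a s \<in> m \<longleftrightarrow> a \<in> P"
proof
 assume as: "a \<in> carrier R" "s \<in> carrier R - P"
 show "a \<in> P" if "fr a s \<in> m"
 proof -
  obtain u where "u \<in> carrier R - P" "a \<otimes> u \<in> P"
   using fr_mem_extended[OF as P.ideal_axioms] \<open>fr a s \<in> m\<close> unfolding local_max_ideal_def by blast
  then show ?thesis using P.I_prime as by blast
 qed
 show "fr a s \<in> m" if "a \<in> P" unfolding m_eq using that as by blast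
qed

lemma res_hom: "res \<in> ring_hom R \<kappa>"
 using ring_hom_trans[OF phi_hom pi_hom] by (simp add: res_def[abs_def] comp_def)

sublocale res: light_hom R \<kappa> res
 by (intro light_hom.intro R.ring_axioms kappa.ring_axioms res_hom)

lemma one_not_in_P: "\<one> \<in> carrier R - P" using submonoid.one_closed[OF complement_submonoid] .

lemma res_zero_iff: "r \<in> carrier R ==> res r = \<zero>\<^sub>\<kappa> \<longleftrightarrow> r \<in> P"
 unfolding res_def using pi_zero_iff[of "\<phi> r"] fr_mem_m[of r \<one>] one_not_in_P
 by (simp add: phi_eq_fr[symmetric])

lemma kappa_fraction: "y \<in> carrier \<kappa> ==> \<exists>a s. a \<in> carrier R \<and> s \<in> carrier R - P \<and> y = \<pi> (fr a s) \<and> y \<otimes>\<^sub>\<kappa> res s = res a"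
proof -
 assume y: "y \<in> carrier \<kappa>"
 obtain x where x: "x \<in> carrier LR" "y = \<pi> x" using pi_surj[OF y] by blast
 obtain a s where a: "a \<in> carrier R" "s \<in> carrier R - P" "x = fr a s" using fr_cases[OF x(1)] by (elim exE conjE)
 have "\<pi> (fr a s) \<otimes>\<^sub>\<kappa> \<pi> (\<phi> s) = \<pi> (\<phi> a)"
  using pi.hom_mult[of "fr a s" "\<phi> s"] fr_denominator[OF a(1,2)] fr_closed[OF a(1,2)] a by simp
 then show ?thesis using a x(2) unfolding res_def by blast
qed

lemma kappa_field: "field \<kappa>"
proof (rule kappa.cring_fieldI2)
 show "\<zero>\<^sub>\<kappa> \<noteq> \<one>\<^sub>\<kappa>" using res_zero_iff[of \<one>] one_not_in_P res.hom_one by auto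
 fix y assume y: "y \<in> carrier \<kappa>" "y \<noteq> \<zero>\<^sub>\<kappa>"
 obtain a s where a: "a \<in> carrier R" "s \<in> carrier R - P" "y = \<pi> (fr a s)" "y \<otimes>\<^sub>\<kappa> res s = res a"
  using kappa_fraction[OF y(1)] by (elim exE conjE)
 have aP: "a \<in> carrier R - P"
  using y(2) a pi_zero_iff[OF fr_closed[OF a(1,2)]] fr_mem_m[OF a(1,2)] by auto
 have "\<pi> (fr s a) \<otimes>\<^sub>\<kappa> res a = res s"
  unfolding res_def using arg_cong[OF fr_denominator[of s a], of \<pi>] fr_closed[of s a] a aP by simp
 moreover have z: "\<pi> (fr s a) \<in> carrier \<kappa>" "res a \<in> carrier \<kappa>" "res s \<in> carrier \<kappa>"
  using fr_closed a aP by auto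
 ultimately have 1: "\<pi> (fr s a) \<otimes>\<^sub>\<kappa> (y \<otimes>\<^sub>\<kappa> res s) = res s" using a(4) by simp
 have "fr \<one> s \<otimes>\<^sub>LR \<phi> s = \<one>\<^sub>LR" using loc.loc_map_unit(1)[OF a(2)] unfolding LR_eq .
 then have inv: "res s \<otimes>\<^sub>\<kappa> \<pi> (fr \<one> s) = \<one>\<^sub>\<kappa>"
  unfolding res_def using pi.hom_mult[of "fr \<one> s" "\<phi> s"] fr_closed[of \<one> s] a(1,2) kappa.m_comm by simp
 have pc: "\<pi> (fr \<one> s) \<in> carrier \<kappa>" using fr_closed a by simp
 have "y \<otimes>\<^sub>\<kappa> \<pi> (fr s a) = (\<pi> (fr s a) \<otimes>\<^sub>\<kappa> (y \<otimes>\<^sub>\<kappa> res s)) \<otimes>\<^sub>\<kappa> \<pi> (fr \<one> s)"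
 proof -
  have "(p \<otimes>\<^sub>\<kappa> (y \<otimes>\<^sub>\<kappa> r)) \<otimes>\<^sub>\<kappa> q = (y \<otimes>\<^sub>\<kappa> p) \<otimes>\<^sub>\<kappa> (r \<otimes>\<^sub>\<kappa> q)"
   if "p \<in> carrier \<kappa>" "r \<in> carrier \<kappa>" "q \<in> carrier \<kappa>" for p r q
   using that y(1) by (simp add: kappa.m_ac)
  from this[OF z(1) z(3) pc] show ?thesis unfolding inv using y(1) z(1) by simp
 qed
 then have "y \<otimes>\<^sub>\<kappa> \<pi> (fr s a) = \<one>\<^sub>\<kappa>" unfolding 1 inv .
 then show "\<exists>b\<in>carrier \<kappa>. y \<otimes>\<^sub>\<kappa> b = \<one>\<^sub>\<kappa>" using z by blast
qed

sublocale kappa: field \<kappa> by (rule kappa_field)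

text \<open>The image of Quot(A) in the residue field, written with fractions over \<open>R\<close>;
  \<open>embed_image\<close> later identifies it with the image of
  \<open>quot_field\<close>.\<close>

definition Kbar :: "('a \<times> 'a) set set set" where
 "Kbar = {\<pi> (fr a s) |a s. a \<in> A \<and> s \<in> A \<and> s \<noteq> \<zero>}"

lemma A_closed: "a \<in> A ==> a \<in> carrier R" using subringE(1)[OF A] by blast

lemma A_not_P: "a \<in> A ==> a \<noteq> \<zero> ==> a \<in> carrier R - P" using PA A_closed by blast

end

locale primary_setting = local_setting +
 fixes I assumes I: "primary_to R P I"
begin

lemma I_ideal: "ideal I R" and I_radical: "radical R I = P"
 using I unfolding primary_to_def primary_ideal_def by simp_all

sublocale I: ideal I R by (rule I_ideal)

lemma I_primary: "a \<in> carrier R ==> s \<in> carrier R - P ==> a \<otimes> s \<in> I ==> a \<in> I"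
 using I unfolding primary_to_def primary_ideal_def by blast

lemma I_subset_P: "I \<subseteq> P"
proof
 fix x assume x: "x \<in> I"
 then have "x [^] (1::nat) \<in> I" using I.Icarr by simp
 then show "x \<in> P" using I_radical x I.Icarr unfolding radical_def by blast
qed

abbreviation "J \<equiv> Idl\<^bsub>LR\<^esub> (\<phi> ` I)"
abbreviation "B \<equiv> LR Quot J"
abbreviation "\<rho> \<equiv> induced_map LR m"
definition \<beta> :: "'a => ('a \<times> 'a) set set" where "\<beta> r = J +>\<^sub>LR \<phi> r"

lemma J_ideal: "ideal J LR" by (rule extended_is_ideal[OF I_ideal])
sublocale J: ideal J LR by (rule J_ideal)

lemma J_subset_m: "J \<subseteq> m"
 unfolding m_eq extended_ideal'[OF I_ideal] using I_subset_P by blast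

lemma B_cring: "cring B" by (rule J.quotient_is_cring[OF LR.cring_axioms])
sublocale B: cring B by (rule B_cring)

lemma quot_hom: "(+>\<^sub>LR) J \<in> ring_hom LR B" by (rule J.rcos_ring_hom)
sublocale quot: light_hom LR B "(+>\<^sub>LR) J"
 by (intro light_hom.intro LR.ring_axioms B.ring_axioms quot_hom)

lemma beta_hom: "\<beta> \<in> ring_hom R B"
 using ring_hom_trans[OF phi_hom quot_hom] by (simp add: \<beta>_def[abs_def] comp_def)
sublocale beta: light_hom R B \<beta>
 by (intro light_hom.intro R.ring_axioms B.ring_axioms beta_hom)

text \<open>The extended ideal remembers \<open>I\<close> only up to a factor outside
  \<open>P\<close>, and such a factor can be cancelled because \<open>I\<close> is primary with
  radical \<open>P\<close>. So \<open>R\<close> modulo \<open>I\<close> embeds into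
  \<open>B\<close>.\<close>

lemma beta_zero_iff: "r \<in> carrier R ==> \<beta> r = \<zero>\<^sub>B \<longleftrightarrow> r \<in> I"
proof -
 assume r: "r \<in> carrier R"
 have "\<phi> r \<in> J \<longleftrightarrow> r \<in> I"
 proof
  assume "\<phi> r \<in> J"
  then obtain u where "u \<in> carrier R - P" "r \<otimes> u \<in> I"
   using fr_mem_extended[OF r one_not_in_P I_ideal] unfolding phi_eq_fr by blast
  then show "r \<in> I" using I_primary[OF r] by blast
 next
  assume "r \<in> I"
  then show "\<phi> r \<in> J" using LR.genideal_self[of "\<phi> ` I"] phi.hom_closed I.Icarr by blast
 qed
 then show ?thesis unfolding \<beta>_def using quotient_eq_zero_iff[OF J_ideal phi.hom_closed[OF r]] by simp
qed

lemma rho_coset: "x \<in> carrier LR ==> \<rho> (J +>\<^sub>LR x) = \<pi> x"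
 unfolding pi_def by (rule induced_map_coset[OF J_ideal m_ideal J_subset_m])

lemma rho_beta: "r \<in> carrier R ==> \<rho> (\<beta> r) = res r"
 unfolding \<beta>_def res_def by (rule rho_coset[OF phi.hom_closed])

lemma beta_unit: "s \<in> carrier R - P ==> \<beta> s \<in> Units B"
 unfolding \<beta>_def
proof -
 assume s: "s \<in> carrier R - P"
 have u: "\<phi> s \<in> Units LR" by (rule phi_unit[OF s])
 have i: "inv\<^bsub>LR\<^esub> \<phi> s \<in> carrier LR" "\<phi> s \<in> carrier LR" using u by (auto simp: LR.Units_closed)
 have "(J +>\<^sub>LR \<phi> s) \<otimes>\<^sub>B (J +>\<^sub>LR inv\<^bsub>LR\<^esub> \<phi> s) = \<one>\<^sub>B"
  using arg_cong[OF LR.Units_r_inv[OF u], of "(+>\<^sub>LR) J"] i by simp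
 moreover have "(J +>\<^sub>LR \<phi> s) \<in> carrier B" "(J +>\<^sub>LR inv\<^bsub>LR\<^esub> \<phi> s) \<in> carrier B"
  using quot.hom_closed i by auto
 ultimately show "J +>\<^sub>LR \<phi> s \<in> Units B"
  unfolding Units_def using B.m_comm by (intro CollectI conjI bexI[of _ "J +>\<^sub>LR inv\<^bsub>LR\<^esub> \<phi> s"]) simp_all
qed

lemma B_fraction: "b \<in> carrier B ==> \<exists>a s. a \<in> carrier R \<and> s \<in> carrier R - P \<and> b = J +>\<^sub>LR fr a s \<and> b \<otimes>\<^sub>B \<beta> s = \<beta> a"
proof -
 assume b: "b \<in> carrier B"
 obtain x where x: "x \<in> carrier LR" "b = J +>\<^sub>LR x" using quotient_elements[OF b] by blast
 obtain a s where a: "a \<in> carrier R" "s \<in> carrier R - P" "x = fr a s" using fr_cases[OF x(1)] by (elim exE conjE)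
 have "b \<otimes>\<^sub>B \<beta> s = \<beta> a"
  unfolding \<beta>_def x(2) a(3)
  using arg_cong[OF fr_denominator[OF a(1,2)], of "(+>\<^sub>LR) J"] fr_closed[OF a(1,2)] a by simp
 then show ?thesis using a x(2) by blast
qed

lemma B_noetherian: "noetherian_ring B"
proof (rule noetherian_if_fractions[OF noeth B_cring beta_hom])
 fix b assume "b \<in> carrier B"
 from B_fraction[OF this] show "\<exists>a\<in>carrier R. \<exists>s\<in>carrier R. \<beta> s \<in> Units B \<and> b \<otimes>\<^sub>B \<beta> s = \<beta> a"
  using beta_unit by blast
qed

lemma rho_hom: "\<rho> \<in> ring_hom B \<kappa>"
 unfolding residue_field_def by (rule induced_map_hom[OF J_ideal m_ideal J_subset_m])

sublocale rho: light_hom B \<kappa> \<rho>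
 by (intro light_hom.intro B.ring_axioms kappa.ring_axioms rho_hom)

lemma kernel_fraction:
 assumes b: "b \<in> carrier B" "\<rho> b = \<zero>\<^sub>\<kappa>"
 shows "\<exists>p s. p \<in> P \<and> s \<in> carrier R - P \<and> b \<otimes>\<^sub>B \<beta> s = \<beta> p"
proof -
 obtain a s where a: "a \<in> carrier R" "s \<in> carrier R - P" "b = J +>\<^sub>LR fr a s" "b \<otimes>\<^sub>B \<beta> s = \<beta> a"
  using B_fraction[OF b(1)] by (elim exE conjE)
 have "\<pi> (fr a s) = \<zero>\<^sub>\<kappa>" using b(2) rho_coset[OF fr_closed[OF a(1,2)]] a(3) by simp
 then have "a \<in> P" using pi_zero_iff[OF fr_closed[OF a(1,2)]] fr_mem_m[OF a(1,2)] by simp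
 then show ?thesis using a by blast
qed

lemma cancel_beta:
 assumes "b \<in> carrier B" "s \<in> carrier R - P" "b \<otimes>\<^sub>B \<beta> s = \<zero>\<^sub>B" shows "b = \<zero>\<^sub>B"
proof -
 have u: "\<beta> s \<in> Units B" by (rule beta_unit[OF assms(2)])
 have "b = (b \<otimes>\<^sub>B \<beta> s) \<otimes>\<^sub>B inv\<^bsub>B\<^esub> \<beta> s"
  using B.m_assoc[OF assms(1) B.Units_closed[OF u] B.Units_inv_closed[OF u]] B.Units_r_inv[OF u] assms(1) by (simp only: B.r_one)
 then show ?thesis using assms(3) B.Units_inv_closed[OF u] by simp
qed

lemma kernel_nilpotent:
 assumes b: "b \<in> carrier B" "\<rho> b = \<zero>\<^sub>\<kappa>"
 shows "\<exists>n::nat. b [^]\<^sub>B n = \<zero>\<^sub>B"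
proof -
 obtain p s where p: "p \<in> P" "s \<in> carrier R - P" "b \<otimes>\<^sub>B \<beta> s = \<beta> p"
  using kernel_fraction[OF b] by (elim exE conjE)
 obtain n :: nat where n: "p [^] n \<in> I" using p(1) I_radical unfolding radical_def by blast
 have pR: "p \<in> carrier R" "s \<in> carrier R" using p by auto
 have "b [^]\<^sub>B n \<otimes>\<^sub>B \<beta> (s [^] n) = (b \<otimes>\<^sub>B \<beta> s) [^]\<^sub>B n"
  using b(1) pR by (simp add: beta.hom_nat_pow B.nat_pow_distrib)
 also have "\<dots> = \<beta> (p [^] n)" unfolding p(3) using pR by (simp add: beta.hom_nat_pow)
 also have "\<dots> = \<zero>\<^sub>B" using beta_zero_iff n pR by simp
 finally have z: "b [^]\<^sub>B n \<otimes>\<^sub>B \<beta> (s [^] n) = \<zero>\<^sub>B" .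
 have "s [^] n \<in> carrier R - P" for n :: nat
  by (induction n) (use one_not_in_P submonoid.m_closed[OF complement_submonoid _ p(2)] in simp_all)
 then have "b [^]\<^sub>B n = \<zero>\<^sub>B" using cancel_beta[OF _ _ z] b(1) by simp
 then show ?thesis by blast
qed

lemma rho_surj: "\<rho> ` carrier B = carrier \<kappa>"
proof
 show "\<rho> ` carrier B \<subseteq> carrier \<kappa>" by auto
 show "carrier \<kappa> \<subseteq> \<rho> ` carrier B"
 proof
  fix y assume "y \<in> carrier \<kappa>"
  from pi_surj[OF this] obtain x where x: "x \<in> carrier LR" "y = \<pi> x" by blast
  then have "y = \<rho> (J +>\<^sub>LR x)" "J +>\<^sub>LR x \<in> carrier B" using rho_coset quot.hom_closed by auto
  then show "y \<in> \<rho> ` carrier B" by (rule image_eqI)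
 qed
qed

lemma residue_cover_B: "residue_cover B \<kappa> \<rho>"
 by (intro residue_cover.intro residue_cover_axioms.intro B_cring kappa_field rho_hom rho_surj kernel_nilpotent)

text \<open>Each kernel element is, up to a unit, the image of an element of \<open>P\<close>. A
  product of \<open>n\<close> of them is therefore, up to a unit, the image of an element of the
  n-th power of \<open>P\<close>, which lies in \<open>I\<close>.\<close>

lemma kernel_products:
 assumes n: "P [^]\<^bsub>ideals_set R\<^esub> n \<subseteq> I"
  and xs: "length xs = n" "set xs \<subseteq> carrier B" "!!b. b \<in> set xs ==> \<rho> b = \<zero>\<^sub>\<kappa>" and x: "x \<in> carrier B"
 shows "foldr (\<otimes>\<^sub>B) xs x = \<zero>\<^sub>B"
proof -
 have *: "foldr (\<otimes>\<^sub>B) ys x \<in> carrier B \<and> (\<exists>p s. p \<in> P [^]\<^bsub>ideals_set R\<^esub> (length ys) \<and> p \<in> carrier R \<and> s \<in> carrier R - P \<and>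
   foldr (\<otimes>\<^sub>B) ys x \<otimes>\<^sub>B \<beta> s = \<beta> p \<otimes>\<^sub>B x)" if "set ys \<subseteq> set xs" for ys
  using that
 proof (induction ys)
  case Nil
  have "\<one> \<in> P [^]\<^bsub>ideals_set R\<^esub> (0::nat)" by (simp add: ideals_set_def)
  then show ?case using one_not_in_P x
   by (intro conjI exI[of _ \<one>]) simp_all
 next
  case (Cons b ys)
  have b: "b \<in> carrier B" "\<rho> b = \<zero>\<^sub>\<kappa>" using Cons.prems xs by auto
  have IH: "foldr (\<otimes>\<^sub>B) ys x \<in> carrier B" "\<exists>p s. p \<in> P [^]\<^bsub>ideals_set R\<^esub> (length ys) \<and> p \<in> carrier R \<and> s \<in> carrier R - P \<and>
   foldr (\<otimes>\<^sub>B) ys x \<otimes>\<^sub>B \<beta> s = \<beta> p \<otimes>\<^sub>B x" using Cons.IH Cons.prems by auto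
  obtain p s where p: "p \<in> P [^]\<^bsub>ideals_set R\<^esub> (length ys)" "p \<in> carrier R" "s \<in> carrier R - P"
   "foldr (\<otimes>\<^sub>B) ys x \<otimes>\<^sub>B \<beta> s = \<beta> p \<otimes>\<^sub>B x" using IH(2) by (elim exE conjE)
  obtain q t where q: "q \<in> P" "t \<in> carrier R - P" "b \<otimes>\<^sub>B \<beta> t = \<beta> q"
   using kernel_fraction[OF b] by (elim exE conjE)
  have id: "(b \<otimes>\<^sub>B y) \<otimes>\<^sub>B (s \<otimes>\<^sub>B t) = (b \<otimes>\<^sub>B t) \<otimes>\<^sub>B (y \<otimes>\<^sub>B s)"
   if "b \<in> carrier B" "y \<in> carrier B" "s \<in> carrier B" "t \<in> carrier B" for b y s t
   using that by (simp add: B.m_ac)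
  have cR: "q \<in> carrier R" "s \<in> carrier R" "t \<in> carrier R" using q p by auto
  have "foldr (\<otimes>\<^sub>B) (b # ys) x \<otimes>\<^sub>B \<beta> (s \<otimes> t) = (b \<otimes>\<^sub>B \<beta> t) \<otimes>\<^sub>B (foldr (\<otimes>\<^sub>B) ys x \<otimes>\<^sub>B \<beta> s)"
   using id[OF b(1) IH(1), of "\<beta> s" "\<beta> t"] cR by simp
  also have "\<dots> = \<beta> (p \<otimes> q) \<otimes>\<^sub>B x"
   unfolding q(3) p(4) using cR p(2) x by (simp add: B.m_ac)
  finally have eq: "foldr (\<otimes>\<^sub>B) (b # ys) x \<otimes>\<^sub>B \<beta> (s \<otimes> t) = \<beta> (p \<otimes> q) \<otimes>\<^sub>B x" .
  have "p \<otimes> q \<in> P [^]\<^bsub>ideals_set R\<^esub> (length (b # ys))"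
   using ideal_prod.prod[OF p(1) q(1)] by (simp add: ideals_set_def)
  moreover have "s \<otimes> t \<in> carrier R - P" using submonoid.m_closed[OF complement_submonoid p(3) q(2)] .
  moreover have "foldr (\<otimes>\<^sub>B) (b # ys) x \<in> carrier B" using b(1) IH(1) by simp
  ultimately show ?case using eq p(2) cR by (intro conjI exI[of _ "p \<otimes> q"] exI[of _ "s \<otimes> t"]) simp_all
 qed
 obtain p s where p: "p \<in> P [^]\<^bsub>ideals_set R\<^esub> (length xs)" "p \<in> carrier R" "s \<in> carrier R - P"
   "foldr (\<otimes>\<^sub>B) xs x \<otimes>\<^sub>B \<beta> s = \<beta> p \<otimes>\<^sub>B x" using *[OF order_refl] by (elim exE conjE)
 have "\<beta> p = \<zero>\<^sub>B" using p(1,2) n xs(1) beta_zero_iff by blast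
 then have "foldr (\<otimes>\<^sub>B) xs x \<otimes>\<^sub>B \<beta> s = \<zero>\<^sub>B" using p(4) x by simp
 then show ?thesis using cancel_beta *[OF order_refl] p(3) by blast
qed

text \<open>A copy of Quot(A) inside \<open>B\<close>, available because \<open>I\<close> meets
  \<open>A\<close> only in zero. The maximal subfield is grown from it.\<close>

definition K0 :: "('a \<times> 'a) set set set" where
 "K0 = {c \<otimes>\<^sub>B inv\<^bsub>B\<^esub> d |c d. c \<in> \<beta> ` A \<and> d \<in> \<beta> ` A \<and> d \<noteq> \<zero>\<^sub>B}"

lemma beta_A_nonzero: "a \<in> A ==> \<beta> a \<noteq> \<zero>\<^sub>B \<longleftrightarrow> a \<noteq> \<zero>"
 using beta_zero_iff[OF A_closed] I_subset_P PA I.zero_closed beta.hom_zero by blast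

lemma K0_subfield: "subfield K0 B" "\<beta> ` A \<subseteq> K0"
proof -
 have sub: "subring (\<beta> ` A) B" by (rule beta.img_is_subring[OF A])
 have inj: "c = \<zero>\<^sub>B" if c: "c \<in> \<beta> ` A" "\<rho> c = \<zero>\<^sub>\<kappa>" for c
 proof -
  obtain a where a: "a \<in> A" "c = \<beta> a" using c(1) by (rule imageE) simp
  then have "a \<in> P" using c(2) rho_beta[OF A_closed[OF a(1)]] res_zero_iff[OF A_closed[OF a(1)]] by simp
  then have "a = \<zero>" using PA a(1) by blast
  then show ?thesis using a(2) by simp
 qed
 show "subfield K0 B" "\<beta> ` A \<subseteq> K0"
  unfolding K0_def by (rule residue_cover.fraction_subfield[OF residue_cover_B sub inj]; assumption)+
qed

lemma rho_K0: "\<rho> ` K0 = Kbar"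
proof -
 have val: "\<rho> (\<beta> a \<otimes>\<^sub>B inv\<^bsub>B\<^esub> \<beta> s) = \<pi> (fr a s)" if a: "a \<in> A" and s: "s \<in> A" "s \<noteq> \<zero>" for a s
 proof -
  have sP: "s \<in> carrier R - P" and aR: "a \<in> carrier R" using A_not_P[OF s] A_closed[OF a] by simp_all
  have u: "\<beta> s \<in> Units B" by (rule beta_unit[OF sP])
  have F: "fr a s \<in> carrier LR" by (rule fr_closed[OF aR sP])
  have eq: "(J +>\<^sub>LR fr a s) \<otimes>\<^sub>B \<beta> s = \<beta> a"
   unfolding \<beta>_def using arg_cong[OF fr_denominator[OF aR sP], of "(+>\<^sub>LR) J"] F sP by simp
  have "\<beta> a \<otimes>\<^sub>B inv\<^bsub>B\<^esub> \<beta> s = J +>\<^sub>LR fr a s"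
   unfolding eq[symmetric]
   using B.m_assoc[OF quot.hom_closed[OF F] B.Units_closed[OF u] B.Units_inv_closed[OF u]] B.Units_r_inv[OF u]
    quot.hom_closed[OF F] by (simp only: B.r_one)
  then show ?thesis using rho_coset[OF F] by simp
 qed
 show ?thesis
 proof
  show "\<rho> ` K0 \<subseteq> Kbar"
  proof (rule image_subsetI)
   fix x assume "x \<in> K0"
   then obtain a s where a: "a \<in> A" "s \<in> A" "\<beta> s \<noteq> \<zero>\<^sub>B" "x = \<beta> a \<otimes>\<^sub>B inv\<^bsub>B\<^esub> \<beta> s" unfolding K0_def by blast
   then show "\<rho> x \<in> Kbar" using val[of a s] beta_A_nonzero[of s] unfolding Kbar_def by blast
  qed
  show "Kbar \<subseteq> \<rho> ` K0"
  proof
   fix y assume "y \<in> Kbar"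
   then obtain a s where a: "a \<in> A" "s \<in> A" "s \<noteq> \<zero>" "y = \<pi> (fr a s)" unfolding Kbar_def by blast
   have "\<beta> a \<otimes>\<^sub>B inv\<^bsub>B\<^esub> \<beta> s \<in> K0" unfolding K0_def using a beta_A_nonzero[of s] by blast
   then show "y \<in> \<rho> ` K0" using val[OF a(1-3)] a(4) by (metis imageI)
  qed
 qed
qed

end

lemma (in light_hom) hom_uminus: "x \<in> carrier R ==> h (\<ominus> x) = \<ominus>\<^sub>S h x"
proof -
 interpret R: ring R by (rule R)
 interpret S: ring S by (rule S)
 assume x: "x \<in> carrier R"
 then have "h (\<ominus> x) \<oplus>\<^sub>S h x = \<zero>\<^sub>S" using hom_add[of "\<ominus> x" x] hom_zero by (simp del: hom_add add: R.l_neg)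
 then show ?thesis using S.minus_equality x by simp
qed

text \<open>Through the isomorphism with the localization, the images of the algebra generators
  together with \<open>A\<close> generate the image of the algebra, and the denominators are images
  of algebra elements that have become units.\<close>

lemma ess_finite_type_fraction_generated:
 fixes R :: "'a ring"
 assumes "cring R" "A \<subseteq> carrier R" "ess_finite_type R A"
 shows "\<exists>V. finite V \<and> V \<subseteq> carrier R \<and> fraction_generated R (A \<union> V)"
proof -
 obtain B :: "'a ring" and f S U h where B: "cring B" "f \<in> ring_hom (R\<lparr>carrier := A\<rparr>) B"
  and U: "finite U" "U \<subseteq> carrier B" "generate_ring B (f ` A \<union> U) = carrier B"
  and S: "submonoid S B" and h: "h \<in> ring_iso (localization B S) R" "\<forall>a\<in>A. h (loc_map B S (f a)) = a"
  using assms(3) unfolding ess_finite_type_def by (elim exE conjE bexE) (rule that, simp_all)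
 interpret R: cring R by fact
 interpret loc: localization_setting B S by (intro localization_setting.intro localization_setting_axioms.intro B(1) S)
 have hh: "h \<in> ring_hom loc.L R" "bij_betw h (carrier loc.L) (carrier R)" using h(1) unfolding ring_iso_def by auto
 have Lring: "ring loc.L" using loc.localization_cring cring.axioms(1) by blast
 interpret h: light_hom loc.L R h by (intro light_hom.intro Lring R.ring_axioms hh(1))
 interpret l: light_hom B loc.L "loc_map B S" by (intro light_hom.intro Lring loc.ring_axioms loc.loc_map_hom)
 let ?g = "\<lambda>b. h (loc_map B S b)"
 interpret g: light_hom B R ?g
  by (intro light_hom.intro loc.ring_axioms R.ring_axioms) (use ring_hom_trans[OF loc.loc_map_hom hh(1)] in \<open>simp add: comp_def\<close>)
 have gen: "?g b \<in> generate_ring R (A \<union> ?g ` U)" if b: "b \<in> carrier B" for b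
  using b unfolding U(3)[symmetric]
 proof (induction b rule: generate_ring.induct)
  case one
  show ?case unfolding g.hom_one by (rule generate_ring.one)
 next
  case (incl b)
  then show ?case
  proof
   assume "b \<in> f ` A"
   then obtain a where a: "a \<in> A" "b = f a" by (rule imageE) simp
   show ?thesis unfolding a(2) bspec[OF h(2) a(1)] by (rule generate_ring.incl) (use a in simp)
  next
   assume "b \<in> U"
   then show ?thesis by (intro generate_ring.incl) simp
  qed
 next
  case (a_inv b)
  then have "b \<in> carrier B" unfolding U(3) by simp
  from g.hom_uminus[OF this] show ?case using generate_ring.a_inv[OF a_inv.IH] by simp
 next
  case (eng_add b1 b2)
  then have "b1 \<in> carrier B" "b2 \<in> carrier B" unfolding U(3) by simp_all
  from g.hom_add[OF this] show ?case using generate_ring.eng_add[OF eng_add.IH] by simp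
 next
  case (eng_mult b1 b2)
  then have "b1 \<in> carrier B" "b2 \<in> carrier B" unfolding U(3) by simp_all
  from g.hom_mult[OF this] show ?case using generate_ring.eng_mult[OF eng_mult.IH] by simp
 qed
 have "fraction_generated R (A \<union> ?g ` U)"
  unfolding fraction_generated_def
 proof
  fix r assume r: "r \<in> carrier R"
  then have "r \<in> h ` carrier loc.L" using hh(2) unfolding bij_betw_def by simp
  then obtain x where x: "x \<in> carrier loc.L" "r = h x" by (rule imageE) simp
  obtain b s where bs: "b \<in> carrier B" "s \<in> S" "x = loc_frac B S b s" using loc.frac_cases[OF x(1)] by (elim exE conjE)
  have sB: "s \<in> carrier B" using bs(2) by simp
  have 1: "r \<otimes>\<^sub>R ?g s = ?g b"
   using arg_cong[OF loc.frac_mult_denominator[OF bs(1,2)], of h] x bs(3) sB by simp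
  have fs: "loc_frac B S \<one>\<^sub>B s \<in> carrier loc.L" by (rule loc.frac_mem) (use bs in auto)
  have 2: "h (loc_frac B S \<one>\<^sub>B s) \<otimes>\<^sub>R ?g s = \<one>\<^sub>R"
   using arg_cong[OF loc.loc_map_unit(1)[OF bs(2)], of h] fs sB by simp
  have gs: "?g s \<in> carrier R" "h (loc_frac B S \<one>\<^sub>B s) \<in> carrier R" using fs sB by simp_all
  have u: "?g s \<in> Units R"
   using 2 R.m_comm[OF gs] gs unfolding Units_def by (intro CollectI conjI bexI[of _ "h (loc_frac B S \<one>\<^sub>B s)"]) simp_all
  have "r = ?g b \<otimes>\<^sub>R inv\<^bsub>R\<^esub> ?g s"
   unfolding 1[symmetric] using R.m_assoc[OF r R.Units_closed[OF u] R.Units_inv_closed[OF u]] R.Units_r_inv[OF u] r by (simp only: R.r_one)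
  then show "\<exists>c\<in>generate_ring R (A \<union> ?g ` U). \<exists>w\<in>generate_ring R (A \<union> ?g ` U). w \<in> Units R \<and> r = c \<otimes>\<^sub>R inv\<^bsub>R\<^esub> w"
   using gen[OF bs(1)] gen[OF sB] u by blast
 qed
 moreover have "finite (?g ` U)" "?g ` U \<subseteq> carrier R" using U g.hom_closed by auto
 ultimately show ?thesis by blast
qed

context local_setting
begin

lemma fr_mult: "a \<in> carrier R ==> s \<in> carrier R - P ==> b \<in> carrier R ==> t \<in> carrier R - P ==>
  fr a s \<otimes>\<^sub>LR fr b t = fr (a \<otimes> b) (s \<otimes> t)"
 using loc.frac_mult unfolding LR_eq .

lemma fr_add: "a \<in> carrier R ==> s \<in> carrier R - P ==> b \<in> carrier R ==> t \<in> carrier R - P ==>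
  fr a s \<oplus>\<^sub>LR fr b t = fr (a \<otimes> t \<oplus> b \<otimes> s) (s \<otimes> t)"
 using loc.frac_add unfolding LR_eq .

lemma division_in_subfield:
 assumes G: "subfield G \<kappa>" and y: "y \<in> carrier \<kappa>" and d: "d \<in> G" "d \<noteq> \<zero>\<^sub>\<kappa>" and yd: "y \<otimes>\<^sub>\<kappa> d \<in> G"
 shows "y \<in> G"
proof -
 have dk: "d \<in> carrier \<kappa>" using d(1) subfieldE(3)[OF G] by blast
 then have u: "d \<in> Units \<kappa>" using d(2) kappa.field_Units by simp
 have "inv\<^bsub>\<kappa>\<^esub> d \<in> G" using kappa.subfield_m_inv(1)[OF G] d by simp
 then have "(y \<otimes>\<^sub>\<kappa> d) \<otimes>\<^sub>\<kappa> inv\<^bsub>\<kappa>\<^esub> d \<in> G" using subringE(6)[OF subfieldE(1)[OF G] yd] by simp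
 moreover have "(y \<otimes>\<^sub>\<kappa> d) \<otimes>\<^sub>\<kappa> inv\<^bsub>\<kappa>\<^esub> d = y"
  using kappa.m_assoc[OF y dk kappa.Units_inv_closed[OF u]] kappa.Units_r_inv[OF u] y by simp
 ultimately show ?thesis by simp
qed

lemma Kbar_closed: "Kbar \<subseteq> carrier \<kappa>"
proof
 fix y assume "y \<in> Kbar"
 then obtain a s where "a \<in> A" "s \<in> A" "s \<noteq> \<zero>" "y = \<pi> (fr a s)" unfolding Kbar_def by blast
 then show "y \<in> carrier \<kappa>" using fr_closed[OF A_closed A_not_P] by simp
qed

lemma one_in_A: "\<one> \<in> A" "\<one> \<noteq> \<zero>"
 using subringE(3)[OF A] one_not_in_P P.zero_closed by auto

lemma res_A: "a \<in> A ==> res a \<in> Kbar"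
 unfolding res_def phi_eq_fr Kbar_def using one_in_A by blast

text \<open>Units of \<open>R\<close> and elements outside \<open>P\<close> have nonzero residues.
  So a subfield containing the residues of the generators contains the residues of all fractions,
  first those in \<open>R\<close> and then those in the local ring.\<close>

lemma kappa_generated:
 assumes V: "V \<subseteq> carrier R" "fraction_generated R (A \<union> V)"
 shows "generate_field \<kappa> (Kbar \<union> res ` V) = carrier \<kappa>"
proof -
 have sub: "Kbar \<union> res ` V \<subseteq> carrier \<kappa>" using Kbar_closed V(1) res.hom_closed by auto
 let ?G = "generate_field \<kappa> (Kbar \<union> res ` V)"
 have G: "subfield ?G \<kappa>" by (rule kappa.generate_field_is_subfield[OF sub])
 note Gr = subfieldE(1)[OF G]
 have gen: "c \<in> carrier R \<and> res c \<in> ?G" if "c \<in> generate_ring R (A \<union> V)" for c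
  using that
 proof (induction c rule: generate_ring.induct)
  case one
  then show ?case using subringE(3)[OF Gr] by simp
 next
  case (incl c)
  have "res c \<in> Kbar \<union> res ` V"
   using incl by (elim UnE) (rule UnI1, rule res_A, assumption, rule UnI2, rule imageI, assumption)
  moreover have "c \<in> carrier R" using incl by (elim UnE) (rule A_closed, assumption, rule subsetD[OF V(1)], assumption)
  ultimately show ?case by (intro conjI generate_field.incl)
 next
  case (a_inv c)
  then show ?case using subringE(5)[OF Gr] res.hom_uminus by simp
 next
  case (eng_add c1 c2)
  then show ?case using subringE(7)[OF Gr] by simp
 next
  case (eng_mult c1 c2)
  then show ?case using subringE(6)[OF Gr] by simp
 qed
 have resG: "res r \<in> ?G" if r: "r \<in> carrier R" for r
 proof -
  obtain c w where c: "c \<in> generate_ring R (A \<union> V)" "w \<in> generate_ring R (A \<union> V)" "w \<in> Units R" "r = c \<otimes> inv w"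
   using V(2) r unfolding fraction_generated_def by blast
  have cR: "c \<in> carrier R" "w \<in> carrier R" using gen[OF c(1)] gen[OF c(2)] by simp_all
  have rw: "r \<otimes> w = c" unfolding c(4)
   using R.m_assoc[OF cR(1) R.Units_inv_closed[OF c(3)] cR(2)] R.Units_l_inv[OF c(3)] cR by simp
  have "res r \<otimes>\<^sub>\<kappa> res w = res c" using arg_cong[OF rw, of res] r cR by simp
  moreover have "res w \<noteq> \<zero>\<^sub>\<kappa>"
  proof
   assume "res w = \<zero>\<^sub>\<kappa>"
   then have "w \<in> P" using res_zero_iff cR by simp
   then have "inv w \<otimes> w \<in> P" using P.I_l_closed R.Units_inv_closed[OF c(3)] by simp
   then show False using R.Units_l_inv[OF c(3)] one_not_in_P by simp
  qed
  ultimately show ?thesis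
   using division_in_subfield[OF G res.hom_closed[OF r], of "res w"] gen[OF c(1)] gen[OF c(2)] by simp
 qed
 have "y \<in> ?G" if y: "y \<in> carrier \<kappa>" for y
 proof -
  obtain a s where a: "a \<in> carrier R" "s \<in> carrier R - P" "y \<otimes>\<^sub>\<kappa> res s = res a"
   using kappa_fraction[OF y] by (elim exE conjE)
  have "res s \<noteq> \<zero>\<^sub>\<kappa>" using res_zero_iff a(2) by simp
  then show ?thesis using division_in_subfield[OF G y, of "res s"] resG a by simp
 qed
 then show ?thesis using subfieldE(3)[OF G] by blast
qed

end

section \<open>The fraction field of A and its embedding into the residue field\<close>

locale fraction_setting = local_setting +
 assumes AR: "domain (R\<lparr>carrier := A\<rparr>)"
begin

abbreviation "AR \<equiv> R\<lparr>carrier := A\<rparr>"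
abbreviation "Q \<equiv> quot_field AR"

lemma AR_cring: "cring AR" using AR unfolding domain_def by simp

text \<open>The additive inverse in the restricted record is an inverse within \<open>A\<close>; it
  is matched with the one in \<open>R\<close> before fractions over the two rings are
  compared.\<close>

lemma AR_minus: "x \<in> A ==> y \<in> A ==> x \<ominus>\<^sub>AR y = x \<ominus> y"
proof -
 interpret AR: cring AR by (rule AR_cring)
 assume xy: "x \<in> A" "y \<in> A"
 then have my: "\<ominus> y \<in> A" using subringE(5)[OF A] by simp
 have "\<ominus> y \<oplus> y = \<zero>" using R.l_neg A_closed xy by simp
 then have "\<ominus>\<^sub>AR y = \<ominus> y" using AR.minus_equality[of "\<ominus> y" y] xy my by simp
 then show ?thesis by (simp add: a_minus_def)
qed

lemma A_submonoid: "submonoid (A - {\<zero>}) AR"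
proof (rule submonoid.intro)
 show "\<one>\<^sub>AR \<in> A - {\<zero>}" using one_in_A by simp
 show "x \<otimes>\<^sub>AR y \<in> A - {\<zero>}" if "x \<in> A - {\<zero>}" "y \<in> A - {\<zero>}" for x y
  using that domain.integral[OF AR, of x y] subringE(6)[OF A] by auto
qed auto

lemma locA: "localization_setting AR (A - {\<zero>})"
 by (intro localization_setting.intro localization_setting_axioms.intro AR_cring A_submonoid)

lemma Q_eq: "localization AR (A - {\<zero>}) = Q" by (simp add: quot_field_def)

abbreviation "frA \<equiv> loc_frac AR (A - {\<zero>})"

lemma frA_closed: "a \<in> A ==> s \<in> A ==> s \<noteq> \<zero> ==> frA a s \<in> carrier Q"
 using localization_setting.frac_mem[OF locA] unfolding Q_eq by simp

lemma frA_cases: "x \<in> carrier Q ==> \<exists>a s. a \<in> A \<and> s \<in> A \<and> s \<noteq> \<zero> \<and> x = frA a s"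
 using localization_setting.frac_cases[OF locA, of x] unfolding Q_eq by auto

text \<open>Nonzero elements of \<open>A\<close> lie outside \<open>P\<close>, so equality of
  fractions over \<open>A\<close> implies equality in the local ring; all members of the class on
  the left therefore have the same image.\<close>

lemma quot_embed_frA:
 assumes a: "a \<in> A" and s: "s \<in> A" "s \<noteq> \<zero>"
 shows "quot_embed R P (frA a s) = fr a s"
proof -
 have "loc_rel R (carrier R - P) `` {p} = fr a s" if p: "p \<in> frA a s" for p
 proof -
  obtain b t u where b: "p = (b, t)" "b \<in> A" "t \<in> A" "t \<noteq> \<zero>" "u \<in> A" "u \<noteq> \<zero>" "u \<otimes> (a \<otimes> t \<ominus>\<^sub>AR b \<otimes> s) = \<zero>"
   using localization_setting.frac_rep[OF locA p] by (elim exE conjE bexE) (rule that, auto)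
  have "a \<otimes> t \<ominus>\<^sub>AR b \<otimes> s = a \<otimes> t \<ominus> b \<otimes> s" using AR_minus subringE(6)[OF A] a s b by simp
  then have "fr a s = fr b t"
   using loc.frac_eq_iff[OF A_closed[OF a] A_not_P[OF s] A_closed[OF b(2)] A_not_P[OF b(3,4)]] A_not_P[OF b(5,6)] b(7) by auto
  then show ?thesis unfolding b(1) loc_frac_def by simp
 qed
 moreover have "(a, s) \<in> frA a s" using localization_setting.frac_self[OF locA] a s by simp
 ultimately show ?thesis unfolding quot_embed_def Image_eq_UN[of _ "frA a s"] by (intro UN_constant_eq ballI)
qed

lemma embed_frA: "a \<in> A ==> s \<in> A ==> s \<noteq> \<zero> ==> quot_residue_embed R P (frA a s) = \<pi> (fr a s)"
 by (simp add: quot_residue_embed_def quot_embed_frA)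

lemma embed_image: "quot_residue_embed R P ` carrier Q = Kbar"
proof
 show "quot_residue_embed R P ` carrier Q \<subseteq> Kbar"
 proof (rule image_subsetI)
  fix x assume "x \<in> carrier Q"
  from frA_cases[OF this] obtain a s where "a \<in> A" "s \<in> A" "s \<noteq> \<zero>" "x = frA a s" by (elim exE conjE)
  then show "quot_residue_embed R P x \<in> Kbar" unfolding Kbar_def by (intro CollectI exI[of _ a] exI[of _ s]) (simp add: embed_frA)
 qed
 show "Kbar \<subseteq> quot_residue_embed R P ` carrier Q"
 proof
  fix y assume "y \<in> Kbar"
  then obtain a s where a: "a \<in> A" "s \<in> A" "s \<noteq> \<zero>" "y = \<pi> (fr a s)" unfolding Kbar_def by blast
  show "y \<in> quot_residue_embed R P ` carrier Q"
   by (rule image_eqI[OF _ frA_closed[OF a(1-3)]]) (simp add: embed_frA[OF a(1-3)] a(4))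
 qed
qed

lemma Q_cring: "cring Q" using localization_setting.localization_cring[OF locA] unfolding Q_eq .

lemma quot_embed_closed: "x \<in> carrier Q ==> quot_embed R P x \<in> carrier LR"
proof -
 assume "x \<in> carrier Q"
 from frA_cases[OF this] obtain a s where a: "a \<in> A" "s \<in> A" "s \<noteq> \<zero>" "x = frA a s" by (elim exE conjE)
 show ?thesis unfolding a(4) quot_embed_frA[OF a(1-3)] by (rule fr_closed[OF A_closed[OF a(1)] A_not_P[OF a(2,3)]])
qed

lemma embed_eq: "quot_residue_embed R P x = \<pi> (quot_embed R P x)"
 by (simp add: quot_residue_embed_def)

lemma embed_hom: "quot_residue_embed R P \<in> ring_hom Q \<kappa>"
proof (rule ring_hom_memI)
 show "quot_residue_embed R P x \<in> carrier \<kappa>" if "x \<in> carrier Q" for x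
  unfolding embed_eq by (rule pi.hom_closed[OF quot_embed_closed[OF that]])
 show "quot_residue_embed R P \<one>\<^sub>Q = \<one>\<^sub>\<kappa>"
 proof -
  have 1: "\<one>\<^sub>Q = frA \<one> \<one>" using localization_setting.frac_one[OF locA] unfolding Q_eq by simp
  have "quot_residue_embed R P \<one>\<^sub>Q = \<pi> (fr \<one> \<one>)" unfolding 1 by (rule embed_frA[OF one_in_A(1) one_in_A])
  also have "\<dots> = \<one>\<^sub>\<kappa>" using res.hom_one unfolding res_def phi_eq_fr .
  finally show ?thesis .
 qed
 fix x y assume x: "x \<in> carrier Q" and y: "y \<in> carrier Q"
 obtain a s where a: "a \<in> A" "s \<in> A" "s \<noteq> \<zero>" "x = frA a s" using frA_cases[OF x] by (elim exE conjE)
 obtain b t where b: "b \<in> A" "t \<in> A" "t \<noteq> \<zero>" "y = frA b t" using frA_cases[OF y] by (elim exE conjE)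
 have "s \<otimes>\<^sub>AR t \<in> A - {\<zero>}" by (rule submonoid.m_closed[OF A_submonoid]) (use a b in simp_all)
 then have nz: "s \<otimes> t \<in> A" "s \<otimes> t \<noteq> \<zero>" by simp_all
 have cl: "a \<otimes> b \<in> A" "a \<otimes> t \<oplus> b \<otimes> s \<in> A" using subringE(6,7)[OF A] a b by simp_all
 note aR = A_closed[OF a(1)] and sP = A_not_P[OF a(2,3)] and bR = A_closed[OF b(1)] and tP = A_not_P[OF b(2,3)]
 note k = fr_closed[OF aR sP] fr_closed[OF bR tP]
 note e = embed_frA[OF a(1-3)] embed_frA[OF b(1-3)]
 have "x \<otimes>\<^sub>Q y = frA (a \<otimes> b) (s \<otimes> t)"
  using localization_setting.frac_mult[OF locA, of a s b t] a b unfolding Q_eq by simp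
 then show "quot_residue_embed R P (x \<otimes>\<^sub>Q y) = quot_residue_embed R P x \<otimes>\<^sub>\<kappa> quot_residue_embed R P y"
  unfolding a(4) b(4) e by (simp only: embed_frA[OF cl(1) nz] fr_mult[OF aR sP bR tP, symmetric] pi.hom_mult[OF k])
 have "x \<oplus>\<^sub>Q y = frA (a \<otimes> t \<oplus> b \<otimes> s) (s \<otimes> t)"
  using localization_setting.frac_add[OF locA, of a s b t] a b unfolding Q_eq by simp
 then show "quot_residue_embed R P (x \<oplus>\<^sub>Q y) = quot_residue_embed R P x \<oplus>\<^sub>\<kappa> quot_residue_embed R P y"
  unfolding a(4) b(4) e by (simp only: embed_frA[OF cl(2) nz] fr_add[OF aR sP bR tP, symmetric] pi.hom_add[OF k])
qed

lemma perfect_imp_separable: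
 assumes perf: "perfect_field Q" and Kb: "subfield Kbar \<kappa>"
 shows "kappa.separable_extension Kbar"
proof (rule kappa.perfect_imp_separable_extension[OF Kb])
 fix p :: nat and x
 assume p: "Factorial_Ring.prime p" "add_pow \<kappa> p \<one>\<^sub>\<kappa> = \<zero>\<^sub>\<kappa>" and x: "x \<in> Kbar"
 have Qf: "field Q" using perf unfolding perfect_field_def by simp
 interpret e: light_hom Q \<kappa> "quot_residue_embed R P"
  by (intro light_hom.intro kappa.ring_axioms embed_hom cring.axioms(1)[OF Q_cring])
 have oQ: "\<one>\<^sub>Q \<in> carrier Q" using monoid.one_closed[OF ring.is_monoid[OF cring.axioms(1)[OF Q_cring]]] .
 have pQ: "add_pow Q p \<one>\<^sub>Q \<in> carrier Q" 
  using monoid.nat_pow_closed[OF abelian_monoid.a_monoid[OF abelian_group.axioms(1)[OF ring.is_abelian_group[OF cring.axioms(1)[OF Q_cring]]]], of "\<one>\<^sub>Q" p] oQ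
  by (simp add: add_pow_def)
 have epQ: "quot_residue_embed R P (add_pow Q p \<one>\<^sub>Q) = \<zero>\<^sub>\<kappa>"
  using ring_hom_add_pow[OF cring.axioms(1)[OF Q_cring] kappa.ring_axioms embed_hom oQ, of p] p(2) by simp
 \<comment> \<open>Its image in the residue field is 0, so it cannot be a unit of the field
   \<open>Q\<close>. Hence \<open>Q\<close> has characteristic \<open>p\<close>, and perfectness
   provides p-th roots.\<close>
 have "add_pow Q p \<one>\<^sub>Q = \<zero>\<^sub>Q"
 proof (rule ccontr)
  assume "add_pow Q p \<one>\<^sub>Q \<noteq> \<zero>\<^sub>Q"
  then have u: "add_pow Q p \<one>\<^sub>Q \<in> Units Q" using field.field_Units[OF Qf] pQ by simp
  then obtain c where c: "c \<in> carrier Q" "c \<otimes>\<^sub>Q add_pow Q p \<one>\<^sub>Q = \<one>\<^sub>Q" unfolding Units_def by blast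
  then have "\<one>\<^sub>\<kappa> = \<zero>\<^sub>\<kappa>" using e.hom_mult[OF c(1) pQ] epQ e.hom_closed[OF c(1)] by simp
  then show False using kappa.one_not_zero by simp
 qed
 then have ex: "\<forall>z\<in>carrier Q. \<exists>w\<in>carrier Q. w [^]\<^sub>Q p = z" using perf p(1) unfolding perfect_field_def by blast
 obtain z where z: "z \<in> carrier Q" "x = quot_residue_embed R P z" using x unfolding embed_image[symmetric] by (rule imageE) simp
 obtain w where w: "w \<in> carrier Q" "w [^]\<^sub>Q p = z" using ex z(1) by blast
 have "quot_residue_embed R P w \<in> Kbar" unfolding embed_image[symmetric] using w(1) by (rule imageI)
 moreover have "quot_residue_embed R P w [^]\<^sub>\<kappa> p = x" using e.hom_nat_pow[OF w(1), of p] w(2) z(2) by simp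
 ultimately show "\<exists>y\<in>Kbar. y [^]\<^sub>\<kappa> p = x" by blast
qed

end

section \<open>Noetherian tensor products\<close>

text \<open>Zorn's lemma gives an L-subspace V maximal among those containing 1 but not
  \<open>l\<close>. The field is then the direct sum of V and the line through \<open>l\<close>, and
  the functional is the coefficient of \<open>l\<close>.\<close>

lemma (in field) separating_functional:
 assumes L: "subfield L R" and l: "l \<in> carrier R" "l \<notin> L"
 shows "\<exists>\<phi>. (\<forall>x\<in>carrier R. \<phi> x \<in> carrier R) \<and> (\<forall>x\<in>carrier R. \<forall>y\<in>carrier R. \<phi> (x \<oplus> y) = \<phi> x \<oplus> \<phi> y) \<and>
  (\<forall>c\<in>L. \<forall>x\<in>carrier R. \<phi> (c \<otimes> x) = c \<otimes> \<phi> x) \<and> \<phi> \<one> = \<zero> \<and> \<phi> l = \<one>"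
proof -
 note Lr = subfieldE(1)[OF L]
 have LR: "c \<in> carrier R" if "c \<in> L" for c using that subfieldE(3)[OF L] by blast
 let ?A = "{V. V \<subseteq> carrier R \<and> \<one> \<in> V \<and> l \<notin> V \<and> (\<forall>x\<in>V. \<forall>y\<in>V. x \<oplus> y \<in> V) \<and> (\<forall>c\<in>L. \<forall>x\<in>V. c \<otimes> x \<in> V)}"
 have "\<exists>V\<in>?A. \<forall>W\<in>?A. V \<subseteq> W --> W = V"
 proof (rule subset_Zorn_nonempty)
  have "L \<in> ?A" using subfieldE(3)[OF L] subringE(3,6,7)[OF Lr] l by simp
  then show "?A \<noteq> {}" by blast
  fix C assume C: "C \<noteq> {}" "subset.chain ?A C"
  have CA: "V \<in> ?A" if "V \<in> C" for V using C(2) that unfolding subset_chain_def by blast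
  have tot: "V \<subseteq> W \<or> W \<subseteq> V" if "V \<in> C" "W \<in> C" for V W using C(2) that unfolding subset_chain_def by blast
  obtain V0 where V0: "V0 \<in> C" using C(1) by blast
  have "x \<oplus> y \<in> \<Union>C" if xy: "x \<in> \<Union>C" "y \<in> \<Union>C" for x y
  proof -
   obtain V W where VW: "V \<in> C" "x \<in> V" "W \<in> C" "y \<in> W" using xy by blast
   from tot[OF VW(1,3)] show ?thesis
   proof
    assume "V \<subseteq> W"
    then have "x \<oplus> y \<in> W" using CA[OF VW(3)] VW by blast
    then show ?thesis using VW by blast
   next
    assume "W \<subseteq> V"
    then have "x \<oplus> y \<in> V" using CA[OF VW(1)] VW by blast
    then show ?thesis using VW by blast
   qed
  qed
  moreover have "c \<otimes> x \<in> \<Union>C" if c: "c \<in> L" and xC: "x \<in> \<Union>C" for c x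
  proof -
   obtain V where V: "V \<in> C" "x \<in> V" using xC by blast
   then have "c \<otimes> x \<in> V" using CA[OF V(1)] c by blast
   then show ?thesis using V(1) by blast
  qed
  moreover have "\<Union>C \<subseteq> carrier R" "l \<notin> \<Union>C" using CA by blast+
  moreover have "\<one> \<in> \<Union>C" using CA[OF V0] V0 by blast
  ultimately show "\<Union>C \<in> ?A" by (intro CollectI conjI ballI)
 qed
 then obtain V where VA0: "V \<in> ?A" and max: "\<forall>W\<in>?A. V \<subseteq> W --> W = V" by (rule bexE)
 note VA = VA0[unfolded mem_Collect_eq]
 have V: "V \<subseteq> carrier R" "\<one> \<in> V" "l \<notin> V" and Vadd: "!!x y. x \<in> V ==> y \<in> V ==> x \<oplus> y \<in> V"
  and Vsm: "!!c x. c \<in> L ==> x \<in> V ==> c \<otimes> x \<in> V" using VA by blast+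
 have VR: "x \<in> carrier R" if "x \<in> V" for x using that V(1) by blast
 have zL: "\<zero> \<in> L" and oL: "\<one> \<in> L" using subringE(2,3)[OF Lr] by simp_all
 have Vz: "\<zero> \<in> V" using Vsm[OF zL V(2)] by simp
 have iL: "inv c \<in> L" "inv c \<otimes> c = \<one>" "inv c \<in> carrier R" if "c \<in> L" "c \<noteq> \<zero>" for c
 proof -
  show "inv c \<in> L" using subfield_m_inv(1)[OF L] that by simp
  then show "inv c \<in> carrier R" by (rule LR)
  show "inv c \<otimes> c = \<one>" using subfield_m_inv(3)[OF L] that by simp
 qed
 \<comment> \<open>Existence of the decomposition: if \<open>x\<close> is not in \<open>V\<close>,
   maximality puts \<open>l\<close> into the sum of \<open>V\<close> and the line of
   \<open>x\<close>. The coefficient of \<open>x\<close> there is nonzero, as \<open>l\<close> is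
   not in \<open>V\<close>, so the equation can be solved for \<open>x\<close>.\<close>
 have dec: "\<exists>c\<in>L. x \<ominus> c \<otimes> l \<in> V" if x: "x \<in> carrier R" for x
 proof (cases "x \<in> V")
  case True
  then have "x \<ominus> \<zero> \<otimes> l \<in> V" using x l by (simp add: minus_eq)
  then show ?thesis using zL by blast
 next
  case False
  define W where "W = {v \<oplus> c \<otimes> x |v c. v \<in> V \<and> c \<in> L}"
  have WI: "v \<oplus> c \<otimes> x \<in> W" if "v \<in> V" "c \<in> L" for v c unfolding W_def using that by blast
  have WE: "\<exists>v c. y = v \<oplus> c \<otimes> x \<and> v \<in> V \<and> c \<in> L" if "y \<in> W" for y
   using that unfolding W_def by blast
  have VW: "V \<subseteq> W"
  proof
   fix v assume v: "v \<in> V"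
   have "v \<oplus> \<zero> \<otimes> x = v" using x VR[OF v] by simp
   then show "v \<in> W" using WI[OF v zL] by simp
  qed
  have "\<zero> \<oplus> \<one> \<otimes> x = x" using x by simp
  then have xW: "x \<in> W" using WI[OF Vz oL] by simp
  have Wadd: "y \<oplus> z \<in> W" if "y \<in> W" "z \<in> W" for y z
  proof -
   obtain v c where y: "y = v \<oplus> c \<otimes> x" "v \<in> V" "c \<in> L" using WE[OF \<open>y \<in> W\<close>] by (elim exE conjE)
   obtain w d where z: "z = w \<oplus> d \<otimes> x" "w \<in> V" "d \<in> L" using WE[OF \<open>z \<in> W\<close>] by (elim exE conjE)
   have id: "(v \<oplus> c \<otimes> x) \<oplus> (w \<oplus> d \<otimes> x) = (v \<oplus> w) \<oplus> (c \<oplus> d) \<otimes> x"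
    if "v \<in> carrier R" "c \<in> carrier R" "w \<in> carrier R" "d \<in> carrier R" for v c w d using that x by algebra
   have "y \<oplus> z = (v \<oplus> w) \<oplus> (c \<oplus> d) \<otimes> x" unfolding y(1) z(1) using id y z VR LR by simp
   then show ?thesis using WI[OF Vadd[OF y(2) z(2)] subringE(7)[OF Lr y(3) z(3)]] by simp
  qed
  have Wsm: "a \<otimes> y \<in> W" if a: "a \<in> L" and yW: "y \<in> W" for a y
  proof -
   obtain v c where y: "y = v \<oplus> c \<otimes> x" "v \<in> V" "c \<in> L" using WE[OF yW] by (elim exE conjE)
   have "a \<otimes> y = a \<otimes> v \<oplus> (a \<otimes> c) \<otimes> x" unfolding y(1) using y VR LR a x by (simp add: r_distr m_assoc)
   then show ?thesis using WI[OF Vsm[OF a y(2)] subringE(6)[OF Lr a y(3)]] by simp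
  qed
  have WR: "W \<subseteq> carrier R" unfolding W_def using VR LR x by auto
  have "l \<in> W"
  proof (rule ccontr)
   assume "l \<notin> W"
   moreover have "\<one> \<in> W" using VW V(2) by blast
   ultimately have "W \<in> ?A" using WR Wadd Wsm by simp
   then have "W = V" using bspec[OF max] VW by simp
   then show False using xW False by blast
  qed
  from WE[OF this] obtain v c where vc: "l = v \<oplus> c \<otimes> x" "v \<in> V" "c \<in> L" by (elim exE conjE)
  have c0: "c \<noteq> \<zero>"
  proof
   assume "c = \<zero>"
   then have "l = v" using vc(1) VR[OF vc(2)] x by simp
   then show False using V(3) vc(2) by simp
  qed
  note i = iL[OF vc(3) c0]
  have id: "x' \<ominus> i \<otimes> (v \<oplus> y) = (x' \<ominus> i \<otimes> y) \<oplus> (\<ominus> i) \<otimes> v" if "x' \<in> carrier R" "i \<in> carrier R" "v \<in> carrier R" "y \<in> carrier R" for x' i v y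
   using that by algebra
  have "inv c \<otimes> (c \<otimes> x) = x" using i x LR[OF vc(3)] by (simp add: m_assoc[symmetric])
  then have "x \<ominus> inv c \<otimes> l = (\<ominus> (inv c)) \<otimes> v"
   unfolding vc(1) using id[OF x i(3) VR[OF vc(2)], of "c \<otimes> x"] x i VR[OF vc(2)] LR[OF vc(3)] by (simp add: r_neg minus_eq)
  moreover have "(\<ominus> (inv c)) \<otimes> v \<in> V" using Vsm[OF subringE(5)[OF Lr i(1)] vc(2)] .
  ultimately show ?thesis using i(1) by (intro bexI[of _ "inv c"]) simp_all
 qed
 have uniq: "c = c'" if c: "c \<in> L" "x \<ominus> c \<otimes> l \<in> V" and c': "c' \<in> L" "x \<ominus> c' \<otimes> l \<in> V" and x: "x \<in> carrier R" for c c' x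
 proof (rule ccontr)
  assume ne: "c \<noteq> c'"
  define d where "d = c \<ominus> c'"
  have dL: "d \<in> L" unfolding d_def minus_eq using subringE(5,7)[OF Lr] c c' by simp
  have d0: "d \<noteq> \<zero>" unfolding d_def using ne LR[OF c(1)] LR[OF c'(1)] by simp
  have id: "(x \<ominus> c' \<otimes> l) \<oplus> (\<ominus> \<one>) \<otimes> (x \<ominus> c \<otimes> l) = (c \<ominus> c') \<otimes> l"
   if "x \<in> carrier R" "c \<in> carrier R" "c' \<in> carrier R" for x c c' using that l(1) by algebra
  have "(x \<ominus> c' \<otimes> l) \<oplus> (\<ominus> \<one>) \<otimes> (x \<ominus> c \<otimes> l) \<in> V"
   by (rule Vadd[OF c'(2) Vsm[OF subringE(5)[OF Lr oL] c(2)]])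
  then have "d \<otimes> l \<in> V" unfolding d_def id[OF x LR[OF c(1)] LR[OF c'(1)]] .
  then have "inv d \<otimes> (d \<otimes> l) \<in> V" using Vsm[OF iL(1)[OF dL d0]] by blast
  moreover have "inv d \<otimes> (d \<otimes> l) = l" using iL(2,3)[OF dL d0] l(1) LR[OF dL] by (simp add: m_assoc[symmetric])
  ultimately show False using V(3) by simp
 qed
 define \<phi> where "\<phi> x = (SOME c. c \<in> L \<and> x \<ominus> c \<otimes> l \<in> V)" for x
 have phi: "\<phi> x \<in> L \<and> x \<ominus> \<phi> x \<otimes> l \<in> V" if "x \<in> carrier R" for x
  unfolding \<phi>_def using dec[OF that] by (intro someI_ex[of "\<lambda>c. c \<in> L \<and> x \<ominus> c \<otimes> l \<in> V"]) blast
 have phi_eq: "\<phi> x = c" if "x \<in> carrier R" "c \<in> L" "x \<ominus> c \<otimes> l \<in> V" for x c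
  using uniq[OF _ _ that(2,3,1)] phi[OF that(1)] by blast
 show ?thesis
 proof (intro exI[of _ \<phi>] conjI ballI)
  fix x assume x: "x \<in> carrier R"
  show "\<phi> x \<in> carrier R" using phi[OF x] LR by blast
  fix y assume y: "y \<in> carrier R"
  show "\<phi> (x \<oplus> y) = \<phi> x \<oplus> \<phi> y"
  proof (rule phi_eq)
   have id: "(x \<oplus> y) \<ominus> (c \<oplus> c') \<otimes> l = (x \<ominus> c \<otimes> l) \<oplus> (y \<ominus> c' \<otimes> l)" if "c \<in> carrier R" "c' \<in> carrier R" for c c'
    using that x y l(1) by algebra
   show "(x \<oplus> y) \<ominus> (\<phi> x \<oplus> \<phi> y) \<otimes> l \<in> V"
    unfolding id[OF LR[OF conjunct1[OF phi[OF x]]] LR[OF conjunct1[OF phi[OF y]]]]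
    by (rule Vadd) (use phi[OF x] phi[OF y] in simp_all)
  qed (use x y phi[OF x] phi[OF y] subringE(7)[OF Lr] in simp_all)
 next
  fix c x assume c: "c \<in> L" and x: "x \<in> carrier R"
  show "\<phi> (c \<otimes> x) = c \<otimes> \<phi> x"
  proof (rule phi_eq)
   have id: "c \<otimes> x \<ominus> (c \<otimes> d) \<otimes> l = c \<otimes> (x \<ominus> d \<otimes> l)" if "c \<in> carrier R" "d \<in> carrier R" for c d
    using that x l(1) by algebra
   show "c \<otimes> x \<ominus> (c \<otimes> \<phi> x) \<otimes> l \<in> V"
    unfolding id[OF LR[OF c] LR[OF conjunct1[OF phi[OF x]]]] by (rule Vsm[OF c]) (use phi[OF x] in simp)
  qed (use x c LR[OF c] phi[OF x] subringE(6)[OF Lr] in simp_all)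
 next
  show "\<phi> \<one> = \<zero>" by (rule phi_eq) (use zL l V(2) in \<open>simp_all add: minus_eq\<close>)
  show "\<phi> l = \<one>" by (rule phi_eq) (use oL l Vz in \<open>simp_all add: minus_eq r_neg\<close>)
 qed
qed

text \<open>Pairing with functionals that are linear over a subfield \<open>L\<close> of \<open>k\<close> describes the kernel of
 \<open>k \<otimes> S \<rightarrow> k \<otimes>\<^sub>L k\<close>. Finite generation of the kernel for \<open>L = k\<close> shows that it equals the kernel for
 a subfield finitely generated over the image of \<open>Q\<close>.\<close>

locale functional_pairing = k: field k + S: cring S
 for k :: "('k, 'm) ring_scheme" and S :: "('s, 'n) ring_scheme" +
 fixes \<pi> :: "'s => 'k"
 assumes pi_hom: "\<pi> \<in> ring_hom S k"
begin

abbreviation "FT \<equiv> free_tensor k S"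
abbreviation "ST \<equiv> carrier k \<times> carrier S"

definition functional :: "'k set => ('k => 'k) => bool" where
 "functional L \<phi> \<longleftrightarrow> (\<forall>x\<in>carrier k. \<phi> x \<in> carrier k) \<and>
  (\<forall>x\<in>carrier k. \<forall>y\<in>carrier k. \<phi> (x \<oplus>\<^sub>k y) = \<phi> x \<oplus>\<^sub>k \<phi> y) \<and>
  (\<forall>c\<in>L. \<forall>x\<in>carrier k. \<phi> (c \<otimes>\<^sub>k x) = c \<otimes>\<^sub>k \<phi> x)"

definition pairing :: "('k => 'k) => ('k \<times> 's \<Rightarrow>\<^sub>0 int) => 'k" where
 "pairing \<phi> = (SOME h. h \<in> hom (free_Abelian_group ST) (add_monoid k) \<and>
   (\<forall>q\<in>ST. h (frag_of q) = fst q \<otimes>\<^sub>k \<phi> (\<pi> (snd q))))"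

definition pairing_kernel :: "'k set => ('k \<times> 's \<Rightarrow>\<^sub>0 int) set" where
 "pairing_kernel L = {u. keys u \<subseteq> ST \<and> (\<forall>\<phi>. functional L \<phi> --> pairing \<phi> u = \<zero>\<^sub>k)}"

lemma pi_closed [simp]: "s \<in> carrier S ==> \<pi> s \<in> carrier k"
 using ring_hom_closed[OF pi_hom] .

context
 fixes L \<phi> assumes \<phi>: "functional L \<phi>"
begin

lemma functional_closed: "x \<in> carrier k ==> \<phi> x \<in> carrier k"
 and functional_add: "x \<in> carrier k ==> y \<in> carrier k ==> \<phi> (x \<oplus>\<^sub>k y) = \<phi> x \<oplus>\<^sub>k \<phi> y"
 and functional_smult: "c \<in> L ==> x \<in> carrier k ==> \<phi> (c \<otimes>\<^sub>k x) = c \<otimes>\<^sub>k \<phi> x"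
 using \<phi> unfolding functional_def by blast+

lemma pairing_spec: "pairing \<phi> \<in> hom (free_Abelian_group ST) (add_monoid k) \<and>
   (\<forall>q\<in>ST. pairing \<phi> (frag_of q) = fst q \<otimes>\<^sub>k \<phi> (\<pi> (snd q)))"
proof -
 have "(\<lambda>q. fst q \<otimes>\<^sub>k \<phi> (\<pi> (snd q))) ` ST \<subseteq> carrier (add_monoid k)"
  using functional_closed by (simp add: image_subset_iff)
 note im = this
 obtain h where "h \<in> hom (free_Abelian_group ST) (add_monoid k)" "!!q. q \<in> ST ==> h (frag_of q) = fst q \<otimes>\<^sub>k \<phi> (\<pi> (snd q))"
  by (rule comm_group.free_Abelian_group_universal[OF k.a_comm_group im]) (rule that, simp_all)
 then have "\<exists>h. h \<in> hom (free_Abelian_group ST) (add_monoid k) \<and>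
   (\<forall>q\<in>ST. h (frag_of q) = fst q \<otimes>\<^sub>k \<phi> (\<pi> (snd q)))" by (intro exI[of _ h]) simp
 then show ?thesis unfolding pairing_def by (rule someI_ex)
qed

lemma pairing_of: "c \<in> carrier k ==> s \<in> carrier S ==> pairing \<phi> (frag_of (c, s)) = c \<otimes>\<^sub>k \<phi> (\<pi> s)"
 using pairing_spec by simp

lemma pairing_closed: "keys u \<subseteq> ST ==> pairing \<phi> u \<in> carrier k"
 using hom_in_carrier[OF conjunct1[OF pairing_spec], of u] by (simp add: free_Abelian_group_def)

lemma pairing_add:
 assumes "keys u \<subseteq> ST" "keys v \<subseteq> ST"
 shows "pairing \<phi> (u + v) = pairing \<phi> u \<oplus>\<^sub>k pairing \<phi> v"
 using hom_mult[OF conjunct1[OF pairing_spec], of u v] assms by (simp add: free_Abelian_group_def)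

lemma pairing_diff:
 assumes "keys u \<subseteq> ST" "keys v \<subseteq> ST"
 shows "pairing \<phi> (u - v) = pairing \<phi> u \<ominus>\<^sub>k pairing \<phi> v"
proof -
 have uv: "keys (u - v) \<subseteq> ST" using keys_diff[of u v] assms by blast
 have "pairing \<phi> u = pairing \<phi> (u - v) \<oplus>\<^sub>k pairing \<phi> v" using pairing_add[OF uv assms(2)] by simp
 then show ?thesis using pairing_closed[OF uv] pairing_closed[OF assms(2)]
  by (simp add: k.minus_eq k.a_assoc k.r_neg)
qed

lemma pairing_zero: "pairing \<phi> 0 = \<zero>\<^sub>k"
 using pairing_diff[of 0 0] pairing_closed[of 0] by (simp add: k.minus_eq k.r_neg)

end

lemma pairing_unique:
 assumes \<phi>: "functional L \<phi>" and \<psi>: "functional L' \<psi>" and u: "keys u \<subseteq> ST"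
  and eq: "!!q. q \<in> keys u ==> \<phi> (\<pi> (snd q)) = \<psi> (\<pi> (snd q))"
 shows "pairing \<phi> u = pairing \<psi> u"
proof -
 have "keys v \<subseteq> ST \<and> pairing \<phi> v = pairing \<psi> v" if "keys v \<subseteq> keys u" for v
  using that
 proof (induction v rule: frag_induction)
  case zero
  show ?case using pairing_zero[OF \<phi>] pairing_zero[OF \<psi>] by simp
 next
  case (one q)
  obtain c s where q: "q = (c, s)" "c \<in> carrier k" "s \<in> carrier S" using one u by auto
  show ?case using pairing_of[OF \<phi> q(2,3)] pairing_of[OF \<psi> q(2,3)] eq[OF one] q by simp
 next
  case (diff v w)
  then show ?case using pairing_diff[OF \<phi>, of v w] pairing_diff[OF \<psi>, of v w] keys_diff[of v w] by auto
 qed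
 then show ?thesis by blast
qed

text \<open>Multiplication of a formal sum by a pair is absorbed by changing the functional, which
  stays linear over \<open>L\<close>. This is why the common kernel of all pairings is an
  ideal.\<close>

lemma pairing_mult:
 assumes \<phi>: "functional L \<phi>" and c: "c \<in> carrier k" and s: "s \<in> carrier S" and Lk: "L \<subseteq> carrier k"
  and u: "keys u \<subseteq> ST"
 shows "functional L (\<lambda>x. c \<otimes>\<^sub>k \<phi> (\<pi> s \<otimes>\<^sub>k x))"
  and "pairing \<phi> (frag_of (c, s) \<otimes>\<^sub>FT u) = pairing (\<lambda>x. c \<otimes>\<^sub>k \<phi> (\<pi> s \<otimes>\<^sub>k x)) u"
proof -
 let ?\<psi> = "\<lambda>x. c \<otimes>\<^sub>k \<phi> (\<pi> s \<otimes>\<^sub>k x)"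
 note f = functional_closed[OF \<phi>] functional_add[OF \<phi>] functional_smult[OF \<phi>]
 have ps: "\<pi> s \<in> carrier k" using s by simp
 show \<psi>: "functional L ?\<psi>"
  unfolding functional_def
 proof (intro conjI ballI)
  show "?\<psi> x \<in> carrier k" if "x \<in> carrier k" for x using that ps c f(1) by simp
  show "?\<psi> (x \<oplus>\<^sub>k y) = ?\<psi> x \<oplus>\<^sub>k ?\<psi> y" if "x \<in> carrier k" "y \<in> carrier k" for x y
   using that ps c f(1,2) by (simp add: k.r_distr)
  show "?\<psi> (a \<otimes>\<^sub>k x) = a \<otimes>\<^sub>k ?\<psi> x" if a: "a \<in> L" and x: "x \<in> carrier k" for a x
  proof -
   have ak: "a \<in> carrier k" using a Lk by blast
   have "\<pi> s \<otimes>\<^sub>k (a \<otimes>\<^sub>k x) = a \<otimes>\<^sub>k (\<pi> s \<otimes>\<^sub>k x)" using ps ak x by (rule k.m_lcomm)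
   then show ?thesis using f(3)[OF a, of "\<pi> s \<otimes>\<^sub>k x"] ps ak x c f(1)[of "\<pi> s \<otimes>\<^sub>k x"] by (simp add: k.m_lcomm)
  qed
 qed
 interpret FT: cring FT by (rule free_tensor_cring[OF k.is_cring S.is_cring])
 have closed: "keys (frag_of (c, s) \<otimes>\<^sub>FT v) \<subseteq> ST" if "keys v \<subseteq> ST" for v
  using FT.m_closed[of "frag_of (c, s)" v] that c s by simp
 have "keys u \<subseteq> ST \<and> pairing \<phi> (frag_of (c, s) \<otimes>\<^sub>FT u) = pairing ?\<psi> u"
  using u
 proof (induction u rule: frag_induction)
  case zero
  show ?case using pairing_zero[OF \<phi>] pairing_zero[OF \<psi>] by (simp add: free_tensor_mult_diff)
 next
  case (one q)
  obtain d t where q: "q = (d, t)" "d \<in> carrier k" "t \<in> carrier S" using one by auto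
  have "pairing \<phi> (frag_of (c, s) \<otimes>\<^sub>FT frag_of q) = (c \<otimes>\<^sub>k d) \<otimes>\<^sub>k \<phi> (\<pi> s \<otimes>\<^sub>k \<pi> t)"
   unfolding q(1) free_tensor_mult_of
   using pairing_of[OF \<phi>, of "c \<otimes>\<^sub>k d" "s \<otimes>\<^sub>S t"] q c s ring_hom_mult[OF pi_hom] by simp
  also have "\<dots> = d \<otimes>\<^sub>k ?\<psi> (\<pi> t)" using c q ps f(1) by (simp add: k.m_ac)
  finally show ?case using pairing_of[OF \<psi> q(2,3)] q by simp
 next
  case (diff v w)
  then show ?case
   using pairing_diff[OF \<phi>, of "frag_of (c, s) \<otimes>\<^sub>FT v" "frag_of (c, s) \<otimes>\<^sub>FT w"] closed[of v] closed[of w]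
    pairing_diff[OF \<psi>, of v w] keys_diff[of v w]
   by (auto simp: free_tensor_mult_diff)
 qed
 then show "pairing \<phi> (frag_of (c, s) \<otimes>\<^sub>FT u) = pairing ?\<psi> u" by blast
qed

lemma pairing_kernel_diff:
 assumes "u \<in> pairing_kernel L" "v \<in> pairing_kernel L"
 shows "u - v \<in> pairing_kernel L"
proof -
 have uv: "keys u \<subseteq> ST" "keys v \<subseteq> ST" using assms unfolding pairing_kernel_def by simp_all
 have "pairing \<phi> (u - v) = \<zero>\<^sub>k" if \<phi>: "functional L \<phi>" for \<phi>
  using pairing_diff[OF \<phi> uv] assms \<phi> unfolding pairing_kernel_def by (simp add: k.minus_eq)
 then show ?thesis using keys_diff[of u v] uv unfolding pairing_kernel_def by blast
qed

lemma pairing_kernel_zero: "0 \<in> pairing_kernel L"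
 unfolding pairing_kernel_def using pairing_zero by simp

lemma pairing_kernel_ideal:
 assumes Lk: "L \<subseteq> carrier k"
 shows "ideal (pairing_kernel L) FT"
proof -
 interpret FT: cring FT by (rule free_tensor_cring[OF k.is_cring S.is_cring])
 let ?I = "pairing_kernel L"
 have IT: "?I \<subseteq> carrier FT" unfolding pairing_kernel_def by auto
 have neg: "- u \<in> ?I" if "u \<in> ?I" for u using pairing_kernel_diff[OF pairing_kernel_zero that] by simp
 have mult: "v \<otimes>\<^sub>FT u \<in> ?I" if u: "u \<in> ?I" and v: "keys v \<subseteq> ST" for u v
  using v
 proof (induction v rule: frag_induction)
  case zero
  show ?case using pairing_kernel_zero by (simp add: free_tensor_mult_diff)
 next
  case (one q)
  obtain c s where q: "q = (c, s)" "c \<in> carrier k" "s \<in> carrier S" using one by auto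
  have uT: "keys u \<subseteq> ST" using u unfolding pairing_kernel_def by simp
  have "pairing \<phi> (frag_of q \<otimes>\<^sub>FT u) = \<zero>\<^sub>k" if \<phi>: "functional L \<phi>" for \<phi>
   unfolding q(1) pairing_mult(2)[OF \<phi> q(2,3) Lk uT]
   using u pairing_mult(1)[OF \<phi> q(2,3) Lk uT] unfolding pairing_kernel_def by blast
  moreover have "keys (frag_of q \<otimes>\<^sub>FT u) \<subseteq> ST"
   using FT.m_closed[of "frag_of q" u] uT q by simp
  ultimately show ?case unfolding pairing_kernel_def by blast
 next
  case (diff v w)
  then show ?case unfolding free_tensor_mult_diff by (intro pairing_kernel_diff)
 qed
 show ?thesis
 proof (rule idealI[OF FT.ring_axioms])
  show "subgroup ?I (add_monoid FT)"
  proof (rule FT.add.subgroupI[OF IT])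
   show "?I \<noteq> {}" using pairing_kernel_zero by blast
   show "\<ominus>\<^sub>FT u \<in> ?I" if u: "u \<in> ?I" for u
   proof -
    have "\<ominus>\<^sub>FT u = - u" by (rule FT.minus_equality) (use u neg[OF u] IT in auto)
    then show ?thesis using neg[OF u] by simp
   qed
   show "u \<oplus>\<^sub>FT v \<in> ?I" if "u \<in> ?I" "v \<in> ?I" for u v
    using pairing_kernel_diff[OF that(1) neg[OF that(2)]] by simp
  qed
  show "v \<otimes>\<^sub>FT u \<in> ?I" if "u \<in> ?I" "v \<in> carrier FT" for u v using mult that by simp
  show "u \<otimes>\<^sub>FT v \<in> ?I" if "u \<in> ?I" "v \<in> carrier FT" for u v
  proof -
   have "u \<otimes>\<^sub>FT v = v \<otimes>\<^sub>FT u" using FT.m_comm that IT by blast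
   then show ?thesis using mult that by simp
  qed
 qed
qed

text \<open>The balancing relations vanish because elements coming from \<open>Q\<close> act through
  \<open>L\<close>, over which the functionals are linear. So the pairings factor through the tensor
  product.\<close>

lemma tensor_ideal_subset_pairing_kernel:
 assumes Lk: "L \<subseteq> carrier k" and e: "!!a. a \<in> carrier Q ==> e a \<in> L" "!!a. a \<in> carrier Q ==> \<pi> (g a) = e a"
  and g: "!!a. a \<in> carrier Q ==> g a \<in> carrier S"
 shows "tensor_ideal Q e k g S \<subseteq> pairing_kernel L"
proof -
 interpret FT: cring FT by (rule free_tensor_cring[OF k.is_cring S.is_cring])
 have three: "frag_of x - frag_of y - frag_of z \<in> pairing_kernel L"
  if "x \<in> ST" "y \<in> ST" "z \<in> ST" "!!\<phi>. functional L \<phi> ==> pairing \<phi> (frag_of x) = pairing \<phi> (frag_of y) \<oplus>\<^sub>k pairing \<phi> (frag_of z)" for x y z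
 proof -
  have kk: "keys (frag_of w) \<subseteq> ST" if "w \<in> ST" for w using that by simp
  have xy: "keys (frag_of x - frag_of y) \<subseteq> ST" using keys_diff[of "frag_of x" "frag_of y"] that by auto
  have "pairing \<phi> (frag_of x - frag_of y - frag_of z) = \<zero>\<^sub>k" if \<phi>: "functional L \<phi>" for \<phi>
  proof -
   have id: "(a \<oplus>\<^sub>k b) \<ominus>\<^sub>k a \<ominus>\<^sub>k b = \<zero>\<^sub>k" if "a \<in> carrier k" "b \<in> carrier k" for a b
   proof -
    have "(a \<oplus>\<^sub>k b) \<ominus>\<^sub>k a = b"
     using that k.a_comm[of a b] by (simp add: k.minus_eq k.a_assoc k.r_neg)
    then show ?thesis using that by (simp add: k.minus_eq k.r_neg)
   qed
   show ?thesis
    unfolding pairing_diff[OF \<phi> xy kk[OF \<open>z \<in> ST\<close>]] pairing_diff[OF \<phi> kk[OF \<open>x \<in> ST\<close>] kk[OF \<open>y \<in> ST\<close>]]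
     \<open>!!\<phi>. functional L \<phi> ==> pairing \<phi> (frag_of x) = pairing \<phi> (frag_of y) \<oplus>\<^sub>k pairing \<phi> (frag_of z)\<close>[OF \<phi>]
    by (rule id) (rule pairing_closed[OF \<phi> kk[OF \<open>y \<in> ST\<close>]], rule pairing_closed[OF \<phi> kk[OF \<open>z \<in> ST\<close>]])
  qed
  moreover have "keys (frag_of x - frag_of y - frag_of z) \<subseteq> ST"
   using keys_diff[of "frag_of x - frag_of y" "frag_of z"] xy that by auto
  ultimately show ?thesis unfolding pairing_kernel_def by blast
 qed
 have "tensor_relations Q e k g S \<subseteq> pairing_kernel L"
 proof
  fix u assume "u \<in> tensor_relations Q e k g S"
  then show "u \<in> pairing_kernel L" unfolding tensor_relations_def
  proof (elim UnE CollectE exE conjE)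
   fix b b' c assume u: "u = frag_of (b \<oplus>\<^sub>k b', c) - frag_of (b, c) - frag_of (b', c)"
    and m: "b \<in> carrier k" "b' \<in> carrier k" "c \<in> carrier S"
   show ?thesis unfolding u
    by (rule three) (use m functional_closed in \<open>simp_all add: pairing_of k.l_distr\<close>)
  next
   fix b c c' assume u: "u = frag_of (b, c \<oplus>\<^sub>S c') - frag_of (b, c) - frag_of (b, c')"
    and m: "b \<in> carrier k" "c \<in> carrier S" "c' \<in> carrier S"
   show ?thesis unfolding u
    by (rule three) (use m functional_closed in \<open>simp_all add: pairing_of k.r_distr ring_hom_add[OF pi_hom] functional_add\<close>)
  next
   fix a b c assume u: "u = frag_of (e a \<otimes>\<^sub>k b, c) - frag_of (b, g a \<otimes>\<^sub>S c)"
    and m: "a \<in> carrier Q" "b \<in> carrier k" "c \<in> carrier S"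
   have ea: "e a \<in> L" "e a \<in> carrier k" "g a \<in> carrier S" using e(1)[OF m(1)] g[OF m(1)] Lk by auto
   have kk: "keys (frag_of (e a \<otimes>\<^sub>k b, c)) \<subseteq> ST" "keys (frag_of (b, g a \<otimes>\<^sub>S c)) \<subseteq> ST"
    using m ea by simp_all
   have "pairing \<phi> u = \<zero>\<^sub>k" if \<phi>: "functional L \<phi>" for \<phi>
   proof -
    have fc: "\<phi> (\<pi> c) \<in> carrier k" using functional_closed[OF \<phi>] m by simp
    have "pairing \<phi> (frag_of (b, g a \<otimes>\<^sub>S c)) = b \<otimes>\<^sub>k \<phi> (\<pi> (g a \<otimes>\<^sub>S c))"
     by (rule pairing_of[OF \<phi> m(2)]) (use ea m in simp)
    also have "\<pi> (g a \<otimes>\<^sub>S c) = e a \<otimes>\<^sub>k \<pi> c" using ring_hom_mult[OF pi_hom ea(3) m(3)] e(2)[OF m(1)] by simp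
    also have "\<phi> (e a \<otimes>\<^sub>k \<pi> c) = e a \<otimes>\<^sub>k \<phi> (\<pi> c)" by (rule functional_smult[OF \<phi> ea(1)]) (use m in simp)
    finally have 2: "pairing \<phi> (frag_of (b, g a \<otimes>\<^sub>S c)) = b \<otimes>\<^sub>k (e a \<otimes>\<^sub>k \<phi> (\<pi> c))" .
    have 1: "pairing \<phi> (frag_of (e a \<otimes>\<^sub>k b, c)) = (e a \<otimes>\<^sub>k b) \<otimes>\<^sub>k \<phi> (\<pi> c)"
     by (rule pairing_of[OF \<phi> _ m(3)]) (use ea m in simp)
    have id: "(x \<otimes>\<^sub>k b) \<otimes>\<^sub>k z \<ominus>\<^sub>k b \<otimes>\<^sub>k (x \<otimes>\<^sub>k z) = \<zero>\<^sub>k" if "x \<in> carrier k" "z \<in> carrier k" for x z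
     using that m(2) by algebra
    show ?thesis unfolding u pairing_diff[OF \<phi> kk] 1 2 by (rule id[OF ea(2) fc])
   qed
   moreover have "keys u \<subseteq> ST"
    unfolding u using keys_diff[of "frag_of (e a \<otimes>\<^sub>k b, c)" "frag_of (b, g a \<otimes>\<^sub>S c)"] kk by blast
   ultimately show ?thesis unfolding pairing_kernel_def by blast
  qed
 qed
 then show ?thesis unfolding tensor_ideal_def by (rule FT.genideal_minimal[OF pairing_kernel_ideal[OF Lk]])
qed

text \<open>\<open>Y\<close> collects the residues of the second components in finitely many
  generators of the kernel for \<open>L\<close> equal to \<open>k\<close>. Over the field generated
  by \<open>Y\<close> and the image of \<open>Q\<close>, a functional acts on these residues as
  multiplication by its value at 1. On the generators it therefore agrees with a
  \<open>k\<close>-linear functional, and its pairing with them is zero.\<close>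

theorem finitely_generated_if_noetherian_tensor:
 assumes surj: "!!y. y \<in> carrier k ==> \<exists>x\<in>carrier S. y = \<pi> x"
  and e: "!!a. a \<in> carrier Q ==> e a \<in> carrier k" "!!a. a \<in> carrier Q ==> \<pi> (g a) = e a"
  and g: "!!a. a \<in> carrier Q ==> g a \<in> carrier S"
  and noeth: "noetherian_ring (tensor_ring Q e k g S)"
 shows "\<exists>Y. finite Y \<and> Y \<subseteq> carrier k \<and> generate_field k (e ` carrier Q \<union> Y) = carrier k"
proof -
 interpret FT: cring FT by (rule free_tensor_cring[OF k.is_cring S.is_cring])
 let ?T = "tensor_ideal Q e k g S" and ?Ik = "pairing_kernel (carrier k)"
 have T: "ideal ?T FT" by (rule tensor_ideal_is_ideal[OF k.is_cring S.is_cring]) (use e g in auto)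
 interpret T: ideal ?T FT by (rule T)
 have Ik: "ideal ?Ik FT" by (rule pairing_kernel_ideal) simp
 have qIk: "ideal ((+>\<^sub>FT) ?T ` ?Ik) (FT Quot ?T)" by (rule FT.ring_ideal_imp_quot_ideal[OF T Ik])
 obtain W where W: "W \<subseteq> carrier (FT Quot ?T)" "finite W" "(+>\<^sub>FT) ?T ` ?Ik = Idl\<^bsub>FT Quot ?T\<^esub> W"
  using noetherian_ring.finetely_gen[OF noeth[unfolded tensor_ring_def] qIk] by blast
 have qr: "ring (FT Quot ?T)" by (rule T.quotient_is_ring)
 have "W \<subseteq> (+>\<^sub>FT) ?T ` ?Ik" unfolding W(3) by (rule ring.genideal_self[OF qr W(1)])
 then obtain Us where Us: "Us \<subseteq> ?Ik" "finite Us" "W = (+>\<^sub>FT) ?T ` Us"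
  using finite_subset_image[OF W(2)] by blast
 define Y where "Y = (\<Union>u\<in>Us. (\<lambda>q. \<pi> (snd q)) ` keys u)"
 have finY: "finite Y" unfolding Y_def using Us(2) by simp
 have Yk: "Y \<subseteq> carrier k"
 proof
  fix y assume "y \<in> Y"
  then obtain u q where uq: "u \<in> Us" "q \<in> keys u" "y = \<pi> (snd q)" unfolding Y_def by blast
  then have "q \<in> ST" using Us(1) unfolding pairing_kernel_def by blast
  then show "y \<in> carrier k" unfolding uq(3) by auto
 qed
 have sub: "e ` carrier Q \<union> Y \<subseteq> carrier k" using Yk e(1) by blast
 let ?L = "generate_field k (e ` carrier Q \<union> Y)"
 have L: "subfield ?L k" by (rule k.generate_field_is_subfield[OF sub])
 have Lk: "?L \<subseteq> carrier k" using subfieldE(3)[OF L] .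
 have IL: "ideal (pairing_kernel ?L) FT" by (rule pairing_kernel_ideal[OF Lk])
 have TL: "?T \<subseteq> pairing_kernel ?L"
 proof (rule tensor_ideal_subset_pairing_kernel[OF Lk _ e(2) g])
  show "e a \<in> ?L" if "a \<in> carrier Q" for a using that by (intro generate_field.incl) simp
 qed
 have UL: "u \<in> pairing_kernel ?L" if u: "u \<in> Us" for u
 proof -
  have uI: "u \<in> ?Ik" using u Us(1) by blast
  then have keys: "keys u \<subseteq> ST" unfolding pairing_kernel_def by simp
  have "pairing \<phi> u = \<zero>\<^sub>k" if \<phi>: "functional ?L \<phi>" for \<phi>
  proof -
   have p1: "\<phi> \<one>\<^sub>k \<in> carrier k" using functional_closed[OF \<phi>] by simp
   have \<psi>: "functional (carrier k) (\<lambda>x. x \<otimes>\<^sub>k \<phi> \<one>\<^sub>k)"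
    unfolding functional_def using p1 by (simp add: k.l_distr k.m_assoc)
   have "\<phi> (\<pi> (snd q)) = \<pi> (snd q) \<otimes>\<^sub>k \<phi> \<one>\<^sub>k" if q: "q \<in> keys u" for q
   proof -
    have "\<pi> (snd q) \<in> Y" unfolding Y_def using u q by blast
    then have "\<pi> (snd q) \<in> ?L" by (intro generate_field.incl) simp
    moreover have "\<pi> (snd q) \<in> carrier k" using \<open>\<pi> (snd q) \<in> Y\<close> Yk by blast
    ultimately show ?thesis using functional_smult[OF \<phi>, of "\<pi> (snd q)" "\<one>\<^sub>k"] by simp
   qed
   then have "pairing \<phi> u = pairing (\<lambda>x. x \<otimes>\<^sub>k \<phi> \<one>\<^sub>k) u" by (rule pairing_unique[OF \<phi> \<psi> keys])
   then show ?thesis using uI \<psi> unfolding pairing_kernel_def by simp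
  qed
  then show ?thesis using keys unfolding pairing_kernel_def by blast
 qed
 have "(+>\<^sub>FT) ?T ` ?Ik \<subseteq> (+>\<^sub>FT) ?T ` pairing_kernel ?L"
  unfolding W(3)
  by (rule ring.genideal_minimal[OF qr FT.ring_ideal_imp_quot_ideal[OF T IL]]) (use Us(3) UL in blast)
 then have IkL: "u \<in> pairing_kernel ?L" if u: "u \<in> ?Ik" for u
 proof -
  have "?T +>\<^sub>FT u \<in> (+>\<^sub>FT) ?T ` pairing_kernel ?L"
   using \<open>(+>\<^sub>FT) ?T ` ?Ik \<subseteq> (+>\<^sub>FT) ?T ` pairing_kernel ?L\<close> u by blast
  then obtain v where v: "v \<in> pairing_kernel ?L" "?T +>\<^sub>FT u = ?T +>\<^sub>FT v" by blast
  have "u \<in> ?T +>\<^sub>FT v" unfolding v(2)[symmetric] by (rule T.a_rcos_self[OF ideal.Icarr[OF Ik u]])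
  then obtain t where t: "t \<in> ?T" "u = t \<oplus>\<^sub>FT v" unfolding a_r_coset_def' by blast
  have "t \<oplus>\<^sub>FT v \<in> pairing_kernel ?L"
   by (rule additive_subgroup.a_closed[OF ideal.axioms(1)[OF IL]]) (use t v TL in auto)
  then show ?thesis unfolding t(2) .
 qed
 have "l \<in> ?L" if l: "l \<in> carrier k" for l
 proof (rule ccontr)
  assume nl: "l \<notin> ?L"
  obtain \<phi> where phi: "(\<forall>x\<in>carrier k. \<phi> x \<in> carrier k) \<and> (\<forall>x\<in>carrier k. \<forall>y\<in>carrier k. \<phi> (x \<oplus>\<^sub>k y) = \<phi> x \<oplus>\<^sub>k \<phi> y) \<and>
   (\<forall>c\<in>?L. \<forall>x\<in>carrier k. \<phi> (c \<otimes>\<^sub>k x) = c \<otimes>\<^sub>k \<phi> x) \<and> \<phi> \<one>\<^sub>k = \<zero>\<^sub>k \<and> \<phi> l = \<one>\<^sub>k"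
   using k.separating_functional[OF L l nl] by (elim exE)
  have \<phi>: "functional ?L \<phi>" unfolding functional_def using phi by blast
  obtain s where s: "s \<in> carrier S" "l = \<pi> s" using surj[OF l] by blast
  \<comment> \<open>This element maps to l - l = 0 in \<open>k\<close> and so lies in the kernel for
    \<open>k\<close>; yet its pairing with \<open>\<phi>\<close>, which is 0 at 1 and 1 at
    \<open>l\<close>, is -1.\<close>
  let ?u = "frag_of (l, \<one>\<^sub>S) - frag_of (\<one>\<^sub>k, s)"
  have kk: "keys (frag_of (l, \<one>\<^sub>S)) \<subseteq> ST" "keys (frag_of (\<one>\<^sub>k, s)) \<subseteq> ST"
   using l s by simp_all
  have val: "pairing \<psi> ?u = l \<otimes>\<^sub>k \<psi> \<one>\<^sub>k \<ominus>\<^sub>k \<psi> l" if \<psi>: "functional L' \<psi>" for \<psi> L'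
   unfolding pairing_diff[OF \<psi> kk]
   using pairing_of[OF \<psi> l S.one_closed] pairing_of[OF \<psi> k.one_closed s(1)] ring_hom_one[OF pi_hom] s(2)
    functional_closed[OF \<psi> l] by simp
  have "pairing \<psi> ?u = \<zero>\<^sub>k" if \<psi>: "functional (carrier k) \<psi>" for \<psi>
   using val[OF \<psi>] functional_smult[OF \<psi> l k.one_closed] l functional_closed[OF \<psi> k.one_closed] by (simp add: k.minus_eq k.r_neg)
  moreover have "keys ?u \<subseteq> ST"
   using keys_diff[of "frag_of (l, \<one>\<^sub>S)" "frag_of (\<one>\<^sub>k, s)"] kk by blast
  ultimately have "?u \<in> ?Ik" unfolding pairing_kernel_def by blast
  then have "?u \<in> pairing_kernel ?L" by (rule IkL)
  then have "pairing \<phi> ?u = \<zero>\<^sub>k" using \<phi> unfolding pairing_kernel_def by blast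
  then have "\<ominus>\<^sub>k \<one>\<^sub>k = \<zero>\<^sub>k" using val[OF \<phi>] phi l by (simp add: k.minus_eq)
  then have "\<one>\<^sub>k = \<zero>\<^sub>k" using k.minus_minus[of "\<one>\<^sub>k"] by simp
  then show False using k.one_not_zero by simp
 qed
 then have "?L = carrier k" using Lk by blast
 then show ?thesis using finY Yk by blast
qed

end

section \<open>The main theorem\<close>

text \<open>Two records describe the same module although their scalar multiplications agree only on
  the carriers; the recursion keeps all values inside them.\<close>

lemma ord_lt_module_cong:
 assumes M: "module R M" and eq: "carrier M = carrier M'" "add M = add M'" "\<zero>\<^sub>M = \<zero>\<^sub>M'"
  and smult: "!!r x. r \<in> carrier R ==> x \<in> carrier M ==> r \<odot>\<^sub>M x = r \<odot>\<^sub>M' x"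
  and "\<delta> \<in> carrier R \<rightarrow> carrier M" "ord_lt R M L n \<delta>"
 shows "ord_lt R M' L n \<delta>"
 using assms(6-)
proof (induction n arbitrary: \<delta>)
 case 0
 then show ?case by simp
next
 case (Suc n)
 interpret M: module R M by (rule M)
 have "ord_lt R M' L n (ad R M' r \<delta>)" if r: "r \<in> carrier R" for r
 proof -
  have "ord_lt R M' L n (ad R M r \<delta>)"
   by (rule Suc.IH[OF M.ad_closed[OF Suc.prems(1) r]]) (use Suc.prems(2) r in simp)
  then show ?thesis
  proof (rule ord_lt_cong[OF M.R.ring_axioms, THEN iffD1, rotated])
   fix x assume "x \<in> carrier R"
   then have "\<delta> x \<in> carrier M" using Suc.prems(1) by auto
   then show "ad R M r \<delta> x = ad R M' r \<delta> x"
    unfolding ad_def a_inv_cong(2)[OF eq] using smult[OF r] by simp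
  qed
 qed
 then show ?case by simp
qed

context residue_cover
begin

text \<open>What the construction of operators takes over from \<open>B\<close>: functionals of
  bounded order that separate points and whose span over \<open>k\<close> is stable under
  multiplication in the argument. Linearity is recorded over \<open>K0\<close>, which in the
  application contains the image of \<open>A\<close>.\<close>

definition functional_basis :: "'b set => nat => nat => (nat => 'b => 'c) => bool" where
 "functional_basis K0 n m \<delta> \<longleftrightarrow>
   (\<forall>i<m. flin K0 (\<delta> i) \<and> ord_lt B kmod {\<zero>\<^sub>k} n (\<delta> i)) \<and>
   (\<forall>x\<in>carrier B. (\<forall>i<m. \<delta> i x = \<zero>\<^sub>k) --> x = \<zero>) \<and>
   (\<forall>i<m. \<forall>b\<in>carrier B. \<exists>c. (\<forall>j<m. c j \<in> carrier k) \<and>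
    (\<forall>x\<in>carrier B. \<delta> i (b \<otimes> x) = (\<Oplus>\<^sub>k j\<in>{..<m}. c j \<otimes>\<^sub>k \<delta> j x)))"

lemma functional_basis_of_basis:
 assumes F: "subfield F B" "K0 \<subseteq> F" and Bs: "independent F Bs" "Span F Bs = carrier B"
  and ord: "!!\<delta>. flin F \<delta> ==> ord_lt B kmod {\<zero>\<^sub>k} n \<delta>"
 shows "\<exists>m \<delta>. functional_basis K0 n m \<delta>"
proof -
 have FB: "f \<in> carrier B" if "f \<in> F" for f using that subfieldE(3)[OF F(1)] by blast
 have BsB: "Bs ! j \<in> carrier B" if "j < length Bs" for j
  using independent_in_carrier[OF Bs(1)] that nth_mem by blast
 obtain \<delta> where \<delta>: "(\<forall>i<length Bs. flin F (\<delta> i)) \<and>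
  (\<forall>x\<in>carrier B. (\<forall>i<length Bs. \<delta> i x = \<zero>\<^sub>k) --> x = \<zero>) \<and>
  (\<forall>g. flin F g --> (\<forall>x\<in>carrier B. g x = (\<Oplus>\<^sub>k i\<in>{..<length Bs}. g (Bs ! i) \<otimes>\<^sub>k \<delta> i x)))"
  using coordinate_functionals[OF F(1) Bs] by (elim exE)
 have fl: "flin F (\<delta> i)" if "i < length Bs" for i using \<delta> that by blast
 have flK: "flin K0 (\<delta> i)" if "i < length Bs" for i
  using fl[OF that] F(2) unfolding flin_def by blast
 have g: "flin F (\<lambda>x. \<delta> i (b \<otimes> x))" if i: "i < length Bs" and b: "b \<in> carrier B" for i b
 proof (rule flinI)
  show "\<delta> i (b \<otimes> x) \<in> carrier k" if "x \<in> carrier B" for x using flinD(2)[OF fl[OF i]] b that by simp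
  show "\<delta> i (b \<otimes> (x \<oplus> y)) = \<delta> i (b \<otimes> x) \<oplus>\<^sub>k \<delta> i (b \<otimes> y)" if "x \<in> carrier B" "y \<in> carrier B" for x y
   using flinD(3)[OF fl[OF i], of "b \<otimes> x" "b \<otimes> y"] b that by (simp add: r_distr)
  show "\<delta> i (b \<otimes> (f \<otimes> x)) = \<rho> f \<otimes>\<^sub>k \<delta> i (b \<otimes> x)" if f: "f \<in> F" and x: "x \<in> carrier B" for f x
   unfolding m_lcomm[OF b FB[OF f] x] by (rule flinD(4)[OF fl[OF i] f]) (use b x in simp)
 qed
 have "functional_basis K0 n (length Bs) \<delta>"
  unfolding functional_basis_def
 proof (intro conjI allI impI ballI)
  show "flin K0 (\<delta> i)" if "i < length Bs" for i by (rule flK[OF that])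
  show "ord_lt B kmod {\<zero>\<^sub>k} n (\<delta> i)" if "i < length Bs" for i by (rule ord[OF fl[OF that]])
  show "x = \<zero>" if "x \<in> carrier B" "\<forall>i<length Bs. \<delta> i x = \<zero>\<^sub>k" for x using \<delta> that by blast
  fix i b assume i: "i < length Bs" and b: "b \<in> carrier B"
  show "\<exists>c. (\<forall>j<length Bs. c j \<in> carrier k) \<and>
    (\<forall>x\<in>carrier B. \<delta> i (b \<otimes> x) = (\<Oplus>\<^sub>k j\<in>{..<length Bs}. c j \<otimes>\<^sub>k \<delta> j x))"
  proof (intro exI[of _ "\<lambda>j. \<delta> i (b \<otimes> Bs ! j)"] conjI allI impI ballI)
   show "\<delta> i (b \<otimes> Bs ! j) \<in> carrier k" if "j < length Bs" for j using flinD(2)[OF g[OF i b] BsB[OF that]] .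
   show "\<delta> i (b \<otimes> x) = (\<Oplus>\<^sub>k j\<in>{..<length Bs}. \<delta> i (b \<otimes> Bs ! j) \<otimes>\<^sub>k \<delta> j x)" if "x \<in> carrier B" for x
    using conjunct2[OF conjunct2[OF \<delta>], THEN spec, THEN mp, OF g[OF i b], THEN bspec, OF that] .
  qed
 qed
 then show ?thesis by (intro exI)
qed

lemma functional_basis_exists:
 assumes noeth: "noetherian_ring B" and K0: "subfield K0 B" and Y: "finite Y" "Y \<subseteq> carrier k"
  and gen: "generate_field k (\<rho> ` K0 \<union> Y) = carrier k"
 shows "\<exists>n m \<delta>. 0 < n \<and> functional_basis K0 n m \<delta>"
proof -
 obtain F where F: "K0 \<subseteq> F" "maximal_subfield F" using maximal_subfield_exists[OF K0] by (elim exE conjE)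
 obtain Bs where Bs: "independent F Bs" "Span F Bs = carrier B"
  using finite_basis[OF noeth F(1) Y gen F(2)] by (elim exE conjE)
 obtain n where n: "\<forall>\<delta>. flin F \<delta> --> ord_lt B kmod {\<zero>\<^sub>k} n \<delta>"
  using flin_order_bound[OF F(2) independent_in_carrier[OF Bs(1)] Bs(2)] by (elim exE)
 have z: "submodule {\<zero>\<^sub>k} B kmod" using module.zero_submodule[OF module_kmod] by simp
 \<comment> \<open>The bound is raised to at least 1, as required by the passage from
   \<open>Diff_lt\<close> to \<open>Diff\<close> and by the monomials of length below the
   bound.\<close>
 have ordF: "ord_lt B kmod {\<zero>\<^sub>k} (max n 1) \<delta>" if d: "flin F \<delta>" for \<delta>
 proof (cases "n = 0")
  case True
  then have v: "\<delta> x \<in> {\<zero>\<^sub>k}" if "x \<in> carrier B" for x using n d that by simp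
  show ?thesis by (rule module.ord_lt_if_values[OF module_kmod z v])
 next
  case False
  then have "max n 1 = n" by simp
  then show ?thesis using n d by simp
 qed
 have "\<exists>m \<delta>. functional_basis K0 (max n 1) m \<delta>"
  by (rule functional_basis_of_basis[OF F_subfield[OF F(2)] F(1) Bs]) (rule ordF)
 then obtain m \<delta> where "functional_basis K0 (max n 1) m \<delta>" by (elim exE)
 then show ?thesis by (intro exI[of _ "max n 1"] exI[of _ m] exI[of _ \<delta>]) simp
qed

lemma functional_basis_separable:
 assumes noeth: "noetherian_ring B" and K0: "subfield K0 B" and Y: "finite Y" "Y \<subseteq> carrier k"
  and gen: "generate_field k (\<rho> ` K0 \<union> Y) = carrier k" and sep: "k.separable_extension (\<rho> ` K0)"
  and nil: "!!xs x. length xs = n ==> set xs \<subseteq> carrier B ==> (!!z. z \<in> set xs ==> \<rho> z = \<zero>\<^sub>k) ==> x \<in> carrier B ==>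
   foldr (\<otimes>) xs x = \<zero>"
 shows "\<exists>m \<delta>. functional_basis K0 n m \<delta>"
proof -
 obtain F where F: "K0 \<subseteq> F" "maximal_subfield F" "\<rho> ` F = carrier k"
  using separable_section[OF K0 sep Y gen] by (elim exE conjE)
 obtain Bs where Bs: "independent F Bs" "Span F Bs = carrier B"
  using finite_basis[OF noeth F(1) Y gen F(2)] by (elim exE conjE)
 show ?thesis
 proof (rule functional_basis_of_basis[OF F_subfield[OF F(2)] F(1) Bs])
  fix \<delta> assume d: "flin F \<delta>"
  show "ord_lt B kmod {\<zero>\<^sub>k} n \<delta>"
  proof (rule flin_order_if_section[OF F_subset[OF F(2)] F(3) d])
   fix xs x assume xs: "length xs = n" "!!z. z \<in> set xs ==> z \<in> carrier B \<and> \<rho> z = \<zero>\<^sub>k" and x: "x \<in> carrier B"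
   have "foldr (\<otimes>) xs x = \<zero>" by (rule nil[OF xs(1) _ _ x]) (use xs(2) in auto)
   then show "\<delta> (foldr (\<otimes>) xs x) = \<zero>\<^sub>k" using flin_zero[OF d] by simp
  qed
 qed
qed

end

lemma finsum_ring_module [simp]: "finsum (ring_module S) = finsum S"
 by (simp add: fun_eq_iff finsum_def finprod_def)

context local_setting
begin

lemma residue_over_local_simps [simp]:
 "carrier (residue_over_local R P) = carrier \<kappa>" "\<zero>\<^bsub>residue_over_local R P\<^esub> = \<zero>\<^sub>\<kappa>"
 "add (residue_over_local R P) = add \<kappa>" "x \<odot>\<^bsub>residue_over_local R P\<^esub> y = \<pi> x \<otimes>\<^sub>\<kappa> y"
 "finsum (residue_over_local R P) = finsum \<kappa>"
 by (simp_all add: residue_over_local_def)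

lemma residue_over_ring_simps [simp]:
 "carrier (residue_over_ring R P) = carrier \<kappa>" "\<zero>\<^bsub>residue_over_ring R P\<^esub> = \<zero>\<^sub>\<kappa>"
 "add (residue_over_ring R P) = add \<kappa>" "r \<odot>\<^bsub>residue_over_ring R P\<^esub> y = res r \<otimes>\<^sub>\<kappa> y"
 by (simp_all add: residue_over_ring_def res_def)

lemma residue_over_local_module: "module LR (residue_over_local R P)"
 unfolding residue_over_local_def
 by (rule module_restrict_scalars[OF LR.cring_axioms pi_hom module_ring_module[OF kappa_cring]])

lemma residue_over_ring_module: "module R (residue_over_ring R P)"
 unfolding residue_over_ring_def by (rule module_restrict_scalars[OF R phi_hom residue_over_local_module])

end

section \<open>From functionals on B to operators on R\<close>

context primary_setting
begin

context
 fixes n m \<delta> assumes fb: "residue_cover.functional_basis B \<kappa> \<rho> K0 n m \<delta>"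
begin

lemmas basis_facts = fb[unfolded residue_cover.functional_basis_def[OF residue_cover_B]]

lemma basis_flin: "i < m ==> residue_cover.flin B \<kappa> \<rho> K0 (\<delta> i)"
 by (rule conjunct1[OF mp[OF spec[OF conjunct1[OF basis_facts]]]])

lemma basis_ord: "i < m ==> ord_lt B (restrict_scalars \<rho> (ring_module \<kappa>)) {\<zero>\<^sub>\<kappa>} n (\<delta> i)"
 by (rule conjunct2[OF mp[OF spec[OF conjunct1[OF basis_facts]]]])

lemma basis_separates:
 assumes "x \<in> carrier B" "!!i. i < m ==> \<delta> i x = \<zero>\<^sub>\<kappa>" shows "x = \<zero>\<^sub>B"
 by (rule mp[OF bspec[OF conjunct1[OF conjunct2[OF basis_facts]] assms(1)]]) (intro allI impI, rule assms(2))

lemma basis_mult: "i < m ==> b \<in> carrier B ==> \<exists>c. (\<forall>j<m. c j \<in> carrier \<kappa>) \<and>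
  (\<forall>x\<in>carrier B. \<delta> i (b \<otimes>\<^sub>B x) = (\<Oplus>\<^sub>\<kappa> j\<in>{..<m}. c j \<otimes>\<^sub>\<kappa> \<delta> j x))"
 by (rule bspec[OF mp[OF spec[OF conjunct2[OF conjunct2[OF basis_facts]]]]])

abbreviation "D i \<equiv> (\<lambda>x. \<delta> i (\<beta> x))"

lemma D_closed: "i < m ==> x \<in> carrier R ==> D i x \<in> carrier \<kappa>"
 by (rule residue_cover.flinD(2)[OF residue_cover_B basis_flin beta.hom_closed])

lemma D_add: "i < m ==> x \<in> carrier R ==> y \<in> carrier R ==> D i (x \<oplus> y) = D i x \<oplus>\<^sub>\<kappa> D i y"
 by (simp only: beta.hom_add residue_cover.flinD(3)[OF residue_cover_B basis_flin beta.hom_closed beta.hom_closed])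

lemma D_linear: "i < m ==> a \<in> A ==> x \<in> carrier R ==> D i (a \<otimes> x) = res a \<otimes>\<^sub>\<kappa> D i x"
proof -
 assume i: "i < m" and a: "a \<in> A" and x: "x \<in> carrier R"
 have "\<beta> a \<in> K0" by (rule subsetD[OF K0_subfield(2) imageI[OF a]])
 from residue_cover.flinD(4)[OF residue_cover_B basis_flin[OF i] this beta.hom_closed[OF x]]
 show ?thesis unfolding beta.hom_mult[OF A_closed[OF a] x] rho_beta[OF A_closed[OF a]] .
qed

lemma D_ord: "i < m ==> ord_lt R (residue_over_ring R P) {\<zero>\<^sub>\<kappa>} n (D i)"
proof -
 assume i: "i < m"
 have kB: "module B (restrict_scalars \<rho> (ring_module \<kappa>))"
  by (rule module_restrict_scalars[OF B_cring rho_hom module_ring_module[OF kappa_cring]])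
 show ?thesis
 proof (rule ord_lt_module_cong[OF module_restrict_scalars[OF R beta_hom kB] _ _ _ _ _ ord_lt_restrict_scalars[OF R.ring_axioms beta_hom basis_ord[OF i]]])
  show "r \<odot>\<^bsub>restrict_scalars \<beta> (restrict_scalars \<rho> (ring_module \<kappa>))\<^esub> x = r \<odot>\<^bsub>residue_over_ring R P\<^esub> x" if "r \<in> carrier R" for r x
   using rho_beta[OF that] by simp
  show "D i \<in> carrier R \<rightarrow> carrier (restrict_scalars \<beta> (restrict_scalars \<rho> (ring_module \<kappa>)))"
   using D_closed[OF i] by simp
 qed simp_all
qed

lemma D_solutions: "I = {x \<in> carrier R. \<forall>i<m. D i x = \<zero>\<^sub>\<kappa>}"
proof (intro equalityI subsetI)
 fix x assume x: "x \<in> I"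
 then have xR: "x \<in> carrier R" by (rule I.Icarr)
 have "\<beta> x = \<zero>\<^sub>B" using beta_zero_iff[OF xR] x by simp
 then have "D i x = \<zero>\<^sub>\<kappa>" if "i < m" for i
  using residue_cover.flin_zero[OF residue_cover_B basis_flin[OF that]] by simp
 then show "x \<in> {x \<in> carrier R. \<forall>i<m. D i x = \<zero>\<^sub>\<kappa>}" using xR by simp
next
 fix x assume x: "x \<in> {x \<in> carrier R. \<forall>i<m. D i x = \<zero>\<^sub>\<kappa>}"
 then have "\<beta> x = \<zero>\<^sub>B" using basis_separates[of "\<beta> x"] by simp
 then show "x \<in> I" using beta_zero_iff x by simp
qed

text \<open>Multiplication in the argument recombines the functionals with coefficients in the
  residue field. Each coefficient is the residue of an element of the local ring, so the left span
  over the local ring is already stable.\<close>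

theorem operators_residue_field:
 "\<exists>E. E \<subseteq> Diff_lt R A (ring_module R) (residue_over_ring R P) n \<and>
   env_submodule R A (ring_module R) (residue_over_ring R P) E \<and>
   I = solutions (ring_module R) (residue_over_ring R P) E \<and>
   fg_submodule E LR (Hom_module A (ring_module R) (residue_over_ring R P)
    (left_act (ring_module R) (residue_over_local R P)))"
proof -
 interpret hs: hom_setting R A LR \<phi> "residue_over_local R P"
  by (intro hom_setting.intro R phi_hom residue_over_local_module subringE(1)[OF A])
 define \<Delta> where "\<Delta> i = (\<lambda>x\<in>carrier R. D i x)" for i
 let ?U = "\<Delta> ` {..<m}"
 have DH: "\<Delta> i \<in> hs.H" if i: "i < m" for i
  unfolding \<Delta>_def
 proof (rule hs.HomI)
  show "D i x \<in> carrier (residue_over_local R P)" if "x \<in> carrier R" for x using D_closed[OF i that] by simp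
  show "D i (x \<oplus> y) = D i x \<oplus>\<^bsub>residue_over_local R P\<^esub> D i y" if "x \<in> carrier R" "y \<in> carrier R" for x y
   using D_add[OF i that] by simp
  show "D i (a \<otimes> x) = \<phi> a \<odot>\<^bsub>residue_over_local R P\<^esub> D i x" if "a \<in> A" "x \<in> carrier R" for a x
   using D_linear[OF i that] by (simp add: res_def)
 qed
 have UH: "?U \<subseteq> hs.H" using DH by blast
 have ord: "ord_lt R hs.N {\<zero>\<^bsub>residue_over_local R P\<^esub>} n \<epsilon>" if "\<epsilon> \<in> ?U" for \<epsilon>
 proof -
  obtain i where i: "i < m" "\<epsilon> = \<Delta> i" using \<open>\<epsilon> \<in> ?U\<close> by (elim imageE) (rule that, simp_all)
  have "ord_lt R hs.N {\<zero>\<^sub>\<kappa>} n (D i)" using D_ord[OF i(1)] unfolding residue_over_ring_def .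
  then have "ord_lt R hs.N {\<zero>\<^sub>\<kappa>} n \<epsilon>"
   unfolding i(2) \<Delta>_def by (rule ord_lt_cong[OF R.ring_axioms, THEN iffD1, rotated]) simp
  then show ?thesis unfolding residue_over_local_simps .
 qed
 have sol: "I = {x \<in> carrier R. \<forall>\<epsilon>\<in>?U. \<epsilon> x = \<zero>\<^bsub>residue_over_local R P\<^esub>}"
  unfolding residue_over_local_simps
 proof (rule trans[OF D_solutions], rule Collect_cong, rule conj_cong[OF refl])
  show "(\<forall>i<m. D i x = \<zero>\<^sub>\<kappa>) \<longleftrightarrow> (\<forall>\<epsilon>\<in>?U. \<epsilon> x = \<zero>\<^sub>\<kappa>)" if "x \<in> carrier R" for x
   using that by (simp add: \<Delta>_def lessThan_def)
 qed
 have stable: "(\<lambda>x\<in>carrier R. \<epsilon> (s \<otimes> x)) \<in> hs.gen ?U" if "\<epsilon> \<in> ?U" and s: "s \<in> carrier R" for \<epsilon> s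
 proof -
  obtain i where i: "i < m" "\<epsilon> = \<Delta> i" using \<open>\<epsilon> \<in> ?U\<close> by (elim imageE) (rule that, simp_all)
  obtain c where c: "\<forall>j<m. c j \<in> carrier \<kappa>"
   "\<forall>x\<in>carrier B. \<delta> i (\<beta> s \<otimes>\<^sub>B x) = (\<Oplus>\<^sub>\<kappa> j\<in>{..<m}. c j \<otimes>\<^sub>\<kappa> \<delta> j x)"
   using basis_mult[OF i(1) beta.hom_closed[OF s]] by (elim exE conjE)
  have "\<forall>j. \<exists>l. j < m --> l \<in> carrier LR \<and> c j = \<pi> l"
  proof
   fix j show "\<exists>l. j < m --> l \<in> carrier LR \<and> c j = \<pi> l"
    using pi_surj[of "c j"] c(1) by (cases "j < m") auto
  qed
  then have "\<exists>l. \<forall>j. j < m --> l j \<in> carrier LR \<and> c j = \<pi> (l j)" by (rule choice)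
  then obtain l where lf: "\<forall>j. j < m --> l j \<in> carrier LR \<and> c j = \<pi> (l j)" by (elim exE)
  have l: "l j \<in> carrier LR \<and> c j = \<pi> (l j)" if "j < m" for j using lf that by simp
  have "(\<lambda>x\<in>carrier R. \<epsilon> (s \<otimes> x)) = (\<lambda>x\<in>carrier R. \<Oplus>\<^bsub>residue_over_local R P\<^esub>j\<in>{..<m}. l j \<odot>\<^bsub>residue_over_local R P\<^esub> \<Delta> j x)"
  proof (rule restrict_ext)
   fix x assume x: "x \<in> carrier R"
   have "\<epsilon> (s \<otimes> x) = \<delta> i (\<beta> s \<otimes>\<^sub>B \<beta> x)" unfolding i(2) \<Delta>_def using s x by simp
   also have "\<dots> = (\<Oplus>\<^sub>\<kappa> j\<in>{..<m}. c j \<otimes>\<^sub>\<kappa> \<delta> j (\<beta> x))" by (rule bspec[OF c(2) beta.hom_closed[OF x]])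
   also have "\<dots> = (\<Oplus>\<^sub>\<kappa> j\<in>{..<m}. \<pi> (l j) \<otimes>\<^sub>\<kappa> \<Delta> j x)"
    by (rule kappa.add.finprod_cong') (use l D_closed x in \<open>auto simp: \<Delta>_def\<close>)
   finally show "\<epsilon> (s \<otimes> x) = (\<Oplus>\<^bsub>residue_over_local R P\<^esub>j\<in>{..<m}. l j \<odot>\<^bsub>residue_over_local R P\<^esub> \<Delta> j x)"
    unfolding residue_over_local_simps .
  qed
  also have "\<dots> \<in> hs.gen ?U"
  proof (rule hs.submodule_sum_closed[OF hs.gen_submodule[OF UH]])
   show "l j \<in> carrier LR" if "j \<in> {..<m}" for j using l that by simp
   show "\<Delta> j \<in> hs.gen ?U" if "j \<in> {..<m}" for j by (rule subsetD[OF hs.gen_incl imageI[OF that]])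
  qed simp
  finally show ?thesis .
 qed
 show ?thesis
  unfolding residue_over_ring_def
  using hs.operator_module[OF finite_imageI[OF finite_lessThan] UH ord sol stable] by (intro exI[of _ "hs.gen ?U"] conjI)
qed

text \<open>Torsion-freeness makes multiplication of a nonzero vector \<open>x0\<close> an embedding
  of R/P into \<open>N\<close>, and every element of the residue field has a denominator outside
  \<open>P\<close> that moves it into the image of \<open>R\<close>. These are the data for
  \<open>operator_module_transfer\<close>.\<close>

theorem operators_torsion_free:
 fixes N :: "('a set, 'n) module"
 assumes n: "0 < n" and fg: "fg_module (R Quot P) N" and tf: "torsion_free_module (R Quot P) N"
  and nz: "carrier N \<noteq> {\<zero>\<^sub>N}"
  and V: "finite V" "V \<subseteq> carrier R" "fraction_generated R (A \<union> V)"
 shows "\<exists>E. E \<subseteq> Diff_lt R A (ring_module R) (quotient_module_over_ring R P N) n \<and>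
   env_submodule R A (ring_module R) (quotient_module_over_ring R P N) E \<and>
   I = solutions (ring_module R) (quotient_module_over_ring R P N) E \<and>
   fg_submodule E R (Hom_module A (ring_module R) (quotient_module_over_ring R P N)
    (left_act (ring_module R) (quotient_module_over_ring R P N)))"
proof -
 let ?N = "quotient_module_over_ring R P N" and ?q = "\<lambda>r. P +> r"
 have NM: "module (R Quot P) N" using fg unfolding fg_module_def by simp
 interpret N: module "R Quot P" N by (rule NM)
 have qhom: "?q \<in> ring_hom R (R Quot P)" by (rule P.rcos_ring_hom)
 have N'M: "module R ?N" unfolding quotient_module_over_ring_def by (rule module_restrict_scalars[OF R qhom NM])
 \<comment> \<open>\<open>hom_setting\<close> presents its target as a restriction of scalars; here
   \<open>S\<close> is \<open>R\<close> and the restriction is along the identity.\<close>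
 have idN: "restrict_scalars (\<lambda>r. r) ?N = ?N" by (simp add: quotient_module_over_ring_def restrict_scalars_def)
 have hs: "hom_setting R A R (\<lambda>r. r) ?N"
  by (intro hom_setting.intro R N'M subringE(1)[OF A]) (simp add: ring_hom_def)
 obtain x0 where x0: "x0 \<in> carrier N" "x0 \<noteq> \<zero>\<^sub>N" using nz N.M.zero_closed by blast
 \<comment> \<open>A preimage under \<open>res\<close> is chosen. By \<open>qeq\<close> its class
   modulo \<open>P\<close> is unique, so \<open>h\<close> sends the residue of r to r times
   \<open>x0\<close>.\<close>
 define pre where "pre y = (SOME r. r \<in> carrier R \<and> y = res r)" for y
 define h where "h y = ?q (pre y) \<odot>\<^sub>N x0" for y
 let ?L = "res ` carrier R"
 have pre: "pre (res r) \<in> carrier R \<and> res r = res (pre (res r))" if "r \<in> carrier R" for r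
  unfolding pre_def by (rule someI[of "\<lambda>z. z \<in> carrier R \<and> res r = res z" r]) (use that in simp)
 have qc: "?q r \<in> carrier (R Quot P)" if "r \<in> carrier R" for r by (rule ring_hom_closed[OF qhom that])
 have q0: "?q r = \<zero>\<^bsub>R Quot P\<^esub> \<longleftrightarrow> r \<in> P" if "r \<in> carrier R" for r
  by (rule quotient_eq_zero_iff[OF P.ideal_axioms that])
 have qeq: "?q r = ?q s" if rs: "r \<in> carrier R" "s \<in> carrier R" "res r = res s" for r s
 proof -
  have "res (r \<ominus> s) = res r \<ominus>\<^sub>\<kappa> res s" using rs by (simp add: R.minus_eq kappa.minus_eq res.hom_uminus)
  then have "r \<ominus> s \<in> P" using res_zero_iff[of "r \<ominus> s"] rs by (simp add: kappa.minus_eq kappa.r_neg)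
  then have "r \<in> ?q s" unfolding a_r_coset_def' using rs by (intro UN_I[of "r \<ominus> s"]) (simp_all add: R.minus_eq R.a_assoc R.l_neg)
  then show ?thesis using P.a_repr_independence'[OF _ rs(2)] by simp
 qed
 have h_res: "h (res r) = ?q r \<odot>\<^sub>N x0" if r: "r \<in> carrier R" for r
  unfolding h_def using qeq[of "pre (res r)" r] pre[OF r] r by simp
 have L: "submodule ?L R (residue_over_ring R P)"
 proof (rule module.submoduleI[OF residue_over_ring_module])
  show "?L \<subseteq> carrier (residue_over_ring R P)" using res.hom_closed by auto
  show "\<zero>\<^bsub>residue_over_ring R P\<^esub> \<in> ?L" using image_eqI[of _ res \<zero>] by simp
  show "\<ominus>\<^bsub>residue_over_ring R P\<^esub> a \<in> ?L" if aL: "a \<in> ?L" for a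
  proof -
   obtain r where r: "r \<in> carrier R" "a = res r" using aL by (elim imageE) (rule that)
   have "\<ominus>\<^bsub>residue_over_ring R P\<^esub> a = \<ominus>\<^sub>\<kappa> a" 
    using a_inv_cong(1)[of "residue_over_ring R P" \<kappa>] by simp
   then have "\<ominus>\<^bsub>residue_over_ring R P\<^esub> a = res (\<ominus> r)" using r res.hom_uminus by simp
   then show ?thesis using r by (intro image_eqI[of _ res "\<ominus> r"]) simp_all
  qed
  show "a \<oplus>\<^bsub>residue_over_ring R P\<^esub> b \<in> ?L" if aL: "a \<in> ?L" and bL: "b \<in> ?L" for a b
  proof -
   obtain r s where r: "r \<in> carrier R" "a = res r" "s \<in> carrier R" "b = res s" using aL bL by (elim imageE) (rule that)
   then show ?thesis by (intro image_eqI[of _ res "r \<oplus> s"]) simp_all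
  qed
  show "r \<odot>\<^bsub>residue_over_ring R P\<^esub> b \<in> ?L" if r: "r \<in> carrier R" and bL: "b \<in> ?L" for r b
  proof -
   obtain s where s: "s \<in> carrier R" "b = res s" using bL by (elim imageE) (rule that)
   then show ?thesis using r by (intro image_eqI[of _ res "r \<otimes> s"]) simp_all
  qed
 qed
 have smN: "r \<odot>\<^bsub>?N\<^esub> x = ?q r \<odot>\<^sub>N x" and addN: "x \<oplus>\<^bsub>?N\<^esub> y = x \<oplus>\<^sub>N y" and cN: "carrier ?N = carrier N" and zN: "\<zero>\<^bsub>?N\<^esub> = \<zero>\<^sub>N" for r x y
  by (simp_all add: quotient_module_over_ring_def)
 define W where "W = (\<lambda>i. D i) ` {..<m}"
 have WE: "\<exists>i<m. \<epsilon> = D i" if "\<epsilon> \<in> W" for \<epsilon> using that unfolding W_def by auto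
 have "\<exists>E. E \<subseteq> Diff_lt R A (ring_module R) (restrict_scalars (\<lambda>r. r) ?N) n \<and>
   env_submodule R A (ring_module R) (restrict_scalars (\<lambda>r. r) ?N) E \<and>
   I = solutions (ring_module R) (restrict_scalars (\<lambda>r. r) ?N) E \<and>
   fg_submodule E R (Hom_module A (ring_module R) (restrict_scalars (\<lambda>r. r) ?N) (left_act (ring_module R) ?N))"
 proof (rule hom_setting.operator_module_transfer[OF hs residue_over_ring_module P.primeideal_axioms L _ _ _ _ _ _ _ _ _ _ _ n V I_ideal, where h = h and W = W])
  show "\<exists>d\<in>carrier R - P. d \<odot>\<^bsub>residue_over_ring R P\<^esub> y \<in> ?L" if "y \<in> carrier (residue_over_ring R P)" for y
  proof -
   have y: "y \<in> carrier \<kappa>" using that by simp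
   obtain a s where a: "a \<in> carrier R" "s \<in> carrier R - P" "y \<otimes>\<^sub>\<kappa> res s = res a"
    using kappa_fraction[OF y] by (elim exE conjE)
   have "res s \<otimes>\<^sub>\<kappa> y = res a" using a y kappa.m_comm by simp
   then show ?thesis using a by (intro bexI[of _ s]) simp_all
  qed
  show "y = \<zero>\<^bsub>residue_over_ring R P\<^esub>" if d: "d \<in> carrier R - P" and y: "y \<in> carrier (residue_over_ring R P)"
   and z: "d \<odot>\<^bsub>residue_over_ring R P\<^esub> y = \<zero>\<^bsub>residue_over_ring R P\<^esub>" for d y
  proof -
   have "res d \<noteq> \<zero>\<^sub>\<kappa>" using res_zero_iff d by simp
   then show ?thesis using kappa.integral[of "res d" y] z y d by auto
  qed
  show "h \<in> ?L \<rightarrow> carrier ?N"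
   unfolding cN
  proof
   fix y assume "y \<in> ?L"
   then obtain r where r: "r \<in> carrier R" "y = res r" by (elim imageE) (rule that)
   show "h y \<in> carrier N" unfolding r(2) h_res[OF r(1)] by (rule N.smult_closed[OF qc[OF r(1)] x0(1)])
  qed
  show "h (a \<oplus>\<^bsub>residue_over_ring R P\<^esub> b) = h a \<oplus>\<^bsub>?N\<^esub> h b" if aL: "a \<in> ?L" and bL: "b \<in> ?L" for a b
  proof -
   obtain r s where r: "r \<in> carrier R" "a = res r" "s \<in> carrier R" "b = res s" using aL bL by (elim imageE) (rule that)
   have "a \<oplus>\<^bsub>residue_over_ring R P\<^esub> b = res (r \<oplus> s)" using r by simp
   then show ?thesis
    unfolding addN r(2,4) using h_res[of "r \<oplus> s"] h_res[OF r(1)] h_res[OF r(3)] r ring_hom_add[OF qhom r(1,3)]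
     N.smult_l_distr[OF qc[OF r(1)] qc[OF r(3)] x0(1)] by simp
  qed
  show "h (r \<odot>\<^bsub>residue_over_ring R P\<^esub> a) = r \<odot>\<^bsub>?N\<^esub> h a" if r: "r \<in> carrier R" and aL: "a \<in> ?L" for r a
  proof -
   obtain s where s: "s \<in> carrier R" "a = res s" using aL by (elim imageE) (rule that)
   have "r \<odot>\<^bsub>residue_over_ring R P\<^esub> a = res (r \<otimes> s)" using r s by simp
   then show ?thesis
    unfolding smN s(2) using h_res[of "r \<otimes> s"] h_res[OF s(1)] r s ring_hom_mult[OF qhom r s(1)]
     N.smult_assoc1[OF qc[OF r] qc[OF s(1)] x0(1)] by simp
  qed
  show "a = \<zero>\<^bsub>residue_over_ring R P\<^esub>" if aL: "a \<in> ?L" and z: "h a = \<zero>\<^bsub>?N\<^esub>" for a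
  proof -
   obtain r where r: "r \<in> carrier R" "a = res r" using aL by (elim imageE) (rule that)
   have "?q r \<odot>\<^sub>N x0 = \<zero>\<^sub>N" using z h_res[OF r(1)] r(2) zN by simp
   then have "?q r = \<zero>\<^bsub>R Quot P\<^esub>" using tf qc[OF r(1)] x0 unfolding torsion_free_module_def by blast
   then show ?thesis using q0[OF r(1)] res_zero_iff[OF r(1)] r(2) by simp
  qed
  show "finite W" unfolding W_def by simp
  show "\<epsilon> \<in> carrier R \<rightarrow> carrier (residue_over_ring R P)" if "\<epsilon> \<in> W" for \<epsilon>
   using WE[OF that] D_closed by auto
  show "\<epsilon> (x \<oplus> y) = \<epsilon> x \<oplus>\<^bsub>residue_over_ring R P\<^esub> \<epsilon> y" if "\<epsilon> \<in> W" "x \<in> carrier R" "y \<in> carrier R" for \<epsilon> x y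
   using WE[OF that(1)] D_add[OF _ that(2,3)] by auto
  show "\<epsilon> (a \<otimes> x) = a \<odot>\<^bsub>residue_over_ring R P\<^esub> \<epsilon> x" if "\<epsilon> \<in> W" "a \<in> A" "x \<in> carrier R" for \<epsilon> a x
   using WE[OF that(1)] D_linear[OF _ that(2,3)] by auto
  show "ord_lt R (residue_over_ring R P) {\<zero>\<^bsub>residue_over_ring R P\<^esub>} n \<epsilon>" if "\<epsilon> \<in> W" for \<epsilon>
   using WE[OF that] D_ord by auto
  show "I = {x \<in> carrier R. \<forall>\<epsilon>\<in>W. \<epsilon> x = \<zero>\<^bsub>residue_over_ring R P\<^esub>}"
   unfolding W_def residue_over_ring_simps
  proof (rule trans[OF D_solutions], rule Collect_cong, rule conj_cong[OF refl])
   show "(\<forall>i<m. D i x = \<zero>\<^sub>\<kappa>) \<longleftrightarrow> (\<forall>\<epsilon>\<in>(\<lambda>i. D i) ` {..<m}. \<epsilon> x = \<zero>\<^sub>\<kappa>)" for x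
    by (simp add: lessThan_def)
  qed
 qed
 then show ?thesis unfolding idN .
qed

end

end

context fraction_setting
begin

lemma residue_field_finitely_generated:
 assumes "noetherian_ring (tensor_ring Q (quot_residue_embed R P) \<kappa> (quot_embed R P) LR)"
 shows "\<exists>Y. finite Y \<and> Y \<subseteq> carrier \<kappa> \<and> generate_field \<kappa> (Kbar \<union> Y) = carrier \<kappa>"
 unfolding embed_image[symmetric]
proof (rule functional_pairing.finitely_generated_if_noetherian_tensor[OF _ pi_surj _ _ _ assms])
 show "functional_pairing \<kappa> LR \<pi>"
  by (intro functional_pairing.intro functional_pairing_axioms.intro kappa_field LR.cring_axioms pi_hom)
 show "quot_residue_embed R P a \<in> carrier \<kappa>" if "a \<in> carrier Q" for a by (rule ring_hom_closed[OF embed_hom that])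
 show "\<pi> (quot_embed R P a) = quot_residue_embed R P a" if "a \<in> carrier Q" for a by (rule embed_eq[symmetric])
 show "quot_embed R P a \<in> carrier LR" if "a \<in> carrier Q" for a by (rule quot_embed_closed[OF that])
qed

lemma Kbar_subfield:
 assumes "field Q" shows "subfield Kbar \<kappa>"
 unfolding embed_image[symmetric]
proof (rule ring_hom_ring.img_is_subfield(2)[OF _ field.carrier_is_subfield[OF assms] kappa.one_not_zero])
 show "ring_hom_ring Q \<kappa> (quot_residue_embed R P)"
  by (intro ring_hom_ringI2 cring.axioms(1)[OF Q_cring] kappa.ring_axioms embed_hom)
qed

end

lemma Diff_lt_subset_Diff: "0 < n ==> Diff_lt R A M N n \<subseteq> Diff R A M N"
 unfolding Diff_def Diff_le_def by (cases n) auto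

theorem theoremA:
  fixes R :: "'a ring" and A P :: "'a set" and N :: "('a set, 'n) module"
  assumes "cring R" "noetherian_ring R"
    and "subring A R" "noetherian_domain (R\<lparr>carrier := A\<rparr>)"
    and "primeideal P R" "P \<inter> A = {\<zero>\<^bsub>R\<^esub>}"
  shows
    "(noetherian_ring
        (tensor_ring (quot_field (R\<lparr>carrier := A\<rparr>))
           (quot_residue_embed R P) (residue_field R P) (quot_embed R P) (local_ring R P)) \<longrightarrow>
      (\<forall>I. primary_to R P I \<longrightarrow>
        (\<exists>E \<subseteq> Diff R A (ring_module R) (residue_over_ring R P).
           env_submodule R A (ring_module R) (residue_over_ring R P) E \<and>
           I = solutions (ring_module R) (residue_over_ring R P) E \<and>
           fg_submodule E (local_ring R P)
             (Hom_module A (ring_module R) (residue_over_ring R P)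
                (left_act (ring_module R) (residue_over_local R P))))))
     \<and>
     (ess_finite_type R A \<and> fg_module (R Quot P) N \<and> torsion_free_module (R Quot P) N \<and>
      carrier N \<noteq> {\<zero>\<^bsub>N\<^esub>} \<longrightarrow>
      (\<forall>I. primary_to R P I \<longrightarrow>
        (\<exists>E \<subseteq> Diff R A (ring_module R) (quotient_module_over_ring R P N).
           env_submodule R A (ring_module R) (quotient_module_over_ring R P N) E \<and>
           I = solutions (ring_module R) (quotient_module_over_ring R P N) E \<and>
           fg_submodule E R
             (Hom_module A (ring_module R) (quotient_module_over_ring R P N)
                (left_act (ring_module R) (quotient_module_over_ring R P N)))))
      \<and>
      (ring.separable_extension (residue_field R P)
         (quot_residue_embed R P ` carrier (quot_field (R\<lparr>carrier := A\<rparr>))) \<longrightarrow>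
       (\<forall>(n::nat) I. primary_to R P I \<and> P [^]\<^bsub>ideals_set R\<^esub> (n + 1) \<subseteq> I \<longrightarrow>
         (\<exists>E \<subseteq> Diff_le R A (ring_module R) (quotient_module_over_ring R P N) n.
            env_submodule R A (ring_module R) (quotient_module_over_ring R P N) E \<and>
            I = solutions (ring_module R) (quotient_module_over_ring R P N) E))))
     \<and>
     (perfect_field (quot_field (R\<lparr>carrier := A\<rparr>)) \<longrightarrow>
      ring.separable_extension (residue_field R P)
        (quot_residue_embed R P ` carrier (quot_field (R\<lparr>carrier := A\<rparr>))))"
proof -
 have ls: "local_setting R A P" by (rule local_setting.intro[OF assms(1-3,5,6)])
 have fs: "fraction_setting R A P"
  using assms(4) by (intro fraction_setting.intro fraction_setting_axioms.intro ls) (simp add: noetherian_domain_def)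
 have ps: "primary_setting R A P I" if "primary_to R P I" for I
  by (intro primary_setting.intro primary_setting_axioms.intro ls that)
 have V: "\<exists>V. finite V \<and> V \<subseteq> carrier R \<and> fraction_generated R (A \<union> V)" if "ess_finite_type R A"
  by (rule ess_finite_type_fraction_generated[OF assms(1) subringE(1)[OF assms(3)] that])
 have Y: "finite (local_setting.res R P ` V)" "local_setting.res R P ` V \<subseteq> carrier (residue_field R P)"
  "generate_field (residue_field R P) (local_setting.Kbar R A P \<union> local_setting.res R P ` V) = carrier (residue_field R P)"
  if "finite V" "V \<subseteq> carrier R" "fraction_generated R (A \<union> V)" for V
 proof -
  show "finite (local_setting.res R P ` V)" using that(1) by (rule finite_imageI)
  show "local_setting.res R P ` V \<subseteq> carrier (residue_field R P)"
   by (rule image_subsetI) (rule ring_hom_closed[OF local_setting.res_hom[OF ls] subsetD[OF that(2)]])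
  show "generate_field (residue_field R P) (local_setting.Kbar R A P \<union> local_setting.res R P ` V) = carrier (residue_field R P)"
   by (rule local_setting.kappa_generated[OF ls that(2,3)])
 qed
 show ?thesis
 proof (intro conjI impI allI, goal_cases)
  case (1 I)
  note ps = ps[OF 1(2)]
  obtain Y where Y: "finite Y" "Y \<subseteq> carrier (residue_field R P)"
   "generate_field (residue_field R P) (local_setting.Kbar R A P \<union> Y) = carrier (residue_field R P)"
   using fraction_setting.residue_field_finitely_generated[OF fs 1(1)] by (elim exE conjE)
  obtain n m \<delta> where n: "0 < n" and fb: "residue_cover.functional_basis (primary_setting.B R P I) (residue_field R P)
    (induced_map (local_ring R P) (local_max_ideal R P)) (primary_setting.K0 R A P I) n m \<delta>"
   using residue_cover.functional_basis_exists[OF primary_setting.residue_cover_B[OF ps]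
    primary_setting.B_noetherian[OF ps] primary_setting.K0_subfield(1)[OF ps] Y(1,2),
    unfolded primary_setting.rho_K0[OF ps], OF Y(3)] by (elim exE conjE)
  from primary_setting.operators_residue_field[OF ps fb] show ?case
   by (elim exE conjE) (intro exI conjI, erule subset_trans, rule Diff_lt_subset_Diff[OF n], assumption+)
 next
  case (2 I)
  note ps = ps[OF 2(2)]
  obtain V where V: "finite V" "V \<subseteq> carrier R" "fraction_generated R (A \<union> V)"
   using V[OF conjunct1[OF 2(1)]] by (elim exE conjE)
  obtain n m \<delta> where n: "0 < n" and fb: "residue_cover.functional_basis (primary_setting.B R P I) (residue_field R P)
    (induced_map (local_ring R P) (local_max_ideal R P)) (primary_setting.K0 R A P I) n m \<delta>"
   using residue_cover.functional_basis_exists[OF primary_setting.residue_cover_B[OF ps]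
    primary_setting.B_noetherian[OF ps] primary_setting.K0_subfield(1)[OF ps] Y(1,2)[OF V],
    unfolded primary_setting.rho_K0[OF ps], OF Y(3)[OF V]] by (elim exE conjE)
  have hN: "fg_module (R Quot P) N" "torsion_free_module (R Quot P) N" "carrier N \<noteq> {\<zero>\<^sub>N}" using 2(1) by simp_all
  from primary_setting.operators_torsion_free[OF ps fb n hN V] show ?case
   by (elim exE conjE) (intro exI conjI, erule subset_trans, rule Diff_lt_subset_Diff[OF n], assumption+)
 next
  case (3 n I)
  note ps = ps[OF conjunct1[OF 3(3)]]
  note rho_K0 = primary_setting.rho_K0[OF ps]
  obtain V where V: "finite V" "V \<subseteq> carrier R" "fraction_generated R (A \<union> V)"
   using V[OF conjunct1[OF 3(1)]] by (elim exE conjE)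
  \<comment> \<open>Products of n + 1 kernel elements vanish, which bounds the order of the
    functionals by n; this fits because \<open>Diff_le\<close> at n is \<open>Diff_lt\<close> at n +
    1.\<close>
  have "\<exists>m \<delta>. residue_cover.functional_basis (primary_setting.B R P I) (residue_field R P)
    (induced_map (local_ring R P) (local_max_ideal R P)) (primary_setting.K0 R A P I) (n + 1) m \<delta>"
  proof (rule residue_cover.functional_basis_separable[OF primary_setting.residue_cover_B[OF ps]
    primary_setting.B_noetherian[OF ps] primary_setting.K0_subfield(1)[OF ps] Y(1,2)[OF V], unfolded rho_K0,
    OF Y(3)[OF V] 3(2)[unfolded fraction_setting.embed_image[OF fs]]])
  qed (rule primary_setting.kernel_products[OF ps conjunct2[OF 3(3)]])
  then obtain m \<delta> where fb: "residue_cover.functional_basis (primary_setting.B R P I) (residue_field R P)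
    (induced_map (local_ring R P) (local_max_ideal R P)) (primary_setting.K0 R A P I) (n + 1) m \<delta>" by (elim exE)
  have hN: "fg_module (R Quot P) N" "torsion_free_module (R Quot P) N" "carrier N \<noteq> {\<zero>\<^sub>N}" using 3(1) by simp_all
  have n: "0 < n + 1" by simp
  from primary_setting.operators_torsion_free[OF ps fb n hN V] show ?case
   unfolding Diff_le_def Suc_eq_plus1 by (elim exE conjE) (intro exI conjI, assumption+)
 next
  case 4
  have "field (quot_field (R\<lparr>carrier := A\<rparr>))" using 4 unfolding perfect_field_def by (rule conjunct1)
  then show ?case
   unfolding fraction_setting.embed_image[OF fs]
   by (rule fraction_setting.perfect_imp_separable[OF fs 4 fraction_setting.Kbar_subfield[OF fs]])
 qed
qed

end
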